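(* Every stratified regular monoid action uniquely determines a stratified vector bundle, and every smooth stratified regular monoid action uniquely determines a differentiable stratified vector bundle.
   Context: **Stratified spaces.** A stratified space is a pair $(X,\Sigma)$ with $X$ a Hausdorff, second countable, paracompact topological space and $\Sigma$ a locally finite partition of $X$ into connected, locally closed subspaces (strata) such that (i) each $S\in\Sigma$ is a topological manifold in the subspace topology; (ii) each $S\in\Sigma$ is equipped with the structure of a smooth manifold; (iii) (frontier condition) if $S,R\in\Sigma$ and $S\cap\overline{R}\neq\emptyset$ then $S\subset\overline{R}$. A stratified morphism $f:(X_1,\Sigma_1)\to(X_2,\Sigma_2)$ is a continuous map $f:X_1\to X_2$ such that for each $S_1\in\Sigma_1$ there is $S_2\in\Sigma_2$ with $f(S_1)\subset S_2$ and $f|_{S_1}:S_1\to S_2$ smooth. For a stratified space $(A,\Sigma_A)$, the space $\mathbb{R}\times A$ is stratified by $\{\mathbb{R}\times S\mid S\in\Sigma_A\}$. **Differentiable stratified spaces.** A chart of $(X,\Sigma)$ is an open $U\subset X$ with a topological embedding $\phi:U\to\mathbb{R}^n$ as a locally closed subspace, for some $n$, such that for all $S\in\Sigma$, $\phi(S\cap U)$ is an embedded submanifold of $\mathbb{R}^n$. Charts $\phi:U\to\mathbb{R}^n$, $\psi:V\to\mathbb{R}^n$ are compatible if each $p\in U\cap V$ has an open neighbourhood $W\subset U\cap V$ for which there are open neighbourhoods $O_U\supset\phi(W)$, $O_V\supset\psi(W)$ in $\mathbb{R}^n$ and a diffeomorphism $H:O_U\to O_V$ with $H\circ\phi|_W=\psi|_W$;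 charts into $\mathbb{R}^n$ and $\mathbb{R}^m$ are compatible if they are so after composing with the inclusions of the first coordinates into $\mathbb{R}^{\max\{n,m\}}$. A smooth atlas is a covering by compatible charts; a smooth structure is a maximal atlas; a differentiable stratified space is a stratified space with a smooth structure. A continuous $f:X\to\mathbb{R}$ is smooth if for every chart $\phi:U\to\mathbb{R}^n$ there is a smooth $g:\mathbb{R}^n\to\mathbb{R}$ with $f|_U=g\circ\phi$. A map $F:X\to Y$ of differentiable stratified spaces is smooth if $f\circ F$ is smooth for every smooth $f:Y\to\mathbb{R}$. **Stratified vector bundles.** A stratified vector bundle consists of two stratified spaces $(A,\Sigma_A)$, $(X,\Sigma_X)$ and a stratified morphism $p:A\to X$ such that (i) for each $S\in\Sigma_X$, $A|_S:=p^{-1}(S)\in\Sigma_A$; (ii) for each $S\in\Sigma_X$, $p:A|_S\to S$ is a smooth vector bundle; (iii) the scalar multiplication map $\mathbb{R}\times A\to A$ is a stratified morphism. It is differentiable if $A$ and $X$ both have smooth structures, $p$ is a smooth map, and the scalar multiplication $\mathbb{R}\times A\to A$ is smooth. **Monoid actions.** A monoid action of the multiplicative monoid $(\mathbb{R},\cdot)$ on $E$ is a map $h:\mathbb{R}\times E\to E$ such that, writing $h_t:=h(t,\cdot)$, one has $h_1=\mathrm{Id}$ and $h_t\circ h_s=h_{ts}$ for all $s,t\in\mathbb{R}$. A smooth action $h$ of $(\mathbb{R},\cdot)$ on a smooth manifold $E$ is regular if for all $e\in E$: $\frac{d}{dt}\big|_{t=0}h_t(e)=0$ if and only if $e=h_0(e)$.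 A monoid action $\mu:\mathbb{R}\times A\to A$ on a stratified space $(A,\Sigma_A)$ is stratified regular if (i) $\mu$ is a stratified morphism, and (ii) for each $B\in\Sigma_A$, the restriction $\mu|_B:\mathbb{R}\times B\to B$ is regular. If $A$ has a smooth structure and $\mu$ is a smooth map, the action is called smooth stratified regular.
   Formalization: Uniqueness up to isomorphism is claimed among bundles whose zero section is continuous (resp. smooth), since otherwise it fails; in general one gets a unique bijective comparison, diffeomorphic on strata. Smooth functions need factor through charts only locally. *)

theory Defs
  imports "HOL-Analysis.Analysis"
begin

section \<open>Smooth maps between open subsets of coordinate spaces\<close>

text \<open>Dimensions vary from stratum to stratum and from chart to chart, so \<open>\<real>\<^sup>n\<close> is rendered by the
  library space \<^const>\<open>Euclidean_space\<close>, whose points are the functions \<open>nat \<Rightarrow> real\<close> that vanish from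
  index \<open>n\<close> on.  In particular the inclusion of the first coordinates
  \<open>\<real>\<^sup>n \<subseteq> \<real>\<^sup>m\<close> for \<open>n \<le> m\<close> is a literal inclusion of sets.\<close>

abbreviation Rn :: "nat \<Rightarrow> (nat \<Rightarrow> real) set" where
  "Rn n \<equiv> topspace (Euclidean_space n)"

text \<open>Functions on an open subset of \<open>\<real>\<^sup>n\<close> all of whose iterated partial derivatives of order
  at most \<open>k\<close> exist and are continuous.\<close>

primrec Ck_fun :: "nat \<Rightarrow> nat \<Rightarrow> (nat \<Rightarrow> real) set \<Rightarrow> ((nat \<Rightarrow> real) \<Rightarrow> real) \<Rightarrow> bool" where
  "Ck_fun 0 n U f \<longleftrightarrow> continuous_map (subtopology (Euclidean_space n) U) euclideanreal f"
| "Ck_fun (Suc k) n U f \<longleftrightarrow> continuous_map (subtopology (Euclidean_space n) U) euclideanreal f \<and>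
     (\<forall>i<n. \<exists>f'. Ck_fun k n U f' \<and>
        (\<forall>x\<in>U. ((\<lambda>t. f (x(i := t))) has_real_derivative f' x) (at (x i))))"

definition smooth_fun :: "nat \<Rightarrow> (nat \<Rightarrow> real) set \<Rightarrow> ((nat \<Rightarrow> real) \<Rightarrow> real) \<Rightarrow> bool" where
  "smooth_fun n U f \<longleftrightarrow> openin (Euclidean_space n) U \<and> (\<forall>k. Ck_fun k n U f)"

definition smooth_coord_map ::
    "nat \<Rightarrow> (nat \<Rightarrow> real) set \<Rightarrow> nat \<Rightarrow> ((nat \<Rightarrow> real) \<Rightarrow> nat \<Rightarrow> real) \<Rightarrow> bool" where
  "smooth_coord_map n U m F \<longleftrightarrow>
     openin (Euclidean_space n) U \<and> F ` U \<subseteq> Rn m \<and> (\<forall>i<m. smooth_fun n U (\<lambda>x. F x i))"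

definition coord_diffeo ::
    "nat \<Rightarrow> (nat \<Rightarrow> real) set \<Rightarrow> (nat \<Rightarrow> real) set \<Rightarrow> ((nat \<Rightarrow> real) \<Rightarrow> nat \<Rightarrow> real) \<Rightarrow> bool" where
  "coord_diffeo n P Q H \<longleftrightarrow>
     bij_betw H P Q \<and> smooth_coord_map n P n H \<and> smooth_coord_map n Q n (inv_into P H)"

definition embedded_submanifold :: "nat \<Rightarrow> (nat \<Rightarrow> real) set \<Rightarrow> bool" where
  "embedded_submanifold n M \<longleftrightarrow> M \<subseteq> Rn n \<and>
     (\<exists>k\<le>n. \<forall>x\<in>M. \<exists>P Q H. x \<in> P \<and> coord_diffeo n P Q H \<and> H ` (M \<inter> P) = Q \<inter> Rn k)"


section \<open>Smooth manifolds\<close>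

type_synonym 'a coord = "'a set \<times> ('a \<Rightarrow> nat \<Rightarrow> real)"

record 'a mfd =
  mtop :: "'a topology"
  mdim :: nat
  mcharts :: "'a coord set"

abbreviation mpoints :: "'a mfd \<Rightarrow> 'a set" where
  "mpoints M \<equiv> topspace (mtop M)"

definition mfd_chart :: "'a topology \<Rightarrow> nat \<Rightarrow> 'a coord \<Rightarrow> bool" where
  "mfd_chart T n = (\<lambda>(U, \<phi>). openin T U \<and> openin (Euclidean_space n) (\<phi> ` U) \<and>
     homeomorphic_map (subtopology T U) (subtopology (Euclidean_space n) (\<phi> ` U)) \<phi>)"

definition mfd_compatible :: "nat \<Rightarrow> 'a coord \<Rightarrow> 'a coord \<Rightarrow> bool" where
  "mfd_compatible n = (\<lambda>(U, \<phi>) (V, \<psi>).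
     smooth_coord_map n (\<phi> ` (U \<inter> V)) n (\<psi> \<circ> inv_into U \<phi>) \<and>
     smooth_coord_map n (\<psi> ` (U \<inter> V)) n (\<phi> \<circ> inv_into V \<psi>))"

definition topological_manifold :: "nat \<Rightarrow> 'a topology \<Rightarrow> bool" where
  "topological_manifold n T \<longleftrightarrow> Hausdorff_space T \<and> second_countable T \<and>
     (\<forall>x\<in>topspace T. \<exists>c. mfd_chart T n c \<and> x \<in> fst c)"

text \<open>A smooth manifold carries a maximal smooth atlas.\<close>

definition smooth_manifold :: "'a mfd \<Rightarrow> bool" where
  "smooth_manifold M \<longleftrightarrow>
     topological_manifold (mdim M) (mtop M) \<and>
     (\<forall>c\<in>mcharts M. mfd_chart (mtop M) (mdim M) c) \<and>
     \<Union> (fst ` mcharts M) = mpoints M \<and>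
     (\<forall>c\<in>mcharts M. \<forall>d\<in>mcharts M. mfd_compatible (mdim M) c d) \<and>
     (\<forall>c. mfd_chart (mtop M) (mdim M) c \<and> (\<forall>d\<in>mcharts M. mfd_compatible (mdim M) c d)
        \<longrightarrow> c \<in> mcharts M)"

text \<open>The manifold whose maximal atlas is generated by a given smooth atlas.\<close>

definition mfd_of_atlas :: "'a topology \<Rightarrow> nat \<Rightarrow> 'a coord set \<Rightarrow> 'a mfd" where
  "mfd_of_atlas T n \<A> = \<lparr>mtop = T, mdim = n,
     mcharts = {c. mfd_chart T n c \<and> (\<forall>d\<in>\<A>. mfd_compatible n c d)}\<rparr>"

definition smooth_map :: "'a mfd \<Rightarrow> 'b mfd \<Rightarrow> ('a \<Rightarrow> 'b) \<Rightarrow> bool" where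
  "smooth_map M N f \<longleftrightarrow> continuous_map (mtop M) (mtop N) f \<and>
     (\<forall>(U, \<phi>)\<in>mcharts M. \<forall>(V, \<psi>)\<in>mcharts N.
        smooth_coord_map (mdim M) (\<phi> ` (U \<inter> f -` V)) (mdim N) (\<psi> \<circ> f \<circ> inv_into U \<phi>))"

definition diffeomorphism :: "'a mfd \<Rightarrow> 'b mfd \<Rightarrow> ('a \<Rightarrow> 'b) \<Rightarrow> bool" where
  "diffeomorphism M N f \<longleftrightarrow> bij_betw f (mpoints M) (mpoints N) \<and>
     smooth_map M N f \<and> smooth_map N M (inv_into (mpoints M) f)"

definition open_submfd :: "'a mfd \<Rightarrow> 'a set \<Rightarrow> 'a mfd" where
  "open_submfd M U = \<lparr>mtop = subtopology (mtop M) U, mdim = mdim M,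
     mcharts = {c \<in> mcharts M. fst c \<subseteq> U}\<rparr>"

text \<open>Identification of \<open>\<real>\<^sup>m \<times> \<real>\<^sup>n\<close> with \<open>\<real>\<^sup>m\<^sup>+\<^sup>n\<close>.\<close>

definition join_coords :: "nat \<Rightarrow> (nat \<Rightarrow> real) \<Rightarrow> (nat \<Rightarrow> real) \<Rightarrow> nat \<Rightarrow> real" where
  "join_coords m x y = (\<lambda>i. if i < m then x i else y (i - m))"

definition prod_mfd :: "'a mfd \<Rightarrow> 'b mfd \<Rightarrow> ('a \<times> 'b) mfd" where
  "prod_mfd M N = mfd_of_atlas (prod_topology (mtop M) (mtop N)) (mdim M + mdim N)
     {(U \<times> V, \<lambda>(x, y). join_coords (mdim M) (\<phi> x) (\<psi> y)) | U \<phi> V \<psi>.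
        (U, \<phi>) \<in> mcharts M \<and> (V, \<psi>) \<in> mcharts N}"

definition Rn_mfd :: "nat \<Rightarrow> (nat \<Rightarrow> real) mfd" where
  "Rn_mfd n = mfd_of_atlas (Euclidean_space n) n {(Rn n, \<lambda>x. x)}"

definition real_coord :: "real \<Rightarrow> nat \<Rightarrow> real" where
  "real_coord t = (\<lambda>i. if i = 0 then t else 0)"

definition real_mfd :: "real mfd" where
  "real_mfd = mfd_of_atlas euclideanreal 1 {(UNIV, real_coord)}"


section \<open>Smooth vector bundles\<close>

definition real_vector_space_on ::
    "'a set \<Rightarrow> ('a \<Rightarrow> 'a \<Rightarrow> 'a) \<Rightarrow> 'a \<Rightarrow> (real \<Rightarrow> 'a \<Rightarrow> 'a) \<Rightarrow> bool" where
  "real_vector_space_on V add zero scl \<longleftrightarrow>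
     zero \<in> V \<and> (\<forall>u\<in>V. \<forall>v\<in>V. add u v \<in> V) \<and> (\<forall>r. \<forall>u\<in>V. scl r u \<in> V) \<and>
     (\<forall>u\<in>V. \<forall>v\<in>V. \<forall>w\<in>V. add (add u v) w = add u (add v w)) \<and>
     (\<forall>u\<in>V. \<forall>v\<in>V. add u v = add v u) \<and>
     (\<forall>u\<in>V. add zero u = u) \<and> (\<forall>u\<in>V. \<exists>v\<in>V. add u v = zero) \<and>
     (\<forall>r. \<forall>u\<in>V. \<forall>v\<in>V. scl r (add u v) = add (scl r u) (scl r v)) \<and>
     (\<forall>r s. \<forall>u\<in>V. scl (r + s) u = add (scl r u) (scl s u)) \<and>
     (\<forall>r s. \<forall>u\<in>V. scl (r * s) u = scl r (scl s u)) \<and>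
     (\<forall>u\<in>V. scl 1 u = u)"

definition fibre :: "'a set \<Rightarrow> ('a \<Rightarrow> 'b) \<Rightarrow> 'b \<Rightarrow> 'a set" where
  "fibre E p x = {e \<in> E. p e = x}"

definition smooth_vector_bundle ::
    "'a mfd \<Rightarrow> 'b mfd \<Rightarrow> ('a \<Rightarrow> 'b) \<Rightarrow> ('a \<Rightarrow> 'a \<Rightarrow> 'a) \<Rightarrow> ('b \<Rightarrow> 'a) \<Rightarrow> (real \<Rightarrow> 'a \<Rightarrow> 'a) \<Rightarrow> bool" where
  "smooth_vector_bundle E M p add zero scl \<longleftrightarrow>
     smooth_manifold E \<and> smooth_manifold M \<and> smooth_map E M p \<and>
     (\<forall>x\<in>mpoints M. real_vector_space_on (fibre (mpoints E) p x) add (zero x) scl) \<and>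
     (\<forall>x\<in>mpoints M. \<exists>U k \<Phi>. openin (mtop M) U \<and> x \<in> U \<and>
        diffeomorphism (open_submfd E {e \<in> mpoints E. p e \<in> U})
          (prod_mfd (open_submfd M U) (Rn_mfd k)) \<Phi> \<and>
        (\<forall>e\<in>mpoints E. p e \<in> U \<longrightarrow> fst (\<Phi> e) = p e) \<and>
        (\<forall>y\<in>U. \<forall>u\<in>fibre (mpoints E) p y. \<forall>v\<in>fibre (mpoints E) p y. \<forall>i.
           snd (\<Phi> (add u v)) i = snd (\<Phi> u) i + snd (\<Phi> v) i) \<and>
        (\<forall>y\<in>U. \<forall>u\<in>fibre (mpoints E) p y. \<forall>r i.
           snd (\<Phi> (scl r u)) i = r * snd (\<Phi> u) i))"


section \<open>Stratified spaces\<close>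

definition paracompact_space :: "'a topology \<Rightarrow> bool" where
  "paracompact_space T \<longleftrightarrow>
     (\<forall>\<U>. (\<forall>U\<in>\<U>. openin T U) \<and> \<Union>\<U> = topspace T \<longrightarrow>
        (\<exists>\<V>. (\<forall>V\<in>\<V>. openin T V) \<and> \<Union>\<V> = topspace T \<and>
           (\<forall>V\<in>\<V>. \<exists>U\<in>\<U>. V \<subseteq> U) \<and> locally_finite_in T \<V>))"

definition locally_closed_in :: "'a topology \<Rightarrow> 'a set \<Rightarrow> bool" where
  "locally_closed_in T S \<longleftrightarrow> (\<exists>U C. openin T U \<and> closedin T C \<and> S = U \<inter> C)"

text \<open>The third field gives, for each stratum, its structure of a smooth manifold;
  its value on sets that are not strata is irrelevant.\<close>

record 'a strat_space =
  stop :: "'a topology"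
  strata :: "'a set set"
  smfd :: "'a set \<Rightarrow> 'a mfd"

abbreviation spoints :: "'a strat_space \<Rightarrow> 'a set" where
  "spoints X \<equiv> topspace (stop X)"

definition stratified_space :: "'a strat_space \<Rightarrow> bool" where
  "stratified_space X \<longleftrightarrow>
     Hausdorff_space (stop X) \<and> second_countable (stop X) \<and> paracompact_space (stop X) \<and>
     partition_on (spoints X) (strata X) \<and> locally_finite_in (stop X) (strata X) \<and>
     (\<forall>S\<in>strata X. connectedin (stop X) S \<and> locally_closed_in (stop X) S) \<and>
     (\<forall>S\<in>strata X. mtop (smfd X S) = subtopology (stop X) S \<and> smooth_manifold (smfd X S)) \<and>
     (\<forall>S\<in>strata X. \<forall>R\<in>strata X. S \<inter> (stop X closure_of R) \<noteq> {} \<longrightarrow> S \<subseteq> stop X closure_of R)"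

definition stratified_morphism :: "'a strat_space \<Rightarrow> 'b strat_space \<Rightarrow> ('a \<Rightarrow> 'b) \<Rightarrow> bool" where
  "stratified_morphism X Y f \<longleftrightarrow> continuous_map (stop X) (stop Y) f \<and>
     (\<forall>S\<in>strata X. \<exists>R\<in>strata Y. f ` S \<subseteq> R \<and> smooth_map (smfd X S) (smfd Y R) f)"

text \<open>\<open>\<real> \<times> A\<close>; note that \<open>snd ` (UNIV \<times> S) = S\<close>.\<close>

definition real_times :: "'a strat_space \<Rightarrow> (real \<times> 'a) strat_space" where
  "real_times A = \<lparr>stop = prod_topology euclideanreal (stop A),
     strata = (\<lambda>S. UNIV \<times> S) ` strata A,
     smfd = (\<lambda>P. prod_mfd real_mfd (smfd A (snd ` P)))\<rparr>"


section \<open>Differentiable stratified spaces\<close>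

text \<open>A chart \<open>\<phi> : U \<rightarrow> \<real>\<^sup>n\<close> is the triple \<open>(n, U, \<phi>)\<close>.\<close>

type_synonym 'a schart = "nat \<times> 'a set \<times> ('a \<Rightarrow> nat \<Rightarrow> real)"

definition strat_chart :: "'a strat_space \<Rightarrow> 'a schart \<Rightarrow> bool" where
  "strat_chart X = (\<lambda>(n, U, \<phi>). openin (stop X) U \<and>
     embedding_map (subtopology (stop X) U) (Euclidean_space n) \<phi> \<and>
     locally_closed_in (Euclidean_space n) (\<phi> ` U) \<and>
     (\<forall>S\<in>strata X. embedded_submanifold n (\<phi> ` (S \<inter> U))))"

definition strat_compatible :: "'a strat_space \<Rightarrow> 'a schart \<Rightarrow> 'a schart \<Rightarrow> bool" where
  "strat_compatible X = (\<lambda>(n, U, \<phi>) (m, V, \<psi>). \<forall>x\<in>U \<inter> V. \<exists>W P Q H.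
     openin (stop X) W \<and> x \<in> W \<and> W \<subseteq> U \<inter> V \<and> \<phi> ` W \<subseteq> P \<and> \<psi> ` W \<subseteq> Q \<and>
     coord_diffeo (max n m) P Q H \<and> (\<forall>w\<in>W. H (\<phi> w) = \<psi> w))"

definition smooth_structure :: "'a strat_space \<Rightarrow> 'a schart set \<Rightarrow> bool" where
  "smooth_structure X \<D> \<longleftrightarrow>
     (\<forall>c\<in>\<D>. strat_chart X c) \<and>
     \<Union> {U. \<exists>n \<phi>. (n, U, \<phi>) \<in> \<D>} = spoints X \<and>
     (\<forall>c\<in>\<D>. \<forall>d\<in>\<D>. strat_compatible X c d) \<and>
     (\<forall>c. strat_chart X c \<and> (\<forall>d\<in>\<D>. strat_compatible X c d) \<longrightarrow> c \<in> \<D>)"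

text \<open>Smoothness of a real function, \<open>f = g \<circ> \<phi>\<close> with \<open>g\<close> smooth on \<open>\<real>\<^sup>n\<close>, is required locally on
  the domain of each chart.  As \<open>\<D>\<close> is a maximal atlas, a single \<open>g\<close> on all of \<open>\<real>\<^sup>n\<close> for the whole
  chart domain would be too much to ask: for the chart \<open>1/x\<close> of the half-line \<open>x > 0\<close> in \<open>\<real>\<close> it would
  exclude the identity function of \<open>\<real>\<close>.\<close>

definition smooth_strat_fun :: "'a strat_space \<Rightarrow> 'a schart set \<Rightarrow> ('a \<Rightarrow> real) \<Rightarrow> bool" where
  "smooth_strat_fun X \<D> f \<longleftrightarrow> continuous_map (stop X) euclideanreal f \<and>
     (\<forall>(n, U, \<phi>)\<in>\<D>. \<forall>x\<in>U. \<exists>W g. openin (stop X) W \<and> x \<in> W \<and> W \<subseteq> U \<and>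
        smooth_fun n (Rn n) g \<and> (\<forall>w\<in>W. f w = g (\<phi> w)))"

definition smooth_strat_map ::
    "'a strat_space \<Rightarrow> 'a schart set \<Rightarrow> 'b strat_space \<Rightarrow> 'b schart set \<Rightarrow> ('a \<Rightarrow> 'b) \<Rightarrow> bool" where
  "smooth_strat_map X \<D> Y \<E> F \<longleftrightarrow> F ` spoints X \<subseteq> spoints Y \<and>
     (\<forall>f. smooth_strat_fun Y \<E> f \<longrightarrow> smooth_strat_fun X \<D> (f \<circ> F))"

text \<open>The product smooth structure on \<open>\<real> \<times> A\<close>: the maximal atlas generated by the charts \<open>id \<times> \<phi>\<close>.\<close>

definition real_times_structure ::
    "'a strat_space \<Rightarrow> 'a schart set \<Rightarrow> (real \<times> 'a) schart set" where
  "real_times_structure A \<D> =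
     {c. strat_chart (real_times A) c \<and>
         (\<forall>(n, U, \<phi>)\<in>\<D>. strat_compatible (real_times A) c
            (1 + n, UNIV \<times> U, \<lambda>(t, x). join_coords 1 (real_coord t) (\<phi> x)))}"


section \<open>Stratified vector bundles\<close>

record ('a, 'b) svb =
  sv_total :: "'a strat_space"
  sv_base :: "'b strat_space"
  sv_proj :: "'a \<Rightarrow> 'b"
  sv_add :: "'a \<Rightarrow> 'a \<Rightarrow> 'a"
  sv_zero :: "'b \<Rightarrow> 'a"
  sv_scale :: "real \<Rightarrow> 'a \<Rightarrow> 'a"

definition stratified_vector_bundle :: "('a, 'b) svb \<Rightarrow> bool" where
  "stratified_vector_bundle V \<longleftrightarrow>
     stratified_space (sv_total V) \<and> stratified_space (sv_base V) \<and>
     stratified_morphism (sv_total V) (sv_base V) (sv_proj V) \<and>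
     (\<forall>S\<in>strata (sv_base V).
        {a \<in> spoints (sv_total V). sv_proj V a \<in> S} \<in> strata (sv_total V) \<and>
        smooth_vector_bundle
          (smfd (sv_total V) {a \<in> spoints (sv_total V). sv_proj V a \<in> S}) (smfd (sv_base V) S)
          (sv_proj V) (sv_add V) (sv_zero V) (sv_scale V)) \<and>
     stratified_morphism (real_times (sv_total V)) (sv_total V) (\<lambda>(t, a). sv_scale V t a)"

text \<open>The smooth structures of the total space and of the base are the arguments \<open>\<D>\<close> and \<open>\<E>\<close>.\<close>

definition differentiable_svb ::
    "('a, 'b) svb \<Rightarrow> 'a schart set \<Rightarrow> 'b schart set \<Rightarrow> bool" where
  "differentiable_svb V \<D> \<E> \<longleftrightarrow> stratified_vector_bundle V \<and>
     smooth_structure (sv_total V) \<D> \<and> smooth_structure (sv_base V) \<E> \<and>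
     smooth_strat_map (sv_total V) \<D> (sv_base V) \<E> (sv_proj V) \<and>
     smooth_strat_map (real_times (sv_total V)) (real_times_structure (sv_total V) \<D>)
       (sv_total V) \<D> (\<lambda>(t, a). sv_scale V t a)"


section \<open>Monoid actions of the multiplicative reals\<close>

definition monoid_action :: "'a set \<Rightarrow> (real \<times> 'a \<Rightarrow> 'a) \<Rightarrow> bool" where
  "monoid_action E h \<longleftrightarrow> (\<forall>t. \<forall>e\<in>E. h (t, e) \<in> E) \<and> (\<forall>e\<in>E. h (1, e) = e) \<and>
     (\<forall>s t. \<forall>e\<in>E. h (t, h (s, e)) = h (t * s, e))"

text \<open>The velocity of the curve \<open>\<gamma>\<close> at time \<open>0\<close>, a tangent vector of \<open>M\<close> at \<open>\<gamma> 0\<close>, is zero.\<close>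

definition zero_velocity :: "'a mfd \<Rightarrow> (real \<Rightarrow> 'a) \<Rightarrow> bool" where
  "zero_velocity M \<gamma> \<longleftrightarrow> (\<forall>(U, \<phi>)\<in>mcharts M. \<gamma> 0 \<in> U \<longrightarrow>
     (\<forall>i<mdim M. ((\<lambda>t. \<phi> (\<gamma> t) i) has_real_derivative 0) (at 0)))"

definition regular_action :: "'a mfd \<Rightarrow> (real \<times> 'a \<Rightarrow> 'a) \<Rightarrow> bool" where
  "regular_action M h \<longleftrightarrow> monoid_action (mpoints M) h \<and> smooth_map (prod_mfd real_mfd M) M h \<and>
     (\<forall>e\<in>mpoints M. zero_velocity M (\<lambda>t. h (t, e)) \<longleftrightarrow> e = h (0, e))"

definition stratified_regular_action :: "'a strat_space \<Rightarrow> (real \<times> 'a \<Rightarrow> 'a) \<Rightarrow> bool" where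
  "stratified_regular_action A \<mu> \<longleftrightarrow> monoid_action (spoints A) \<mu> \<and>
     stratified_morphism (real_times A) A \<mu> \<and> (\<forall>B\<in>strata A. regular_action (smfd A B) \<mu>)"

definition smooth_stratified_regular_action ::
    "'a strat_space \<Rightarrow> 'a schart set \<Rightarrow> (real \<times> 'a \<Rightarrow> 'a) \<Rightarrow> bool" where
  "smooth_stratified_regular_action A \<D> \<mu> \<longleftrightarrow> stratified_regular_action A \<mu> \<and>
     smooth_structure A \<D> \<and> smooth_strat_map (real_times A) (real_times_structure A \<D>) A \<D> \<mu>"


section \<open>The bundle determined by an action\<close>

definition svb_of_action :: "'a strat_space \<Rightarrow> (real \<times> 'a \<Rightarrow> 'a) \<Rightarrow> ('a, 'b) svb \<Rightarrow> bool" where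
  "svb_of_action A \<mu> V \<longleftrightarrow> stratified_vector_bundle V \<and> sv_total V = A \<and>
     (\<forall>t. \<forall>a\<in>spoints A. sv_scale V t a = \<mu> (t, a))"

definition continuous_zero_section :: "('a, 'b) svb \<Rightarrow> bool" where
  "continuous_zero_section V \<longleftrightarrow>
     continuous_map (stop (sv_base V)) (stop (sv_total V)) (sv_zero V)"

definition smooth_zero_section ::
    "('a, 'b) svb \<Rightarrow> 'a schart set \<Rightarrow> 'b schart set \<Rightarrow> bool" where
  "smooth_zero_section V \<D> \<E> \<longleftrightarrow>
     smooth_strat_map (sv_base V) \<E> (sv_total V) \<D> (sv_zero V)"

text \<open>Bundles with the same total space and the same scalar multiplication are compared by maps \<open>g\<close>
  of their bases such that \<open>(id, g)\<close> is fibrewise linear and is, over each stratum, an isomorphism of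
  smooth vector bundles.  The definition of a stratified vector bundle does not make the zero
  section continuous, so it does not determine the topology of the base:
  the bijection of the disjoint union of \<open>{0}\<close> and \<open>{0<..}\<close> onto \<open>{0..}\<close> is a stratified vector
  bundle of rank zero, with the same scalar multiplication as the identity of its total space.
  If the zero section is continuous, \<open>g\<close> has to be a homeomorphism as well.\<close>

definition svb_comparison :: "('a, 'b) svb \<Rightarrow> ('a, 'c) svb \<Rightarrow> ('b \<Rightarrow> 'c) \<Rightarrow> bool" where
  "svb_comparison V V' g \<longleftrightarrow>
     bij_betw g (spoints (sv_base V)) (spoints (sv_base V')) \<and>
     stratified_morphism (sv_base V) (sv_base V') g \<and>
     (\<forall>S\<in>strata (sv_base V). g ` S \<in> strata (sv_base V') \<and>
        diffeomorphism (smfd (sv_base V) S) (smfd (sv_base V') (g ` S)) g) \<and>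
     (\<forall>a\<in>spoints (sv_total V). sv_proj V' a = g (sv_proj V a)) \<and>
     (\<forall>a\<in>spoints (sv_total V). \<forall>b\<in>spoints (sv_total V).
        sv_proj V a = sv_proj V b \<longrightarrow> sv_add V' a b = sv_add V a b)"

definition svb_isomorphism :: "('a, 'b) svb \<Rightarrow> ('a, 'c) svb \<Rightarrow> ('b \<Rightarrow> 'c) \<Rightarrow> bool" where
  "svb_isomorphism V V' g \<longleftrightarrow> svb_comparison V V' g \<and>
     homeomorphic_map (stop (sv_base V)) (stop (sv_base V')) g"

definition differentiable_svb_isomorphism ::
    "('a, 'b) svb \<Rightarrow> 'b schart set \<Rightarrow> ('a, 'c) svb \<Rightarrow> 'c schart set \<Rightarrow> ('b \<Rightarrow> 'c) \<Rightarrow> bool" where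
  "differentiable_svb_isomorphism V \<E> V' \<E>' g \<longleftrightarrow> svb_isomorphism V V' g \<and>
     smooth_strat_map (sv_base V) \<E> (sv_base V') \<E>' g \<and>
     smooth_strat_map (sv_base V') \<E>' (sv_base V) \<E> (inv_into (spoints (sv_base V)) g)"

end

theory Submission
  imports Defs "HOL-Homology.Invariance_of_Domain" "Jordan_Normal_Form.Column_Operations"
begin

text \<open>For a regular action \<open>h\<close> on a manifold, \<open>h\<^sub>0\<close> is a smooth idempotent, so by the inverse function theorem
  its image is a submanifold and charts exist in which \<open>h\<^sub>0\<close> is a truncation of coordinates.  The map sending
  \<open>e\<close> to \<open>h\<^sub>0 e\<close> and the velocity of \<open>h\<^sub>t e\<close> at \<open>t = 0\<close> turns \<open>h\<^sub>t\<close> into multiplication by \<open>t\<close> and is a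
  diffeomorphism near the fixed points, hence everywhere because \<open>h\<^sub>t\<close> moves any point close to them: the
  manifold is a vector bundle over the image of \<open>h\<^sub>0\<close>, whose addition is the addition of velocities.
  On a stratified space this applies to every stratum, and the base is the closed set \<open>M\<close> of fixed points of \<open>\<mu>\<^sub>0\<close>.
  A chart \<open>\<phi>\<close> of a smooth structure restricts to \<open>M\<close>, because \<open>\<phi> \<circ> \<mu>\<^sub>0\<close> is locally a smooth function of \<open>\<phi>\<close>,
  which is idempotent on each stratum.  A bundle with projection \<open>p'\<close>, zero section \<open>z'\<close> and the same scalar
  multiplication satisfies \<open>z' \<circ> p' = \<mu>\<^sub>0\<close>, so the comparison map can only be the restriction of \<open>p'\<close> to \<open>M\<close>,
  with inverse \<open>z'\<close>.\<close>

section \<open>Smooth functions on coordinate spaces\<close>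

text \<open>Regularity only says which velocities vanish, whereas a trivialisation needs the
  derivative of the velocity at a fixed point to be invertible in the fibre directions. The crux is
  \<open>vel_linearise\<close>: the velocity is homogeneous along orbits, so its derivative
  \<open>K\<close> at a fixed point is idempotent; if \<open>K\<close> were not the full projection
  onto the fibre directions, the inverse function theorem, applied to the velocity plus 1 -
  \<open>K\<close>, would produce a point off the base with zero velocity. All calculus is done with
  partial derivatives, because dimensions vary with strata and charts. Invariance of domain makes
  inverse maps continuous without estimates and shows that the fixed set of a connected stratum has
  only one dimension. In ambient coordinates the transition maps between two charts of a stratified
  space are mutually inverse only along the image of the space, and have to be corrected to become
  diffeomorphisms. Smoothness of maps is tested by global functions, so local coordinates are cut
  off before the smoothness of the action applies to them.\<close>

abbreviation "En \<equiv> Euclidean_space"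

section \<open>Topology of the coordinate spaces\<close>

lemma Euclidean_space_eq: "En n = top_of_set {x. \<forall>i\<ge>n. x i = 0}"
 by (simp add: Euclidean_space_def euclidean_product_topology)

lemma Rn_iff: "x\<in>Rn n \<longleftrightarrow> (\<forall>i\<ge>n. x i = 0)"
 by (simp add: topspace_Euclidean_space)

lemma Rn_mono: "x\<in>Rn k ==> k\<le>n ==> x\<in>Rn n"
 by (auto simp: Rn_iff)

lemma Rn_upd: "x\<in>Rn n ==> i < n ==> x(i := t)\<in>Rn n"
 by (auto simp: Rn_iff)

lemma Rn_eqI:
 assumes "x\<in>Rn n" "y\<in>Rn n" "\<And>i. i < n ==> x i = y i"
 shows "x = y"
proof
 fix i show "x i = y i"
 proof (cases "i < n")
  case False
  then have "x i = 0" "y i = 0" using assms(1,2) unfolding Rn_iff by auto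
  then show ?thesis by simp
 qed (use assms(3) in blast)
qed

lemma continuous_on_coord [continuous_intros]: "continuous_on S (\<lambda>x. (x::nat \<Rightarrow> real) i)"
 by (rule continuous_on_subset[OF continuous_on_product_coordinates]) simp

lemma continuous_map_En_iff:
 assumes "U\<subseteq>Rn n"
 shows "continuous_map (subtopology (En n) U) euclideanreal f \<longleftrightarrow> continuous_on U f"
proof -
 have "subtopology (En n) U = top_of_set U"
  using assms by (auto simp: Euclidean_space_eq subtopology_subtopology topspace_Euclidean_space Int_absorb1)
 then show ?thesis by simp
qed

lemma openin_En_imp_subset: "openin (En n) U ==> U\<subseteq>Rn n"
 by (rule openin_subset)

lemma openin_En_preimage:
 assumes "openin (En n) U" "continuous_on U f" "open T"
 shows "openin (En n) {x\<in>U. f x\<in>T}"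
proof -
 have "openin (top_of_set U) (U\<inter>f -` T)"
  using assms(2,3) continuous_openin_preimage_gen by blast
 moreover have "{x\<in>U. f x\<in>T} = U\<inter>f -` T" by auto
 ultimately have "openin (top_of_set U) {x\<in>U. f x\<in>T}" by simp
 then show ?thesis using assms(1) unfolding Euclidean_space_eq by (rule openin_trans)
qed

text \<open>Cubes serve as basic neighbourhoods because they are adapted to coordinates: one
  coordinate can be moved at a time, a cube about the origin is stable under truncation, and cubes
  of the same radius in two factors form a cube of the product.\<close>

definition cube :: "nat \<Rightarrow> real \<Rightarrow> (nat \<Rightarrow> real) \<Rightarrow> (nat \<Rightarrow> real) set" where
 "cube n \<epsilon> x = {y\<in>Rn n. \<forall>i<n. \<bar>y i - x i\<bar> < \<epsilon>}"

lemma openin_Rn [simp, intro]: "openin (En n) (Rn n)" by simp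

lemma openin_cube [simp, intro]: "openin (En n) (cube n \<epsilon> x)"
proof -
 \<comment> \<open>The factor \<open>Rn n\<close> matters for \<open>n = 0\<close>, where the
   intersection over the indices is the whole type.\<close>
 have "cube n \<epsilon> x = (\<Inter>i\<in>{..<n}. {y\<in>Rn n. y i\<in>ball (x i) \<epsilon>})\<inter>Rn n"
  by (auto simp: cube_def dist_real_def abs_minus_commute)
 moreover have "openin (En n) ((\<Inter>i\<in>{..<n}. {y\<in>Rn n. y i\<in>ball (x i) \<epsilon>})\<inter>Rn n)"
 proof (cases "n = 0")
  case False
  then show ?thesis
   by (intro openin_Int openin_INT openin_En_preimage continuous_intros) auto
 qed simp
 ultimately show ?thesis by simp
qed

lemma cube_centre: "x\<in>Rn n ==> \<epsilon> > 0 ==> x\<in>cube n \<epsilon> x"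
 by (auto simp: cube_def)

lemma cube_mono: "\<epsilon>\<le>\<delta> ==> cube n \<epsilon> x\<subseteq>cube n \<delta> x"
 by (force simp: cube_def)

text \<open>A basic open set of the product topology constrains each coordinate by an open set.
  Beyond \<open>n\<close> both points vanish, so the minimum of the first \<open>n\<close> radii is
  enough.\<close>

lemma cube_nbhd:
 assumes "openin (En n) U" "x\<in>U"
 obtains \<epsilon> where "\<epsilon> > 0" "cube n \<epsilon> x\<subseteq>U"
proof -
 obtain T where T: "open T" "U = Rn n\<inter>T"
  using assms(1) unfolding Euclidean_space_eq openin_open by (auto simp: topspace_Euclidean_space)
 then have "openin (product_topology (\<lambda>i. euclidean) UNIV) T"
  by (simp add: euclidean_product_topology)
 moreover have "x\<in>T" using assms T by auto
 ultimately obtain X where X: "finite {i. X i\<noteq>(UNIV::real set)}" "\<And>i. open (X i)" "x\<in>Pi\<^sub>E UNIV X" "Pi\<^sub>E UNIV X\<subseteq>T"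
  by (force simp: openin_product_topology_alt)
 have "\<exists>e>0. ball (x i) e\<subseteq>X i" for i
  using X(2)[of i] X(3) by (auto simp: PiE_iff open_contains_ball)
 then obtain e where e: "\<And>i. e i > 0" "\<And>i. ball (x i) (e i)\<subseteq>X i" by metis
 \<comment> \<open>The extra element 1 keeps the minimum meaningful when
   \<open>n = 0\<close>.\<close>
 define \<epsilon> where "\<epsilon> = Min (insert 1 (e ` {..<n}))"
 have pos: "\<epsilon> > 0" unfolding \<epsilon>_def using e by (subst Min_gr_iff) auto
 have le: "\<epsilon>\<le>e i" if "i < n" for i unfolding \<epsilon>_def using that by (intro Min_le) auto
 have "cube n \<epsilon> x\<subseteq>U"
 proof
  fix y assume y: "y\<in>cube n \<epsilon> x"
  have "y i\<in>X i" for i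
  proof (cases "i < n")
   case True
   then have "\<bar>y i - x i\<bar> < e i" using y le[OF True] by (force simp: cube_def)
   then have "y i\<in>ball (x i) (e i)" by (simp add: dist_real_def abs_minus_commute)
   then show ?thesis using e by blast
  next
   case False
   then have "y i = x i" using y assms T by (auto simp: cube_def Rn_iff)
   then show ?thesis using X(3) by (auto simp: PiE_iff)
  qed
  then have "y\<in>T" using X(4) by auto
  then show "y\<in>U" using T y by (auto simp: cube_def)
 qed
 with pos show thesis by (rule that)
qed

lemma openin_En_upd_eventually:
 assumes "openin (En n) U" "x\<in>U" "i < n"
 shows "\<forall>\<^sub>F t in nhds (x i). x(i := t)\<in>U"
proof -
 obtain \<epsilon> where e: "\<epsilon> > 0" "cube n \<epsilon> x\<subseteq>U" using cube_nbhd assms by metis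
 have "\<forall>\<^sub>F t in nhds (x i). t\<in>ball (x i) \<epsilon>"
  using e by (intro eventually_nhds_in_open) auto
 then show ?thesis
 proof (eventually_elim)
  case (elim t)
  have "x\<in>Rn n" using assms openin_En_imp_subset by blast
  then have "x(i := t)\<in>cube n \<epsilon> x"
   using elim e(1) assms by (auto simp: cube_def Rn_upd dist_real_def abs_minus_commute)
  then show ?case using e by blast
 qed
qed

lemma openin_En_eventually:
 assumes "openin (En n) U" "x\<in>U" "\<forall>\<^sub>F t in F. c t\<in>Rn n"
  and "\<And>i. i < n ==> ((\<lambda>t. c t i) \<longlongrightarrow> x i) F"
 shows "\<forall>\<^sub>F t in F. c t\<in>U"
proof -
 obtain \<epsilon> where e: "\<epsilon> > 0" "cube n \<epsilon> x\<subseteq>U" using cube_nbhd assms by metis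
 have "\<forall>\<^sub>F t in F. \<forall>i\<in>{..<n}. dist (c t i) (x i) < \<epsilon>"
  using e assms(4) by (intro eventually_ball_finite) (auto intro: tendstoD)
 with assms(3) show ?thesis
  by eventually_elim (use e in \<open>auto simp: cube_def dist_real_def\<close>)
qed

lemma continuous_on_tendsto_coords:
 assumes "openin (En n) U" "x\<in>U" "\<forall>\<^sub>F t in F. c t\<in>Rn n"
  and "\<And>i. i < n ==> ((\<lambda>t. c t i) \<longlongrightarrow> x i) F" and "continuous_on U (f :: _ \<Rightarrow> real)"
 shows "((\<lambda>t. f (c t)) \<longlongrightarrow> f x) F"
proof (rule topological_tendstoI)
 fix S assume "open S" "f x\<in>S"
 then have "openin (En n) {y\<in>U. f y\<in>S}" "x\<in>{y\<in>U. f y\<in>S}"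
  using openin_En_preimage assms by auto
 then have "\<forall>\<^sub>F t in F. c t\<in>{y\<in>U. f y\<in>S}"
  by (rule openin_En_eventually) (use assms in auto)
 then show "\<forall>\<^sub>F t in F. f (c t)\<in>S" by eventually_elim auto
qed

lemma openin_En_vpreimage:
 assumes "openin (En n) U" "openin (En m) V"
  and "\<And>x. x\<in>U ==> g x\<in>Rn m" and "\<And>i. i < m ==> continuous_on U (\<lambda>x. g x i)"
 shows "openin (En n) {x\<in>U. g x\<in>V}"
proof -
 obtain T where T: "open T" "V = Rn m\<inter>T"
  using assms(2) unfolding Euclidean_space_eq openin_open by (auto simp: topspace_Euclidean_space)
 have "continuous_on U (\<lambda>x. g x i)" for i
 proof (cases "i < m")
  case False
  then have "g x i = 0" if "x\<in>U" for x using assms(3)[OF that] by (auto simp: Rn_iff)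
  then show ?thesis by (simp add: continuous_on_const cong: continuous_on_cong)
 qed (use assms in auto)
 then have "continuous_on U g" by (rule continuous_on_coordinatewise_then_product)
 then have "openin (En n) {x\<in>U. g x\<in>T}"
  using openin_En_preimage assms(1) T(1) by blast
 moreover have "{x\<in>U. g x\<in>T} = {x\<in>U. g x\<in>V}" using T assms(3) by auto
 ultimately show ?thesis by simp
qed

section \<open>Partial derivatives and continuous differentiability\<close>

definition pd :: "nat \<Rightarrow> ((nat \<Rightarrow> real) \<Rightarrow> real) \<Rightarrow> (nat \<Rightarrow> real) \<Rightarrow> real" where
 "pd i f x = deriv (\<lambda>t. f (x(i := t))) (x i)"

text \<open>\<open>pd\<close> is total, since \<open>deriv\<close> always denotes some number;
  existence of the derivative is therefore carried by a separate relation.\<close>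

definition has_pd :: "nat \<Rightarrow> ((nat \<Rightarrow> real) \<Rightarrow> real) \<Rightarrow> real \<Rightarrow> (nat \<Rightarrow> real) \<Rightarrow> bool" where
 "has_pd i f D x \<longleftrightarrow> ((\<lambda>t. f (x(i := t))) has_real_derivative D) (at (x i))"

lemma pd_unique: "has_pd i f D x ==> pd i f x = D"
 unfolding has_pd_def pd_def by (rule DERIV_imp_deriv)

lemma has_pd_cong:
 assumes "openin (En n) U" "x\<in>U" "i < n" "\<And>y. y\<in>U ==> f y = g y"
 shows "has_pd i f D x \<longleftrightarrow> has_pd i g D x"
proof -
 have "\<forall>\<^sub>F t in nhds (x i). f (x(i := t)) = g (x(i := t))"
  using openin_En_upd_eventually[OF assms(1-3)] by eventually_elim (use assms in auto)
 then show ?thesis unfolding has_pd_def by (intro DERIV_cong_ev) auto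
qed

lemma pd_cong:
 assumes "openin (En n) U" "x\<in>U" "i < n" "\<And>y. y\<in>U ==> f y = g y"
 shows "pd i f x = pd i g x"
proof -
 have "\<forall>\<^sub>F t in nhds (x i). f (x(i := t)) = g (x(i := t))"
  using openin_En_upd_eventually[OF assms(1-3)] by eventually_elim (use assms in auto)
 then show ?thesis unfolding pd_def by (intro deriv_cong_ev) auto
qed

lemma Ck_fun_cong:
 assumes "openin (En n) U" "\<And>y. y\<in>U ==> f y = g y"
 shows "Ck_fun k n U f \<longleftrightarrow> Ck_fun k n U g"
proof -
 have s: "U\<subseteq>Rn n" using assms openin_En_imp_subset by blast
 have c: "continuous_on U f \<longleftrightarrow> continuous_on U g" using assms by (intro continuous_on_cong) auto
 have d: "(\<forall>x\<in>U. ((\<lambda>t. f (x(i := t))) has_real_derivative f' x) (at (x i)))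
   \<longleftrightarrow> (\<forall>x\<in>U. ((\<lambda>t. g (x(i := t))) has_real_derivative f' x) (at (x i)))" if "i < n" for f' i
  using has_pd_cong[OF assms(1) _ that, of _ f g] assms(2) unfolding has_pd_def by blast
 show ?thesis by (cases k) (auto simp: continuous_map_En_iff[OF s] c d)
qed

lemma Ck_fun_continuous: "Ck_fun k n U f ==> U\<subseteq>Rn n ==> continuous_on U f"
 by (cases k) (auto simp: continuous_map_En_iff)

text \<open>Derivatives are unique, so the existentially quantified derivative in
  \<open>Ck_fun\<close> agrees on \<open>U\<close> with the canonical function
  \<open>pd i f\<close>. This form of the recursion involves no choice of derivatives.\<close>

lemma Ck_fun_Suc:
 assumes U: "openin (En n) U"
 shows "Ck_fun (Suc k) n U f \<longleftrightarrow> continuous_on U f \<and>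
  (\<forall>i<n. Ck_fun k n U (pd i f) \<and> (\<forall>x\<in>U. has_pd i f (pd i f x) x))" (is "?L \<longleftrightarrow> ?R")
proof
 assume L: ?L
 have "Ck_fun k n U (pd i f) \<and> (\<forall>x\<in>U. has_pd i f (pd i f x) x)" if i: "i < n" for i
 proof -
  obtain f' where f': "Ck_fun k n U f'" "\<forall>x\<in>U. has_pd i f (f' x) x"
   using L i by (auto simp: has_pd_def)
  then have "\<And>x. x\<in>U ==> f' x = pd i f x" using pd_unique by metis
  then show ?thesis using f' Ck_fun_cong[OF U, of f' "pd i f" k] by auto
 qed
 then show ?R using L continuous_map_En_iff U openin_En_imp_subset by auto
next
 assume ?R
 then show ?L using continuous_map_En_iff[of U n] U openin_En_imp_subset[of n U]
  by (auto simp: has_pd_def)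
qed

declare Ck_fun.simps [simp del]

lemma Ck_fun_0: "U\<subseteq>Rn n ==> Ck_fun 0 n U f \<longleftrightarrow> continuous_on U f"
 by (simp add: continuous_map_En_iff Ck_fun.simps(1))

lemma Ck_fun_SucI:
 assumes U: "openin (En n) U" and "continuous_on U f"
  and "\<And>i. i < n ==> Ck_fun k n U (f' i)"
  and "\<And>i x. i < n ==> x\<in>U ==> has_pd i f (f' i x) x"
 shows "Ck_fun (Suc k) n U f"
 using assms continuous_map_En_iff[of U n] openin_En_imp_subset[of n U]
 by (auto simp: has_pd_def Ck_fun.simps(2))

lemma Ck_fun_SucD:
 assumes "Ck_fun (Suc k) n U f" "openin (En n) U"
 shows "Ck_fun k n U f"
 using assms
proof (induction k arbitrary: f)
 case 0 then show ?case by (simp add: Ck_fun.simps)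
next
 case (Suc k)
 then show ?case using Ck_fun_Suc[OF Suc(3), of "Suc k" f] Ck_fun_Suc[OF Suc(3), of k f] by blast
qed

lemma Ck_fun_subset:
 assumes "Ck_fun k n U f" "V\<subseteq>U"
 shows "Ck_fun k n V f"
 using assms
proof (induction k arbitrary: f)
 case 0 then show ?case
  using continuous_map_from_subtopology_mono[of _ U _ f V] by (simp add: Ck_fun.simps(1))
next
 case (Suc k)
 have "continuous_map (subtopology (En n) V) euclideanreal f"
  using Suc(2,3) continuous_map_from_subtopology_mono[of _ U _ f V] unfolding Ck_fun.simps(2) by blast
 moreover have "\<exists>f'. Ck_fun k n V f' \<and> (\<forall>x\<in>V. ((\<lambda>t. f (x(i := t))) has_real_derivative f' x) (at (x i)))"
  if i: "i < n" for i
 proof -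
  obtain f' where "Ck_fun k n U f'" "\<forall>x\<in>U. ((\<lambda>t. f (x(i := t))) has_real_derivative f' x) (at (x i))"
   using Suc(2) i unfolding Ck_fun.simps(2) by blast
  then show ?thesis using Suc(1,3) by (intro exI[of _ f']) auto
 qed
 ultimately show ?case unfolding Ck_fun.simps(2) by blast
qed

text \<open>\<open>pd i f\<close> does not depend on the domain, so the derivatives found on the
  various neighbourhoods are restrictions of one function and nothing has to be glued.\<close>

lemma Ck_fun_local:
 assumes U: "openin (En n) U"
  and "\<And>x. x\<in>U ==> \<exists>V. openin (En n) V \<and> x\<in>V \<and> V\<subseteq>U \<and> Ck_fun k n V f"
 shows "Ck_fun k n U f"
 using assms(2)
proof (induction k arbitrary: f)
 case (0 f)
 have U': "U\<subseteq>Rn n" using U openin_En_imp_subset by blast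
 have "continuous (at x within U) f" if "x\<in>U" for x
 proof -
  obtain V where V: "openin (En n) V" "x\<in>V" "V\<subseteq>U" "Ck_fun 0 n V f" using 0 \<open>x\<in>U\<close> by blast
  then have "continuous_on V f" using Ck_fun_continuous U' by blast
  then have "continuous (at x within V) f" using V by (simp add: continuous_on_eq_continuous_within)
  moreover obtain T where "open T" "V = {x. \<forall>i\<ge>n. x i = 0}\<inter>T" using V(1) by (auto simp: Euclidean_space_eq openin_open)
  then have "V = U\<inter>T" using V U' by (auto simp: Rn_iff)
  moreover have "at x within V = at x within U"
   using V(2) \<open>V = U\<inter>T\<close> by (intro at_within_nhd[of x T]) (auto simp: \<open>open T\<close>)
  ultimately show ?thesis by (simp add: continuous_within)
 qed
 then show ?case using Ck_fun_0[OF U'] by (simp add: continuous_on_eq_continuous_within)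
next
 case (Suc k f)
 have U': "U\<subseteq>Rn n" using U openin_En_imp_subset by blast
 have L: "\<exists>V. openin (En n) V \<and> x\<in>V \<and> V\<subseteq>U \<and> Ck_fun (Suc k) n V f" if "x\<in>U" for x using Suc(2) that .
 have "Ck_fun k n U f"
 proof (rule Suc(1))
  fix x assume "x\<in>U"
  then obtain V where V: "openin (En n) V" "x\<in>V" "V\<subseteq>U" "Ck_fun (Suc k) n V f" using L by blast
  from Ck_fun_SucD[OF V(4,1)] V
  show "\<exists>V. openin (En n) V \<and> x\<in>V \<and> V\<subseteq>U \<and> Ck_fun k n V f" by blast
 qed
 then have c: "continuous_on U f" using Ck_fun_continuous U' by blast
 show ?case unfolding Ck_fun_Suc[OF U]
 proof (intro conjI c allI impI ballI)
  fix i assume i: "i < n"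
  show "Ck_fun k n U (pd i f)"
  proof (rule Suc(1))
   fix x assume "x\<in>U"
   then obtain V where V: "openin (En n) V" "x\<in>V" "V\<subseteq>U" "Ck_fun (Suc k) n V f" using L by blast
   then have "Ck_fun k n V (pd i f)" using Ck_fun_Suc[OF V(1)] i by blast
   then show "\<exists>V. openin (En n) V \<and> x\<in>V \<and> V\<subseteq>U \<and> Ck_fun k n V (pd i f)"
    using V by blast
  qed
  show "has_pd i f (pd i f x) x" if x: "x\<in>U" for x
  proof -
   obtain V where V: "openin (En n) V" "x\<in>V" "Ck_fun (Suc k) n V f" using L[OF x] by blast
   then show ?thesis using Ck_fun_Suc[OF V(1)] i by blast
  qed
 qed
qed


text \<open>A slope in direction \<open>j\<close> whose base point and both end points move with
  \<open>t\<close> still tends to the partial derivative: by the mean value theorem it is a value of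
  \<open>pd j f\<close> near \<open>x0\<close>, and \<open>pd j f\<close> is continuous. The product
  form of the conclusion also covers the times at which \<open>u t = v t\<close>.\<close>

lemma MVT_slope:
 assumes V: "openin (En n) V" "x0\<in>V" and j: "j < n"
  and d: "\<And>x. x\<in>V ==> has_pd j f (pd j f x) x" and c: "continuous_on V (pd j f)"
  and m: "\<forall>\<^sub>F t in F. m t\<in>Rn n" "\<And>i. i < n ==> ((\<lambda>t. m t i) \<longlongrightarrow> x0 i) F"
  and u: "(u \<longlongrightarrow> x0 j) F" and v: "(v \<longlongrightarrow> x0 j) F"
 obtains w where "(w \<longlongrightarrow> pd j f x0) F"
  "\<forall>\<^sub>F t in F. f ((m t)(j := u t)) - f ((m t)(j := v t)) = w t * (u t - v t)"
proof -
 \<comment> \<open>Where the end points coincide the limit itself is taken as the slope, which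
   cannot disturb the convergence.\<close>
 define w where "w = (\<lambda>t. if u t = v t then pd j f x0
   else (f ((m t)(j := u t)) - f ((m t)(j := v t))) / (u t - v t))"
 have "(w \<longlongrightarrow> pd j f x0) F"
 proof (rule tendstoI)
  fix e :: real assume e: "e > 0"
  have "openin (En n) {x\<in>V. pd j f x\<in>ball (pd j f x0) e}"
   "x0\<in>{x\<in>V. pd j f x\<in>ball (pd j f x0) e}"
   using openin_En_preimage[OF V(1) c open_ball] V e by auto
  then obtain \<delta> where \<delta>: "\<delta> > 0" "cube n \<delta> x0\<subseteq>{x\<in>V. pd j f x\<in>ball (pd j f x0) e}"
   by (rule cube_nbhd)
  have "x0\<in>Rn n" using V openin_En_imp_subset by blast
  have "\<forall>\<^sub>F t in F. m t\<in>cube n \<delta> x0"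
   by (rule openin_En_eventually[OF openin_cube cube_centre[OF \<open>x0\<in>Rn n\<close> \<delta>(1)] m])
  moreover have "\<forall>\<^sub>F t in F. dist (u t) (x0 j) < \<delta>" "\<forall>\<^sub>F t in F. dist (v t) (x0 j) < \<delta>"
   using u v \<delta> by (auto intro: tendstoD)
  ultimately show "\<forall>\<^sub>F t in F. dist (w t) (pd j f x0) < e"
  proof eventually_elim
   case (elim t)
   have inb: "(m t)(j := s)\<in>cube n \<delta> x0" if "dist s (x0 j) < \<delta>" for s
    using elim(1) that j by (auto simp: cube_def Rn_upd dist_real_def)
   have mv: "\<exists>z. dist z (x0 j) < \<delta> \<and> f ((m t)(j := b)) - f ((m t)(j := a)) = (b - a) * pd j f ((m t)(j := z))"
    if ab: "a < b" "dist a (x0 j) < \<delta>" "dist b (x0 j) < \<delta>" for a b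
   proof -
    have near: "dist s (x0 j) < \<delta>" if "a\<le>s" "s\<le>b" for s
     using ab that by (auto simp: dist_real_def)
    have "((\<lambda>s. f ((m t)(j := s))) has_real_derivative pd j f ((m t)(j := s))) (at s)" if "a\<le>s" "s\<le>b" for s
    proof -
     have "(m t)(j := s)\<in>V" using inb[OF near[OF that]] \<delta> by auto
     from d[OF this] show ?thesis by (simp add: has_pd_def)
    qed
    from MVT2[OF ab(1) this] obtain z where "a < z" "z < b"
     "f ((m t)(j := b)) - f ((m t)(j := a)) = (b - a) * pd j f ((m t)(j := z))" by blast
    then show ?thesis using near[of z] by (intro exI[of _ z]) auto
   qed
   have "\<exists>z. dist z (x0 j) < \<delta> \<and> w t = pd j f ((m t)(j := z))" if ne: "u t\<noteq>v t"
   proof (cases "u t < v t")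
    case True
    then obtain z where z: "dist z (x0 j) < \<delta>" "f ((m t)(j := v t)) - f ((m t)(j := u t)) = (v t - u t) * pd j f ((m t)(j := z))"
     using mv elim by blast
    then have "f ((m t)(j := u t)) - f ((m t)(j := v t)) = pd j f ((m t)(j := z)) * (u t - v t)"
     by (simp add: algebra_simps)
    then show ?thesis using z(1) ne by (intro exI[of _ z]) (simp add: w_def)
   next
    case False
    then obtain z where z: "dist z (x0 j) < \<delta>" "f ((m t)(j := u t)) - f ((m t)(j := v t)) = (u t - v t) * pd j f ((m t)(j := z))"
     using mv[of "v t" "u t"] elim ne by auto
    then show ?thesis using z(1) ne by (intro exI[of _ z]) (simp add: w_def)
   qed
   then show ?case
   proof (cases "u t = v t")
    case False
    then obtain z where z: "dist z (x0 j) < \<delta>" "w t = pd j f ((m t)(j := z))"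
     using \<open>u t\<noteq>v t ==> _\<close> by blast
    then have "(m t)(j := z)\<in>{x\<in>V. pd j f x\<in>ball (pd j f x0) e}" using inb \<delta>(2) by blast
    then show ?thesis using z by (auto simp: dist_commute)
   qed (simp add: w_def e)
  qed
 qed
 then show thesis by (rule that) (auto simp: w_def)
qed

text \<open>Telescoping: the point \<open>mix k t\<close> follows the curve in its first
  \<open>k\<close> coordinates and stays at \<open>c t0\<close> in the others. Passing from
  \<open>k\<close> to \<open>k + 1\<close> changes \<open>f\<close> by a slope times the increment
  of one coordinate, and \<open>MVT_slope\<close> gives the limit of the slope although its base
  point moves. Of the curve, differentiability at the single time \<open>t0\<close> is
  enough.\<close>

lemma C1_chain_curve:
 assumes V: "openin (En m) V" "c t0\<in>V" and f: "Ck_fun 1 m V f"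
  and cR: "\<forall>\<^sub>F t in nhds t0. c t\<in>Rn m"
  and c: "\<And>j. j < m ==> ((\<lambda>t. c t j) has_real_derivative c' j) (at t0)"
 shows "((\<lambda>t. f (c t)) has_real_derivative (\<Sum>j<m. pd j f (c t0) * c' j)) (at t0)"
proof -
 define mix where "mix j t = (\<lambda>i. if i < j then c t i else c t0 i)" for j :: nat and t
 have fp: "has_pd j f (pd j f x) x" "continuous_on V (pd j f)" if "j < m" "x\<in>V" for j x
  using f Ck_fun_Suc[OF V(1), of 0 f] that Ck_fun_continuous[of 0 m V "pd j f"] openin_En_imp_subset[OF V(1)] by auto
 have t0R: "c t0\<in>Rn m" using V openin_En_imp_subset by blast
 have tend: "((\<lambda>t. c t j) \<longlongrightarrow> c t0 j) (at t0)" if "j < m" for j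
  using c[OF that] by (meson DERIV_isCont isCont_def)
 have "((\<lambda>t. f (mix k t)) has_real_derivative (\<Sum>j<k. pd j f (c t0) * c' j)) (at t0)" if "k\<le>m" for k
  using that
 proof (induction k)
  case 0 then show ?case by (simp add: mix_def)
 next
  case (Suc k)
  have mixR: "\<forall>\<^sub>F t in at t0. mix k t\<in>Rn m"
   using cR unfolding eventually_nhds_conv_at using t0R by (auto elim!: eventually_mono simp: mix_def Rn_iff)
  have mt: "((\<lambda>t. mix k t i) \<longlongrightarrow> c t0 i) (at t0)" if "i < m" for i
   using tend[OF that] by (cases "i < k") (simp_all add: mix_def)
  obtain w where w: "(w \<longlongrightarrow> pd k f (c t0)) (at t0)"
   "\<forall>\<^sub>F t in at t0. f ((mix k t)(k := c t k)) - f ((mix k t)(k := c t0 k)) = w t * (c t k - c t0 k)"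
   by (rule MVT_slope[OF V, where j=k and f=f and F="at t0" and m="mix k" and u="\<lambda>t. c t k" and v="\<lambda>_. c t0 k"])
    (use fp V Suc mixR mt tend in auto)
  have e1: "(mix k t)(k := c t k) = mix (Suc k) t" "(mix k t)(k := c t0 k) = mix k t" for t
   by (auto simp: mix_def fun_eq_iff less_Suc_eq)
  have mix0: "mix j t0 = c t0" for j by (auto simp: mix_def)
  have "((\<lambda>t. w t * ((c t k - c t0 k) / (t - t0))) \<longlongrightarrow> pd k f (c t0) * c' k) (at t0)"
   using c[of k] Suc by (intro tendsto_mult w(1)) (simp add: has_field_derivative_iff)
  moreover have "\<forall>\<^sub>F t in at t0. w t * ((c t k - c t0 k) / (t - t0)) = ((f (mix (Suc k) t) - f (mix k t)) - (f (mix (Suc k) t0) - f (mix k t0))) / (t - t0)"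
   using w(2) by eventually_elim (simp add: e1 mix0)
  ultimately have "((\<lambda>t. ((f (mix (Suc k) t) - f (mix k t)) - (f (mix (Suc k) t0) - f (mix k t0))) / (t - t0)) \<longlongrightarrow> pd k f (c t0) * c' k) (at t0)"
   by (rule Lim_transform_eventually)
  then have "((\<lambda>t. f (mix (Suc k) t) - f (mix k t)) has_real_derivative pd k f (c t0) * c' k) (at t0)"
   by (simp add: has_field_derivative_iff)
  from DERIV_add[OF this Suc.IH] Suc(2) show ?case by (simp add: add.commute)
 qed
 from this[of m] have d: "((\<lambda>t. f (mix m t)) has_real_derivative (\<Sum>j<m. pd j f (c t0) * c' j)) (at t0)" by simp
 have "\<forall>\<^sub>F t in nhds t0. f (mix m t) = f (c t)"
  using cR
 proof eventually_elim
  case (elim t)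
  have "mix m t = c t" using elim t0R by (auto simp: mix_def Rn_iff fun_eq_iff)
  then show ?case by simp
 qed
 with d show ?thesis by (subst DERIV_cong_ev[symmetric, OF refl _ refl]) auto
qed

section \<open>Closure properties of continuously differentiable functions\<close>

lemma Ck_fun_const [simp]: "openin (En n) U ==> Ck_fun k n U (\<lambda>x. c)"
proof (induction k arbitrary: c)
 case (Suc k)
 then show ?case by (intro Ck_fun_SucI[where f'="\<lambda>_ _. 0"]) (auto simp: has_pd_def)
qed (simp add: Ck_fun_0 openin_En_imp_subset)

lemma Ck_fun_coord: "openin (En n) U ==> Ck_fun k n U (\<lambda>x. x i)"
proof (cases k)
 case (Suc k')
 assume U: "openin (En n) U"
 have "has_pd j (\<lambda>x. x i) (if j = i then 1 else 0) x" for j x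
  by (auto simp: has_pd_def)
 then show ?thesis unfolding Suc
  by (intro Ck_fun_SucI[where f'="\<lambda>j _. if j = i then 1 else 0"] U continuous_intros) (auto simp: U)
qed (auto simp: Ck_fun_0 openin_En_imp_subset intro!: continuous_intros)

lemma Ck_fun_add:
 assumes U: "openin (En n) U"
 shows "Ck_fun k n U f ==> Ck_fun k n U g ==> Ck_fun k n U (\<lambda>x. f x + g x)"
proof (induction k arbitrary: f g)
 case 0 then show ?case using openin_En_imp_subset[OF U] by (simp add: Ck_fun_0 continuous_on_add)
next
 case (Suc k)
 note f = Suc(2)[unfolded Ck_fun_Suc[OF U]] and g = Suc(3)[unfolded Ck_fun_Suc[OF U]]
 show ?case
 proof (rule Ck_fun_SucI[OF U, where f'="\<lambda>i x. pd i f x + pd i g x"])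
  fix i x assume "i < n" "x\<in>U"
  then have "has_pd i f (pd i f x) x" "has_pd i g (pd i g x) x" using f g by auto
  then show "has_pd i (\<lambda>x. f x + g x) (pd i f x + pd i g x) x"
   unfolding has_pd_def by (rule DERIV_add)
 qed (use f g Suc(1) in \<open>auto intro!: continuous_intros\<close>)
qed

lemma Ck_fun_mult:
 assumes U: "openin (En n) U"
 shows "Ck_fun k n U f ==> Ck_fun k n U g ==> Ck_fun k n U (\<lambda>x. f x * g x)"
proof (induction k arbitrary: f g)
 case 0 then show ?case using openin_En_imp_subset[OF U] by (simp add: Ck_fun_0 continuous_on_mult)
next
 case (Suc k)
 note f = Suc(2)[unfolded Ck_fun_Suc[OF U]] and g = Suc(3)[unfolded Ck_fun_Suc[OF U]]
 note fk = Ck_fun_SucD[OF Suc(2) U] and gk = Ck_fun_SucD[OF Suc(3) U]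
 show ?case
 proof (rule Ck_fun_SucI[OF U, where f'="\<lambda>i x. pd i f x * g x + f x * pd i g x"])
  fix i x assume i: "i < n" "x\<in>U"
  then have "has_pd i f (pd i f x) x" "has_pd i g (pd i g x) x" using f g by auto
  then have "((\<lambda>t. f (x(i := t)) * g (x(i := t))) has_real_derivative
    pd i f x * g (x(i := x i)) + pd i g x * f (x(i := x i))) (at (x i))"
   unfolding has_pd_def by (rule DERIV_mult)
  then show "has_pd i (\<lambda>x. f x * g x) (pd i f x * g x + f x * pd i g x) x"
   by (simp add: has_pd_def mult.commute)
 qed (use f g fk gk Suc(1) in \<open>auto intro!: continuous_intros Ck_fun_add[OF U]\<close>)
qed

lemma Ck_fun_sum:
 assumes U: "openin (En n) U"
 shows "(\<And>i. i\<in>I ==> Ck_fun k n U (f i)) ==> Ck_fun k n U (\<lambda>x. \<Sum>i\<in>I. f i x)"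
 by (induction I rule: infinite_finite_induct) (auto simp: U intro!: Ck_fun_add[OF U])

text \<open>Induction over the order with \<open>f\<close> generalised: by the chain rule the
  derivatives of the composite are sums of products of \<open>pd j f\<close>, composed with
  \<open>g\<close>, and derivatives of \<open>g\<close>, both of one order less.\<close>

lemma Ck_fun_compose:
 assumes U: "openin (En n) U" and V: "openin (En m) V"
 shows "Ck_fun k m V f ==> (\<And>j. j < m ==> Ck_fun k n U (\<lambda>x. g x j)) ==> (\<And>x. x\<in>U ==> g x\<in>V)
  ==> Ck_fun k n U (\<lambda>x. f (g x))"
proof (induction k arbitrary: f)
 case (0 f)
 have V': "V\<subseteq>Rn m" and U': "U\<subseteq>Rn n" using U V openin_En_imp_subset by auto
 have "continuous_on U (\<lambda>x. g x j)" for j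
 proof (cases "j < m")
  case True then show ?thesis using 0(2) Ck_fun_0[OF U'] by auto
 next
  case False
  then have "g x j = 0" if "x\<in>U" for x using 0(3)[OF that] V' by (force simp: Rn_iff)
  then show ?thesis by (simp add: continuous_on_const cong: continuous_on_cong)
 qed
 then have "continuous_on U g" by (rule continuous_on_coordinatewise_then_product)
 moreover have "continuous_on (g ` U) f" using 0(1,3) Ck_fun_0[OF V'] by (auto intro: continuous_on_subset)
 ultimately show ?case using Ck_fun_0[OF U'] continuous_on_compose[of U g f] by (simp add: o_def)
next
 case (Suc k f)
 have V': "V\<subseteq>Rn m" and U': "U\<subseteq>Rn n" using U V openin_En_imp_subset by auto
 have gk: "Ck_fun k n U (\<lambda>x. g x j)" if "j < m" for j using Ck_fun_SucD[OF Suc(3)[OF that] U] .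
 have fk: "Ck_fun k m V f" using Ck_fun_SucD[OF Suc(2) V] .
 have c: "continuous_on U (\<lambda>x. f (g x))"
  using Suc(1)[OF fk gk Suc(4)] Ck_fun_continuous U' by blast
 have f1: "Ck_fun 1 m V f"
  using Suc(2) unfolding One_nat_def Ck_fun_Suc[OF V] Ck_fun_0[OF V'] using Ck_fun_continuous V' by blast
 show ?case
 proof (rule Ck_fun_SucI[OF U c, where f'="\<lambda>i x. \<Sum>j<m. pd j f (g x) * pd i (\<lambda>x. g x j) x"])
  fix i assume i: "i < n"
  show "Ck_fun k n U (\<lambda>x. \<Sum>j<m. pd j f (g x) * pd i (\<lambda>x. g x j) x)"
  proof (intro Ck_fun_sum[OF U] Ck_fun_mult[OF U])
   fix j assume j: "j\<in>{..<m}"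
   have "Ck_fun k m V (pd j f)" using Suc(2) Ck_fun_Suc[OF V] j by blast
   then show "Ck_fun k n U (\<lambda>x. pd j f (g x))" by (rule Suc(1)[OF _ gk Suc(4)])
   show "Ck_fun k n U (pd i (\<lambda>x. g x j))" using Suc(3)[of j] Ck_fun_Suc[OF U] i j by blast
  qed
  fix x assume x: "x\<in>U"
  have "((\<lambda>t. f (g (x(i := t)))) has_real_derivative (\<Sum>j<m. pd j f (g (x(i := x i))) * pd i (\<lambda>x. g x j) x)) (at (x i))"
  proof (rule C1_chain_curve[OF V _ f1])
   show "g (x(i := x i))\<in>V" using x Suc(4) by simp
   show "\<forall>\<^sub>F t in nhds (x i). g (x(i := t))\<in>Rn m"
    using openin_En_upd_eventually[OF U x i] by eventually_elim (use Suc(4) V' in auto)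
   fix j assume "j < m"
   then have "has_pd i (\<lambda>x. g x j) (pd i (\<lambda>x. g x j) x) x"
    using Suc(3)[of j] Ck_fun_Suc[OF U] i x by blast
   then show "((\<lambda>t. g (x(i := t)) j) has_real_derivative pd i (\<lambda>x. g x j) x) (at (x i))"
    by (simp add: has_pd_def)
  qed
  then show "has_pd i (\<lambda>x. f (g x)) (\<Sum>j<m. pd j f (g x) * pd i (\<lambda>x. g x j) x) x"
   by (simp add: has_pd_def)
 qed
qed

text \<open>The derivative of the reciprocal is a product of the reciprocal itself and
  \<open>pd i f\<close>, so order \<open>k\<close> of the reciprocal yields order
  \<open>k + 1\<close>.\<close>

lemma Ck_fun_inverse:
 assumes U: "openin (En n) U" and nz: "\<And>x. x\<in>U ==> f x\<noteq>0"
 shows "Ck_fun k n U f ==> Ck_fun k n U (\<lambda>x. inverse (f x))"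
proof (induction k)
 case 0 then show ?case using openin_En_imp_subset[OF U] nz by (simp add: Ck_fun_0 continuous_on_inverse)
next
 case (Suc k)
 note f = Suc(2)[unfolded Ck_fun_Suc[OF U]]
 note i = Suc(1)[OF Ck_fun_SucD[OF Suc(2) U]]
 show ?case
 proof (rule Ck_fun_SucI[OF U, where f'="\<lambda>i x. (-1) * (inverse (f x) * pd i f x * inverse (f x))"])
  fix i x assume i: "i < n" "x\<in>U"
  then have "has_pd i f (pd i f x) x" using f by auto
  then have "((\<lambda>t. inverse (f (x(i := t)))) has_real_derivative
    - (inverse (f (x(i:=x i))) * pd i f x * inverse (f (x(i:=x i))))) (at (x i))"
   unfolding has_pd_def using nz[OF i(2)] by (intro DERIV_inverse') auto
  then show "has_pd i (\<lambda>x. inverse (f x)) ((-1) * (inverse (f x) * pd i f x * inverse (f x))) x"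
   by (simp add: has_pd_def)
 next
  fix j assume "j < n"
  with f i show "Ck_fun k n U (\<lambda>x. (-1) * (inverse (f x) * pd j f x * inverse (f x)))"
   by (intro Ck_fun_mult[OF U] Ck_fun_const[OF U]) auto
 qed (use f nz in \<open>auto intro!: continuous_intros\<close>)
qed

text \<open>A family \<open>C\<close> closed under differentiation takes the place of a notion of
  smoothness for functions of one real variable. It is applied to the family of all
  \<open>flat_exp p\<close>.\<close>

lemma Ck_fun_compose1:
 assumes U: "openin (En n) U"
  and C: "\<And>\<phi>. \<phi>\<in>C ==> \<exists>\<phi>'\<in>C. \<forall>y. (\<phi> has_real_derivative \<phi>' y) (at y)"
 shows "Ck_fun k n U g ==> \<phi>\<in>C ==> Ck_fun k n U (\<lambda>x. \<phi> (g x))"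
proof (induction k arbitrary: \<phi>)
 case (0 \<phi>)
 have "continuous_on UNIV \<phi>" using C[OF 0(2)] by (meson DERIV_isCont continuous_at_imp_continuous_on)
 then have "continuous_on (g ` U) \<phi>" by (rule continuous_on_subset) auto
 then show ?case using 0 openin_En_imp_subset[OF U] continuous_on_compose[of U g \<phi>] by (simp add: Ck_fun_0 o_def)
next
 case (Suc k \<phi>)
 note g = Suc(2)[unfolded Ck_fun_Suc[OF U]]
 note gk = Ck_fun_SucD[OF Suc(2) U]
 obtain \<phi>' where p: "\<phi>'\<in>C" "\<And>y. (\<phi> has_real_derivative \<phi>' y) (at y)" using C[OF Suc(3)] by blast
 show ?case
 proof (rule Ck_fun_SucI[OF U, where f'="\<lambda>i x. \<phi>' (g x) * pd i g x"])
  show "continuous_on U (\<lambda>x. \<phi> (g x))"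
   using Suc(1)[OF gk Suc(3)] Ck_fun_continuous openin_En_imp_subset[OF U] by blast
  fix i assume i: "i < n"
  show "Ck_fun k n U (\<lambda>x. \<phi>' (g x) * pd i g x)"
   using g i by (intro Ck_fun_mult[OF U] Suc(1)[OF gk p(1)]) auto
  fix x assume "x\<in>U"
  then have "has_pd i g (pd i g x) x" using g i by auto
  then show "has_pd i (\<lambda>x. \<phi> (g x)) (\<phi>' (g x) * pd i g x) x"
   unfolding has_pd_def by (intro DERIV_chain2) (auto simp: p(2))
 qed
qed

section \<open>Smooth functions and smooth coordinate maps\<close>

lemma smooth_funI: "openin (En n) U ==> (\<And>k. Ck_fun k n U f) ==> smooth_fun n U f"
 by (simp add: smooth_fun_def)

lemma smooth_fun_openin: "smooth_fun n U f ==> openin (En n) U"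
 by (simp add: smooth_fun_def)

lemma smooth_fun_cong:
 assumes "smooth_fun n U f" "\<And>y. y\<in>U ==> f y = g y" shows "smooth_fun n U g"
 using assms Ck_fun_cong[of n U f g] by (auto simp: smooth_fun_def)

lemma smooth_fun_continuous: "smooth_fun n U f ==> continuous_on U f"
 unfolding smooth_fun_def by (metis Ck_fun_continuous openin_En_imp_subset)

lemma smooth_fun_subset: "smooth_fun n U f ==> openin (En n) V ==> V\<subseteq>U ==> smooth_fun n V f"
 unfolding smooth_fun_def by (metis Ck_fun_subset)

lemma smooth_fun_local:
 assumes "openin (En n) U"
  and "\<And>x. x\<in>U ==> \<exists>V. x\<in>V \<and> V\<subseteq>U \<and> smooth_fun n V f"
 shows "smooth_fun n U f"
proof (rule smooth_funI[OF assms(1)])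
 show "Ck_fun k n U f" for k
 proof (rule Ck_fun_local[OF assms(1)])
  fix x assume "x\<in>U"
  then obtain V where "x\<in>V" "V\<subseteq>U" "smooth_fun n V f" using assms(2) by blast
  then show "\<exists>V. openin (En n) V \<and> x\<in>V \<and> V\<subseteq>U \<and> Ck_fun k n V f"
   unfolding smooth_fun_def by (intro exI[of _ V]) simp
 qed
qed

lemma smooth_fun_pd:
 assumes "smooth_fun n U f" "i < n" shows "smooth_fun n U (pd i f)"
proof (rule smooth_funI)
 show U: "openin (En n) U" using assms smooth_fun_openin by blast
 show "Ck_fun k n U (pd i f)" for k
  using assms Ck_fun_Suc[OF U, of k f] by (simp add: smooth_fun_def)
qed

lemma smooth_fun_has_pd:
 assumes "smooth_fun n U f" "i < n" "x\<in>U" shows "has_pd i f (pd i f x) x"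
proof -
 have U: "openin (En n) U" using assms smooth_fun_openin by blast
 have "Ck_fun (Suc 0) n U f" using assms(1) by (auto simp: smooth_fun_def)
 then show ?thesis using Ck_fun_Suc[OF U, of 0 f] assms by blast
qed

lemma smooth_fun_const [simp]: "openin (En n) U ==> smooth_fun n U (\<lambda>x. c)"
 by (rule smooth_funI) auto

lemma smooth_fun_coord: "openin (En n) U ==> smooth_fun n U (\<lambda>x. x i)"
 by (rule smooth_funI) (auto intro: Ck_fun_coord)

lemma smooth_fun_add: "smooth_fun n U f ==> smooth_fun n U g ==> smooth_fun n U (\<lambda>x. f x + g x)"
 by (auto simp: smooth_fun_def intro: Ck_fun_add)

lemma smooth_fun_mult: "smooth_fun n U f ==> smooth_fun n U g ==> smooth_fun n U (\<lambda>x. f x * g x)"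
 by (auto simp: smooth_fun_def intro: Ck_fun_mult)

lemma smooth_fun_minus: "smooth_fun n U f ==> smooth_fun n U (\<lambda>x. - f x)"
 using smooth_fun_mult[of n U "\<lambda>_. -1" f] by (simp add: smooth_fun_openin)

lemma smooth_fun_diff: "smooth_fun n U f ==> smooth_fun n U g ==> smooth_fun n U (\<lambda>x. f x - g x)"
 using smooth_fun_add[of n U f "\<lambda>x. - g x"] smooth_fun_minus by simp

lemma smooth_fun_sum: "openin (En n) U ==> (\<And>i. i\<in>I ==> smooth_fun n U (f i)) ==> smooth_fun n U (\<lambda>x. \<Sum>i\<in>I. f i x)"
 by (induction I rule: infinite_finite_induct) (auto intro: smooth_fun_add)

lemma smooth_fun_prod: "openin (En n) U ==> (\<And>i. i\<in>I ==> smooth_fun n U (f i)) ==> smooth_fun n U (\<lambda>x. \<Prod>i\<in>I. f i x)"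
 by (induction I rule: infinite_finite_induct) (auto intro: smooth_fun_mult)

lemma smooth_fun_inverse: "smooth_fun n U f ==> (\<And>x. x\<in>U ==> f x\<noteq>0) ==> smooth_fun n U (\<lambda>x. inverse (f x))"
 by (auto simp: smooth_fun_def intro: Ck_fun_inverse)

lemma smooth_fun_if: "smooth_fun n U f ==> smooth_fun n U g ==> smooth_fun n U (\<lambda>x. if P then f x else g x)"
 by (cases P) simp_all

lemma cmapI:
 "openin (En n) U ==> (\<And>x. x\<in>U ==> F x\<in>Rn m) ==> (\<And>i. i < m ==> smooth_fun n U (\<lambda>x. F x i))
  ==> smooth_coord_map n U m F"
 by (auto simp: smooth_coord_map_def)

text \<open>Coordinates from \<open>m\<close> on vanish on \<open>U\<close> and zero is smooth, so
  the last conclusion holds for every index, which spares a bound in later uses.\<close>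

lemma cmapD:
 assumes "smooth_coord_map n U m F"
 shows "openin (En n) U" "x\<in>U ==> F x\<in>Rn m" "smooth_fun n U (\<lambda>x. F x i)"
proof -
 show U: "openin (En n) U" and FR: "x\<in>U ==> F x\<in>Rn m" for x
  using assms by (auto simp: smooth_coord_map_def)
 show "smooth_fun n U (\<lambda>x. F x i)"
 proof (cases "i < m")
  case True then show ?thesis using assms by (auto simp: smooth_coord_map_def)
 next
  case False
  then have "0 = F x i" if "x\<in>U" for x using FR[OF that] by (auto simp: Rn_iff)
  then show ?thesis by (rule smooth_fun_cong[OF smooth_fun_const[OF U, of 0]])
 qed
qed

lemma cmap_openin_preimage:
 assumes "smooth_coord_map n U m F" "openin (En m) V"
 shows "openin (En n) {x\<in>U. F x\<in>V}"
 by (rule openin_En_vpreimage[OF cmapD(1)[OF assms(1)] assms(2)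
   cmapD(2)[OF assms(1)] smooth_fun_continuous[OF cmapD(3)[OF assms(1)]]])

lemma cmap_cong:
 assumes "smooth_coord_map n U m F" "\<And>x. x\<in>U ==> F x = G x" shows "smooth_coord_map n U m G"
proof (rule cmapI)
 note D = cmapD[OF assms(1)]
 show "openin (En n) U" by (rule D)
 show "G x\<in>Rn m" if "x\<in>U" for x using D(2)[OF that] assms(2)[OF that] by simp
 show "smooth_fun n U (\<lambda>x. G x i)" for i by (rule smooth_fun_cong[OF D(3)[of i]]) (simp add: assms(2))
qed

lemma cmap_subset:
 assumes "smooth_coord_map n U m F" "openin (En n) V" "V\<subseteq>U" shows "smooth_coord_map n V m F"
 by (rule cmapI[OF assms(2) cmapD(2)[OF assms(1)]
   smooth_fun_subset[OF cmapD(3)[OF assms(1)] assms(2,3)]]) (use assms(3) in auto)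

lemma smooth_fun_compose:
 assumes "smooth_fun m V f" "smooth_coord_map n U m G" "\<And>x. x\<in>U ==> G x\<in>V"
 shows "smooth_fun n U (\<lambda>x. f (G x))"
proof (rule smooth_funI)
 show U: "openin (En n) U" by (rule cmapD[OF assms(2)])
 show "Ck_fun k n U (\<lambda>x. f (G x))" for k
  by (rule Ck_fun_compose[OF U])
   (use assms(1,3) cmapD(3)[OF assms(2)] in \<open>auto simp: smooth_fun_def\<close>)
qed

lemma cmap_compose:
 assumes "smooth_coord_map m V l F" "smooth_coord_map n U m G" "\<And>x. x\<in>U ==> G x\<in>V"
 shows "smooth_coord_map n U l (\<lambda>x. F (G x))"
proof (rule cmapI)
 show "openin (En n) U" by (rule cmapD[OF assms(2)])
 show "F (G x)\<in>Rn l" if "x\<in>U" for x using cmapD[OF assms(1)] assms(3)[OF that] by blast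
 show "smooth_fun n U (\<lambda>x. F (G x) i)" for i
  by (rule smooth_fun_compose[OF cmapD(3)[OF assms(1)] assms(2,3)])
qed

lemma cmap_chain_curve:
 assumes "smooth_fun m V f" "c t0\<in>V" "\<forall>\<^sub>F t in nhds t0. c t\<in>Rn m"
  and "\<And>j. j < m ==> ((\<lambda>t. c t j) has_real_derivative c' j) (at t0)"
 shows "((\<lambda>t. f (c t)) has_real_derivative (\<Sum>j<m. pd j f (c t0) * c' j)) (at t0)"
 by (rule C1_chain_curve) (use assms in \<open>auto simp: smooth_fun_def\<close>)

lemma pd_compose:
 assumes f: "smooth_fun m V f" and g: "smooth_coord_map n U m g" and x: "x\<in>U" "g x\<in>V" and i: "i < n"
 shows "pd i (\<lambda>x. f (g x)) x = (\<Sum>j<m. pd j f (g x) * pd i (\<lambda>x. g x j) x)"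
proof (rule pd_unique)
 note D = cmapD[OF g]
 have "((\<lambda>t. f (g (x(i := t)))) has_real_derivative (\<Sum>j<m. pd j f (g (x(i := x i))) * pd i (\<lambda>x. g x j) x)) (at (x i))"
 proof (rule cmap_chain_curve[OF f])
  show "g (x(i := x i))\<in>V" using x by simp
  show "\<forall>\<^sub>F t in nhds (x i). g (x(i := t))\<in>Rn m"
   using openin_En_upd_eventually[OF D(1) x(1) i] by eventually_elim (use D in auto)
  show "((\<lambda>t. g (x(i := t)) j) has_real_derivative pd i (\<lambda>x. g x j) x) (at (x i))" for j
   using smooth_fun_has_pd[OF D(3) i x(1)] by (simp add: has_pd_def)
 qed
 then show "has_pd i (\<lambda>x. f (g x)) (\<Sum>j<m. pd j f (g x) * pd i (\<lambda>x. g x j) x) x" by (simp add: has_pd_def)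
qed

section \<open>Truncations and diffeomorphisms of open sets\<close>

definition trunc :: "nat \<Rightarrow> (nat \<Rightarrow> real) \<Rightarrow> nat \<Rightarrow> real" where
 "trunc k x = (\<lambda>i. if i < k then x i else 0)"

lemma trunc_Rn [simp]: "trunc k x\<in>Rn k" by (simp add: trunc_def Rn_iff)

lemma trunc_id: "x\<in>Rn k ==> trunc k x = x"
 by (auto simp: trunc_def Rn_iff fun_eq_iff)

lemma trunc_eq_iff: "trunc k x = x \<longleftrightarrow> x\<in>Rn k"
 using trunc_id trunc_Rn by metis

lemma smooth_trunc_into:
 assumes "openin (En n) U" "k\<le>m" shows "smooth_coord_map n U m (trunc k)"
 using assms by (intro cmapI)
  (auto simp: trunc_def Rn_iff intro!: smooth_fun_if smooth_fun_coord smooth_fun_const)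

lemma smooth_trunc: "openin (En n) U ==> smooth_coord_map n U k (trunc k)"
 by (rule smooth_trunc_into) auto

lemma smooth_coord_id: "openin (En n) U ==> n\<le>m ==> smooth_coord_map n U m (\<lambda>x. x)"
 by (rule cmapI[OF _ Rn_mono smooth_fun_coord]) (use openin_En_imp_subset in auto)

lemma cmap_into: "smooth_coord_map n U m F ==> m\<le>l ==> smooth_coord_map n U l F"
 by (rule cmapI[OF cmapD(1) Rn_mono[OF cmapD(2)] cmapD(3)])

text \<open>An explicit inverse \<open>G\<close> stands in for \<open>inv_into\<close>: the two
  agree on \<open>Q\<close>, and smoothness depends only on the values there.\<close>

lemma coord_diffeoI:
 assumes H: "smooth_coord_map n P n H" and G: "smooth_coord_map n Q n G"
  and HQ: "\<And>x. x\<in>P ==> H x\<in>Q" and GP: "\<And>y. y\<in>Q ==> G y\<in>P"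
  and GH: "\<And>x. x\<in>P ==> G (H x) = x" and HG: "\<And>y. y\<in>Q ==> H (G y) = y"
 shows "coord_diffeo n P Q H"
proof -
 have bij: "bij_betw H P Q" by (rule bij_betw_byWitness[where f'=G]) (use assms in auto)
 have "G y = inv_into P H y" if "y\<in>Q" for y
  using bij_betw_imp_inj_on[OF bij] GP HG that by (metis inv_into_f_f)
 then have "smooth_coord_map n Q n (inv_into P H)" by (rule cmap_cong[OF G])
 then show ?thesis using bij H by (simp add: coord_diffeo_def)
qed

lemma coord_diffeoE:
 assumes "coord_diffeo n P Q H"
 obtains G where "smooth_coord_map n P n H" "smooth_coord_map n Q n G"
  "\<And>x. x\<in>P ==> H x\<in>Q" "\<And>y. y\<in>Q ==> G y\<in>P"
  "\<And>x. x\<in>P ==> G (H x) = x" "\<And>y. y\<in>Q ==> H (G y) = y"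
proof -
 have bij: "bij_betw H P Q" using assms by (simp add: coord_diffeo_def)
 show thesis
 proof (rule that[of "inv_into P H"])
  show "smooth_coord_map n P n H" "smooth_coord_map n Q n (inv_into P H)"
   using assms by (auto simp: coord_diffeo_def)
  show "H x\<in>Q" "inv_into P H (H x) = x" if "x\<in>P" for x
   using bij that by (auto simp: bij_betw_def)
  show "inv_into P H y\<in>P" "H (inv_into P H y) = y" if "y\<in>Q" for y
   using bij that by (auto simp: bij_betw_def inv_into_into f_inv_into_f)
 qed
qed

lemma coord_diffeo_compose:
 assumes "coord_diffeo n P Q H" "coord_diffeo n P' Q' H'" "Q\<subseteq>P'"
 shows "coord_diffeo n P (H' ` Q) (\<lambda>x. H' (H x))"
proof -
 obtain G where G: "smooth_coord_map n P n H" "smooth_coord_map n Q n G"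
  "\<And>x. x\<in>P ==> H x\<in>Q" "\<And>y. y\<in>Q ==> G y\<in>P"
  "\<And>x. x\<in>P ==> G (H x) = x" "\<And>y. y\<in>Q ==> H (G y) = y" using coord_diffeoE[OF assms(1)] by blast
 obtain G' where G': "smooth_coord_map n P' n H'" "smooth_coord_map n Q' n G'"
  "\<And>x. x\<in>P' ==> H' x\<in>Q'" "\<And>y. y\<in>Q' ==> G' y\<in>P'"
  "\<And>x. x\<in>P' ==> G' (H' x) = x" "\<And>y. y\<in>Q' ==> H' (G' y) = y" using coord_diffeoE[OF assms(2)] by blast
 have "H' ` Q = {y\<in>Q'. G' y\<in>Q}" using G' assms(3) by force
 then have o: "openin (En n) (H' ` Q)"
  using cmap_openin_preimage[OF G'(2) cmapD(1)[OF G(2)]] by simp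
 show ?thesis
 proof (rule coord_diffeoI[where G="\<lambda>y. G (G' y)"])
  show "smooth_coord_map n P n (\<lambda>x. H' (H x))" by (rule cmap_compose[OF G'(1) G(1)]) (use G(3) assms(3) in auto)
  have "smooth_coord_map n (H' ` Q) n G'" by (rule cmap_subset[OF G'(2) o]) (use G'(3) assms(3) in auto)
  then show "smooth_coord_map n (H' ` Q) n (\<lambda>y. G (G' y))"
   by (rule cmap_compose[OF G(2)]) (use G'(5) assms(3) in auto)
 qed (use G G' subsetD[OF assms(3)] in auto)
qed

lemma coord_diffeo_restrict:
 assumes "coord_diffeo n P Q H" "openin (En n) P'" "P'\<subseteq>P"
 shows "coord_diffeo n P' (H ` P') H" "openin (En n) (H ` P')"
proof -
 obtain G where G: "smooth_coord_map n P n H" "smooth_coord_map n Q n G"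
  "\<And>x. x\<in>P ==> H x\<in>Q" "\<And>y. y\<in>Q ==> G y\<in>P"
  "\<And>x. x\<in>P ==> G (H x) = x" "\<And>y. y\<in>Q ==> H (G y) = y" using coord_diffeoE[OF assms(1)] by blast
 have "H ` P' = {y\<in>Q. G y\<in>P'}" using G assms(3) by force
 then show o: "openin (En n) (H ` P')"
  using cmap_openin_preimage[OF G(2) assms(2)] by simp
 show "coord_diffeo n P' (H ` P') H"
 proof (rule coord_diffeoI[where G=G])
  show "smooth_coord_map n P' n H" by (rule cmap_subset[OF G(1) assms(2,3)])
  show "smooth_coord_map n (H ` P') n G" by (rule cmap_subset[OF G(2) o]) (use G(3) assms(3) in auto)
 qed (use G assms in auto)
qed

lemma coord_diffeo_inverse:
 assumes "coord_diffeo n P Q H"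
 obtains G where "coord_diffeo n Q P G" "\<And>x. x\<in>P ==> G (H x) = x" "\<And>y. y\<in>Q ==> H (G y) = y"
proof -
 obtain G where G: "smooth_coord_map n P n H" "smooth_coord_map n Q n G"
  "\<And>x. x\<in>P ==> H x\<in>Q" "\<And>y. y\<in>Q ==> G y\<in>P"
  "\<And>x. x\<in>P ==> G (H x) = x" "\<And>y. y\<in>Q ==> H (G y) = y" using coord_diffeoE[OF assms(1)] by blast
 show thesis by (rule that[OF coord_diffeoI[OF G(2,1,4,3,6,5)] G(5,6)])
qed

section \<open>Cutoff functions and extension of smooth germs\<close>

definition flat_exp :: "real poly \<Rightarrow> real \<Rightarrow> real" where
 "flat_exp p x = (if x > 0 then poly p (inverse x) * exp (- inverse x) else 0)"

lemma poly_exp_tendsto_0: "((\<lambda>y. poly p y * exp (- y)) \<longlongrightarrow> (0::real)) at_top"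
proof -
 have "((\<lambda>y. poly.coeff p i * (y ^ i / exp y)) \<longlongrightarrow> 0) at_top" for i
  using tendsto_mult[OF tendsto_const[of "poly.coeff p i"] tendsto_power_div_exp_0[of i]] by simp
 then have "((\<lambda>y. \<Sum>i\<le>Polynomial.degree p. poly.coeff p i * (y ^ i / exp y)) \<longlongrightarrow> 0) at_top"
  by (intro tendsto_null_sum)
 moreover have "(\<Sum>i\<le>Polynomial.degree p. poly.coeff p i * (y ^ i / exp y)) = poly p y * exp (- y)" for y
  by (simp add: poly_altdef sum_distrib_right exp_minus divide_inverse mult.assoc)
 ultimately show ?thesis by simp
qed

text \<open>These are the functions p(1/x) exp(-1/x), continued by zero. In the variable y = 1/x,
  differentiation with respect to x is -y^2 d/dy, and d/dy sends p exp(-y) to (p' - p) exp(-y);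
  hence the factor \<open>[:0, 0, 1:]\<close>. At the origin the difference quotient from the left
  is zero, and the one from the right tends to zero because exp(-y) decays faster than any
  polynomial grows.\<close>

lemma flat_exp_deriv:
 "(flat_exp p has_real_derivative flat_exp ([:0, 0, 1:] * (p - pderiv p)) x) (at x)"
proof -
 consider "x > 0" | "x < 0" | "x = 0" by linarith
 then show ?thesis
 proof cases
  case 1
  have "((\<lambda>x. poly p (inverse x) * exp (- inverse x)) has_real_derivative
   flat_exp ([:0, 0, 1:] * (p - pderiv p)) x) (at x)"
   using 1 by (auto intro!: derivative_eq_intros DERIV_chain'[OF _ poly_DERIV] simp: flat_exp_def field_simps power2_eq_square)
  moreover have "\<forall>\<^sub>F y in nhds x. y > 0" using 1 using eventually_nhds_in_open[of "{0<..}" x] by simp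
  then have "\<forall>\<^sub>F y in nhds x. poly p (inverse y) * exp (- inverse y) = flat_exp p y"
   by eventually_elim (simp add: flat_exp_def)
  from DERIV_cong_ev[OF refl this refl] calculation show ?thesis by simp
 next
  case 2
  have "\<forall>\<^sub>F y in nhds x. y < 0" using 2 using eventually_nhds_in_open[of "{..<0}" x] by simp
  then have "\<forall>\<^sub>F y in nhds x. 0 = flat_exp p y"
   by eventually_elim (simp add: flat_exp_def)
  from DERIV_cong_ev[OF refl this refl] DERIV_const[of 0 "at x"]
  have "(flat_exp p has_real_derivative 0) (at x)" by blast
  moreover have "flat_exp ([:0, 0, 1:] * (p - pderiv p)) x = 0" using 2 by (simp add: flat_exp_def)
  ultimately show ?thesis by simp
 next
  case 3
  \<comment> \<open>Dividing by x multiplies the polynomial in 1/x by its variable.\<close>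
  have "((\<lambda>y. poly (pCons 0 p) (inverse y) * exp (- inverse y)) \<longlongrightarrow> 0) (at_right (0::real))"
   using filterlim_compose[OF poly_exp_tendsto_0 filterlim_inverse_at_top_right] .
  moreover have "\<forall>\<^sub>F y in at_right (0::real). poly (pCons 0 p) (inverse y) * exp (- inverse y) = flat_exp p y / y"
   by (rule eventually_at_rightI[of 0 1]) (auto simp: flat_exp_def field_simps)
  ultimately have r: "((\<lambda>y. flat_exp p y / y) \<longlongrightarrow> 0) (at_right 0)" by (rule Lim_transform_eventually)
  have "\<forall>\<^sub>F y in at_left (0::real). 0 = flat_exp p y / y"
   by (rule eventually_at_leftI[of "-1"]) (auto simp: flat_exp_def)
  then have l: "((\<lambda>y. flat_exp p y / y) \<longlongrightarrow> 0) (at_left 0)"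
   by (rule Lim_transform_eventually[OF tendsto_const])
  show ?thesis using 3 filterlim_split_at[OF l r]
   by (simp add: has_field_derivative_iff flat_exp_def)
 qed
qed

lemma smooth_fun_flat_exp: "smooth_fun n U g ==> smooth_fun n U (\<lambda>x. flat_exp p (g x))"
 unfolding smooth_fun_def
proof (intro conjI allI)
 assume *: "openin (En n) U \<and> (\<forall>k. Ck_fun k n U g)"
 then show U: "openin (En n) U" by blast
 have C: "\<exists>\<phi>'\<in>range flat_exp. \<forall>y. (\<phi> has_real_derivative \<phi>' y) (at y)" if "\<phi>\<in>range flat_exp" for \<phi>
  using that flat_exp_deriv by blast
 show "Ck_fun k n U (\<lambda>x. flat_exp p (g x))" for k
  by (rule Ck_fun_compose1[OF U C]) (use * in auto)
qed

text \<open>The usual smooth transition from 0 to 1 on the unit interval. The denominator is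
  positive everywhere because \<open>s\<close> and \<open>1 - s\<close> are never both
  non-positive.\<close>

definition smooth_step :: "real \<Rightarrow> real" where
 "smooth_step s = flat_exp 1 s * inverse (flat_exp 1 s + flat_exp 1 (1 - s))"

lemma flat_exp_1: "flat_exp 1 s\<ge>0" "flat_exp 1 s + flat_exp 1 (1 - s) > 0"
 by (auto simp: flat_exp_def add_pos_pos)

lemma smooth_step: "s\<le>0 ==> smooth_step s = 0" "s\<ge>1 ==> smooth_step s = 1"
 using flat_exp_1(2)[of s] by (auto simp: smooth_step_def flat_exp_def)

lemma smooth_fun_step: "smooth_fun n U g ==> smooth_fun n U (\<lambda>x. smooth_step (g x))"
 unfolding smooth_step_def
 by (intro smooth_fun_mult smooth_fun_inverse smooth_fun_add smooth_fun_flat_exp smooth_fun_diff)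
  (auto simp: smooth_fun_openin less_imp_neq[OF flat_exp_1(2), symmetric])

lemma smooth_cutoff:
 assumes "\<epsilon> > 0"
 obtains \<rho> where "smooth_fun n (Rn n) \<rho>" "\<And>y. y\<in>cube n \<epsilon> x ==> \<rho> y = 1"
  "\<And>y i. i < n ==> \<bar>y i - x i\<bar>\<ge>3/2 * \<epsilon> ==> \<rho> y = 0"
proof
 \<comment> \<open>With r = (y i - x i) / \<epsilon> each factor is
   \<open>smooth_step (2 - r * r)\<close>, where the square avoids the absolute value. It is 1 for
   r^2 \<le> 1 and 0 for r^2 \<ge> 2, in particular for |r| \<ge> 3/2.\<close>
 let ?\<rho> = "\<lambda>y. \<Prod>i<n. smooth_step (2 - ((y i - x i) * (inverse \<epsilon>)) * ((y i - x i) * (inverse \<epsilon>)))"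
 show "smooth_fun n (Rn n) ?\<rho>"
  by (intro smooth_fun_prod smooth_fun_step smooth_fun_diff smooth_fun_mult smooth_fun_coord) auto
 fix y
 show "?\<rho> y = 1" if "y\<in>cube n \<epsilon> x"
 proof (rule prod.neutral, intro ballI)
  fix i assume "i\<in>{..<n}"
  then have "\<bar>(y i - x i) * inverse \<epsilon>\<bar>\<le>1" using that assms by (auto simp: cube_def abs_mult field_simps)
  then have "((y i - x i) * inverse \<epsilon>)\<^sup>2\<le>1" by (simp add: abs_square_le_1)
  then show "smooth_step (2 - (y i - x i) * inverse \<epsilon> * ((y i - x i) * inverse \<epsilon>)) = 1"
   by (intro smooth_step) (simp add: power2_eq_square)
 qed
 show "?\<rho> y = 0" if "i < n" "\<bar>y i - x i\<bar>\<ge>3/2 * \<epsilon>" for i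
 proof -
  have "\<bar>(y i - x i) * inverse \<epsilon>\<bar>\<ge>\<bar>3/2\<bar>" using that assms by (auto simp: abs_mult field_simps)
  then have "((y i - x i) * inverse \<epsilon>)\<^sup>2\<ge>(3/2)\<^sup>2" by (simp only: abs_le_square_iff)
  then have "smooth_step (2 - (y i - x i) * inverse \<epsilon> * ((y i - x i) * inverse \<epsilon>)) = 0"
   by (intro smooth_step) (simp add: power2_eq_square)
  then show ?thesis using that(1) by (intro prod_zero) auto
 qed
qed

text \<open>Multiplication by a cutoff and continuation by zero. The price is that \<open>f\<close>
  is kept only near \<open>x\<close>, which suffices for statements about germs.\<close>

lemma smooth_fun_extend:
 assumes f: "smooth_fun n U f" and x: "x\<in>U"
 obtains g V where "smooth_fun n (Rn n) g" "openin (En n) V" "x\<in>V" "V\<subseteq>U"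
  "\<And>y. y\<in>V ==> g y = f y"
proof -
 have U: "openin (En n) U" using f smooth_fun_openin by blast
 obtain \<delta> where d: "\<delta> > 0" "cube n \<delta> x\<subseteq>U" using cube_nbhd[OF U x] by blast
 \<comment> \<open>Halving leaves a gap between 3/2 \<epsilon>, where the cutoff has become zero,
   and 2 \<epsilon>, up to which the cube stays in \<open>U\<close>; points outside \<open>U\<close>
   thus have a neighbourhood on which the product vanishes.\<close>
 define \<epsilon> where "\<epsilon> = \<delta> / 2"
 have e: "\<epsilon> > 0" "cube n (2 * \<epsilon>) x\<subseteq>U" using d by (auto simp: \<epsilon>_def)
 obtain \<rho> where r: "smooth_fun n (Rn n) \<rho>" "\<And>y. y\<in>cube n \<epsilon> x ==> \<rho> y = 1"
  "\<And>y i. i < n ==> \<bar>y i - x i\<bar>\<ge>3/2 * \<epsilon> ==> \<rho> y = 0" using smooth_cutoff[OF e(1)] by metis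
 define g where "g y = (if y\<in>U then \<rho> y * f y else 0)" for y
 have "smooth_fun n (Rn n) g"
 proof (rule smooth_fun_local)
  fix y assume y: "y\<in>Rn n"
  show "\<exists>V. y\<in>V \<and> V\<subseteq>Rn n \<and> smooth_fun n V g"
  proof (cases "y\<in>U")
   case True
   have "smooth_fun n U (\<lambda>y. \<rho> y * f y)"
    by (intro smooth_fun_mult f smooth_fun_subset[OF r(1) U openin_En_imp_subset[OF U]])
   then have "smooth_fun n U g" by (rule smooth_fun_cong) (simp add: g_def)
   then show ?thesis using True openin_En_imp_subset[OF U] by blast
  next
   case False
   then have "\<not> y\<in>cube n (2 * \<epsilon>) x" using e by blast
   then obtain i where i: "i < n" "\<bar>y i - x i\<bar>\<ge>2 * \<epsilon>" using y by (auto simp: cube_def not_less)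
   let ?V = "{z\<in>Rn n. z i\<in>{z. \<bar>z - x i\<bar> > 3/2 * \<epsilon>}}"
   have "open {z::real. \<bar>z - x i\<bar> > 3/2 * \<epsilon>}" by (intro open_Collect_less continuous_intros)
   then have V: "openin (En n) ?V"
    by (intro openin_En_preimage continuous_intros) auto
   have "0 = g z" if "z\<in>?V" for z using that r(3)[OF i(1), of z] by (auto simp: g_def)
   then have "smooth_fun n ?V g" by (rule smooth_fun_cong[OF smooth_fun_const[OF V, of 0]])
   moreover have "y\<in>?V" using i y e by auto
   ultimately show ?thesis by (intro exI[of _ ?V] conjI) auto
  qed
 qed auto
 moreover have "cube n \<epsilon> x\<subseteq>U" using e cube_mono[of \<epsilon> "2 * \<epsilon>" n x] by force
 moreover have "g y = f y" if "y\<in>cube n \<epsilon> x" for y using that r(2) calculation(2) by (auto simp: g_def)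
 moreover have "x\<in>Rn n" using x U openin_En_imp_subset by blast
 ultimately show thesis using that[of g "cube n \<epsilon> x"] e by (auto simp: cube_centre)
qed

lemma cmap_extend:
 assumes f: "smooth_coord_map n U m f" and x: "x\<in>U"
 obtains g V where "smooth_coord_map n (Rn n) m g" "openin (En n) V" "x\<in>V" "V\<subseteq>U"
  "\<And>y. y\<in>V ==> g y = f y"
proof -
 note D = cmapD[OF f]
 have "\<forall>i. \<exists>g V. smooth_fun n (Rn n) g \<and> openin (En n) V \<and> x\<in>V \<and> V\<subseteq>U \<and> (\<forall>y\<in>V. g y = f y i)"
  using smooth_fun_extend[OF D(3) x] by metis
 then obtain g V where g: "\<And>i. smooth_fun n (Rn n) (g i)" "\<And>i. openin (En n) (V i)"
  "\<And>i. x\<in>V i" "\<And>i. V i\<subseteq>U" "\<And>i y. y\<in>V i ==> g i y = f y i" by metis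
 define G where "G y = trunc m (\<lambda>i. g i y)" for y
 define W where "W = (\<Inter>i\<in>{..<m}. V i)\<inter>U"
 have "smooth_coord_map n (Rn n) m G"
  by (rule cmapI) (auto simp: G_def trunc_def Rn_iff g)
 moreover have W: "openin (En n) W" unfolding W_def
  using g D(1) by (cases "m = 0") (auto intro!: openin_Int openin_INT)
 moreover have "x\<in>W" "W\<subseteq>U" using g x by (auto simp: W_def)
 moreover have "G y = f y" if y: "y\<in>W" for y
 proof (rule Rn_eqI)
  show "G y i = f y i" if "i < m" for i using y g(5) that by (auto simp: G_def trunc_def W_def)
 qed (use y D(2) in \<open>auto simp: G_def W_def\<close>)
 ultimately show thesis using that by blast
qed

section \<open>The inverse function theorem\<close>

lemma continuous_map_En_into:
 assumes "U\<subseteq>Rn n" "\<And>x. x\<in>U ==> F x\<in>Rn m" "\<And>i. continuous_on U (\<lambda>x. F x i)"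
 shows "continuous_map (subtopology (En n) U) (En m) F"
proof -
 have "continuous_on U F" by (rule continuous_on_coordinatewise_then_product) (rule assms)
 then show ?thesis using assms(1,2) unfolding cm_Euclidean_space_iff_continuous_on[of n U m F]
  by (auto simp: Int_absorb1 inf.absorb2)
qed

lemma cmap_continuous_map:
 assumes "smooth_coord_map n U m F"
 shows "continuous_map (subtopology (En n) U) (En m) F"
 by (rule continuous_map_En_into[OF openin_En_imp_subset[OF cmapD(1)[OF assms]]
   cmapD(2)[OF assms] smooth_fun_continuous[OF cmapD(3)[OF assms]]])

lemma continuous_on_En_openI:
 assumes "openin (En n) U" "\<And>T. open T ==> openin (En n) {x\<in>U. f x\<in>T}"
 shows "continuous_on U f"
proof -
 have U: "U\<subseteq>{x. \<forall>i\<ge>n. x i = 0}"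
  using openin_En_imp_subset[OF assms(1)] unfolding topspace_Euclidean_space .
 have "openin (top_of_set U) (U\<inter>f -` T)" if "open T" for T
 proof -
  have "U\<inter>f -` T = {x\<in>U. f x\<in>T}" by auto
  then have "openin (top_of_set {x. \<forall>i\<ge>n. x i = 0}) (U\<inter>f -` T)"
   using assms(2)[OF that] unfolding Euclidean_space_eq by simp
  then show ?thesis by (rule openin_subset_trans[OF _ Int_lower1 U])
 qed
 then show ?thesis by (simp add: continuous_openin_preimage_eq)
qed

text \<open>The inverse function theorem for maps that alter a single coordinate. Monotonicity in
  that coordinate gives injectivity on a cube, invariance of domain gives an open image and a
  continuous inverse, implicit differentiation gives its derivatives and then, inductively, its
  smoothness. The formula for the derivatives at the base point is what
  \<open>inverse_function_id\<close> needs to control the next step.\<close>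

lemma coordinate_step:
 assumes f: "smooth_fun n O' f" and x0: "x0\<in>O'" and i: "i < n" and pos: "pd i f x0 > 0"
 obtains P G where "x0\<in>P" "P\<subseteq>O'" "coord_diffeo n P ((\<lambda>x. x(i := f x)) ` P) (\<lambda>x. x(i := f x))"
  "smooth_coord_map n ((\<lambda>x. x(i := f x)) ` P) n G" "\<And>x. x\<in>P ==> G (x(i := f x)) = x"
  "\<And>j. j < n ==> pd j (\<lambda>y. G y i) (x0(i := f x0)) = (if j = i then 1 else - pd j f x0) * inverse (pd i f x0)"
proof -
 let ?H = "\<lambda>x. x(i := f x)"
 have U: "openin (En n) O'" using f smooth_fun_openin by blast
 have "openin (En n) {x\<in>O'. pd i f x\<in>{0<..}}"
  by (rule openin_En_preimage[OF U smooth_fun_continuous[OF smooth_fun_pd[OF f i]]]) auto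
 then obtain \<epsilon> where e: "\<epsilon> > 0" "cube n \<epsilon> x0\<subseteq>{x\<in>O'. pd i f x\<in>{0<..}}"
  using x0 pos by (auto elim: cube_nbhd)
 define P where "P = cube n \<epsilon> x0"
 define Q where "Q = ?H ` P"
 have Pop: "openin (En n) P" by (simp add: P_def)
 have PR: "P\<subseteq>Rn n" by (rule openin_En_imp_subset[OF Pop])
 have PO: "P\<subseteq>O'" and Ppos: "\<And>x. x\<in>P ==> pd i f x > 0" using e by (auto simp: P_def)
 have x0P: "x0\<in>P" using x0 U openin_En_imp_subset e by (auto simp: P_def intro!: cube_centre)
 have fP: "smooth_fun n P f" by (rule smooth_fun_subset[OF f Pop PO])
 have inc: "f x < f (x(i := b))" if x: "x\<in>P" "x i < b" "x(i := b)\<in>P" for x b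
 proof -
  have "\<exists>y. ((\<lambda>s. f (x(i := s))) has_real_derivative y) (at s) \<and> y > 0" if s: "x i\<le>s" "s\<le>b" for s
  proof -
   have "x(i := s)\<in>P" using x s i by (auto simp: P_def cube_def Rn_upd abs_less_iff)
   then show ?thesis using smooth_fun_has_pd[OF fP i] Ppos by (fastforce simp: has_pd_def)
  qed
  from DERIV_pos_imp_increasing[OF x(2) this] show ?thesis by simp
 qed
 have inj: "inj_on ?H P"
 proof (rule inj_onI)
  fix x y assume xy: "x\<in>P" "y\<in>P" "x(i := f x) = y(i := f y)"
  have feq: "f x = f y" using fun_cong[OF xy(3), of i] by simp
  have y: "y = x(i := y i)" using xy(3) by (auto simp: fun_eq_iff split: if_splits)
  have x: "x = y(i := x i)" using xy(3) by (auto simp: fun_eq_iff split: if_splits)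
  have "\<not> x i < y i" using inc[OF xy(1), of "y i"] y xy(2) feq by auto
  moreover have "\<not> y i < x i" using inc[OF xy(2), of "x i"] x xy(1) feq by auto
  ultimately show "x = y" using y by (metis fun_upd_triv linorder_neqE)
 qed
 have Hs: "smooth_coord_map n P n ?H"
 proof (rule cmapI[OF Pop])
  show "x(i := f x)\<in>Rn n" if "x\<in>P" for x using that PR i by (auto intro: Rn_upd)
  show "smooth_fun n P (\<lambda>x. (x(i := f x)) j)" for j
   using fP smooth_fun_coord[OF Pop] by (cases "j = i") auto
 qed
 \<comment> \<open>Invariance of domain, used on every open part of \<open>P\<close>, replaces the
   estimates by which continuity of the inverse is usually shown.\<close>
 have Hopen: "openin (En n) (?H ` P')" if "openin (En n) P'" "P'\<subseteq>P" for P'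
  by (rule invariance_of_domain_Euclidean_space[OF that(1) cmap_continuous_map[OF
    cmap_subset[OF Hs that]] inj_on_subset[OF inj that(2)]])
 have Qop: "openin (En n) Q" unfolding Q_def by (rule Hopen[OF Pop]) simp
 define g where "g y = inv_into P ?H y i" for y
 define G where "G y = y(i := g y)" for y
 have GH: "G (?H x) = x" if "x\<in>P" for x
 proof -
  have "inv_into P ?H (?H x) = x" by (rule inv_into_f_f[OF inj that])
  then show ?thesis by (simp add: G_def g_def)
 qed
 have GP: "G y\<in>P" "?H (G y) = y" if "y\<in>Q" for y using that GH by (auto simp: Q_def)
 have gcont: "continuous_on Q g"
 proof (rule continuous_on_En_openI[OF Qop])
  fix T :: "real set" assume T: "open T"
  have "openin (En n) (?H ` {x\<in>P. x i\<in>T})"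
   by (intro Hopen openin_En_preimage Pop T continuous_intros) auto
  moreover have "{y\<in>Q. g y\<in>T} = ?H ` {x\<in>P. x i\<in>T}"
  proof -
   have "g (?H x) = x i" if "x\<in>P" for x using GH[OF that] by (metis G_def fun_upd_same)
   then show ?thesis by (auto simp: Q_def)
  qed
  ultimately show "openin (En n) {y\<in>Q. g y\<in>T}" by simp
 qed
 \<comment> \<open>Obtained by implicit differentiation of \<open>f (G y) = y i\<close> with respect
   to coordinate \<open>j\<close>.\<close>
 define dg where "dg j y = (if j = i then 1 else - pd j f (G y)) * inverse (pd i f (G y))" for j y
 have gpd: "has_pd j g (dg j y) y" if j: "j < n" and y: "y\<in>Q" for j y
 proof -
  let ?x = "G y" and ?F = "at (y j)"
  define u where "u t = g (y(j := t))" for t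
  have xP: "?x\<in>P" using GP y by blast
  have yR: "y\<in>Rn n" using y Qop openin_En_imp_subset by blast
  have xi: "?x i = g y" by (simp add: G_def)
  have ylim: "((\<lambda>t. (y(j := t)) l) \<longlongrightarrow> y l) ?F" for l by (cases "l = j") auto
  have evR: "\<forall>\<^sub>F t in ?F. y(j := t)\<in>Rn n" using Rn_upd[OF yR j] by (intro always_eventually) blast
  have ut: "(u \<longlongrightarrow> ?x i) ?F" unfolding u_def xi
   by (rule continuous_on_tendsto_coords[OF Qop y evR ylim gcont])
  \<comment> \<open>When coordinate \<open>j\<close> of \<open>y\<close> moves, \<open>m t\<close>
    moves along but keeps coordinate \<open>i\<close> of \<open>G y\<close>; the remaining change of
    \<open>G\<close>, from \<open>?x i\<close> to \<open>u t\<close>, happens in coordinate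
    \<open>i\<close> alone.\<close>
  define m where "m t = (y(j := t))(i := ?x i)" for t
  have mR: "\<forall>\<^sub>F t in ?F. m t\<in>Rn n" using yR i j by (auto simp: m_def Rn_upd)
  have mlim: "((\<lambda>t. m t l) \<longlongrightarrow> ?x l) ?F" if "l < n" for l
  proof (cases "l = i")
   case False then show ?thesis using ylim[of l] by (simp add: m_def G_def)
  qed (simp add: m_def)
  obtain w where w: "(w \<longlongrightarrow> pd i f ?x) ?F"
   "\<forall>\<^sub>F t in ?F. f ((m t)(i := u t)) - f ((m t)(i := ?x i)) = w t * (u t - ?x i)"
   by (rule MVT_slope[OF Pop xP i smooth_fun_has_pd[OF fP i]
      smooth_fun_continuous[OF smooth_fun_pd[OF fP i]] mR mlim ut tendsto_const])
  have evQ: "\<forall>\<^sub>F t in ?F. y(j := t)\<in>Q"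
   using openin_En_upd_eventually[OF Qop y j] by (simp add: eventually_nhds_conv_at)
  have wnz: "pd i f ?x\<noteq>0" using Ppos[OF xP] by simp
  have evw: "\<forall>\<^sub>F t in ?F. w t\<noteq>0" using tendsto_imp_eventually_ne[OF w(1) wnz] .
  have fx: "f ?x = y i" using fun_cong[OF GP(2)[OF y], of i] by simp
  \<comment> \<open>The change of \<open>f\<close> with coordinate \<open>i\<close> frozen. For
    \<open>j = i\<close> nothing moves and the quotient is zero; otherwise it tends to
    \<open>pd j f ?x\<close>.\<close>
  define q where "q t = (f ((m t)(i := ?x i)) - f ?x) / (t - y j)" for t
  have eqn: "\<forall>\<^sub>F t in ?F. (u t - g y) / (t - y j) = ((if j = i then 1 else 0) - q t) * inverse (w t)"
   using w(2) evQ evw eventually_neq_at_within[of "y j" "y j" UNIV]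
  proof eventually_elim
   case (elim t)
   have "(m t)(i := u t) = G (y(j := t))" by (auto simp: m_def G_def u_def)
   then have "f ((m t)(i := u t)) = (y(j := t)) i" using fun_cong[OF GP(2)[OF elim(2)], of i] by simp
   then have *: "(y(j := t)) i - f ((m t)(i := ?x i)) = w t * (u t - ?x i)" using elim(1) by simp
   have "((y(j := t)) i - y i) = (if j = i then 1 else 0) * (t - y j)" by auto
   then have "((y(j := t)) i - f ((m t)(i := ?x i))) = ((if j = i then 1 else 0) - q t) * (t - y j)"
    using elim(4) fx by (simp add: q_def field_simps)
   then show ?case using * elim(3,4) by (simp add: xi field_simps)
  qed
  have "(q \<longlongrightarrow> (if j = i then 0 else pd j f ?x)) ?F"
  proof (cases "j = i")
   case True
   have "q = (\<lambda>_. 0)" using True by (simp add: fun_eq_iff q_def m_def G_def)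
   then show ?thesis using True by simp
  next
   case False
   have mt: "(m t)(i := ?x i) = ?x(j := t)" for t using False by (auto simp: m_def G_def)
   have xj: "?x j = y j" using False by (simp add: G_def)
   show ?thesis using smooth_fun_has_pd[OF fP j xP] False
    unfolding has_pd_def has_field_derivative_iff q_def mt xj by (simp add: xj[symmetric])
  qed
  then have "((\<lambda>t. ((if j = i then 1 else 0) - q t) * inverse (w t)) \<longlongrightarrow>
    ((if j = i then 1 else 0) - (if j = i then 0 else pd j f ?x)) * inverse (pd i f ?x)) ?F"
   using w(1) wnz by (intro tendsto_mult tendsto_diff tendsto_const tendsto_inverse)
  also have "((if j = i then 1 else 0) - (if j = i then 0 else pd j f ?x)) * inverse (pd i f ?x) = dg j y"
   by (simp add: dg_def)
  finally have "((\<lambda>t. (u t - g y) / (t - y j)) \<longlongrightarrow> dg j y) ?F"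
   using eqn by (simp add: tendsto_cong)
  then show ?thesis by (simp add: has_pd_def has_field_derivative_iff u_def)
 qed
 \<comment> \<open>Bootstrap: \<open>dg\<close> is built from the functions \<open>pd l f\<close>
   composed with \<open>G\<close>, so differentiability of order \<open>k\<close> of
   \<open>g\<close> implies order \<open>k + 1\<close>.\<close>
 have gk: "Ck_fun k n Q g" for k
 proof (induction k)
  case 0 show ?case using gcont Ck_fun_0[OF openin_En_imp_subset[OF Qop]] by blast
 next
  case (Suc k)
  have Gk: "Ck_fun k n Q (\<lambda>y. G y l)" for l
   using Suc Ck_fun_coord[OF Qop] by (cases "l = i") (auto simp: G_def)
  have pk: "Ck_fun k n Q (\<lambda>y. pd l f (G y))" if "l < n" for l
  proof (rule Ck_fun_compose[OF Qop Pop _ Gk])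
   show "Ck_fun k n P (pd l f)" using smooth_fun_pd[OF fP that] by (simp add: smooth_fun_def)
  qed (rule GP)
  show ?case
  proof (rule Ck_fun_SucI[OF Qop gcont, where f'=dg])
   fix j assume j: "j < n"
   have "Ck_fun k n Q (\<lambda>y. inverse (pd i f (G y)))"
    by (rule Ck_fun_inverse[OF Qop _ pk[OF i]]) (use Ppos GP in force)
   moreover have "Ck_fun k n Q (\<lambda>y. if j = i then 1 else - pd j f (G y))"
    using Ck_fun_mult[OF Qop Ck_fun_const[OF Qop, of k "-1"] pk[OF j]] Qop by (cases "j = i") auto
   ultimately show "Ck_fun k n Q (dg j)" unfolding dg_def[abs_def] by (intro Ck_fun_mult[OF Qop])
  qed (rule gpd)
 qed
 have Gs: "smooth_coord_map n Q n G"
 proof (rule cmapI[OF Qop])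
  show "G y\<in>Rn n" if "y\<in>Q" for y using GP that PR by blast
  show "smooth_fun n Q (\<lambda>y. G y l)" for l
   using gk Qop smooth_fun_coord[OF Qop] by (cases "l = i") (auto simp: G_def smooth_fun_def)
 qed
 have "coord_diffeo n P Q ?H"
  by (rule coord_diffeoI[OF Hs Gs]) (use GP GH in \<open>auto simp: Q_def\<close>)
 moreover have "pd j (\<lambda>y. G y i) (?H x0) = (if j = i then 1 else - pd j f x0) * inverse (pd i f x0)" if "j < n" for j
 proof -
  have "(\<lambda>y. G y i) = g" by (simp add: G_def)
  then show ?thesis using pd_unique[OF gpd[OF that]] x0P GH[OF x0P] by (simp add: dg_def Q_def)
 qed
 ultimately show thesis using that[OF x0P PO] Gs GH unfolding Q_def by blast
qed

text \<open>Induction on the number \<open>m\<close> of leading coordinates that \<open>F\<close>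
  may still change. \<open>coordinate_step\<close> absorbs the change of the last of them; dividing
  it out leaves a map that changes one coordinate less, and since the corresponding row of the
  Jacobian is a unit vector, the Jacobian of the quotient is again the identity.\<close>

lemma inverse_function_id:
 assumes F: "smooth_coord_map n O' n F" and x0: "x0\<in>O'"
  and J: "\<And>i j. i < n ==> j < n ==> pd j (\<lambda>x. F x i) x0 = (if i = j then 1 else 0)"
 obtains P where "x0\<in>P" "P\<subseteq>O'" "coord_diffeo n P (F ` P) F"
proof -
 have "\<exists>P. x0\<in>P \<and> P\<subseteq>O' \<and> coord_diffeo n P (F ` P) F"
  if "m\<le>n" "smooth_coord_map n O' n F" "x0\<in>O'"
   "\<And>i j. i < n ==> j < n ==> pd j (\<lambda>x. F x i) x0 = (if i = j then 1 else 0)"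
   "\<And>x i. x\<in>O' ==> m\<le>i ==> i < n ==> F x i = x i" for m O' F x0
  using that
 proof (induction m arbitrary: O' F x0)
  case (0 O' F x0)
  note D = cmapD[OF 0(2)]
  have "F x = x" if "x\<in>O'" for x
   by (rule Rn_eqI[OF D(2)[OF that]]) (use 0(5) that openin_En_imp_subset[OF D(1)] in auto)
  then have "coord_diffeo n O' O' F" using 0(2)
   by (intro coord_diffeoI[where G=F]) auto
  moreover have "F ` O' = O'" using \<open>\<And>x. x\<in>O' ==> F x = x\<close> by force
  ultimately show ?case using 0(3) by (intro exI[of _ O']) auto
 next
  case (Suc m O' F x0)
  note D = cmapD[OF Suc(3)]
  have m: "m < n" using Suc by simp
  let ?H = "\<lambda>x. x(m := F x m)"
  have "pd m (\<lambda>x. F x m) x0 > 0" using Suc(5)[OF m m] by simp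
  from coordinate_step[OF D(3)[of m] Suc(4) m this] obtain P G where P: "x0\<in>P" "P\<subseteq>O'"
   "coord_diffeo n P (?H ` P) ?H" "smooth_coord_map n (?H ` P) n G" "\<And>x. x\<in>P ==> G (?H x) = x"
   "\<And>j. j < n ==> pd j (\<lambda>y. G y m) (?H x0) = (if j = m then 1 else - pd j (\<lambda>x. F x m) x0) * inverse (pd m (\<lambda>x. F x m) x0)"
   by blast
  define Q where "Q = ?H ` P"
  note DG = cmapD[OF P(4), folded Q_def]
  have GQ: "G y\<in>P" "?H (G y) = y" if "y\<in>Q" for y using that P(5) by (auto simp: Q_def)
  have Pop: "openin (En n) P"
   using P(3) by (auto simp: coord_diffeo_def smooth_coord_map_def)
  define F' where "F' y = F (G y)" for y
  have F's: "smooth_coord_map n Q n F'" unfolding F'_def[abs_def]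
   by (rule cmap_compose[OF Suc(3) P(4)[folded Q_def]]) (use GQ P(2) in blast)
  have Gid: "G y i = y i" if "y\<in>Q" "i\<noteq>m" for y i using fun_cong[OF GQ(2)[OF that(1)], of i] that(2) by simp
  have x0Q: "?H x0\<in>Q" using P(1) by (simp add: Q_def)
  have Jg: "pd j (\<lambda>y. G y i) (?H x0) = (if i = j then 1 else 0)" if ij: "i < n" "j < n" for i j
  proof (cases "i = m")
   case True then show ?thesis using P(6)[OF ij(2)] Suc(5)[OF m ij(2)] Suc(5)[OF m m] by auto
  next
   case False
   have "pd j (\<lambda>y. G y i) (?H x0) = pd j (\<lambda>y. y i) (?H x0)"
    by (rule pd_cong[OF DG(1) x0Q ij(2)]) (use Gid False in auto)
   also have "has_pd j (\<lambda>y. y i) (if i = j then 1 else 0) (?H x0)" by (auto simp: has_pd_def)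
   then have "pd j (\<lambda>y. y i) (?H x0) = (if i = j then 1 else 0)" by (rule pd_unique)
   finally show ?thesis .
  qed
  have "\<exists>P'. ?H x0\<in>P' \<and> P'\<subseteq>Q \<and> coord_diffeo n P' (F' ` P') F'"
  proof (rule Suc.IH[OF _ F's x0Q])
   show "m\<le>n" using m by simp
   fix i j assume ij: "i < n" "j < n"
   have "pd j (\<lambda>y. F' y i) (?H x0) = (\<Sum>l<n. pd l (\<lambda>x. F x i) (G (?H x0)) * pd j (\<lambda>y. G y l) (?H x0))"
    unfolding F'_def
    by (rule pd_compose[OF D(3) P(4)[folded Q_def] x0Q _ ij(2)]) (use P(1,2) P(5)[OF P(1)] in auto)
   also have "\<dots> = (\<Sum>l<n. if l = j then pd j (\<lambda>x. F x i) x0 else 0)"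
    by (rule sum.cong) (use Jg ij P(5)[OF P(1)] in auto)
   also have "\<dots> = (if i = j then 1 else 0)" using ij Suc(5) by simp
   finally show "pd j (\<lambda>y. F' y i) (?H x0) = (if i = j then 1 else 0)" .
  next
   fix y i assume yi: "y\<in>Q" "m\<le>i" "i < n"
   show "F' y i = y i"
   proof (cases "i = m")
    case True
    then show ?thesis using fun_cong[OF GQ(2)[OF yi(1)], of m] by (simp add: F'_def)
   next
    case False
    then have "F (G y) i = G y i" using Suc(6)[of "G y" i] GQ(1)[OF yi(1)] P(2) yi by auto
    then show ?thesis using Gid[OF yi(1) False] by (simp add: F'_def)
   qed
  qed
  then obtain P' where P': "?H x0\<in>P'" "P'\<subseteq>Q" "coord_diffeo n P' (F' ` P') F'" by blast
  define P2 where "P2 = {x\<in>P. ?H x\<in>P'}"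
  have P'op: "openin (En n) P'" using P'(3) by (auto simp: coord_diffeo_def smooth_coord_map_def)
  have Hs: "smooth_coord_map n P n ?H" using P(3) by (simp add: coord_diffeo_def)
  have "openin (En n) P2" unfolding P2_def by (rule cmap_openin_preimage[OF Hs P'op])
  then have c1: "coord_diffeo n P2 (?H ` P2) ?H" using coord_diffeo_restrict(1)[OF P(3)] by (auto simp: P2_def)
  have im: "?H ` P2 = P'" using P'(2) by (auto simp: P2_def Q_def)
  have c2: "coord_diffeo n P2 (F' ` P') (\<lambda>x. F' (?H x))"
   using coord_diffeo_compose[OF c1 P'(3)] im by simp
  have eq: "F' (?H x) = F x" if "x\<in>P2" for x using P(5) that by (simp add: F'_def P2_def)
  have "F' ` P' = F ` P2" unfolding im[symmetric] image_image using eq by (rule image_cong[OF refl])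
  have "coord_diffeo n P2 (F ` P2) F"
  proof -
   obtain K where K: "smooth_coord_map n P2 n (\<lambda>x. F' (?H x))" "smooth_coord_map n (F' ` P') n K"
    "\<And>x. x\<in>P2 ==> F' (?H x)\<in>F' ` P'" "\<And>y. y\<in>F' ` P' ==> K y\<in>P2"
    "\<And>x. x\<in>P2 ==> K (F' (?H x)) = x" "\<And>y. y\<in>F' ` P' ==> F' (?H (K y)) = y"
    using coord_diffeoE[OF c2] by blast
   show ?thesis unfolding \<open>F' ` P' = F ` P2\<close>[symmetric]
    by (rule coord_diffeoI[OF cmap_cong[OF K(1)] K(2)]) (use K(3-6) eq in auto)
  qed
  then show ?case using P(1,2) P'(1) by (intro exI[of _ P2]) (auto simp: P2_def)
 qed
 from this[of n, OF _ F x0 J] show thesis using that by auto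
qed

section \<open>Normal forms of square matrices\<close>

definition inverse_mats :: "nat \<Rightarrow> real mat \<Rightarrow> real mat \<Rightarrow> bool" where
 "inverse_mats n P P' \<longleftrightarrow> P\<in>carrier_mat n n \<and> P'\<in>carrier_mat n n \<and> P * P' = 1\<^sub>m n \<and> P' * P = 1\<^sub>m n"

lemma inverse_mats_mult:
 assumes "inverse_mats n P P'" "inverse_mats n Q Q'"
 shows "inverse_mats n (P * Q) (Q' * P')"
proof -
 have c: "P\<in>carrier_mat n n" "P'\<in>carrier_mat n n" "Q\<in>carrier_mat n n" "Q'\<in>carrier_mat n n"
  and e: "P * P' = 1\<^sub>m n" "P' * P = 1\<^sub>m n" "Q * Q' = 1\<^sub>m n" "Q' * Q = 1\<^sub>m n"
  using assms by (auto simp: inverse_mats_def)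
 have "P * Q * (Q' * P') = P * ((Q * Q') * P')" "Q' * P' * (P * Q) = Q' * ((P' * P) * Q)"
  using c by (simp_all add: assoc_mult_mat[where n\<^sub>1=n and n\<^sub>2=n and n\<^sub>3=n and n\<^sub>4=n])
 then show ?thesis using c e by (simp add: inverse_mats_def)
qed

lemma inverse_mats_one: "inverse_mats n (1\<^sub>m n) (1\<^sub>m n)"
 by (simp add: inverse_mats_def)

definition mat_equiv :: "nat \<Rightarrow> real mat \<Rightarrow> real mat \<Rightarrow> bool" where
 "mat_equiv n A B \<longleftrightarrow> (\<exists>P P' Q Q'. inverse_mats n P P' \<and> inverse_mats n Q Q' \<and> B = P * A * Q)"

lemma mat_equiv_trans:
 assumes "mat_equiv n A B" "mat_equiv n B C" "A\<in>carrier_mat n n" shows "mat_equiv n A C"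
proof -
 obtain P P' Q Q' where 1: "inverse_mats n P P'" "inverse_mats n Q Q'" "B = P * A * Q" using assms(1) by (auto simp: mat_equiv_def)
 obtain R R' S S' where 2: "inverse_mats n R R'" "inverse_mats n S S'" "C = R * B * S" using assms(2) by (auto simp: mat_equiv_def)
 have c: "P\<in>carrier_mat n n" "Q\<in>carrier_mat n n" "R\<in>carrier_mat n n" "S\<in>carrier_mat n n"
  using 1 2 by (auto simp: inverse_mats_def)
 have "C = (R * P) * A * (Q * S)" unfolding 1 2 using c assms(3)
  by (simp add: assoc_mult_mat[where n\<^sub>1=n and n\<^sub>2=n and n\<^sub>3=n and n\<^sub>4=n])
 then show ?thesis using inverse_mats_mult[OF 2(1) 1(1)] inverse_mats_mult[OF 1(2) 2(2)] by (auto simp: mat_equiv_def)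
qed

definition diag_rank :: "nat \<Rightarrow> nat \<Rightarrow> real mat" where
 "diag_rank n r = mat n n (\<lambda>(i, j). if i = j \<and> i < r then 1 else 0)"

lemma diag_rank_carrier [simp]: "diag_rank n r\<in>carrier_mat n n"
 by (simp add: diag_rank_def)

lemma inverse_mats_swap: "k < n ==> l < n ==> inverse_mats n (swaprows_mat n k l) (swaprows_mat n k l)"
 by (simp add: inverse_mats_def swaprows_mat_inv)

text \<open>The block matrix of one elimination step: with pivot \<open>a\<close> and the column
  \<open>C\<close> below it, multiplication from the left by the first matrix turns the pivot into 1
  and clears the column. The matrices of \<open>inverse_mats_upper\<close> clear the row from the
  right.\<close>

lemma inverse_mats_lower:
 assumes "inverse_mats 1 a a'" "C\<in>carrier_mat n 1"
 shows "inverse_mats (Suc n) (four_block_mat a' (0\<^sub>m 1 n) (- (C * a')) (1\<^sub>m n)) (four_block_mat a (0\<^sub>m 1 n) C (1\<^sub>m n))"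
proof -
 have c: "a\<in>carrier_mat 1 1" "a'\<in>carrier_mat 1 1" and e: "a * a' = 1\<^sub>m 1" "a' * a = 1\<^sub>m 1"
  using assms by (auto simp: inverse_mats_def)
 have z: "- (C * a') * a + 1\<^sub>m n * C = 0\<^sub>m n 1"
 proof -
  have "- (C * a') * a = - (C * (a' * a))" using c assms(2) by simp
  also have "\<dots> = - C" using e assms(2) by simp
  finally show ?thesis using assms(2) by (intro eq_matI) auto
 qed
 have 1: "four_block_mat a' (0\<^sub>m 1 n) (- (C * a')) (1\<^sub>m n) * four_block_mat a (0\<^sub>m 1 n) C (1\<^sub>m n) = 1\<^sub>m (1 + n)"
  unfolding one_mat_def[of "1+n"]
  by (subst mult_four_block_mat[of _ 1 1 _ n _ n _ _ 1 _ n]) (use c e z assms(2) in \<open>auto intro!: eq_matI\<close>)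
 have z2: "C * a' + 1\<^sub>m n * - (C * a') = 0\<^sub>m n 1" using c assms(2) by (intro eq_matI) auto
 have 2: "four_block_mat a (0\<^sub>m 1 n) C (1\<^sub>m n) * four_block_mat a' (0\<^sub>m 1 n) (- (C * a')) (1\<^sub>m n) = 1\<^sub>m (1 + n)"
  unfolding one_mat_def[of "1+n"]
  by (subst mult_four_block_mat[of _ 1 1 _ n _ n _ _ 1 _ n]) (use c e z2 assms(2) in \<open>auto intro!: eq_matI\<close>)
 show ?thesis using 1 2 c assms(2) by (auto simp: inverse_mats_def)
qed


lemma inverse_mats_upper:
 assumes "B\<in>carrier_mat 1 n"
 shows "inverse_mats (Suc n) (four_block_mat (1\<^sub>m 1) (- B) (0\<^sub>m n 1) (1\<^sub>m n)) (four_block_mat (1\<^sub>m 1) B (0\<^sub>m n 1) (1\<^sub>m n))"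
proof -
 have z: "1\<^sub>m 1 * B + (- B) * 1\<^sub>m n = 0\<^sub>m 1 n" "1\<^sub>m 1 * (- B) + B * 1\<^sub>m n = 0\<^sub>m 1 n"
  using assms by (auto intro!: eq_matI)
 have 1: "four_block_mat (1\<^sub>m 1) (- B) (0\<^sub>m n 1) (1\<^sub>m n) * four_block_mat (1\<^sub>m 1) B (0\<^sub>m n 1) (1\<^sub>m n) = 1\<^sub>m (1 + n)"
  unfolding one_mat_def[of "1+n"]
  by (subst mult_four_block_mat[of _ 1 1 _ n _ n _ _ 1 _ n]) (use z assms in \<open>auto intro!: eq_matI\<close>)
 have 2: "four_block_mat (1\<^sub>m 1) B (0\<^sub>m n 1) (1\<^sub>m n) * four_block_mat (1\<^sub>m 1) (- B) (0\<^sub>m n 1) (1\<^sub>m n) = 1\<^sub>m (1 + n)"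
  unfolding one_mat_def[of "1+n"]
  by (subst mult_four_block_mat[of _ 1 1 _ n _ n _ _ 1 _ n]) (use z assms in \<open>auto intro!: eq_matI\<close>)
 show ?thesis using 1 2 assms by (auto simp: inverse_mats_def)
qed

lemma diag_block_mult:
 assumes "X\<in>carrier_mat n n" "Y\<in>carrier_mat n n"
 shows "four_block_mat (1\<^sub>m 1) (0\<^sub>m 1 n) (0\<^sub>m n 1) X * four_block_mat (1\<^sub>m 1) (0\<^sub>m 1 n) (0\<^sub>m n 1) Y
  = four_block_mat (1\<^sub>m 1) (0\<^sub>m 1 n) (0\<^sub>m n 1) (X * Y :: real mat)"
 by (subst mult_four_block_mat[of _ 1 1 _ n _ n _ _ 1 _ n]) (use assms in auto)

lemma inverse_mats_diag_block:
 assumes "inverse_mats n P P'"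
 shows "inverse_mats (Suc n) (four_block_mat (1\<^sub>m 1) (0\<^sub>m 1 n) (0\<^sub>m n 1) P) (four_block_mat (1\<^sub>m 1) (0\<^sub>m 1 n) (0\<^sub>m n 1) P')"
proof -
 have c: "P\<in>carrier_mat n n" "P'\<in>carrier_mat n n" and e: "P * P' = 1\<^sub>m n" "P' * P = 1\<^sub>m n"
  using assms by (auto simp: inverse_mats_def)
 have *: "four_block_mat (1\<^sub>m 1) (0\<^sub>m 1 n) (0\<^sub>m n 1) X * four_block_mat (1\<^sub>m 1) (0\<^sub>m 1 n) (0\<^sub>m n 1) Y = 1\<^sub>m (1 + n)"
  if "X\<in>carrier_mat n n" "Y\<in>carrier_mat n n" "X * Y = 1\<^sub>m n" for X Y :: "real mat"
  unfolding one_mat_def[of "1+n"]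
  by (subst mult_four_block_mat[of _ 1 1 _ n _ n _ _ 1 _ n]) (use that in \<open>auto intro!: eq_matI\<close>)
 show ?thesis using *[OF c e(1)] *[OF c(2,1) e(2)] c by (auto simp: inverse_mats_def)
qed

text \<open>Gaussian elimination: a non-zero entry is swapped into the corner, its column and row
  are cleared, and the remaining block is treated by induction.\<close>

lemma mat_equiv_diag_rank:
 assumes "A\<in>carrier_mat n n"
 shows "\<exists>r\<le>n. mat_equiv n A (diag_rank n r)"
 using assms
proof (induction n arbitrary: A)
 case 0
 have "1\<^sub>m 0 * A * 1\<^sub>m 0 = diag_rank 0 0" using 0 by (intro eq_matI) (auto simp: diag_rank_def)
 then show ?case using inverse_mats_one[of 0] unfolding mat_equiv_def by (metis le_refl)
next
 case (Suc n)
 note A = Suc(2)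
 show ?case
 proof (cases "\<forall>i<Suc n. \<forall>j<Suc n. A $$ (i, j) = 0")
  case True
  then have "diag_rank (Suc n) 0 = 1\<^sub>m (Suc n) * A * 1\<^sub>m (Suc n)" using A by (intro eq_matI) (auto simp: diag_rank_def)
  then show ?thesis using inverse_mats_one[of "Suc n"] unfolding mat_equiv_def by (metis zero_le)
 next
  case False
  then obtain i j where ij: "i < Suc n" "j < Suc n" "A $$ (i, j)\<noteq>0" by blast
  define S where "S = (swaprows_mat (Suc n) 0 i :: real mat)"
  define S' where "S' = (swaprows_mat (Suc n) 0 j :: real mat)"
  define A2 where "A2 = S * A * S'"
  have SA: "S * A = swaprows 0 i A" unfolding S_def using ij A by (intro swaprows_mat[symmetric]) auto
  have "A2 = swapcols 0 j (swaprows 0 i A)" unfolding A2_def SA S'_def using ij A by (intro swapcols_mat[symmetric]) auto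
  then have A200: "A2 $$ (0, 0)\<noteq>0" using ij A by auto
  have A2: "A2\<in>carrier_mat (Suc n) (Suc n)"
   unfolding A2_def S_def S'_def by (rule mult_carrier_mat[OF mult_carrier_mat[OF _ A]]) auto
  have q1: "mat_equiv (Suc n) A A2" unfolding mat_equiv_def A2_def
   using inverse_mats_swap[of 0 "Suc n" i] inverse_mats_swap[of 0 "Suc n" j] ij S_def S'_def by blast
  obtain a b c d where sp: "split_block A2 1 1 = (a, b, c, d)" by (metis prod_cases4)
  have dims: "dim_row A2 = 1 + n" "dim_col A2 = 1 + n" using A2 by auto
  note bl = split_block[OF sp dims]
  have a00: "a $$ (0, 0)\<noteq>0" using A200 bl by (metis One_nat_def dims(1) dims(2) index_mat_four_block(1) carrier_matD lessI zero_less_one add_gr_0)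
  define a' where "a' = mat 1 1 (\<lambda>_. inverse (a $$ (0, 0)))"
  have a': "a'\<in>carrier_mat 1 1" by (simp add: a'_def)
  have inva: "inverse_mats 1 a a'" using bl(1) a00 unfolding inverse_mats_def
   by (auto intro!: eq_matI simp: a'_def scalar_prod_def)
  then have ee: "a * a' = 1\<^sub>m 1" "a' * a = 1\<^sub>m 1" by (auto simp: inverse_mats_def)
  define L where "L = four_block_mat a' (0\<^sub>m 1 n) (- (c * a')) (1\<^sub>m n)"
  define R where "R = four_block_mat (1\<^sub>m 1) (- (a' * b)) (0\<^sub>m n 1) (1\<^sub>m n)"
  \<comment> \<open>The Schur complement of the pivot.\<close>
  define B where "B = - (c * a') * b + d"
  have B: "B\<in>carrier_mat n n" using bl a' by (simp add: B_def)
  have z: "- (c * a') * a + 1\<^sub>m n * c = 0\<^sub>m n 1"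
  proof -
   have "- (c * a') * a = - (c * (a' * a))" using bl a' by simp
   also have "\<dots> = - c" using ee bl by simp
   finally show ?thesis using bl by (intro eq_matI) auto
  qed
  have LA: "L * A2 = four_block_mat (1\<^sub>m 1) (a' * b) (0\<^sub>m n 1) B"
   unfolding L_def bl(5)
   apply (subst mult_four_block_mat[of _ 1 1 _ n _ n _ _ 1 _ n])
   using bl a' ee z by (auto simp: B_def)
  have LAR: "L * A2 * R = four_block_mat (1\<^sub>m 1) (0\<^sub>m 1 n) (0\<^sub>m n 1) B"
  proof -
   have ab: "a' * b\<in>carrier_mat 1 n" using bl a' by simp
   have "1\<^sub>m 1 * - E + E * 1\<^sub>m n = 0\<^sub>m 1 n" "0\<^sub>m n 1 * - E + B * 1\<^sub>m n = B"
    if "E\<in>carrier_mat 1 n" for E :: "real mat" using that B by (auto intro!: eq_matI)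
   from this[OF ab] have "1\<^sub>m 1 * - (a' * b) + a' * b * 1\<^sub>m n = 0\<^sub>m 1 n"
    "0\<^sub>m n 1 * - (a' * b) + B * 1\<^sub>m n = B" .
   moreover have "1\<^sub>m 1 * 1\<^sub>m 1 + E * 0\<^sub>m n 1 = 1\<^sub>m 1" "0\<^sub>m n 1 * 1\<^sub>m 1 + B * 0\<^sub>m n 1 = 0\<^sub>m n 1"
    if "E\<in>carrier_mat 1 n" for E :: "real mat" using that B by (auto intro!: eq_matI)
   note this[OF ab]
   ultimately show ?thesis unfolding LA R_def
    by (subst mult_four_block_mat[of _ 1 1 _ n _ n _ _ 1 _ n]) (use ab B in auto)
  qed
  have ab: "a' * b\<in>carrier_mat 1 n" using bl a' by simp
  have q2: "mat_equiv (Suc n) A2 (four_block_mat (1\<^sub>m 1) (0\<^sub>m 1 n) (0\<^sub>m n 1) B)"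
   unfolding mat_equiv_def LAR[symmetric] L_def R_def
   using inverse_mats_lower[OF inva bl(3)] inverse_mats_upper[OF ab] by blast
  obtain r P P' Q Q' where r: "r\<le>n" "inverse_mats n P P'" "inverse_mats n Q Q'" "diag_rank n r = P * B * Q"
   using Suc(1)[OF B] by (auto simp: mat_equiv_def)
  have c: "P\<in>carrier_mat n n" "Q\<in>carrier_mat n n" using r by (auto simp: inverse_mats_def)
  have "four_block_mat (1\<^sub>m 1) (0\<^sub>m 1 n) (0\<^sub>m n 1) P * four_block_mat (1\<^sub>m 1) (0\<^sub>m 1 n) (0\<^sub>m n 1) B
    * four_block_mat (1\<^sub>m 1) (0\<^sub>m 1 n) (0\<^sub>m n 1) Q = four_block_mat (1\<^sub>m 1) (0\<^sub>m 1 n) (0\<^sub>m n 1) (P * B * Q)"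
   using diag_block_mult[OF c(1) B] diag_block_mult[OF mult_carrier_mat[OF c(1) B] c(2)] by simp
  also have "\<dots> = diag_rank (Suc n) (Suc r)" unfolding r(4)[symmetric]
   by (rule eq_matI) (auto simp: diag_rank_def)
  finally have q3: "mat_equiv (Suc n) (four_block_mat (1\<^sub>m 1) (0\<^sub>m 1 n) (0\<^sub>m n 1) B) (diag_rank (Suc n) (Suc r))"
   unfolding mat_equiv_def using inverse_mats_diag_block[OF r(2)] inverse_mats_diag_block[OF r(3)] by metis
  have "four_block_mat (1\<^sub>m 1) (0\<^sub>m 1 n) (0\<^sub>m n 1) B\<in>carrier_mat (Suc n) (Suc n)" using B by auto
  then show ?thesis using mat_equiv_trans[OF mat_equiv_trans[OF q1 q2 A] q3 A] r(1)
   by (intro exI[of _ "Suc r"]) auto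
 qed
qed

lemma diag_rank_idem: "diag_rank n r * diag_rank n r = diag_rank n r"
proof (rule eq_matI)
 fix i j assume "i < dim_row (diag_rank n r)" "j < dim_col (diag_rank n r)"
 then have ij: "i < n" "j < n" by (auto simp: diag_rank_def)
 have "(diag_rank n r * diag_rank n r) $$ (i, j) = (\<Sum>l = 0..<n. diag_rank n r $$ (i, l) * diag_rank n r $$ (l, j))"
  using ij by (simp add: diag_rank_def scalar_prod_def)
 also have "\<dots> = (\<Sum>l = 0..<n. if l = i then (if i = j \<and> i < r then 1 else 0) else 0)"
  using ij by (intro sum.cong) (auto simp: diag_rank_def)
 also have "\<dots> = diag_rank n r $$ (i, j)" using ij by (simp add: diag_rank_def)
 finally show "(diag_rank n r * diag_rank n r) $$ (i, j) = diag_rank n r $$ (i, j)" .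
qed (auto simp: diag_rank_def)

text \<open>The rank normal form only gives an equivalence D = P L Q, but a similarity is needed.
  The matrix \<open>T\<close> = Q' L Q is similar to \<open>L\<close> and satisfies D T = D and T D
  = T: the idempotents \<open>D\<close> and \<open>T\<close> have the same kernel, and 1 + (D - T)
  conjugates one into the other.\<close>

lemma idempotent_mat_diagonalise:
 assumes L: "L\<in>carrier_mat n n" and idem: "L * L = L"
 obtains W W' r where "inverse_mats n W W'" "r\<le>n" "W * L * W' = diag_rank n r"
proof -
 obtain r P P' Q Q' where r: "r\<le>n" "inverse_mats n P P'" "inverse_mats n Q Q'" "diag_rank n r = P * L * Q"
  using mat_equiv_diag_rank[OF L] by (auto simp: mat_equiv_def)
 have c: "P\<in>carrier_mat n n" "P'\<in>carrier_mat n n" "Q\<in>carrier_mat n n" "Q'\<in>carrier_mat n n"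
  and e: "P * P' = 1\<^sub>m n" "P' * P = 1\<^sub>m n" "Q * Q' = 1\<^sub>m n" "Q' * Q = 1\<^sub>m n"
  using r by (auto simp: inverse_mats_def)
 define D where "D = diag_rank n r"
 note as = assoc_mult_mat[where n\<^sub>1=n and n\<^sub>2=n and n\<^sub>3=n and n\<^sub>4=n]
 have D: "D\<in>carrier_mat n n" "D * D = D" by (auto simp: D_def diag_rank_idem)
 define T where "T = Q' * L * Q"
 have T: "T\<in>carrier_mat n n" using c L by (simp add: T_def)
 have TT: "T * T = T"
 proof -
  have "T * T = Q' * (L * ((Q * Q') * (L * Q)))" using c L unfolding T_def by (simp add: as)
  also have "\<dots> = Q' * ((L * L) * Q)" using c L e by (simp add: as)
  also have "\<dots> = T" using c L idem by (simp add: T_def as)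
  finally show ?thesis .
 qed
 have DT: "D * T = D"
 proof -
  have "D * T = P * (L * ((Q * Q') * (L * Q)))" using c L unfolding T_def D_def r(4) by (simp add: as)
  also have "\<dots> = P * ((L * L) * Q)" using c L e by (simp add: as)
  also have "\<dots> = D" using c L idem by (simp add: D_def r(4) as)
  finally show ?thesis .
 qed
 have TD: "T * D = T"
 proof -
  have L': "P' * D * Q' = L"
  proof -
   have "P' * D * Q' = (P' * P) * (L * (Q * Q'))" using c L unfolding D_def r(4) by (simp add: as)
   then show ?thesis using c L e by simp
  qed
  have "T = Q' * P' * D"
  proof -
   have "T = Q' * (P' * (D * (Q' * Q)))" unfolding T_def L'[symmetric] using c D by (simp add: as)
   then show ?thesis using c D e by (simp add: as)
  qed
  then show ?thesis using c D by (simp add: as)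
 qed
 \<comment> \<open>(D - T)(T - D) = D T - D - T + T D = 0, so \<open>S\<close> and \<open>S'\<close>
   are mutually inverse; the same identities give S T = D and D S' = D.\<close>
 define S where "S = 1\<^sub>m n + (D - T)"
 define S' where "S' = 1\<^sub>m n + (T - D)"
 have S: "S\<in>carrier_mat n n" "S'\<in>carrier_mat n n" using D T by (auto simp: S_def S'_def)
 note ds = add_mult_distrib_mat[where nr=n and n=n and nc=n] mult_add_distrib_mat[where nr=n and n=n and nc=n]
  minus_mult_distrib_mat[where nr=n and n=n and nc=n] mult_minus_distrib_mat[where nr=n and n=n and nc=n]
 have DTc: "D - T\<in>carrier_mat n n" "T - D\<in>carrier_mat n n"
  by (rule minus_carrier_mat, rule T, rule minus_carrier_mat, rule D)
 have "S * S' = 1\<^sub>m n" unfolding S_def S'_def using D T DTc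
  by (simp add: ds TT DT TD) (auto intro!: eq_matI)
 moreover have "S' * S = 1\<^sub>m n" unfolding S_def S'_def using D T DTc
  by (simp add: ds TT DT TD) (auto intro!: eq_matI)
 ultimately have Sinv: "inverse_mats n S S'" using S by (simp add: inverse_mats_def)
 have ST: "S * T = D" unfolding S_def using D T DTc by (simp add: ds TT DT TD) (auto intro!: eq_matI)
 have DS: "D * S' = D" unfolding S'_def using D T DTc by (simp add: ds TT DT TD)
 have "(S * Q') * L * (Q * S') = S * T * S'" unfolding T_def using c L S by (simp add: as)
 also have "\<dots> = D" by (simp add: ST DS)
 finally have "(S * Q') * L * (Q * S') = diag_rank n r" by (simp add: D_def)
 moreover have "inverse_mats n (S * Q') (Q * S')"
  by (rule inverse_mats_mult[OF Sinv]) (use r(3) in \<open>simp add: inverse_mats_def\<close>)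
 ultimately show thesis using that r(1) by blast
qed

text \<open>The ring of matrices has stable range one: since A B and 1 - A B add up to 1, a suitable
  left multiple of 1 - A B makes \<open>B\<close> invertible when added to it. In coordinates where
  \<open>B\<close> is the diagonal matrix \<open>D\<close>, the choice C = 1 - D fills the missing
  diagonal entries up to a nilpotent error.\<close>

lemma mat_stable_range:
 assumes A: "A\<in>carrier_mat n n" and B: "B\<in>carrier_mat n n"
 obtains C M' where "C\<in>carrier_mat n n" "inverse_mats n (B + C * (1\<^sub>m n - A * B)) M'"
proof -
 obtain r P P' Q Q' where r: "inverse_mats n P P'" "inverse_mats n Q Q'" "diag_rank n r = P * B * Q"
  using mat_equiv_diag_rank[OF B] by (auto simp: mat_equiv_def)
 have c: "P\<in>carrier_mat n n" "P'\<in>carrier_mat n n" "Q\<in>carrier_mat n n" "Q'\<in>carrier_mat n n"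
  and e: "P * P' = 1\<^sub>m n" "P' * P = 1\<^sub>m n" "Q * Q' = 1\<^sub>m n" "Q' * Q = 1\<^sub>m n"
  using r by (auto simp: inverse_mats_def)
 note as = assoc_mult_mat[where n\<^sub>1=n and n\<^sub>2=n and n\<^sub>3=n and n\<^sub>4=n]
 note ds = add_mult_distrib_mat[where nr=n and n=n and nc=n] mult_add_distrib_mat[where nr=n and n=n and nc=n]
  minus_mult_distrib_mat[where nr=n and n=n and nc=n] mult_minus_distrib_mat[where nr=n and n=n and nc=n]
 define D where "D = diag_rank n r"
 have D: "D\<in>carrier_mat n n" "D * D = D" by (auto simp: D_def diag_rank_idem)
 have DB: "P' * D = B * Q"
 proof -
  have "P' * D = (P' * P) * (B * Q)" using c B unfolding D_def r(3) by (simp add: as)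
  then show ?thesis using c B e by simp
 qed
 define E where "E = 1\<^sub>m n - D"
 have E: "E\<in>carrier_mat n n" and DE: "D * E = 0\<^sub>m n n" using D by (auto simp: E_def ds)
 define C where "C = P' * (E * Q')"
 define A' where "A' = Q' * (A * P')"
 have A': "A'\<in>carrier_mat n n" and C: "C\<in>carrier_mat n n" using c A E by (auto simp: A'_def C_def)
 \<comment> \<open>The error term. It has square zero because D E = 0, so 1 - X has the inverse 1 +
   X.\<close>
 define X where "X = E * (A' * D)"
 have X: "X\<in>carrier_mat n n" using E A' D by (simp add: X_def)
 have XX: "X * X = 0\<^sub>m n n"
 proof -
  have "X * X = E * (A' * ((D * E) * (A' * D)))" unfolding X_def using E A' D by (simp add: as)
  then show ?thesis using DE E A' D by simp
 qed
 define N where "N = 1\<^sub>m n - X"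
 define N' where "N' = 1\<^sub>m n + X"
 have Nc: "N\<in>carrier_mat n n" unfolding N_def by (rule minus_carrier_mat[OF X])
 have N'c: "N'\<in>carrier_mat n n" using X by (simp add: N'_def)
 have "N * N' = 1\<^sub>m n" "N' * N = 1\<^sub>m n"
 proof -
  have "N * N' = 1\<^sub>m n + X - (X + X * X)" unfolding N_def N'_def using X by (simp add: ds)
  then show "N * N' = 1\<^sub>m n" unfolding XX using X by (auto intro!: eq_matI)
  have "N' * N = 1\<^sub>m n + X - (X + X * X)" unfolding N_def N'_def using X N_def Nc by (simp add: ds)
  then show "N' * N = 1\<^sub>m n" unfolding XX using X by (auto intro!: eq_matI)
 qed
 then have Ninv: "inverse_mats n N N'" using Nc N'c by (simp add: inverse_mats_def)
 have "P' * N * Q' = B + C * (1\<^sub>m n - A * B)"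
 proof -
  have B': "P' * (D * Q') = B"
  proof -
   have "P' * (D * Q') = (P' * D) * Q'" using c D by (simp add: as)
   also have "\<dots> = B * (Q * Q')" unfolding DB using c B by (simp add: as)
   finally show ?thesis using B e by simp
  qed
  have XB: "P' * (X * Q') = C * (A * B)"
  proof -
   have "P' * (X * Q') = P' * (E * (Q' * (A * (P' * (D * Q')))))"
    unfolding X_def A'_def using c D E A by (simp add: as)
   then show ?thesis unfolding B' C_def using c E A B by (simp add: as)
  qed
  have "N = D + (E - X)" unfolding N_def E_def using D X by (intro eq_matI) auto
  then have "P' * N * Q' = P' * (D * Q') + (P' * (E * Q') - P' * (X * Q'))"
  proof -
   have EX: "E - X\<in>carrier_mat n n" by (rule minus_carrier_mat[OF X])
   have 1: "P' * D\<in>carrier_mat n n" "P' * E\<in>carrier_mat n n" "P' * X\<in>carrier_mat n n"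
    using c D E X by (auto intro: mult_carrier_mat)
   then have 2: "P' * E - P' * X\<in>carrier_mat n n" by (intro minus_carrier_mat)
   have "P' * (D + (E - X)) = P' * D + (P' * E - P' * X)" using c D E X EX by (simp add: ds)
   then have "P' * N * Q' = P' * D * Q' + (P' * E * Q' - P' * X * Q')"
    using 1 2 c \<open>N = D + (E - X)\<close> by (simp only: ds)
   then show ?thesis using c D E X by (simp add: as)
  qed
  also have "\<dots> = B + (C - C * (A * B))" unfolding B' XB C_def ..
  also have "\<dots> = B + C * (1\<^sub>m n - A * B)" using A B C by (simp add: ds)
  finally show ?thesis .
 qed
 moreover have "inverse_mats n (P' * N * Q') (Q * (N' * P))"
  by (rule inverse_mats_mult[OF inverse_mats_mult[of n P' P N N']])
    (use Ninv r in \<open>auto simp: inverse_mats_def\<close>)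
 ultimately show thesis using that C by metis
qed

section \<open>Linear maps and Jacobian matrices\<close>

definition lin :: "nat \<Rightarrow> real mat \<Rightarrow> (nat \<Rightarrow> real) \<Rightarrow> nat \<Rightarrow> real" where
 "lin n A x = (\<lambda>i. if i < n then \<Sum>j<n. A $$ (i, j) * x j else 0)"

lemma lin_Rn [simp]: "lin n A x\<in>Rn n" by (simp add: lin_def Rn_iff)

lemma lin_smooth: "openin (En n) U ==> smooth_coord_map n U n (lin n A)"
 by (rule cmapI)
  (auto simp: lin_def Rn_iff intro!: smooth_fun_if smooth_fun_sum smooth_fun_mult smooth_fun_const smooth_fun_coord)

lemma lin_mult:
 assumes "A\<in>carrier_mat n n" "B\<in>carrier_mat n n"
 shows "lin n A (lin n B x) = lin n (A * B) x"
proof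
 fix i
 show "lin n A (lin n B x) i = lin n (A * B) x i"
 proof (cases "i < n")
  case True
  have "lin n A (lin n B x) i = (\<Sum>l<n. A $$ (i, l) * (\<Sum>j<n. B $$ (l, j) * x j))"
   using True by (simp add: lin_def)
  also have "\<dots> = (\<Sum>l<n. \<Sum>j<n. A $$ (i, l) * B $$ (l, j) * x j)"
   by (simp add: sum_distrib_left mult.assoc)
  also have "\<dots> = (\<Sum>j<n. \<Sum>l<n. A $$ (i, l) * B $$ (l, j) * x j)" by (rule sum.swap)
  also have "\<dots> = (\<Sum>j<n. (A * B) $$ (i, j) * x j)"
   using assms True by (intro sum.cong) (auto simp: scalar_prod_def sum_distrib_right atLeast0LessThan)
  finally show ?thesis using True by (simp add: lin_def)
 qed (simp add: lin_def)
qed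

lemma lin_one: "x\<in>Rn n ==> lin n (1\<^sub>m n) x = x"
proof (rule Rn_eqI[of _ n])
 fix i assume i: "i < n"
 have "(\<Sum>j<n. 1\<^sub>m n $$ (i, j) * x j) = (\<Sum>j<n. if i = j then x j else 0)"
  using i by (intro sum.cong) auto
 then show "lin n (1\<^sub>m n) x i = x i" using i by (simp add: lin_def)
qed auto

lemma lin_diag_rank: "r\<le>n ==> lin n (diag_rank n r) x = trunc r x"
proof (rule Rn_eqI[of _ n])
 fix i assume i: "i < n"
 have "(\<Sum>j<n. diag_rank n r $$ (i, j) * x j) = (\<Sum>j<n. if i = j then (if i < r then x j else 0) else 0)"
  using i by (intro sum.cong) (auto simp: diag_rank_def)
 then show "lin n (diag_rank n r) x i = trunc r x i" using i by (simp add: lin_def trunc_def)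
qed (auto simp: Rn_iff trunc_def lin_def)

lemma lin_diffeo:
 assumes "inverse_mats n P P'"
 shows "coord_diffeo n (Rn n) (Rn n) (lin n P)"
 by (rule coord_diffeoI[where G="lin n P'"])
  (use assms in \<open>auto simp: inverse_mats_def lin_mult lin_one intro!: lin_smooth\<close>)

lemma pd_lin:
 assumes F: "smooth_coord_map n U n F" and x: "x\<in>U" and i: "i < n" and j: "j < n"
 shows "pd j (\<lambda>y. lin n A (F y) i) x = (\<Sum>l<n. A $$ (i, l) * pd j (\<lambda>y. F y l) x)"
proof (rule pd_unique)
 have "has_pd j (\<lambda>y. F y l) (pd j (\<lambda>y. F y l) x) x" for l
  by (rule smooth_fun_has_pd[OF cmapD(3)[OF F] j x])
 then have "((\<lambda>t. \<Sum>l<n. A $$ (i, l) * F (x(j := t)) l) has_real_derivative (\<Sum>l<n. A $$ (i, l) * pd j (\<lambda>y. F y l) x)) (at (x j))"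
  unfolding has_pd_def by (intro DERIV_sum DERIV_cmult)
 then show "has_pd j (\<lambda>y. lin n A (F y) i) (\<Sum>l<n. A $$ (i, l) * pd j (\<lambda>y. F y l) x) x"
  using i by (simp add: has_pd_def lin_def)
qed

definition jac :: "nat \<Rightarrow> ((nat \<Rightarrow> real) \<Rightarrow> nat \<Rightarrow> real) \<Rightarrow> (nat \<Rightarrow> real) \<Rightarrow> real mat" where
 "jac n F x = mat n n (\<lambda>(i, j). pd j (\<lambda>y. F y i) x)"

lemma jac_carrier [simp]: "jac n F x\<in>carrier_mat n n" by (simp add: jac_def)

lemma jac_compose:
 assumes "smooth_coord_map n V n F" "smooth_coord_map n U n G" "x\<in>U" "G x\<in>V"
 shows "jac n (\<lambda>x. F (G x)) x = jac n F (G x) * jac n G x"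
proof (rule eq_matI)
 fix i j assume ij: "i < dim_row (jac n F (G x) * jac n G x)" "j < dim_col (jac n F (G x) * jac n G x)"
 then have ij: "i < n" "j < n" by (auto simp: jac_def)
 have "pd j (\<lambda>x. F (G x) i) x = (\<Sum>l<n. pd l (\<lambda>y. F y i) (G x) * pd j (\<lambda>y. G y l) x)"
  by (rule pd_compose[OF cmapD(3)[OF assms(1)] assms(2,3,4) ij(2)])
 then show "jac n (\<lambda>x. F (G x)) x $$ (i, j) = (jac n F (G x) * jac n G x) $$ (i, j)"
  using ij by (simp add: jac_def scalar_prod_def atLeast0LessThan)
qed (auto simp: jac_def)

lemma jac_lin_compose:
 assumes "smooth_coord_map n U n F" "x\<in>U" "A\<in>carrier_mat n n"
 shows "jac n (\<lambda>x. lin n A (F x)) x = A * jac n F x"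
 by (rule eq_matI) (use pd_lin[OF assms(1,2)] assms(3) in \<open>auto simp: jac_def scalar_prod_def atLeast0LessThan\<close>)

lemma jac_cong:
 assumes "openin (En n) U" "x\<in>U" "\<And>y. y\<in>U ==> F y = G y"
 shows "jac n F x = jac n G x"
proof (rule eq_matI)
 fix i j assume "i < dim_row (jac n G x)" "j < dim_col (jac n G x)"
 then have ij: "i < n" "j < n" by (auto simp: jac_def)
 have "pd j (\<lambda>y. F y i) x = pd j (\<lambda>y. G y i) x"
  by (rule pd_cong[OF assms(1,2) ij(2)]) (simp add: assms(3))
 then show "jac n F x $$ (i, j) = jac n G x $$ (i, j)" using ij by (simp add: jac_def)
qed (auto simp: jac_def)

lemma jac_id: "jac n (\<lambda>x. x) x = 1\<^sub>m n"
proof (rule eq_matI)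
 fix i j assume "i < dim_row (1\<^sub>m n :: real mat)" "j < dim_col (1\<^sub>m n :: real mat)"
 moreover have "has_pd j (\<lambda>y. y i) (if i = j then 1 else 0) x" by (auto simp: has_pd_def)
 ultimately show "jac n (\<lambda>x. x) x $$ (i, j) = 1\<^sub>m n $$ (i, j)" by (simp add: jac_def pd_unique)
qed (auto simp: jac_def)

text \<open>Following \<open>F\<close> by the inverse of its Jacobian reduces the claim to the case
  of Jacobian 1; the linear map is composed back afterwards.\<close>

lemma inverse_function:
 assumes F: "smooth_coord_map n O' n F" and x0: "x0\<in>O'" and J: "inverse_mats n (jac n F x0) N"
 obtains P where "x0\<in>P" "P\<subseteq>O'" "coord_diffeo n P (F ` P) F"
proof -
 have N: "N\<in>carrier_mat n n" "N * jac n F x0 = 1\<^sub>m n" "jac n F x0 * N = 1\<^sub>m n" using J by (auto simp: inverse_mats_def)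
 note D = cmapD[OF F]
 have s: "smooth_coord_map n O' n (\<lambda>x. lin n N (F x))"
  by (rule cmap_compose[OF lin_smooth[OF openin_Rn] F D(2)])
 have jj: "jac n (\<lambda>x. lin n N (F x)) x0 = 1\<^sub>m n" using jac_lin_compose[OF F x0 N(1)] N by simp
 have "pd j (\<lambda>x. lin n N (F x) i) x0 = (if i = j then 1 else 0)" if "i < n" "j < n" for i j
 proof -
  have "pd j (\<lambda>x. lin n N (F x) i) x0 = jac n (\<lambda>x. lin n N (F x)) x0 $$ (i, j)" using that by (simp add: jac_def)
  then show ?thesis using jj that by simp
 qed
 from inverse_function_id[OF s x0 this] obtain P where
  P: "x0\<in>P" "P\<subseteq>O'" "coord_diffeo n P ((\<lambda>x. lin n N (F x)) ` P) (\<lambda>x. lin n N (F x))" by metis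
 have "(\<lambda>x. lin n N (F x)) ` P\<subseteq>Rn n" by auto
 from coord_diffeo_compose[OF P(3) lin_diffeo[OF J] this]
 have c: "coord_diffeo n P (lin n (jac n F x0) ` (\<lambda>x. lin n N (F x)) ` P) (\<lambda>x. lin n (jac n F x0) (lin n N (F x)))" .
 have eq: "lin n (jac n F x0) (lin n N (F x)) = F x" if "x\<in>P" for x
  using that P(2) D(2) N by (auto simp: lin_mult lin_one)
 have im: "lin n (jac n F x0) ` (\<lambda>x. lin n N (F x)) ` P = F ` P"
  unfolding image_image using eq by (rule image_cong[OF refl])
 obtain K where K: "smooth_coord_map n P n (\<lambda>x. lin n (jac n F x0) (lin n N (F x)))" "smooth_coord_map n (F ` P) n K"
    "\<And>x. x\<in>P ==> lin n (jac n F x0) (lin n N (F x))\<in>F ` P" "\<And>y. y\<in>F ` P ==> K y\<in>P"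
    "\<And>x. x\<in>P ==> K (lin n (jac n F x0) (lin n N (F x))) = x" "\<And>y. y\<in>F ` P ==> lin n (jac n F x0) (lin n N (F (K y))) = y"
  using coord_diffeoE[OF c[unfolded im]] by blast
 have "coord_diffeo n P (F ` P) F"
  by (rule coord_diffeoI[OF cmap_cong[OF K(1) eq] K(2)]) (use K(3-6) eq in auto)
 then show thesis using that P by blast
qed

section \<open>Straightening idempotent maps\<close>

lemma lin_add: "lin n A (\<lambda>i. x i + y i) i = lin n A x i + lin n A y i"
 by (simp add: lin_def sum.distrib distrib_left)

lemma lin_diff: "lin n A (\<lambda>i. x i - y i) i = lin n A x i - lin n A y i"
 by (simp add: lin_def sum_subtractf right_diff_distrib)

lemma cmap_add:
 assumes "smooth_coord_map n U m F" "smooth_coord_map n U m G"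
 shows "smooth_coord_map n U m (\<lambda>x i. F x i + G x i)"
proof (rule cmapI)
 show "openin (En n) U" by (rule cmapD[OF assms(1)])
 show "(\<lambda>i. F x i + G x i)\<in>Rn m" if "x\<in>U" for x
  using cmapD(2)[OF assms(1) that] cmapD(2)[OF assms(2) that] by (simp add: Rn_iff)
 show "smooth_fun n U (\<lambda>x. F x i + G x i)" for i
  by (intro smooth_fun_add cmapD(3)[OF assms(1)] cmapD(3)[OF assms(2)])
qed

lemma cmap_diff:
 assumes "smooth_coord_map n U m F" "smooth_coord_map n U m G"
 shows "smooth_coord_map n U m (\<lambda>x i. F x i - G x i)"
proof (rule cmapI)
 show "openin (En n) U" by (rule cmapD[OF assms(1)])
 show "(\<lambda>i. F x i - G x i)\<in>Rn m" if "x\<in>U" for x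
  using cmapD(2)[OF assms(1) that] cmapD(2)[OF assms(2) that] by (simp add: Rn_iff)
 show "smooth_fun n U (\<lambda>x. F x i - G x i)" for i
  by (intro smooth_fun_diff cmapD(3)[OF assms(1)] cmapD(3)[OF assms(2)])
qed

lemma jac_add:
 assumes "smooth_coord_map n U n F" "smooth_coord_map n U n G" "x\<in>U"
 shows "jac n (\<lambda>x i. F x i + G x i) x = jac n F x + jac n G x"
proof (rule eq_matI)
 fix i j assume "i < dim_row (jac n F x + jac n G x)" "j < dim_col (jac n F x + jac n G x)"
 then have ij: "i < n" "j < n" by (auto simp: jac_def)
 have "pd j (\<lambda>x. F x i + G x i) x = pd j (\<lambda>x. F x i) x + pd j (\<lambda>x. G x i) x"
  using smooth_fun_has_pd[OF cmapD(3)[OF assms(1)] ij(2) assms(3), of i]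
   smooth_fun_has_pd[OF cmapD(3)[OF assms(2)] ij(2) assms(3), of i]
  unfolding has_pd_def by (intro pd_unique) (auto simp: has_pd_def intro: DERIV_add)
 then show "jac n (\<lambda>x i. F x i + G x i) x $$ (i, j) = (jac n F x + jac n G x) $$ (i, j)"
  using ij by (simp add: jac_def)
qed (auto simp: jac_def)

lemma jac_diff:
 assumes "smooth_coord_map n U n F" "smooth_coord_map n U n G" "x\<in>U"
 shows "jac n (\<lambda>x i. F x i - G x i) x = jac n F x - jac n G x"
proof (rule eq_matI)
 fix i j assume "i < dim_row (jac n F x - jac n G x)" "j < dim_col (jac n F x - jac n G x)"
 then have ij: "i < n" "j < n" by (auto simp: jac_def)
 have "pd j (\<lambda>x. F x i - G x i) x = pd j (\<lambda>x. F x i) x - pd j (\<lambda>x. G x i) x"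
  using smooth_fun_has_pd[OF cmapD(3)[OF assms(1)] ij(2) assms(3), of i]
   smooth_fun_has_pd[OF cmapD(3)[OF assms(2)] ij(2) assms(3), of i]
  unfolding has_pd_def by (intro pd_unique) (auto simp: has_pd_def intro: DERIV_diff)
 then show "jac n (\<lambda>x i. F x i - G x i) x $$ (i, j) = (jac n F x - jac n G x) $$ (i, j)"
  using ij by (simp add: jac_def)
qed (auto simp: jac_def)

text \<open>\<open>F\<close> and \<open>G\<close> are inverse to each other only where G (F z) = z,
  for instance on the image of a singular space, so the product A B of their Jacobians need not be
  1. Adding to \<open>F\<close> a linear image of z - G (F z) changes nothing at those points and
  turns the Jacobian B into B + C (1 - A B), which is invertible for the \<open>C\<close> of
  \<open>mat_stable_range\<close>.\<close>

lemma local_diffeo_of_mutual: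
 assumes F: "smooth_coord_map k U k F" and G: "smooth_coord_map k V k G"
  and x0: "x0\<in>U" "F x0\<in>V" "G (F x0) = x0"
 obtains P H where "x0\<in>P" "P\<subseteq>U" "coord_diffeo k P (H ` P) H" "\<And>z. z\<in>P ==> G (F z) = z ==> H z = F z"
proof -
 define U' where "U' = {z\<in>U. F z\<in>V}"
 have U'op: "openin (En k) U'" unfolding U'_def
  by (rule cmap_openin_preimage[OF F cmapD(1)[OF G]])
 have x0': "x0\<in>U'" using x0 by (simp add: U'_def)
 have F': "smooth_coord_map k U' k F" by (rule cmap_subset[OF F U'op]) (auto simp: U'_def)
 have GF: "smooth_coord_map k U' k (\<lambda>z. G (F z))" by (rule cmap_compose[OF G F']) (simp add: U'_def)
 have I: "smooth_coord_map k U' k (\<lambda>z. z)" by (rule smooth_coord_id[OF U'op order_refl])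
 define E where "E = (\<lambda>z i. z i - G (F z) i)"
 have Es: "smooth_coord_map k U' k E" unfolding E_def by (rule cmap_diff[OF I GF])
 define A where "A = jac k G (F x0)"
 define B where "B = jac k F x0"
 have AB: "A\<in>carrier_mat k k" "B\<in>carrier_mat k k" by (auto simp: A_def B_def)
 have JE: "jac k E x0 = 1\<^sub>m k - A * B"
  using jac_diff[OF I GF x0'] jac_compose[OF G F' x0' x0(2)] by (simp add: E_def jac_id A_def B_def)
 obtain C M' where C: "C\<in>carrier_mat k k" "inverse_mats k (B + C * (1\<^sub>m k - A * B)) M'"
  using mat_stable_range[OF AB] by blast
 define H where "H = (\<lambda>z i. F z i + lin k C (E z) i)"
 have lE: "smooth_coord_map k U' k (\<lambda>z. lin k C (E z))"
  by (rule cmap_compose[OF lin_smooth[OF openin_Rn] Es cmapD(2)[OF Es]])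
 have Hs: "smooth_coord_map k U' k H" unfolding H_def by (rule cmap_add[OF F' lE])
 have "jac k H x0 = B + C * (1\<^sub>m k - A * B)"
  using jac_add[OF F' lE x0'] jac_lin_compose[OF Es x0' C(1)] JE by (simp add: H_def B_def)
 with C(2) have "inverse_mats k (jac k H x0) M'" by simp
 from inverse_function[OF Hs x0' this] obtain P where P: "x0\<in>P" "P\<subseteq>U'" "coord_diffeo k P (H ` P) H" by blast
 show thesis
 proof (rule that[OF P(1) _ P(3)])
  show "P\<subseteq>U" using P(2) by (auto simp: U'_def)
  fix z assume "z\<in>P" and z: "G (F z) = z"
  have E0: "E z = (\<lambda>_. 0)" unfolding E_def z by simp
  have "lin k C (\<lambda>_. 0) = (\<lambda>_. 0)" by (simp add: lin_def fun_eq_iff)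
  then show "H z = F z" unfolding H_def E0 by simp
 qed
qed

lemma translation_diffeo:
 assumes "c\<in>Rn n"
 shows "coord_diffeo n (Rn n) (Rn n) (\<lambda>x i. x i - c i)"
proof (rule coord_diffeoI[where G="\<lambda>x i. x i + c i"])
 have c: "smooth_coord_map n (Rn n) n (\<lambda>_. c)" by (rule cmapI) (use assms in auto)
 have i: "smooth_coord_map n (Rn n) n (\<lambda>x. x)" by (rule smooth_coord_id[OF openin_Rn order_refl])
 show "smooth_coord_map n (Rn n) n (\<lambda>x i. x i - c i)" by (rule cmap_diff[OF i c])
 show "smooth_coord_map n (Rn n) n (\<lambda>x i. x i + c i)" by (rule cmap_add[OF i c])
qed (use assms in \<open>auto simp: Rn_iff\<close>)

text \<open>The derivative \<open>L\<close> of \<open>p\<close> at the fixed point is idempotent,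
  and the map \<open>\<Phi>\<close> intertwines \<open>p\<close> with \<open>L\<close>; a basis
  diagonalising \<open>L\<close> then turns \<open>p\<close> into a truncation. Idempotence of
  \<open>p\<close> is available only where its values stay in the domain, hence the passage to
  smaller and smaller open sets.\<close>

lemma idempotent_straighten:
 assumes p: "smooth_coord_map n O' n p" and x0: "x0\<in>O'" "p x0 = x0"
  and idem: "\<And>x. x\<in>O' ==> p x\<in>O' ==> p (p x) = p x"
 obtains P H k \<epsilon> where "x0\<in>P" "P\<subseteq>O'" "\<epsilon> > 0" "k\<le>n" "coord_diffeo n P (cube n \<epsilon> (\<lambda>_. 0)) H"
  "H x0 = (\<lambda>_. 0)" "\<And>x. x\<in>P ==> p x\<in>P" "\<And>x. x\<in>P ==> H (p x) = trunc k (H x)"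
proof -
 define O1 where "O1 = {x\<in>O'. p x\<in>O'}"
 have O1: "openin (En n) O1" unfolding O1_def
  by (rule cmap_openin_preimage[OF p cmapD(1)[OF p]])
 have O1R: "O1\<subseteq>Rn n" by (rule openin_En_imp_subset[OF O1])
 have x01: "x0\<in>O1" using x0 by (simp add: O1_def)
 have p1: "smooth_coord_map n O1 n p" by (rule cmap_subset[OF p O1]) (auto simp: O1_def)
 have I: "smooth_coord_map n O1 n (\<lambda>x. x)" by (rule smooth_coord_id[OF O1 order_refl])
 define L where "L = jac n p x0"
 have Lc: "L\<in>carrier_mat n n" by (simp add: L_def)
 have LL: "L * L = L"
 proof -
  have "jac n (\<lambda>x. p (p x)) x0 = jac n p (p x0) * jac n p x0"
   by (rule jac_compose[OF p p1 x01]) (use x0 in simp)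
  moreover have "jac n (\<lambda>x. p (p x)) x0 = jac n p x0"
   by (rule jac_cong[OF O1 x01]) (use idem in \<open>auto simp: O1_def\<close>)
  ultimately show ?thesis by (simp add: L_def x0)
 qed
 obtain W W' k where W: "inverse_mats n W W'" "k\<le>n" "W * L * W' = diag_rank n k"
  using idempotent_mat_diagonalise[OF Lc LL] by blast
 have Wc: "W\<in>carrier_mat n n" "W'\<in>carrier_mat n n" "W * W' = 1\<^sub>m n" "W' * W = 1\<^sub>m n" using W by (auto simp: inverse_mats_def)
 define E where "E = (\<lambda>x i. x i - p x i)"
 have Es: "smooth_coord_map n O1 n E" unfolding E_def by (rule cmap_diff[OF I p1])
 have lE: "smooth_coord_map n O1 n (\<lambda>x. lin n L (E x))"
  by (rule cmap_compose[OF lin_smooth[OF openin_Rn] Es cmapD(2)[OF Es]])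
 have lp: "smooth_coord_map n O1 n (\<lambda>x. lin n L (p x))"
  by (rule cmap_compose[OF lin_smooth[OF openin_Rn] p1 cmapD(2)[OF p1]])
 \<comment> \<open>This is L p + (1 - L)(1 - p). Its Jacobian at \<open>x0\<close> is L L + (1 -
   L)(1 - L) = 1, and p p = p gives \<Phi> p = L p = L \<Phi>.\<close>
 define \<Phi> where "\<Phi> = (\<lambda>x i. lin n L (p x) i + (E x i - lin n L (E x) i))"
 have d: "smooth_coord_map n O1 n (\<lambda>x i. E x i - lin n L (E x) i)" by (rule cmap_diff[OF Es lE])
 have \<Phi>s: "smooth_coord_map n O1 n \<Phi>" unfolding \<Phi>_def by (rule cmap_add[OF lp d])
 have JE: "jac n E x0 = 1\<^sub>m n - L" using jac_diff[OF I p1 x01] by (simp add: E_def jac_id L_def)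
 have "jac n \<Phi> x0 = L * L + ((1\<^sub>m n - L) - L * (1\<^sub>m n - L))"
  using jac_add[OF lp d x01] jac_diff[OF Es lE x01] jac_lin_compose[OF Es x01 Lc] jac_lin_compose[OF p1 x01 Lc] JE
  by (simp add: \<Phi>_def L_def)
 also have "L * (1\<^sub>m n - L) = 0\<^sub>m n n" using Lc by (simp add: mult_minus_distrib_mat[where nr=n and n=n and nc=n] LL)
 also have "L * L + ((1\<^sub>m n - L) - 0\<^sub>m n n) = 1\<^sub>m n" unfolding LL using Lc by (intro eq_matI) auto
 finally have "inverse_mats n (jac n \<Phi> x0) (1\<^sub>m n)" using inverse_mats_one by simp
 from inverse_function[OF \<Phi>s x01 this] obtain P0 where P0: "x0\<in>P0" "P0\<subseteq>O1" "coord_diffeo n P0 (\<Phi> ` P0) \<Phi>" by blast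
 have P0op: "openin (En n) P0" using P0(3) by (auto simp: coord_diffeo_def smooth_coord_map_def)
 have Lfun: "lin n L (lin n L x) = lin n L x" for x using lin_mult[OF Lc Lc] LL by simp
 have \<Phi>p: "\<Phi> (p x) = lin n L (\<Phi> x)" if "x\<in>O1" for x
 proof
  fix i
  have px: "p (p x) = p x" using idem that by (auto simp: O1_def)
  have z: "lin n L (\<lambda>_. 0) = (\<lambda>_. 0)" by (simp add: lin_def fun_eq_iff)
  have "\<Phi> (p x) i = lin n L (p x) i" by (simp add: \<Phi>_def E_def px z)
  moreover have "lin n L (\<Phi> x) i = lin n L (lin n L (p x)) i + (lin n L (E x) i - lin n L (lin n L (E x)) i)"
   unfolding \<Phi>_def lin_add lin_diff ..
  ultimately show "\<Phi> (p x) i = lin n L (\<Phi> x) i" by (simp add: Lfun)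
 qed
 define c where "c = lin n W (\<Phi> x0)"
 define H where "H = (\<lambda>x i. lin n W (\<Phi> x) i - c i)"
 have Hx0: "H x0 = (\<lambda>_. 0)" by (simp add: H_def c_def)
 have "\<Phi> ` P0\<subseteq>Rn n" using cmapD(2)[OF \<Phi>s] P0(2) by blast
 from coord_diffeo_compose[OF P0(3) lin_diffeo[OF W(1)] this]
 have 1: "coord_diffeo n P0 (lin n W ` \<Phi> ` P0) (\<lambda>x. lin n W (\<Phi> x))" .
 have "lin n W ` \<Phi> ` P0\<subseteq>Rn n" by auto
 from coord_diffeo_compose[OF 1 translation_diffeo[of c n] this]
 have 2: "coord_diffeo n P0 ((\<lambda>x i. x i - c i) ` lin n W ` \<Phi> ` P0) H" by (simp add: H_def c_def)
 have Hp: "H (p x) = trunc k (H x)" if x: "x\<in>O1" for x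
 proof
  fix i
  have DW: "lin n (diag_rank n k) (lin n W y) = lin n W (lin n L y)" if "y\<in>Rn n" for y
  proof -
   have "diag_rank n k * W = W * L * (W' * W)" unfolding W(3)[symmetric] using Wc Lc
    by (simp add: assoc_mult_mat[where n\<^sub>1=n and n\<^sub>2=n and n\<^sub>3=n and n\<^sub>4=n])
   then have "diag_rank n k * W = W * L" using Wc Lc by simp
   then show ?thesis using Wc Lc by (simp add: lin_mult)
  qed
  have R: "\<Phi> x\<in>Rn n" "\<Phi> x0\<in>Rn n" using cmapD(2)[OF \<Phi>s] x x01 by auto
  \<comment> \<open>\<open>x0\<close> is fixed by \<open>p\<close>, so the translation vector
    \<open>c\<close> lies in the image of the truncation and subtracting it does not disturb the
    intertwining.\<close>
  have c': "c = lin n W (lin n L (\<Phi> x0))" using \<Phi>p[OF x01] x0 by (simp add: c_def)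
  have "trunc k (H x) i = lin n (diag_rank n k) (\<lambda>i. lin n W (\<Phi> x) i - c i) i"
   using lin_diag_rank[OF W(2)] by (simp add: H_def)
  also have "\<dots> = lin n W (lin n L (\<Phi> x)) i - lin n W (lin n L (\<Phi> x0)) i"
   unfolding lin_diff DW[OF R(1)] c_def DW[OF R(2)] ..
  also have "\<dots> = H (p x) i" unfolding H_def \<Phi>p[OF x] c' ..
  finally show "H (p x) i = trunc k (H x) i" by simp
 qed
 define P1 where "P1 = {x\<in>P0. p x\<in>P0}"
 have P1op: "openin (En n) P1" unfolding P1_def
  by (rule cmap_openin_preimage[OF cmap_subset[OF p1 P0op P0(2)] P0op])
 have P1P0: "P1\<subseteq>P0" by (auto simp: P1_def)
 note 3 = coord_diffeo_restrict[OF 2 P1op P1P0]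
 have "(\<lambda>_. 0)\<in>H ` P1" using Hx0 P0(1) x0 by (force simp: P1_def)
 then obtain \<epsilon> where e: "\<epsilon> > 0" "cube n \<epsilon> (\<lambda>_. 0)\<subseteq>H ` P1" using cube_nbhd[OF 3(2)] by metis
 \<comment> \<open>Truncation maps a cube about 0 into itself, which is why the preimage of a cube
   is invariant under \<open>p\<close>.\<close>
 define P where "P = {x\<in>P1. H x\<in>cube n \<epsilon> (\<lambda>_. 0)}"
 have Hs: "smooth_coord_map n P1 n H" using 3(1) by (simp add: coord_diffeo_def)
 have Pop: "openin (En n) P" unfolding P_def
  by (rule cmap_openin_preimage[OF Hs openin_cube])
 have PP1: "P\<subseteq>P1" by (auto simp: P_def)
 have im: "H ` P = cube n \<epsilon> (\<lambda>_. 0)" using e(2) by (auto simp: P_def)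
 note 4 = coord_diffeo_restrict(1)[OF 3(1) Pop PP1, unfolded im]
 have HP: "H (p x) = trunc k (H x)" if "x\<in>P" for x using Hp that P0(2) P1P0 PP1 by blast
 have pP: "p x\<in>P" if x: "x\<in>P" for x
 proof -
  have x1: "x\<in>P0" "p x\<in>P0" using x PP1 by (auto simp: P1_def)
  then have "p (p x) = p x" using idem P0(2) by (auto simp: O1_def)
  then have "p x\<in>P1" using x1 by (simp add: P1_def)
  moreover have "trunc k (H x)\<in>cube n \<epsilon> (\<lambda>_. 0)"
   using x e(1) W(2) by (auto simp: P_def cube_def trunc_def Rn_iff)
  ultimately show ?thesis using HP[OF x] by (simp add: P_def)
 qed
 have "x0\<in>P" using x0 P0(1) Hx0 e(1) by (auto simp: P_def P1_def cube_def Rn_iff)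
 moreover have "P\<subseteq>O'" using PP1 P1P0 P0(2) by (auto simp: O1_def)
 ultimately show thesis using that[OF _ _ e(1) W(2) 4 Hx0 pP HP] by blast
qed

section \<open>Smooth manifolds\<close>

lemma mfd_chartD:
 assumes "mfd_chart T n (U, \<phi>)"
 shows "openin T U" "U\<subseteq>topspace T" "openin (En n) (\<phi> ` U)" "inj_on \<phi> U"
  "\<And>x. x\<in>U ==> \<phi> x\<in>Rn n" "\<And>x. x\<in>U ==> inv_into U \<phi> (\<phi> x) = x"
  "\<And>W. openin T W ==> W\<subseteq>U ==> openin (En n) (\<phi> ` W)"
  "\<And>O'. openin (En n) O' ==> openin T {x\<in>U. \<phi> x\<in>O'}"
proof -
 have c: "openin T U" "openin (En n) (\<phi> ` U)"
  "homeomorphic_map (subtopology T U) (subtopology (En n) (\<phi> ` U)) \<phi>"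
  using assms by (auto simp: mfd_chart_def)
 show U: "openin T U" and UT: "U\<subseteq>topspace T" and o: "openin (En n) (\<phi> ` U)"
  using c openin_subset by auto
 show inj: "inj_on \<phi> U" using homeomorphic_imp_injective_map[OF c(3)] UT by (simp add: Int_absorb1)
 show "\<phi> x\<in>Rn n" if "x\<in>U" for x using openin_En_imp_subset[OF o] that by blast
 show "inv_into U \<phi> (\<phi> x) = x" if "x\<in>U" for x using inj that by simp
 show "openin (En n) (\<phi> ` W)" if W: "openin T W" "W\<subseteq>U" for W
 proof -
  have "openin (subtopology T U) W" using W U by (simp add: openin_open_subtopology)
  then have "openin (subtopology (En n) (\<phi> ` U)) (\<phi> ` W)"
   using homeomorphic_imp_open_map[OF c(3)] by (simp add: open_map_def)
  then show ?thesis using o by (simp add: openin_open_subtopology)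
 qed
 show "openin T {x\<in>U. \<phi> x\<in>O'}" if O': "openin (En n) O'" for O'
 proof -
  have cm: "continuous_map (subtopology T U) (En n) \<phi>"
   using homeomorphic_imp_continuous_map[OF c(3)] by (simp add: continuous_map_in_subtopology)
  have "openin (subtopology T U) {x\<in>topspace (subtopology T U). \<phi> x\<in>O'}"
   by (rule openin_continuous_map_preimage[OF cm O'])
  moreover have "{x\<in>topspace (subtopology T U). \<phi> x\<in>O'} = {x\<in>U. \<phi> x\<in>O'}" using UT by auto
  ultimately show ?thesis using U by (simp add: openin_open_subtopology)
 qed
qed

lemma mfd_chartI:
 assumes U: "openin T U" and o: "openin (En n) (\<phi> ` U)" and inj: "inj_on \<phi> U"
  and W: "\<And>W. openin T W ==> W\<subseteq>U ==> openin (En n) (\<phi> ` W)"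
  and O': "\<And>O'. openin (En n) O' ==> O'\<subseteq>\<phi> ` U ==> openin T {x\<in>U. \<phi> x\<in>O'}"
 shows "mfd_chart T n (U, \<phi>)"
proof -
 have UT: "U\<subseteq>topspace T" using U openin_subset by blast
 have oR: "\<phi> ` U\<subseteq>Rn n" using o openin_subset by blast
 have "homeomorphic_map (subtopology T U) (subtopology (En n) (\<phi> ` U)) \<phi>"
 proof (rule bijective_open_imp_homeomorphic_map)
  show "continuous_map (subtopology T U) (subtopology (En n) (\<phi> ` U)) \<phi>"
  proof (unfold continuous_map_def, intro conjI allI impI)
   show "\<phi>\<in>topspace (subtopology T U) \<rightarrow> topspace (subtopology (En n) (\<phi> ` U))"
    using oR by auto
   fix S assume "openin (subtopology (En n) (\<phi> ` U)) S"
   then have S: "openin (En n) S" "S\<subseteq>\<phi> ` U" using o by (auto simp: openin_open_subtopology)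
   have "{x\<in>topspace (subtopology T U). \<phi> x\<in>S} = {x\<in>U. \<phi> x\<in>S}" using UT by auto
   then show "openin (subtopology T U) {x\<in>topspace (subtopology T U). \<phi> x\<in>S}"
    using O'[OF S] U by (simp add: openin_open_subtopology)
  qed
  show "open_map (subtopology T U) (subtopology (En n) (\<phi> ` U)) \<phi>"
   unfolding open_map_def using W U o by (auto simp: openin_open_subtopology)
 qed (use UT oR inj in \<open>auto simp: Int_absorb1\<close>)
 then show ?thesis using U o by (simp add: mfd_chart_def)
qed

section \<open>Germs of functions in charts\<close>

definition germ :: "nat \<Rightarrow> 'a coord \<Rightarrow> ('a \<Rightarrow> real) \<Rightarrow> 'a \<Rightarrow> bool" where
 "germ n c f x \<longleftrightarrow> (\<exists>O' g. smooth_fun n O' g \<and> snd c x\<in>O' \<and> (\<forall>y\<in>fst c. snd c y\<in>O' \<longrightarrow> f y = g (snd c y)))"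

lemma germI: "smooth_fun n O' g ==> \<phi> x\<in>O' ==> (\<And>y. y\<in>U ==> \<phi> y\<in>O' ==> f y = g (\<phi> y)) ==> germ n (U, \<phi>) f x"
 by (auto simp: germ_def)

lemma germE:
 assumes "germ n (U, \<phi>) f x"
 obtains O' g where "smooth_fun n O' g" "\<phi> x\<in>O'" "\<And>y. y\<in>U ==> \<phi> y\<in>O' ==> f y = g (\<phi> y)"
 using assms by (auto simp: germ_def)

text \<open>Smoothness of a function composed with an inverse chart, as it occurs in the
  definitions, becomes a condition at single points in which \<open>inv_into\<close> no longer
  appears.\<close>

lemma germ_iff:
 assumes c: "mfd_chart T n (U, \<phi>)" and W: "openin T W" "W\<subseteq>U"
 shows "smooth_fun n (\<phi> ` W) (\<lambda>z. f (inv_into U \<phi> z)) \<longleftrightarrow> (\<forall>x\<in>W. germ n (U, \<phi>) f x)"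
proof (intro iffI ballI)
 note D = mfd_chartD[OF c]
 fix x assume *: "smooth_fun n (\<phi> ` W) (\<lambda>z. f (inv_into U \<phi> z))" "x\<in>W"
 show "germ n (U, \<phi>) f x"
  by (rule germI[OF *(1)]) (use * D(6) in auto)
next
 note D = mfd_chartD[OF c]
 assume *: "\<forall>x\<in>W. germ n (U, \<phi>) f x"
 show "smooth_fun n (\<phi> ` W) (\<lambda>z. f (inv_into U \<phi> z))"
 proof (rule smooth_fun_local)
  show oW: "openin (En n) (\<phi> ` W)" by (rule D(7)[OF W])
  fix z assume "z\<in>\<phi> ` W"
  then obtain x where x: "x\<in>W" "z = \<phi> x" by blast
  obtain O' g where O': "smooth_fun n O' g" "\<phi> x\<in>O'" "\<And>y. y\<in>U ==> \<phi> y\<in>O' ==> f y = g (\<phi> y)"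
   using germE[OF bspec[OF * x(1)]] by metis
  have op: "openin (En n) (O'\<inter>\<phi> ` W)" using smooth_fun_openin[OF O'(1)] oW by blast
  have "smooth_fun n (O'\<inter>\<phi> ` W) g" by (rule smooth_fun_subset[OF O'(1) op]) auto
  then have "smooth_fun n (O'\<inter>\<phi> ` W) (\<lambda>z. f (inv_into U \<phi> z))"
   by (rule smooth_fun_cong) (use O'(3) D(6) W(2) in auto)
  then show "\<exists>V. z\<in>V \<and> V\<subseteq>\<phi> ` W \<and> smooth_fun n V (\<lambda>z. f (inv_into U \<phi> z))"
   using x O'(2) by (intro exI[of _ "O'\<inter>\<phi> ` W"]) auto
 qed
qed

lemma germ_iff_map:
 assumes c: "mfd_chart T n (U, \<phi>)" and W: "openin T W" "W\<subseteq>U" and R: "\<And>y. y\<in>W ==> F y\<in>Rn m"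
 shows "smooth_coord_map n (\<phi> ` W) m (\<lambda>z. F (inv_into U \<phi> z)) \<longleftrightarrow> (\<forall>x\<in>W. \<forall>i<m. germ n (U, \<phi>) (\<lambda>y. F y i) x)"
proof -
 note D = mfd_chartD[OF c]
 have "(\<lambda>z. F (inv_into U \<phi> z)) ` \<phi> ` W\<subseteq>Rn m" using R D(6) W(2) by auto
 then show ?thesis
  unfolding smooth_coord_map_def using D(7)[OF W] germ_iff[OF c W, of "\<lambda>y. F y i" for i] by auto
qed

lemma germ_cong:
 assumes c: "mfd_chart T n (U, \<phi>)" and "germ n (U, \<phi>) f x" "openin T W" "x\<in>W" "x\<in>U" "\<And>y. y\<in>W ==> f y = g y"
 shows "germ n (U, \<phi>) g x"
proof -
 note D = mfd_chartD[OF c]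
 obtain O' h where O': "smooth_fun n O' h" "\<phi> x\<in>O'" "\<And>y. y\<in>U ==> \<phi> y\<in>O' ==> f y = h (\<phi> y)"
  using assms(2) by (auto elim: germE)
 have o: "openin (En n) (\<phi> ` (W\<inter>U))" using D(1) assms by (intro D(7)) auto
 show ?thesis
 proof (rule germI[of n "O'\<inter>\<phi> ` (W\<inter>U)" h])
  show "smooth_fun n (O'\<inter>\<phi> ` (W\<inter>U)) h"
   by (rule smooth_fun_subset[OF O'(1)]) (use o smooth_fun_openin[OF O'(1)] in auto)
  show "\<phi> x\<in>O'\<inter>\<phi> ` (W\<inter>U)" using assms O' by auto
  fix y assume y: "y\<in>U" "\<phi> y\<in>O'\<inter>\<phi> ` (W\<inter>U)"
  then have "y\<in>W" using D(4) by (auto dest: inj_onD)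
  then show "g y = h (\<phi> y)" using O'(3)[of y] y assms(6) by auto
 qed
qed

text \<open>Only the first \<open>m\<close> coordinates of \<open>g\<close> are known to be smooth;
  \<open>trunc m\<close> turns its value into a point of \<open>Rn m\<close> regardless of the
  others.\<close>

lemma germ_compose:
 assumes U: "x\<in>U" and g: "\<And>j. j < m ==> germ n (U, \<phi>) (\<lambda>y. g y j) x"
  and f: "smooth_fun m O' f" "trunc m (g x)\<in>O'" and R: "\<phi> x\<in>Rn n"
 shows "germ n (U, \<phi>) (\<lambda>y. f (trunc m (g y))) x"
proof -
 have "\<forall>j. \<exists>Q h. j < m \<longrightarrow> smooth_fun n Q h \<and> \<phi> x\<in>Q \<and> (\<forall>y\<in>U. \<phi> y\<in>Q \<longrightarrow> g y j = h (\<phi> y))"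
  using g unfolding germ_def by fastforce
 then obtain Q h where Q: "\<And>j. j < m ==> smooth_fun n (Q j) (h j)" "\<And>j. j < m ==> \<phi> x\<in>Q j"
  "\<And>j y. j < m ==> y\<in>U ==> \<phi> y\<in>Q j ==> g y j = h j (\<phi> y)" by metis
 define Q0 where "Q0 = (\<Inter>j\<in>{..<m}. Q j)\<inter>Rn n"
 have Q0: "openin (En n) Q0"
 proof (cases "m = 0")
  case False
  then show ?thesis unfolding Q0_def
   using Q(1) smooth_fun_openin by (intro openin_Int openin_INT) auto
 qed (simp add: Q0_def)
 define H where "H z = trunc m (\<lambda>j. h j z)" for z
 have Hs: "smooth_coord_map n Q0 m H"
 proof (rule cmapI[OF Q0])
  show "H z\<in>Rn m" for z by (simp add: H_def)
  show "smooth_fun n Q0 (\<lambda>z. H z j)" if "j < m" for j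
  proof -
   have "smooth_fun n Q0 (h j)" using that by (intro smooth_fun_subset[OF Q(1)[OF that] Q0]) (auto simp: Q0_def)
   then show ?thesis using that by (simp add: H_def trunc_def)
  qed
 qed
 have Hg: "H (\<phi> y) = trunc m (g y)" if "y\<in>U" "\<phi> y\<in>Q0" for y
  using Q(3) that by (auto simp: H_def trunc_def Q0_def)
 define Q1 where "Q1 = {z\<in>Q0. H z\<in>O'}"
 have x0: "\<phi> x\<in>Q0" using Q(2) R by (auto simp: Q0_def)
 have Q1: "openin (En n) Q1" unfolding Q1_def
  by (rule cmap_openin_preimage[OF Hs smooth_fun_openin[OF f(1)]])
 have "smooth_coord_map n Q1 m H" by (rule cmap_subset[OF Hs Q1]) (auto simp: Q1_def)
 then have "smooth_fun n Q1 (\<lambda>z. f (H z))" by (rule smooth_fun_compose[OF f(1)]) (simp add: Q1_def)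
 then show ?thesis
  by (rule germI) (use x0 Hg U f(2) in \<open>auto simp: Q1_def\<close>)
qed

lemma mfd_compatible_iff:
 assumes "mfd_chart T n (U, \<phi>)" "mfd_chart T n (V, \<psi>)"
 shows "mfd_compatible n (U, \<phi>) (V, \<psi>) \<longleftrightarrow>
  (\<forall>x\<in>U\<inter>V. \<forall>i<n. germ n (U, \<phi>) (\<lambda>y. \<psi> y i) x) \<and> (\<forall>x\<in>U\<inter>V. \<forall>i<n. germ n (V, \<psi>) (\<lambda>y. \<phi> y i) x)"
proof -
 note D = mfd_chartD[OF assms(1)] and E = mfd_chartD[OF assms(2)]
 have o: "openin T (U\<inter>V)" using D(1) E(1) by blast
 have 1: "smooth_coord_map n (\<phi> ` (U\<inter>V)) n (\<lambda>z. \<psi> (inv_into U \<phi> z)) \<longleftrightarrow> (\<forall>x\<in>U\<inter>V. \<forall>i<n. germ n (U, \<phi>) (\<lambda>y. \<psi> y i) x)"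
  by (rule germ_iff_map[OF assms(1) o]) (use E(5) in auto)
 have 2: "smooth_coord_map n (\<psi> ` (U\<inter>V)) n (\<lambda>z. \<phi> (inv_into V \<psi> z)) \<longleftrightarrow> (\<forall>x\<in>U\<inter>V. \<forall>i<n. germ n (V, \<psi>) (\<lambda>y. \<phi> y i) x)"
  by (rule germ_iff_map[OF assms(2) o]) (use D(5) in auto)
 show ?thesis unfolding mfd_compatible_def using 1 2 by (simp add: o_def)
qed

lemma mfd_compatibleD:
 assumes "mfd_chart T n (U, \<phi>)" "mfd_chart T n (V, \<psi>)" "mfd_compatible n (U, \<phi>) (V, \<psi>)"
  "x\<in>U" "x\<in>V" "i < n"
 shows "germ n (U, \<phi>) (\<lambda>y. \<psi> y i) x" "germ n (V, \<psi>) (\<lambda>y. \<phi> y i) x"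
 using assms unfolding mfd_compatible_iff[OF assms(1,2)] by simp_all

lemma germ_change:
 assumes c: "mfd_chart T n (U, \<phi>)" "mfd_chart T n (V, \<psi>)"
  and tr: "\<And>i. i < n ==> germ n (U, \<phi>) (\<lambda>y. \<psi> y i) x"
  and x: "x\<in>U" "x\<in>V" and f: "germ n (V, \<psi>) f x"
 shows "germ n (U, \<phi>) f x"
proof -
 note D = mfd_chartD[OF c(1)] and E = mfd_chartD[OF c(2)]
 obtain O' h where O': "smooth_fun n O' h" "\<psi> x\<in>O'" "\<And>y. y\<in>V ==> \<psi> y\<in>O' ==> f y = h (\<psi> y)"
  using f by (auto elim: germE)
 have "germ n (U, \<phi>) (\<lambda>y. h (trunc n (\<psi> y))) x"
  by (rule germ_compose[OF x(1) tr O'(1)]) (use O'(2) x D(5) E(5) in \<open>auto simp: trunc_id\<close>)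
 then show ?thesis
  by (rule germ_cong[OF c(1) _ E(8)[OF smooth_fun_openin[OF O'(1)]]])
   (use x O' E(5) in \<open>auto simp: trunc_id\<close>)
qed

text \<open>The part of \<open>smooth_manifold\<close> that concerns charts. Separation and
  countability are left out, so that open parts and products can be treated without establishing
  them again.\<close>

definition atlas_mfd :: "'a mfd \<Rightarrow> bool" where
 "atlas_mfd M \<longleftrightarrow> (\<forall>c\<in>mcharts M. mfd_chart (mtop M) (mdim M) c) \<and>
   \<Union> (fst ` mcharts M) = mpoints M \<and>
   (\<forall>c\<in>mcharts M. \<forall>d\<in>mcharts M. mfd_compatible (mdim M) c d) \<and>
   (\<forall>c. mfd_chart (mtop M) (mdim M) c \<and> (\<forall>d\<in>mcharts M. mfd_compatible (mdim M) c d) \<longrightarrow> c\<in>mcharts M)"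

lemma smooth_manifold_iff: "smooth_manifold M \<longleftrightarrow> topological_manifold (mdim M) (mtop M) \<and> atlas_mfd M"
 by (simp add: smooth_manifold_def atlas_mfd_def)

lemma smooth_manifold_imp_atlas: "smooth_manifold M ==> atlas_mfd M"
 by (simp add: smooth_manifold_iff)

lemma atlas_mfd_chart: "atlas_mfd M ==> c\<in>mcharts M ==> mfd_chart (mtop M) (mdim M) c"
 by (simp add: atlas_mfd_def)

lemma atlas_mfd_cover:
 assumes "atlas_mfd M" "x\<in>mpoints M" obtains U \<phi> where "(U, \<phi>)\<in>mcharts M" "x\<in>U"
proof -
 have "x\<in>\<Union> (fst ` mcharts M)" using assms by (simp add: atlas_mfd_def)
 then show thesis using that by auto
qed

lemma atlas_mfd_change:
 assumes M: "atlas_mfd M" and c: "(U, \<phi>)\<in>mcharts M" "(V, \<psi>)\<in>mcharts M" and x: "x\<in>U" "x\<in>V"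
  and f: "germ (mdim M) (V, \<psi>) f x"
 shows "germ (mdim M) (U, \<phi>) f x"
proof -
 note ch = atlas_mfd_chart[OF M c(1)] atlas_mfd_chart[OF M c(2)]
 have "mfd_compatible (mdim M) (U, \<phi>) (V, \<psi>)" using M c unfolding atlas_mfd_def by blast
 from germ_change[OF ch mfd_compatibleD(1)[OF ch this x] x f] show ?thesis .
qed

lemma germ_coord:
 assumes "mfd_chart T n (U, \<phi>)" "x\<in>U" shows "germ n (U, \<phi>) (\<lambda>y. \<phi> y i) x"
 by (rule germI[OF smooth_fun_coord[OF openin_Rn, of n i]]) (use mfd_chartD(5)[OF assms(1)] assms(2) in auto)

text \<open>Two charts compatible with all generating charts are compatible with each other: near a
  given point the change of coordinates passes through a generating chart around that point.\<close>

lemma atlas_mfd_of_atlas: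
 assumes ch: "\<And>c. c\<in>\<A> ==> mfd_chart T n c" and cov: "\<Union> (fst ` \<A>) = topspace T"
  and comp: "\<And>c d. c\<in>\<A> ==> d\<in>\<A> ==> mfd_compatible n c d"
 shows "atlas_mfd (mfd_of_atlas T n \<A>)" "\<A>\<subseteq>mcharts (mfd_of_atlas T n \<A>)"
proof -
 let ?M = "mfd_of_atlas T n \<A>"
 have s: "mtop ?M = T" "mdim ?M = n" "mcharts ?M = {c. mfd_chart T n c \<and> (\<forall>d\<in>\<A>. mfd_compatible n c d)}"
  by (auto simp: mfd_of_atlas_def)
 show sub: "\<A>\<subseteq>mcharts ?M" using ch comp by (auto simp: s)
 have trans: "mfd_compatible n c d" if c: "c\<in>mcharts ?M" and d: "d\<in>mcharts ?M" for c d
 proof -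
  obtain U \<phi> V \<psi> where cd: "c = (U, \<phi>)" "d = (V, \<psi>)" by (metis prod.exhaust)
  have C: "mfd_chart T n (U, \<phi>)" "mfd_chart T n (V, \<psi>)" using c d by (auto simp: s cd)
  have key: "germ n (U, \<phi>) (\<lambda>y. \<psi> y i) x"
   if C: "mfd_chart T n (U, \<phi>)" "mfd_chart T n (V, \<psi>)" and "\<And>d. d\<in>\<A> ==> mfd_compatible n (U, \<phi>) d"
    "\<And>d. d\<in>\<A> ==> mfd_compatible n (V, \<psi>) d" and x: "x\<in>U" "x\<in>V" and i: "i < n" for U \<phi> V \<psi> i x
  proof -
   have "x\<in>topspace T" using mfd_chartD(2)[OF C(1)] x by blast
   then have "x\<in>\<Union> (fst ` \<A>)" using cov by simp
   then obtain W \<kappa> where W: "(W, \<kappa>)\<in>\<A>" "x\<in>W" by auto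
   have w: "mfd_chart T n (W, \<kappa>)" by (rule ch[OF W(1)])
   have 1: "germ n (W, \<kappa>) (\<lambda>y. \<psi> y i) x" by (rule mfd_compatibleD(2)[OF C(2) w that(4)[OF W(1)] x(2) W(2) i])
   have 2: "germ n (U, \<phi>) (\<lambda>y. \<kappa> y j) x" if "j < n" for j
    by (rule mfd_compatibleD(1)[OF C(1) w \<open>\<And>d. d\<in>\<A> ==> mfd_compatible n (U, \<phi>) d\<close>[OF W(1)] x(1) W(2) that])
   show ?thesis by (rule germ_change[OF C(1) w 2 x(1) W(2) 1])
  qed
  have cA: "mfd_compatible n (U, \<phi>) e" "mfd_compatible n (V, \<psi>) e" if "e\<in>\<A>" for e
   using c d that unfolding s cd by blast+
  show ?thesis unfolding cd mfd_compatible_iff[OF C]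
  proof (intro conjI ballI allI impI)
   show "germ n (U, \<phi>) (\<lambda>y. \<psi> y i) x" if "x\<in>U\<inter>V" "i < n" for x i
    by (rule key[OF C cA]) (use that in auto)
   show "germ n (V, \<psi>) (\<lambda>y. \<phi> y i) x" if "x\<in>U\<inter>V" "i < n" for x i
    by (rule key[OF C(2,1) cA(2,1)]) (use that in auto)
  qed
 qed
 show "atlas_mfd ?M" unfolding atlas_mfd_def
 proof (intro conjI ballI allI impI)
  show "mfd_chart (mtop ?M) (mdim ?M) c" if "c\<in>mcharts ?M" for c using that by (simp add: s)
  show "\<Union> (fst ` mcharts ?M) = mpoints ?M"
  proof
   show "\<Union> (fst ` mcharts ?M)\<subseteq>mpoints ?M"
   proof
    fix x assume "x\<in>\<Union> (fst ` mcharts ?M)"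
    then obtain U \<phi> where "mfd_chart T n (U, \<phi>)" "x\<in>U" by (auto simp: s)
    then show "x\<in>mpoints ?M" using mfd_chartD(2)[of T n U \<phi>] by (auto simp: s)
   qed
   show "mpoints ?M\<subseteq>\<Union> (fst ` mcharts ?M)" unfolding s(1) cov[symmetric] by (intro Union_mono image_mono sub)
  qed
  show "mfd_compatible (mdim ?M) c d" if "c\<in>mcharts ?M" "d\<in>mcharts ?M" for c d using trans that by (simp add: s(2))
  show "c\<in>mcharts ?M" if "mfd_chart (mtop ?M) (mdim ?M) c \<and> (\<forall>d\<in>mcharts ?M. mfd_compatible (mdim ?M) c d)" for c
   using that sub unfolding s by blast
 qed
qed

section \<open>Smooth functions and smooth maps on manifolds\<close>

definition smooth_at :: "'a mfd \<Rightarrow> ('a \<Rightarrow> real) \<Rightarrow> 'a \<Rightarrow> bool" where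
 "smooth_at M f x \<longleftrightarrow> x\<in>mpoints M \<and> (\<forall>(U, \<phi>)\<in>mcharts M. x\<in>U \<longrightarrow> germ (mdim M) (U, \<phi>) f x)"

lemma smooth_atI:
 assumes "atlas_mfd M" "(U, \<phi>)\<in>mcharts M" "x\<in>U" "germ (mdim M) (U, \<phi>) f x" shows "smooth_at M f x"
 using assms atlas_mfd_change[OF assms(1) _ assms(2) _ assms(3,4)] mfd_chartD(2)[OF atlas_mfd_chart[OF assms(1,2)]]
 by (auto simp: smooth_at_def)

lemma smooth_at_germ: "smooth_at M f x ==> (U, \<phi>)\<in>mcharts M ==> x\<in>U ==> germ (mdim M) (U, \<phi>) f x"
 by (auto simp: smooth_at_def)

lemma smooth_at_coord:
 assumes "atlas_mfd M" "(U, \<phi>)\<in>mcharts M" "x\<in>U" shows "smooth_at M (\<lambda>y. \<phi> y i) x"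
 by (rule smooth_atI[OF assms germ_coord[OF atlas_mfd_chart[OF assms(1,2)] assms(3)]])

lemma smooth_at_cong:
 assumes M: "atlas_mfd M" and f: "smooth_at M f x" and W: "openin (mtop M) W" "x\<in>W" "\<And>y. y\<in>W ==> f y = g y"
 shows "smooth_at M g x"
proof -
 have "x\<in>mpoints M" using f by (simp add: smooth_at_def)
 then obtain U \<phi> where c: "(U, \<phi>)\<in>mcharts M" "x\<in>U" using atlas_mfd_cover[OF M] by blast
 show ?thesis by (rule smooth_atI[OF M c germ_cong[OF atlas_mfd_chart[OF M c(1)] smooth_at_germ[OF f c] W(1,2) c(2) W(3)]])
qed

lemma smooth_at_compose:
 assumes M: "atlas_mfd M" and x: "x\<in>mpoints M" and g: "\<And>j. j < m ==> smooth_at M (\<lambda>y. g y j) x"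
  and f: "smooth_fun m O' f" "trunc m (g x)\<in>O'"
 shows "smooth_at M (\<lambda>y. f (trunc m (g y))) x"
proof -
 obtain U \<phi> where c: "(U, \<phi>)\<in>mcharts M" "x\<in>U" using x atlas_mfd_cover[OF M] by blast
 show ?thesis
  by (rule smooth_atI[OF M c germ_compose[OF c(2) smooth_at_germ[OF g c] f]])
   (use mfd_chartD(5)[OF atlas_mfd_chart[OF M c(1)] c(2)] in auto)
qed

lemma smooth_at_const:
 assumes M: "atlas_mfd M" and x: "x\<in>mpoints M" shows "smooth_at M (\<lambda>_. c) x"
proof -
 \<comment> \<open>A constant is a smooth function of no variables.\<close>
 have "(\<lambda>_. 0)\<in>Rn 0" by (simp add: Rn_iff)
 then show ?thesis
  using smooth_at_compose[OF M x, of 0 "\<lambda>_ _. 0" "Rn 0" "\<lambda>_. c"] by (simp add: trunc_def)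
qed

lemma smooth_at_binary:
 assumes M: "atlas_mfd M" and f: "smooth_at M f x" and g: "smooth_at M g x" and h: "smooth_fun 2 (Rn 2) (\<lambda>z. h (z 0) (z 1))"
 shows "smooth_at M (\<lambda>y. h (f y) (g y)) x"
proof -
 have x: "x\<in>mpoints M" using f by (simp add: smooth_at_def)
 have "smooth_at M (\<lambda>y. (if j = 0 then f y else g y)) x" for j :: nat using f g by (cases "j = 0") auto
 then have "smooth_at M (\<lambda>y. h (trunc 2 (\<lambda>j. if j = 0 then f y else g y) 0) (trunc 2 (\<lambda>j. if j = 0 then f y else g y) 1)) x"
  by (intro smooth_at_compose[OF M x _ h]) auto
 then show ?thesis by (simp add: trunc_def)
qed

lemma smooth_at_mult: "atlas_mfd M ==> smooth_at M f x ==> smooth_at M g x ==> smooth_at M (\<lambda>y. f y * g y) x"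
 by (rule smooth_at_binary[of M f x g "(*)"]) (simp_all add: smooth_fun_mult smooth_fun_coord)

lemma smooth_at_open:
 assumes M: "atlas_mfd M" and f: "smooth_at M f x" and c: "(U, \<phi>)\<in>mcharts M" "x\<in>U"
 obtains O' g where "smooth_fun (mdim M) O' g" "O'\<subseteq>\<phi> ` U" "\<phi> x\<in>O'" "\<And>y. y\<in>U ==> \<phi> y\<in>O' ==> f y = g (\<phi> y)"
  "openin (mtop M) {y\<in>U. \<phi> y\<in>O'}" "\<And>y. y\<in>U ==> \<phi> y\<in>O' ==> smooth_at M f y"
proof -
 note D = mfd_chartD[OF atlas_mfd_chart[OF M c(1)]]
 obtain O1 g where O': "smooth_fun (mdim M) O1 g" "\<phi> x\<in>O1" "\<And>y. y\<in>U ==> \<phi> y\<in>O1 ==> f y = g (\<phi> y)"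
  using smooth_at_germ[OF f c] by (auto elim: germE)
 let ?O = "O1\<inter>\<phi> ` U"
 have "openin (En (mdim M)) ?O" using smooth_fun_openin[OF O'(1)] D(3) by blast
 then have 1: "smooth_fun (mdim M) ?O g" by (intro smooth_fun_subset[OF O'(1)]) auto
 show thesis
 proof (rule that[OF 1])
  show "openin (mtop M) {y\<in>U. \<phi> y\<in>?O}" by (rule D(8)[OF smooth_fun_openin[OF 1]])
  show "smooth_at M f y" if "y\<in>U" "\<phi> y\<in>?O" for y
   by (rule smooth_atI[OF M c(1) that(1)], rule germI[OF 1]) (use that O' in auto)
 qed (use O' c in auto)
qed

text \<open>Continuity makes the coordinate domains in \<open>smooth_map\<close> open, and then
  smoothness on them can be checked point by point.\<close>

lemma smooth_map_iff:
 assumes M: "atlas_mfd M" and N: "atlas_mfd N"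
 shows "smooth_map M N F \<longleftrightarrow> continuous_map (mtop M) (mtop N) F \<and>
  (\<forall>x\<in>mpoints M. \<forall>(V, \<psi>)\<in>mcharts N. F x\<in>V \<longrightarrow> (\<forall>i<mdim N. smooth_at M (\<lambda>y. \<psi> (F y) i) x))" (is "?L \<longleftrightarrow> ?C \<and> ?R")
proof -
 have "smooth_coord_map (mdim M) (\<phi> ` (U\<inter>F -` V)) (mdim N) (\<psi> \<circ> F \<circ> inv_into U \<phi>) \<longleftrightarrow>
  (\<forall>x\<in>U\<inter>F -` V. \<forall>i<mdim N. germ (mdim M) (U, \<phi>) (\<lambda>y. \<psi> (F y) i) x)"
  if C: ?C and c: "(U, \<phi>)\<in>mcharts M" and d: "(V, \<psi>)\<in>mcharts N" for U \<phi> V \<psi>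
 proof -
  note D = mfd_chartD[OF atlas_mfd_chart[OF M c]] and E = mfd_chartD[OF atlas_mfd_chart[OF N d]]
  have "openin (mtop M) {x\<in>mpoints M. F x\<in>V}" by (rule openin_continuous_map_preimage[OF C E(1)])
  then have "openin (mtop M) (U\<inter>{x\<in>mpoints M. F x\<in>V})" using D(1) by blast
  moreover have "U\<inter>{x\<in>mpoints M. F x\<in>V} = U\<inter>F -` V" using D(2) by auto
  ultimately have o: "openin (mtop M) (U\<inter>F -` V)" by simp
  show ?thesis
   using germ_iff_map[OF atlas_mfd_chart[OF M c] o, of "\<lambda>y. \<psi> (F y)" "mdim N"] E(5) by (auto simp: o_def)
 qed
 then have "?L \<longleftrightarrow> ?C \<and> (\<forall>(U, \<phi>)\<in>mcharts M. \<forall>(V, \<psi>)\<in>mcharts N. \<forall>x\<in>U\<inter>F -` V. \<forall>i<mdim N. germ (mdim M) (U, \<phi>) (\<lambda>y. \<psi> (F y) i) x)"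
  unfolding smooth_map_def by (auto split: prod.splits)
 also have "\<dots> \<longleftrightarrow> ?C \<and> ?R"
 proof (intro conj_cong refl)
  show "(\<forall>(U, \<phi>)\<in>mcharts M. \<forall>(V, \<psi>)\<in>mcharts N. \<forall>x\<in>U\<inter>F -` V. \<forall>i<mdim N. germ (mdim M) (U, \<phi>) (\<lambda>y. \<psi> (F y) i) x) \<longleftrightarrow> ?R" (is "?G \<longleftrightarrow> _")
  proof
   assume ?G then show ?R unfolding smooth_at_def by fast
  next
   assume R: ?R
   show ?G
   proof clarify
    fix U \<phi> V \<psi> x i assume *: "(U, \<phi>)\<in>mcharts M" "(V, \<psi>)\<in>mcharts N" "x\<in>U" "F x\<in>V" "i < mdim N"
    have "x\<in>mpoints M" using mfd_chartD(2)[OF atlas_mfd_chart[OF M *(1)]] *(3) by blast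
    then have "smooth_at M (\<lambda>y. \<psi> (F y) i) x" using R * by fast
    then show "germ (mdim M) (U, \<phi>) (\<lambda>y. \<psi> (F y) i) x" by (rule smooth_at_germ[OF _ *(1,3)])
   qed
  qed
 qed
 finally show ?thesis .
qed

lemma smooth_map_cont: "smooth_map M N F ==> continuous_map (mtop M) (mtop N) F"
 by (simp add: smooth_map_def)

lemma smooth_map_at:
 assumes M: "atlas_mfd M" and N: "atlas_mfd N" and F: "smooth_map M N F" and x: "x\<in>mpoints M"
  and f: "smooth_at N f (F x)"
 shows "smooth_at M (\<lambda>y. f (F y)) x"
proof -
 have C: "continuous_map (mtop M) (mtop N) F" using F by (rule smooth_map_cont)
 have "F x\<in>mpoints N" using f by (simp add: smooth_at_def)
 then obtain V \<psi> where d: "(V, \<psi>)\<in>mcharts N" "F x\<in>V" using atlas_mfd_cover[OF N] by blast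
 note E = mfd_chartD[OF atlas_mfd_chart[OF N d(1)]]
 obtain O' h where O': "smooth_fun (mdim N) O' h" "\<psi> (F x)\<in>O'" "\<And>y. y\<in>V ==> \<psi> y\<in>O' ==> f y = h (\<psi> y)"
  using smooth_at_germ[OF f d] by (auto elim: germE)
 have *: "smooth_at M (\<lambda>y. \<psi> (F y) i) x" if "i < mdim N" for i
  using F x d that unfolding smooth_map_iff[OF M N] by blast
 have "smooth_at M (\<lambda>y. h (trunc (mdim N) (\<psi> (F y)))) x"
  by (rule smooth_at_compose[OF M x * O'(1)]) (use O'(2) E(5)[OF d(2)] in \<open>auto simp: trunc_id\<close>)
 moreover have "openin (mtop M) {y\<in>mpoints M. F y\<in>{z\<in>V. \<psi> z\<in>O'}}"
  by (rule openin_continuous_map_preimage[OF C E(8)[OF smooth_fun_openin[OF O'(1)]]])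
 ultimately show ?thesis
  by (rule smooth_at_cong[OF M]) (use x d O' E(5) in \<open>auto simp: trunc_id\<close>)
qed

text \<open>Continuity of \<open>F\<close> is a consequence: locally \<open>F\<close> is recovered from its smooth coordinate functions.\<close>

lemma smooth_mapI:
 assumes M: "atlas_mfd M" and N: "atlas_mfd N"
  and loc: "\<And>x. x\<in>mpoints M ==> \<exists>W V \<psi>. openin (mtop M) W \<and> x\<in>W \<and> (V, \<psi>)\<in>mcharts N \<and> F ` W\<subseteq>V \<and>
   (\<forall>i<mdim N. smooth_at M (\<lambda>y. \<psi> (F y) i) x)"
 shows "smooth_map M N F"
proof -
 have C: "continuous_map (mtop M) (mtop N) F"
  unfolding continuous_map_def
 proof (intro conjI allI impI)
  show FN: "F\<in>mpoints M \<rightarrow> mpoints N"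
  proof
   fix x assume x: "x\<in>mpoints M"
   obtain W V \<psi> where *: "x\<in>W" "(V, \<psi>)\<in>mcharts N" "F ` W\<subseteq>V" using loc[OF x] by blast
   then show "F x\<in>mpoints N" using mfd_chartD(2)[OF atlas_mfd_chart[OF N *(2)]] by blast
  qed
  fix S assume S: "openin (mtop N) S"
  show "openin (mtop M) {x\<in>mpoints M. F x\<in>S}"
   unfolding openin_subopen[of _ "{x\<in>mpoints M. F x\<in>S}"]
  proof
   fix x assume x: "x\<in>{x\<in>mpoints M. F x\<in>S}"
   then obtain W V \<psi> where W: "openin (mtop M) W" "x\<in>W" "(V, \<psi>)\<in>mcharts N" "F ` W\<subseteq>V"
    "\<And>i. i < mdim N ==> smooth_at M (\<lambda>y. \<psi> (F y) i) x" using loc[of x] by blast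
   note E = mfd_chartD[OF atlas_mfd_chart[OF N W(3)]]
   obtain U \<phi> where c: "(U, \<phi>)\<in>mcharts M" "x\<in>U" using x atlas_mfd_cover[OF M] by blast
   note D = mfd_chartD[OF atlas_mfd_chart[OF M c(1)]]
   have "openin (mtop N) (V\<inter>S)" using E(1) S by blast
   then have o: "openin (En (mdim N)) (\<psi> ` (V\<inter>S))" by (intro E(7)) auto
   have "smooth_fun (mdim N) (\<psi> ` (V\<inter>S)) (\<lambda>_. 0)" using o by simp
   \<comment> \<open>Membership in a cube is a finite list of inequalities between coordinates, and
     each of them is an open condition because the coordinate functions of \<open>F\<close> are
     smooth.\<close>
   obtain \<delta> where d: "\<delta> > 0" "cube (mdim N) \<delta> (\<psi> (F x))\<subseteq>\<psi> ` (V\<inter>S)"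
    using cube_nbhd[OF o, of "\<psi> (F x)"] W x by blast
   have "\<forall>i. \<exists>Q h. i < mdim N \<longrightarrow> smooth_fun (mdim M) Q h \<and> \<phi> x\<in>Q \<and> (\<forall>y\<in>U. \<phi> y\<in>Q \<longrightarrow> \<psi> (F y) i = h (\<phi> y))"
    using smooth_at_germ[OF W(5) c] unfolding germ_def by fastforce
   then obtain Q h where Q: "\<And>i. i < mdim N ==> smooth_fun (mdim M) (Q i) (h i)" "\<And>i. i < mdim N ==> \<phi> x\<in>Q i"
    "\<And>i y. i < mdim N ==> y\<in>U ==> \<phi> y\<in>Q i ==> \<psi> (F y) i = h i (\<phi> y)" by metis
   define Z where "Z i = {z\<in>Q i. h i z\<in>ball (\<psi> (F x) i) \<delta>}" for i
   have Zo: "openin (En (mdim M)) (Z i)" if "i < mdim N" for i unfolding Z_def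
    by (rule openin_En_preimage[OF smooth_fun_openin[OF Q(1)[OF that]] smooth_fun_continuous[OF Q(1)[OF that]]]) simp
   have xZ: "\<phi> x\<in>Z i" if "i < mdim N" for i using Q(2)[OF that] Q(3)[OF that c(2)] d by (simp add: Z_def)
   define Z0 where "Z0 = (\<Inter>i\<in>{..<mdim N}. Z i)\<inter>Rn (mdim M)"
   have Z0: "openin (En (mdim M)) Z0"
   proof (cases "mdim N = 0")
    case False
    then show ?thesis unfolding Z0_def by (intro openin_Int openin_INT) (auto intro: Zo)
   qed (simp add: Z0_def)
   let ?T = "W\<inter>{y\<in>U. \<phi> y\<in>Z0}"
   have "openin (mtop M) ?T" using W(1) D(8)[OF Z0] by blast
   moreover have "x\<in>?T" using W(2) c(2) xZ D(5)[OF c(2)] by (auto simp: Z0_def)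
   moreover have "?T\<subseteq>{x\<in>mpoints M. F x\<in>S}"
   proof
    fix y assume y: "y\<in>?T"
    have FV: "F y\<in>V" using y W(4) by blast
    have "\<bar>\<psi> (F y) i - \<psi> (F x) i\<bar> < \<delta>" if "i < mdim N" for i
     using y that Q(3)[OF that, of y] by (auto simp: Z0_def Z_def dist_real_def abs_minus_commute)
    then have "\<psi> (F y)\<in>cube (mdim N) \<delta> (\<psi> (F x))" using E(5)[OF FV] by (simp add: cube_def)
    then have "\<psi> (F y)\<in>\<psi> ` (V\<inter>S)" using d by blast
    then have "F y\<in>S" using E(4) FV by (auto dest: inj_onD)
    then show "y\<in>{x\<in>mpoints M. F x\<in>S}" using y D(2) by auto
   qed
   ultimately show "\<exists>T. openin (mtop M) T \<and> x\<in>T \<and> T\<subseteq>{x\<in>mpoints M. F x\<in>S}" by blast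
  qed
 qed
 have "smooth_at M (\<lambda>y. \<psi>' (F y) i) x" if x: "x\<in>mpoints M" and d: "(V', \<psi>')\<in>mcharts N" "F x\<in>V'" and i: "i < mdim N" for x V' \<psi>' i
 proof -
  obtain W V \<psi> where W: "openin (mtop M) W" "x\<in>W" "(V, \<psi>)\<in>mcharts N" "F ` W\<subseteq>V"
    "\<And>i. i < mdim N ==> smooth_at M (\<lambda>y. \<psi> (F y) i) x" using loc[OF x] by blast
  note E = mfd_chartD[OF atlas_mfd_chart[OF N W(3)]]
  have FV: "F x\<in>V" using W by blast
  obtain O' h where O': "smooth_fun (mdim N) O' h" "\<psi> (F x)\<in>O'" "\<And>y. y\<in>V ==> \<psi> y\<in>O' ==> \<psi>' y i = h (\<psi> y)"
   using smooth_at_germ[OF smooth_at_coord[OF N d, of i] W(3) FV] by (auto elim: germE)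
  have "smooth_at M (\<lambda>y. h (trunc (mdim N) (\<psi> (F y)))) x"
   by (rule smooth_at_compose[OF M x W(5) O'(1)]) (use O'(2) E(5)[OF FV] in \<open>auto simp: trunc_id\<close>)
  moreover have "openin (mtop M) {y\<in>mpoints M. F y\<in>{z\<in>V. \<psi> z\<in>O'}}"
   by (rule openin_continuous_map_preimage[OF C E(8)[OF smooth_fun_openin[OF O'(1)]]])
  ultimately show ?thesis
   by (rule smooth_at_cong[OF M]) (use x FV O' E(5) in \<open>auto simp: trunc_id\<close>)
 qed
 then show ?thesis unfolding smooth_map_iff[OF M N] using C by auto
qed

lemma germ_restrict:
 assumes c: "mfd_chart T n (V, \<psi>)" and W: "openin T W" "W\<subseteq>V" "x\<in>W"
 shows "germ n (W, \<psi>) f x \<longleftrightarrow> germ n (V, \<psi>) f x"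
proof
 note D = mfd_chartD[OF c]
 assume "germ n (W, \<psi>) f x"
 then obtain O' h where O': "smooth_fun n O' h" "\<psi> x\<in>O'" "\<And>y. y\<in>W ==> \<psi> y\<in>O' ==> f y = h (\<psi> y)"
  by (rule germE) blast
 have o: "openin (En n) (O'\<inter>\<psi> ` W)" using smooth_fun_openin[OF O'(1)] D(7)[OF W(1,2)] by blast
 show "germ n (V, \<psi>) f x"
 proof (rule germI[OF smooth_fun_subset[OF O'(1) o]])
  show "\<psi> x\<in>O'\<inter>\<psi> ` W" using O' W by blast
  fix y assume y: "y\<in>V" "\<psi> y\<in>O'\<inter>\<psi> ` W"
  then have "y\<in>W" using D(4) W(2) by (auto dest: inj_onD)
  then show "f y = h (\<psi> y)" using O'(3) y by blast
 qed auto
next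
 assume "germ n (V, \<psi>) f x"
 then obtain O' h where O': "smooth_fun n O' h" "\<psi> x\<in>O'" "\<And>y. y\<in>V ==> \<psi> y\<in>O' ==> f y = h (\<psi> y)"
  by (rule germE) blast
 show "germ n (W, \<psi>) f x" by (rule germI[OF O'(1)]) (use O'(2,3) W(2) in auto)
qed

lemma mfd_chart_diffeo:
 assumes c: "mfd_chart T n (U, \<phi>)" and H: "coord_diffeo n P Q H"
 shows "mfd_chart T n ({x\<in>U. \<phi> x\<in>P}, \<lambda>x. H (\<phi> x))"
proof (rule mfd_chartI)
 note D = mfd_chartD[OF c]
 have Hs: "smooth_coord_map n P n H" and inj: "inj_on H P" using H by (auto simp: coord_diffeo_def bij_betw_def)
 have P: "openin (En n) P" by (rule cmapD[OF Hs])
 show "openin T {x\<in>U. \<phi> x\<in>P}" by (rule D(8)[OF P])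
 show "inj_on (\<lambda>x. H (\<phi> x)) {x\<in>U. \<phi> x\<in>P}"
  using inj D(4) by (auto simp: inj_on_def)
 show W: "openin (En n) ((\<lambda>x. H (\<phi> x)) ` W)" if "openin T W" "W\<subseteq>{x\<in>U. \<phi> x\<in>P}" for W
 proof -
  have "openin (En n) (\<phi> ` W)" by (rule D(7)) (use that in auto)
  then have "openin (En n) (H ` \<phi> ` W)" by (rule coord_diffeo_restrict(2)[OF H]) (use that in auto)
  then show ?thesis by (simp add: image_image)
 qed
 then show "openin (En n) ((\<lambda>x. H (\<phi> x)) ` {x\<in>U. \<phi> x\<in>P})"
  using D(8)[OF P] by blast
 show "openin T {x\<in>{x\<in>U. \<phi> x\<in>P}. H (\<phi> x)\<in>O'}" if O': "openin (En n) O'" for O'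
 proof -
  have "openin T {x\<in>U. \<phi> x\<in>{z\<in>P. H z\<in>O'}}"
   by (rule D(8)[OF cmap_openin_preimage[OF Hs O']])
  moreover have "{x\<in>U. \<phi> x\<in>{z\<in>P. H z\<in>O'}} = {x\<in>{x\<in>U. \<phi> x\<in>P}. H (\<phi> x)\<in>O'}" by auto
  ultimately show ?thesis by simp
 qed
qed

lemma germ_diffeo:
 assumes H: "coord_diffeo n P Q H" and f: "germ n (U, \<phi>) f x" and x: "\<phi> x\<in>P"
 shows "germ n ({x\<in>U. \<phi> x\<in>P}, \<lambda>x. H (\<phi> x)) f x"
proof -
 obtain G where G: "coord_diffeo n Q P G" "\<And>x. x\<in>P ==> G (H x) = x" "\<And>y. y\<in>Q ==> H (G y) = y"
  using coord_diffeo_inverse[OF H] by blast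
 have Gs: "smooth_coord_map n Q n G" using G(1) by (simp add: coord_diffeo_def)
 have HQ: "H z\<in>Q" if "z\<in>P" for z using H that by (auto simp: coord_diffeo_def bij_betw_def)
 obtain O' h where O': "smooth_fun n O' h" "\<phi> x\<in>O'" "\<And>y. y\<in>U ==> \<phi> y\<in>O' ==> f y = h (\<phi> y)"
  using germE[OF f] by metis
 have o: "openin (En n) {z\<in>Q. G z\<in>O'}"
  by (rule cmap_openin_preimage[OF Gs smooth_fun_openin[OF O'(1)]])
 have "smooth_coord_map n {z\<in>Q. G z\<in>O'} n G" by (rule cmap_subset[OF Gs o]) auto
 then have "smooth_fun n {z\<in>Q. G z\<in>O'} (\<lambda>z. h (G z))" by (rule smooth_fun_compose[OF O'(1)]) auto
 then show ?thesis by (rule germI) (use x HQ G(2) O' in auto)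
qed

lemma mcharts_maximal:
 assumes M: "atlas_mfd M" and c: "mfd_chart (mtop M) (mdim M) (W, \<kappa>)"
  and s: "\<And>x V \<psi> i. x\<in>W ==> (V, \<psi>)\<in>mcharts M ==> x\<in>V ==> i < mdim M ==> germ (mdim M) (W, \<kappa>) (\<lambda>y. \<psi> y i) x"
  and t: "\<And>x i. x\<in>W ==> i < mdim M ==> smooth_at M (\<lambda>y. \<kappa> y i) x"
 shows "(W, \<kappa>)\<in>mcharts M"
proof -
 have "mfd_compatible (mdim M) (W, \<kappa>) d" if d: "d\<in>mcharts M" for d
 proof -
  obtain V \<psi> where d': "d = (V, \<psi>)" by (metis prod.exhaust)
  show ?thesis unfolding d' mfd_compatible_iff[OF c atlas_mfd_chart[OF M d[unfolded d']]]
   using s t d[unfolded d'] by (auto intro: smooth_at_germ)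
 qed
 then show ?thesis using M c unfolding atlas_mfd_def by blast
qed

lemma smooth_at_compose_chart:
 assumes M: "atlas_mfd M" and c: "(U, \<phi>)\<in>mcharts M" and x: "x\<in>U" and f: "smooth_fun (mdim M) O' f" "\<phi> x\<in>O'"
 shows "smooth_at M (\<lambda>y. f (\<phi> y)) x"
 by (rule smooth_atI[OF M c x germI[OF f(1)]]) (use f in auto)

lemma mcharts_diffeo:
 assumes M: "atlas_mfd M" and c: "(U, \<phi>)\<in>mcharts M" and H: "coord_diffeo (mdim M) P Q H"
 shows "({x\<in>U. \<phi> x\<in>P}, \<lambda>x. H (\<phi> x))\<in>mcharts M"
proof (rule mcharts_maximal[OF M mfd_chart_diffeo[OF atlas_mfd_chart[OF M c] H]])
 have Hs: "smooth_coord_map (mdim M) P (mdim M) H" using H by (simp add: coord_diffeo_def)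
 show "smooth_at M (\<lambda>y. H (\<phi> y) i) x" if "x\<in>{x\<in>U. \<phi> x\<in>P}" for x i
  by (rule smooth_at_compose_chart[OF M c _ cmapD(3)[OF Hs]]) (use that in auto)
 show "germ (mdim M) ({x\<in>U. \<phi> x\<in>P}, \<lambda>x. H (\<phi> x)) (\<lambda>y. \<psi> y i) x"
  if x: "x\<in>{x\<in>U. \<phi> x\<in>P}" and d: "(V, \<psi>)\<in>mcharts M" "x\<in>V" for x V \<psi> i
  by (rule germ_diffeo[OF H smooth_at_germ[OF smooth_at_coord[OF M d] c]]) (use x in auto)
qed

lemma mcharts_subset:
 assumes M: "atlas_mfd M" and c: "(U, \<phi>)\<in>mcharts M" and W: "openin (mtop M) W" "W\<subseteq>U"
 shows "(W, \<phi>)\<in>mcharts M"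
proof -
 note D = mfd_chartD[OF atlas_mfd_chart[OF M c]]
 have o: "openin (En (mdim M)) (\<phi> ` W)" by (rule D(7)[OF W])
 have "coord_diffeo (mdim M) (\<phi> ` W) (\<phi> ` W) (\<lambda>z. z)"
  by (rule coord_diffeoI[where G="\<lambda>z. z"]) (auto intro: smooth_coord_id[OF o])
 from mcharts_diffeo[OF M c this] have "({x\<in>U. \<phi> x\<in>\<phi> ` W}, \<phi>)\<in>mcharts M" by simp
 moreover have "{x\<in>U. \<phi> x\<in>\<phi> ` W} = W" using W(2) D(4) by (auto dest: inj_onD)
 ultimately show ?thesis by simp
qed

section \<open>Open submanifolds\<close>

lemma open_submfd_simps [simp]:
 "mtop (open_submfd M U) = subtopology (mtop M) U" "mdim (open_submfd M U) = mdim M"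
 "mcharts (open_submfd M U) = {c\<in>mcharts M. fst c\<subseteq>U}"
 by (auto simp: open_submfd_def)

lemma mfd_chart_subtopology:
 assumes "openin T S" "W\<subseteq>S"
 shows "mfd_chart (subtopology T S) n (W, \<phi>) \<longleftrightarrow> mfd_chart T n (W, \<phi>)"
proof -
 have "subtopology (subtopology T S) W = subtopology T W" using assms(2) by (simp add: subtopology_subtopology Int_absorb1)
 moreover have "openin (subtopology T S) W \<longleftrightarrow> openin T W" using assms by (simp add: openin_open_subtopology)
 ultimately show ?thesis by (simp add: mfd_chart_def)
qed

lemma
 assumes M: "atlas_mfd M" and S: "openin (mtop M) S"
 shows atlas_open_submfd: "atlas_mfd (open_submfd M S)"
  and smooth_at_open_submfd: "x\<in>S ==> smooth_at (open_submfd M S) f x \<longleftrightarrow> smooth_at M f x"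
proof -
 let ?N = "open_submfd M S"
 have sub: "(V\<inter>S, \<psi>)\<in>mcharts ?N" if "(V, \<psi>)\<in>mcharts M" for V \<psi>
  using mcharts_subset[OF M that, of "V\<inter>S"] mfd_chartD(1)[OF atlas_mfd_chart[OF M that]] S by auto
 have pts: "mpoints ?N = mpoints M\<inter>S" by simp
 show N: "atlas_mfd ?N" unfolding atlas_mfd_def
 proof (intro conjI ballI allI impI)
  fix c assume c: "c\<in>mcharts ?N"
  show "mfd_chart (mtop ?N) (mdim ?N) c"
   using c mfd_chart_subtopology[OF S] atlas_mfd_chart[OF M] by (cases c) auto
  show "mfd_compatible (mdim ?N) c d" if "d\<in>mcharts ?N" for d
   using c that M by (simp add: atlas_mfd_def)
 next
  show "\<Union> (fst ` mcharts ?N) = mpoints ?N"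
  proof
   show "\<Union> (fst ` mcharts ?N)\<subseteq>mpoints ?N"
   proof
    fix x assume "x\<in>\<Union> (fst ` mcharts ?N)"
    then obtain U \<phi> where "(U, \<phi>)\<in>mcharts M" "U\<subseteq>S" "x\<in>U" by auto
    then show "x\<in>mpoints ?N" using mfd_chartD(2)[OF atlas_mfd_chart[OF M]] by auto
   qed
   show "mpoints ?N\<subseteq>\<Union> (fst ` mcharts ?N)"
   proof
    fix x assume "x\<in>mpoints ?N"
    then have x: "x\<in>mpoints M" "x\<in>S" by auto
    then obtain U \<phi> where "(U, \<phi>)\<in>mcharts M" "x\<in>U" using atlas_mfd_cover[OF M] by metis
    then show "x\<in>\<Union> (fst ` mcharts ?N)" using sub x by force
   qed
  qed
 next
  fix c assume c: "mfd_chart (mtop ?N) (mdim ?N) c \<and> (\<forall>d\<in>mcharts ?N. mfd_compatible (mdim ?N) c d)"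
  obtain W \<kappa> where cW: "c = (W, \<kappa>)" by (metis prod.exhaust)
  have WS: "W\<subseteq>S" using c mfd_chartD(2)[of "mtop ?N" "mdim ?N" W \<kappa>] by (auto simp: cW)
  have ch: "mfd_chart (mtop M) (mdim M) (W, \<kappa>)" using c mfd_chart_subtopology[OF S WS] by (simp add: cW)
  \<comment> \<open>For maximality of the restricted atlas: a chart inside \<open>S\<close> meets a
    chart domain \<open>V\<close> of \<open>M\<close> only within V \<inter> S, which carries a
    chart of the restricted atlas with the same coordinates.\<close>
  have key: "germ (mdim M) (W, \<kappa>) (\<lambda>y. \<psi> y i) x" "germ (mdim M) (V, \<psi>) (\<lambda>y. \<kappa> y i) x"
   if x: "x\<in>W" and d: "(V, \<psi>)\<in>mcharts M" "x\<in>V" and i: "i < mdim M" for x V \<psi> i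
  proof -
   have d2: "(V\<inter>S, \<psi>)\<in>mcharts M" using sub[OF d(1)] by simp
   have cmp: "mfd_compatible (mdim M) (W, \<kappa>) (V\<inter>S, \<psi>)" using c sub[OF d(1)] by (simp add: cW)
   have xVS: "x\<in>V\<inter>S" using x WS d by blast
   note K = mfd_compatibleD[OF ch atlas_mfd_chart[OF M d2] cmp x xVS i]
   show "germ (mdim M) (W, \<kappa>) (\<lambda>y. \<psi> y i) x" by (rule K(1))
   show "germ (mdim M) (V, \<psi>) (\<lambda>y. \<kappa> y i) x"
    using K(2) germ_restrict[OF atlas_mfd_chart[OF M d(1)] mfd_chartD(1)[OF atlas_mfd_chart[OF M d2]] _ xVS] by simp
  qed
  have "(W, \<kappa>)\<in>mcharts M"
  proof (rule mcharts_maximal[OF M ch])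
   show "germ (mdim M) (W, \<kappa>) (\<lambda>y. \<psi> y i) x" if "x\<in>W" "(V, \<psi>)\<in>mcharts M" "x\<in>V" "i < mdim M" for x V \<psi> i
    using key(1) that .
   fix x i assume xi: "x\<in>W" "i < mdim M"
   have "x\<in>mpoints M" using xi mfd_chartD(2)[OF ch] by blast
   then obtain U \<phi> where u: "(U, \<phi>)\<in>mcharts M" "x\<in>U" using atlas_mfd_cover[OF M] by metis
   show "smooth_at M (\<lambda>y. \<kappa> y i) x" by (rule smooth_atI[OF M u key(2)[OF xi(1) u xi(2)]])
  qed
  then show "c\<in>mcharts ?N" using WS by (simp add: cW)
 qed
 show "smooth_at ?N f x \<longleftrightarrow> smooth_at M f x" if xS: "x\<in>S"
 proof
  assume L: "smooth_at ?N f x"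
  then have x: "x\<in>mpoints M" by (simp add: smooth_at_def)
  then obtain U \<phi> where u: "(U, \<phi>)\<in>mcharts M" "x\<in>U" using atlas_mfd_cover[OF M] by metis
  have "germ (mdim M) (U\<inter>S, \<phi>) f x" using smooth_at_germ[OF L sub[OF u(1)]] u(2) xS by simp
  then show "smooth_at M f x" using sub[OF u(1)] u(2) xS by (intro smooth_atI[OF M]) auto
 next
  assume R: "smooth_at M f x"
  then have x: "x\<in>mpoints M" by (simp add: smooth_at_def)
  then obtain U \<phi> where u: "(U, \<phi>)\<in>mcharts M" "x\<in>U" using atlas_mfd_cover[OF M] by metis
  have "germ (mdim M) (U\<inter>S, \<phi>) f x" using smooth_at_germ[OF R, of "U\<inter>S"] sub[OF u(1)] u(2) xS by simp
  then show "smooth_at ?N f x" using sub[OF u(1)] u(2) xS by (intro smooth_atI[OF N]) auto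
 qed
qed

lemma smooth_map_id: "atlas_mfd M ==> smooth_map M M (\<lambda>x. x)"
 by (auto simp: smooth_map_iff intro: smooth_at_coord)

lemma smooth_map_compose:
 assumes L: "atlas_mfd L" and M: "atlas_mfd M" and N: "atlas_mfd N" and F: "smooth_map L M F" and G: "smooth_map M N G"
 shows "smooth_map L N (\<lambda>x. G (F x))"
proof -
 have c: "continuous_map (mtop L) (mtop N) (\<lambda>x. G (F x))"
  using continuous_map_compose[OF smooth_map_cont[OF F] smooth_map_cont[OF G]] by (simp add: o_def)
 have FM: "F x\<in>mpoints M" if "x\<in>mpoints L" for x
  using smooth_map_cont[OF F] that by (auto simp: continuous_map_def)
 have "smooth_at L (\<lambda>y. \<psi> (G (F y)) i) x" if x: "x\<in>mpoints L" and d: "(V, \<psi>)\<in>mcharts N" "G (F x)\<in>V" and i: "i < mdim N" for x V \<psi> i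
  by (rule smooth_map_at[OF L M F x smooth_map_at[OF M N G FM[OF x] smooth_at_coord[OF N d]]])
 then show ?thesis unfolding smooth_map_iff[OF L N] using c by auto
qed

lemma smooth_map_cong:
 assumes M: "atlas_mfd M" and N: "atlas_mfd N" and F: "smooth_map M N F" and eq: "\<And>x. x\<in>mpoints M ==> F x = G x"
 shows "smooth_map M N G"
proof -
 have "smooth_at M (\<lambda>y. \<psi> (G y) i) x" if x: "x\<in>mpoints M" and d: "(V, \<psi>)\<in>mcharts N" "G x\<in>V" for x V \<psi> i
 proof (rule smooth_at_cong[OF M, of "\<lambda>y. \<psi> (F y) i" x "mpoints M"])
  show "smooth_at M (\<lambda>y. \<psi> (F y) i) x"
   by (rule smooth_map_at[OF M N F x smooth_at_coord[OF N d(1)]]) (use d eq[OF x] in simp)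
 qed (use eq x in auto)
 moreover have "continuous_map (mtop M) (mtop N) G" using smooth_map_cont[OF F] eq by (rule continuous_map_eq)
 ultimately show ?thesis unfolding smooth_map_iff[OF M N] by auto
qed

lemma smooth_map_open_domain:
 assumes M: "atlas_mfd M" and N: "atlas_mfd N" and S: "openin (mtop M) S" and F: "smooth_map M N F"
 shows "smooth_map (open_submfd M S) N F"
proof -
 have "smooth_at M (\<lambda>y. \<psi> (F y) i) x" if "x\<in>mpoints M" "(V, \<psi>)\<in>mcharts N" "F x\<in>V" for x V \<psi> i
  by (rule smooth_map_at[OF M N F that(1) smooth_at_coord[OF N that(2,3)]])
 then show ?thesis unfolding smooth_map_iff[OF atlas_open_submfd[OF M S] N]
  using smooth_map_cont[OF F] by (auto simp: smooth_at_open_submfd[OF M S] intro: continuous_map_from_subtopology)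
qed

lemma smooth_map_open_codomain:
 assumes M: "atlas_mfd M" and N: "atlas_mfd N" and S: "openin (mtop N) S" and F: "smooth_map M N F"
  and im: "\<And>x. x\<in>mpoints M ==> F x\<in>S"
 shows "smooth_map M (open_submfd N S) F"
proof -
 have "smooth_at M (\<lambda>y. \<psi> (F y) i) x" if "x\<in>mpoints M" "(V, \<psi>)\<in>mcharts N" "F x\<in>V" for x V \<psi> i
  by (rule smooth_map_at[OF M N F that(1) smooth_at_coord[OF N that(2,3)]])
 then show ?thesis unfolding smooth_map_iff[OF M atlas_open_submfd[OF N S]]
  using smooth_map_cont[OF F] im by (auto simp: continuous_map_in_subtopology)
qed

section \<open>Products, coordinate spaces and the real line\<close>

definition shift :: "nat \<Rightarrow> (nat \<Rightarrow> real) \<Rightarrow> nat \<Rightarrow> real" where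
 "shift m z = (\<lambda>i. z (i + m))"

lemma join_coords_simps:
 assumes "x\<in>Rn m" "y\<in>Rn n"
 shows "join_coords m x y\<in>Rn (m + n)" "trunc m (join_coords m x y) = x" "shift m (join_coords m x y) = y"
 using assms by (auto simp: join_coords_def Rn_iff trunc_def shift_def fun_eq_iff)

lemma join_trunc_shift [simp]: "join_coords m (trunc m z) (shift m z) = z"
 by (auto simp: join_coords_def trunc_def shift_def)

lemma shift_Rn: "z\<in>Rn (m + n) ==> shift m z\<in>Rn n"
 by (auto simp: shift_def Rn_iff)

lemma smooth_shift: "smooth_coord_map (m + n) (Rn (m + n)) n (shift m)"
proof (rule cmapI)
 show "smooth_fun (m + n) (Rn (m + n)) (\<lambda>z. shift m z i)" for i
  unfolding shift_def by (rule smooth_fun_coord[OF openin_Rn])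
qed (auto simp: shift_Rn)

lemma openin_join:
 assumes "openin (En m) A" "openin (En n) B"
 shows "openin (En (m + n)) {z\<in>Rn (m + n). trunc m z\<in>A \<and> shift m z\<in>B}"
proof -
 have "openin (En (m + n)) {z\<in>Rn (m + n). trunc m z\<in>A}"
  by (rule cmap_openin_preimage[OF smooth_trunc assms(1)]) simp
 moreover have "openin (En (m + n)) {z\<in>Rn (m + n). shift m z\<in>B}"
  by (rule cmap_openin_preimage[OF smooth_shift assms(2)])
 ultimately have "openin (En (m + n)) ({z\<in>Rn (m + n). trunc m z\<in>A}\<inter>{z\<in>Rn (m + n). shift m z\<in>B})" by blast
 moreover have "{z\<in>Rn (m + n). trunc m z\<in>A}\<inter>{z\<in>Rn (m + n). shift m z\<in>B} = {z\<in>Rn (m + n). trunc m z\<in>A \<and> shift m z\<in>B}" by auto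
 ultimately show ?thesis by simp
qed

abbreviation prod_chart :: "nat \<Rightarrow> ('a \<Rightarrow> nat \<Rightarrow> real) \<Rightarrow> ('b \<Rightarrow> nat \<Rightarrow> real) \<Rightarrow> 'a\<times>'b \<Rightarrow> nat \<Rightarrow> real" where
 "prod_chart m \<phi> \<psi> \<equiv> (\<lambda>(x, y). join_coords m (\<phi> x) (\<psi> y))"

lemma prod_chart_mfd_chart:
 assumes c: "mfd_chart S m (U, \<phi>)" and d: "mfd_chart T n (V, \<psi>)"
 shows "mfd_chart (prod_topology S T) (m + n) (U\<times>V, prod_chart m \<phi> \<psi>)"
proof (rule mfd_chartI)
 note D = mfd_chartD[OF c] and E = mfd_chartD[OF d]
 let ?\<theta> = "prod_chart m \<phi> \<psi>"
 have img: "?\<theta> ` (A\<times>B) = {z\<in>Rn (m + n). trunc m z\<in>\<phi> ` A \<and> shift m z\<in>\<psi> ` B}" if "A\<subseteq>U" "B\<subseteq>V" for A B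
 proof -
  have R: "\<phi> x\<in>Rn m" "\<psi> y\<in>Rn n" if "x\<in>A" "y\<in>B" for x y using that \<open>A\<subseteq>U\<close> \<open>B\<subseteq>V\<close> D(5) E(5) by auto
  show ?thesis
  proof (intro equalityI subsetI)
   fix z assume "z\<in>?\<theta> ` (A\<times>B)"
   then obtain x y where "x\<in>A" "y\<in>B" "z = join_coords m (\<phi> x) (\<psi> y)" by auto
   then show "z\<in>{z\<in>Rn (m + n). trunc m z\<in>\<phi> ` A \<and> shift m z\<in>\<psi> ` B}"
    using join_coords_simps[OF R] by simp
  next
   fix z assume z: "z\<in>{z\<in>Rn (m + n). trunc m z\<in>\<phi> ` A \<and> shift m z\<in>\<psi> ` B}"
   then obtain x y where xy: "x\<in>A" "y\<in>B" "trunc m z = \<phi> x" "shift m z = \<psi> y" by auto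
   have "z = ?\<theta> (x, y)" using join_trunc_shift[of m z] xy by simp
   then show "z\<in>?\<theta> ` (A\<times>B)" using xy by blast
  qed
 qed
 show UV: "openin (prod_topology S T) (U\<times>V)" using D(1) E(1) by (simp add: openin_prod_Times_iff)
 show W: "openin (En (m + n)) (?\<theta> ` W)" if W: "openin (prod_topology S T) W" "W\<subseteq>U\<times>V" for W
  unfolding openin_subopen[of _ "?\<theta> ` W"]
 proof
  fix z assume "z\<in>?\<theta> ` W"
  then obtain x y where xy: "(x, y)\<in>W" "z = ?\<theta> (x, y)" by auto
  obtain A B where AB: "openin S A" "openin T B" "x\<in>A" "y\<in>B" "A\<times>B\<subseteq>W"
   using W(1)[unfolded openin_prod_topology_alt, rule_format, OF xy(1)] by blast
  have sub: "A\<subseteq>U" "B\<subseteq>V" using AB W(2) by auto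
  have "openin (En (m + n)) (?\<theta> ` (A\<times>B))" unfolding img[OF sub]
   by (rule openin_join[OF D(7)[OF AB(1) sub(1)] E(7)[OF AB(2) sub(2)]])
  moreover have "z\<in>?\<theta> ` (A\<times>B)" using xy AB by blast
  moreover have "?\<theta> ` (A\<times>B)\<subseteq>?\<theta> ` W" using AB(5) by (rule image_mono)
  ultimately show "\<exists>T. openin (En (m + n)) T \<and> z\<in>T \<and> T\<subseteq>?\<theta> ` W" by blast
 qed
 show "openin (En (m + n)) (?\<theta> ` (U\<times>V))" by (rule W[OF UV]) simp
 show "inj_on ?\<theta> (U\<times>V)"
 proof (rule inj_onI, clarify)
  fix x y x' y' assume *: "x\<in>U" "y\<in>V" "x'\<in>U" "y'\<in>V" "join_coords m (\<phi> x) (\<psi> y) = join_coords m (\<phi> x') (\<psi> y')"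
  have "\<phi> x = \<phi> x'" "\<psi> y = \<psi> y'" using join_coords_simps(2,3) D(5) E(5) * by metis+
  then show "x = x' \<and> y = y'" using * D(4) E(4) by (auto dest: inj_onD)
 qed
 show "openin (prod_topology S T) {p\<in>U\<times>V. ?\<theta> p\<in>O'}" if O': "openin (En (m + n)) O'" for O'
  unfolding openin_prod_topology_alt
 proof (intro allI impI)
  fix x y assume "(x, y)\<in>{p\<in>U\<times>V. ?\<theta> p\<in>O'}"
  then have xy: "x\<in>U" "y\<in>V" "join_coords m (\<phi> x) (\<psi> y)\<in>O'" by auto
  obtain \<epsilon> where e: "\<epsilon> > 0" "cube (m + n) \<epsilon> (join_coords m (\<phi> x) (\<psi> y))\<subseteq>O'" using cube_nbhd[OF O' xy(3)] by blast
  let ?A = "{x'\<in>U. \<phi> x'\<in>cube m \<epsilon> (\<phi> x)}" and ?B = "{y'\<in>V. \<psi> y'\<in>cube n \<epsilon> (\<psi> y)}"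
  have "openin S ?A" "openin T ?B" by (rule D(8)[OF openin_cube] E(8)[OF openin_cube])+
  moreover have "x\<in>?A" "y\<in>?B" using xy e D(5) E(5) by (auto simp: cube_centre)
  moreover have "?A\<times>?B\<subseteq>{p\<in>U\<times>V. ?\<theta> p\<in>O'}"
  proof clarify
   fix x' y' assume *: "x'\<in>U" "\<phi> x'\<in>cube m \<epsilon> (\<phi> x)" "y'\<in>V" "\<psi> y'\<in>cube n \<epsilon> (\<psi> y)"
   have "join_coords m (\<phi> x') (\<psi> y')\<in>cube (m + n) \<epsilon> (join_coords m (\<phi> x) (\<psi> y))"
    using * join_coords_simps(1)[OF D(5)[OF *(1)] E(5)[OF *(3)]] by (auto simp: cube_def join_coords_def)
   then show "(x', y')\<in>U\<times>V \<and> join_coords m (\<phi> x') (\<psi> y')\<in>O'" using e * by blast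
  qed
  ultimately show "\<exists>A B. openin S A \<and> openin T B \<and> x\<in>A \<and> y\<in>B \<and> A\<times>B\<subseteq>{p\<in>U\<times>V. ?\<theta> p\<in>O'}" by blast
 qed
qed

lemma germ_fst:
 assumes f: "germ m (U, \<phi>) f x" and R: "\<And>x. x\<in>U ==> \<phi> x\<in>Rn m" "\<And>y. y\<in>V ==> \<psi> y\<in>Rn n" and xy: "x\<in>U" "y\<in>V"
 shows "germ (m + n) (U\<times>V, prod_chart m \<phi> \<psi>) (\<lambda>p. f (fst p)) (x, y)"
proof -
 obtain O' h where O': "smooth_fun m O' h" "\<phi> x\<in>O'" "\<And>y. y\<in>U ==> \<phi> y\<in>O' ==> f y = h (\<phi> y)"
  using germE[OF f] by metis
 let ?O = "{z\<in>Rn (m + n). trunc m z\<in>O'}"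
 have o: "openin (En (m + n)) ?O"
  by (rule cmap_openin_preimage[OF smooth_trunc smooth_fun_openin[OF O'(1)]]) simp
 have "smooth_fun (m + n) ?O (\<lambda>z. h (trunc m z))" by (rule smooth_fun_compose[OF O'(1) smooth_trunc[OF o]]) auto
 then show ?thesis
  by (rule germI) (use O' xy join_coords_simps[OF R] in auto)
qed

lemma germ_snd:
 assumes f: "germ n (V, \<psi>) f y" and R: "\<And>x. x\<in>U ==> \<phi> x\<in>Rn m" "\<And>y. y\<in>V ==> \<psi> y\<in>Rn n" and xy: "x\<in>U" "y\<in>V"
 shows "germ (m + n) (U\<times>V, prod_chart m \<phi> \<psi>) (\<lambda>p. f (snd p)) (x, y)"
proof -
 obtain O' h where O': "smooth_fun n O' h" "\<psi> y\<in>O'" "\<And>y. y\<in>V ==> \<psi> y\<in>O' ==> f y = h (\<psi> y)"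
  using germE[OF f] by metis
 let ?O = "{z\<in>Rn (m + n). shift m z\<in>O'}"
 have o: "openin (En (m + n)) ?O"
  by (rule cmap_openin_preimage[OF smooth_shift smooth_fun_openin[OF O'(1)]])
 have "smooth_coord_map (m + n) ?O n (shift m)" by (rule cmap_subset[OF smooth_shift o]) auto
 then have "smooth_fun (m + n) ?O (\<lambda>z. h (shift m z))" by (rule smooth_fun_compose[OF O'(1)]) auto
 then show ?thesis
  by (rule germI) (use O' xy join_coords_simps[OF R] in auto)
qed

lemma prod_mfd_simps [simp]:
 "mtop (prod_mfd M N) = prod_topology (mtop M) (mtop N)" "mdim (prod_mfd M N) = mdim M + mdim N"
 by (auto simp: prod_mfd_def mfd_of_atlas_def)

lemma
 assumes M: "atlas_mfd M" and N: "atlas_mfd N"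
 shows atlas_prod_mfd: "atlas_mfd (prod_mfd M N)"
  and prod_mfd_chart: "(U, \<phi>)\<in>mcharts M ==> (V, \<psi>)\<in>mcharts N ==> (U\<times>V, prod_chart (mdim M) \<phi> \<psi>)\<in>mcharts (prod_mfd M N)"
proof -
 let ?A = "{(U\<times>V, prod_chart (mdim M) \<phi> \<psi>) | U \<phi> V \<psi>. (U, \<phi>)\<in>mcharts M \<and> (V, \<psi>)\<in>mcharts N}"
 have ch: "mfd_chart (prod_topology (mtop M) (mtop N)) (mdim M + mdim N) c" if "c\<in>?A" for c
  using that prod_chart_mfd_chart[OF atlas_mfd_chart[OF M] atlas_mfd_chart[OF N]] by auto
 have cov: "\<Union> (fst ` ?A) = topspace (prod_topology (mtop M) (mtop N))"
 proof (intro equalityI subsetI)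
  fix p assume "p\<in>\<Union> (fst ` ?A)"
  then obtain c where c: "c\<in>?A" "p\<in>fst c" by blast
  have "mfd_chart (prod_topology (mtop M) (mtop N)) (mdim M + mdim N) (fst c, snd c)" using ch[OF c(1)] by simp
  from mfd_chartD(2)[OF this] c(2) show "p\<in>topspace (prod_topology (mtop M) (mtop N))" by blast
 next
  fix p assume "p\<in>topspace (prod_topology (mtop M) (mtop N))"
  then obtain x y where xy: "p = (x, y)" "x\<in>mpoints M" "y\<in>mpoints N" by auto
  obtain U \<phi> V \<psi> where "(U, \<phi>)\<in>mcharts M" "x\<in>U" "(V, \<psi>)\<in>mcharts N" "y\<in>V"
   by (meson atlas_mfd_cover[OF M xy(2)] atlas_mfd_cover[OF N xy(3)])
  then have "(U\<times>V, prod_chart (mdim M) \<phi> \<psi>)\<in>?A" "p\<in>U\<times>V" using xy by auto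
  then show "p\<in>\<Union> (fst ` ?A)" by (intro UN_I[of "(U\<times>V, prod_chart (mdim M) \<phi> \<psi>)"]) auto
 qed
 have germs: "germ (mdim M + mdim N) (U\<times>V, prod_chart (mdim M) \<phi> \<psi>) (\<lambda>q. prod_chart (mdim M) \<phi>' \<psi>' q i) p"
  if c: "(U, \<phi>)\<in>mcharts M" "(V, \<psi>)\<in>mcharts N" "(U', \<phi>')\<in>mcharts M" "(V', \<psi>')\<in>mcharts N"
   and p: "p\<in>U\<times>V" "p\<in>U'\<times>V'" for U \<phi> V \<psi> U' \<phi>' V' \<psi>' p i
 proof -
  obtain x y where xy: "p = (x, y)" by (cases p)
  note D = mfd_chartD(5)[OF atlas_mfd_chart[OF M c(1)]] and E = mfd_chartD(5)[OF atlas_mfd_chart[OF N c(2)]]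
  show ?thesis
  proof (cases "i < mdim M")
   case True
   have "germ (mdim M) (U, \<phi>) (\<lambda>y. \<phi>' y i) x"
    using smooth_at_germ[OF smooth_at_coord[OF M c(3)] c(1)] p xy by simp
   from germ_fst[where V=V and \<psi>=\<psi>, OF this D E] show ?thesis using True p xy by (simp add: join_coords_def case_prod_unfold)
  next
   case False
   have "germ (mdim N) (V, \<psi>) (\<lambda>y. \<psi>' y (i - mdim M)) y"
    using smooth_at_germ[OF smooth_at_coord[OF N c(4)] c(2)] p xy by simp
   from germ_snd[where U=U and \<phi>=\<phi>, OF this D E] show ?thesis using False p xy by (simp add: join_coords_def case_prod_unfold)
  qed
 qed
 have comp: "mfd_compatible (mdim M + mdim N) c d" if cd: "c\<in>?A" "d\<in>?A" for c d
 proof -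
  obtain U \<phi> V \<psi> where c: "c = (U\<times>V, prod_chart (mdim M) \<phi> \<psi>)" "(U, \<phi>)\<in>mcharts M" "(V, \<psi>)\<in>mcharts N" using cd(1) by blast
  obtain U' \<phi>' V' \<psi>' where d: "d = (U'\<times>V', prod_chart (mdim M) \<phi>' \<psi>')" "(U', \<phi>')\<in>mcharts M" "(V', \<psi>')\<in>mcharts N" using cd(2) by blast
  show ?thesis unfolding c(1) d(1) mfd_compatible_iff[OF ch[OF cd(1), unfolded c(1)] ch[OF cd(2), unfolded d(1)]]
  proof (intro conjI ballI allI impI)
   fix p i assume p: "p\<in>U\<times>V\<inter>U'\<times>V'"
   show "germ (mdim M + mdim N) (U\<times>V, prod_chart (mdim M) \<phi> \<psi>) (\<lambda>q. prod_chart (mdim M) \<phi>' \<psi>' q i) p"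
    by (rule germs[OF c(2,3) d(2,3)]) (use p in auto)
   show "germ (mdim M + mdim N) (U'\<times>V', prod_chart (mdim M) \<phi>' \<psi>') (\<lambda>q. prod_chart (mdim M) \<phi> \<psi> q i) p"
    by (rule germs[OF d(2,3) c(2,3)]) (use p in auto)
  qed
 qed
 show "atlas_mfd (prod_mfd M N)" unfolding prod_mfd_def by (rule atlas_mfd_of_atlas(1)[OF ch cov comp])
 show "(U\<times>V, prod_chart (mdim M) \<phi> \<psi>)\<in>mcharts (prod_mfd M N)" if "(U, \<phi>)\<in>mcharts M" "(V, \<psi>)\<in>mcharts N"
  unfolding prod_mfd_def using atlas_mfd_of_atlas(2)[OF ch cov comp] that by blast
qed

lemma smooth_at_fst:
 assumes M: "atlas_mfd M" and N: "atlas_mfd N" and f: "smooth_at M f (fst p)" and y: "snd p\<in>mpoints N"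
 shows "smooth_at (prod_mfd M N) (\<lambda>p. f (fst p)) p"
proof -
 have "fst p\<in>mpoints M" using f by (simp add: smooth_at_def)
 then obtain U \<phi> V \<psi> where c: "(U, \<phi>)\<in>mcharts M" "fst p\<in>U" and d: "(V, \<psi>)\<in>mcharts N" "snd p\<in>V"
  using atlas_mfd_cover[OF M] atlas_mfd_cover[OF N y] by metis
 show ?thesis
  by (rule smooth_atI[OF atlas_prod_mfd[OF M N] prod_mfd_chart[OF M N c(1) d(1)]])
   (use c d germ_fst[where V=V and \<psi>=\<psi>, OF smooth_at_germ[OF f c] mfd_chartD(5)[OF atlas_mfd_chart[OF M c(1)]] mfd_chartD(5)[OF atlas_mfd_chart[OF N d(1)]] c(2) d(2)]
    in \<open>auto simp: mem_Times_iff\<close>)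
qed

lemma smooth_at_snd:
 assumes M: "atlas_mfd M" and N: "atlas_mfd N" and f: "smooth_at N f (snd p)" and x: "fst p\<in>mpoints M"
 shows "smooth_at (prod_mfd M N) (\<lambda>p. f (snd p)) p"
proof -
 have "snd p\<in>mpoints N" using f by (simp add: smooth_at_def)
 then obtain U \<phi> V \<psi> where c: "(U, \<phi>)\<in>mcharts M" "fst p\<in>U" and d: "(V, \<psi>)\<in>mcharts N" "snd p\<in>V"
  using atlas_mfd_cover[OF M x] atlas_mfd_cover[OF N] by metis
 show ?thesis
  by (rule smooth_atI[OF atlas_prod_mfd[OF M N] prod_mfd_chart[OF M N c(1) d(1)]])
   (use c d germ_snd[where U=U and \<phi>=\<phi>, OF smooth_at_germ[OF f d] mfd_chartD(5)[OF atlas_mfd_chart[OF M c(1)]] mfd_chartD(5)[OF atlas_mfd_chart[OF N d(1)]] c(2) d(2)]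
    in \<open>auto simp: mem_Times_iff\<close>)
qed

lemma smooth_map_pair:
 assumes L: "atlas_mfd L" and M: "atlas_mfd M" and N: "atlas_mfd N"
  and F: "smooth_map L M F" and G: "smooth_map L N G"
 shows "smooth_map L (prod_mfd M N) (\<lambda>x. (F x, G x))"
proof (rule smooth_mapI[OF L atlas_prod_mfd[OF M N]])
 fix x assume x: "x\<in>mpoints L"
 have cF: "continuous_map (mtop L) (mtop M) F" and cG: "continuous_map (mtop L) (mtop N) G" using F G by (auto intro: smooth_map_cont)
 have "F x\<in>mpoints M" "G x\<in>mpoints N" using cF cG x by (auto simp: continuous_map_def)
 then obtain U \<phi> V \<psi> where c: "(U, \<phi>)\<in>mcharts M" "F x\<in>U" and d: "(V, \<psi>)\<in>mcharts N" "G x\<in>V"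
  using atlas_mfd_cover[OF M] atlas_mfd_cover[OF N] by metis
 let ?W = "{y\<in>mpoints L. F y\<in>U}\<inter>{y\<in>mpoints L. G y\<in>V}"
 have "openin (mtop L) ?W"
  using openin_continuous_map_preimage[OF cF mfd_chartD(1)[OF atlas_mfd_chart[OF M c(1)]]]
   openin_continuous_map_preimage[OF cG mfd_chartD(1)[OF atlas_mfd_chart[OF N d(1)]]] by blast
 moreover have "smooth_at L (\<lambda>y. prod_chart (mdim M) \<phi> \<psi> (F y, G y) i) x" for i
  using smooth_map_at[OF L M F x smooth_at_coord[OF M c]] smooth_map_at[OF L N G x smooth_at_coord[OF N d]]
  by (cases "i < mdim M") (auto simp: join_coords_def)
 ultimately show "\<exists>W V \<psi>. openin (mtop L) W \<and> x\<in>W \<and> (V, \<psi>)\<in>mcharts (prod_mfd M N) \<and>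
   (\<lambda>x. (F x, G x)) ` W\<subseteq>V \<and> (\<forall>i<mdim (prod_mfd M N). smooth_at L (\<lambda>y. \<psi> (F y, G y) i) x)"
  using prod_mfd_chart[OF M N c(1) d(1)] c d x
  by (intro exI[of _ ?W] exI[of _ "U\<times>V"] exI[of _ "prod_chart (mdim M) \<phi> \<psi>"]) auto
qed

lemma Rn_mfd_simps [simp]: "mtop (Rn_mfd n) = En n" "mdim (Rn_mfd n) = n"
 by (auto simp: Rn_mfd_def mfd_of_atlas_def)

lemma
 shows atlas_Rn_mfd: "atlas_mfd (Rn_mfd n)"
  and Rn_mfd_chart: "(Rn n, \<lambda>x. x)\<in>mcharts (Rn_mfd n)"
proof -
 have ch: "mfd_chart (En n) n (Rn n, \<lambda>x. x)"
 proof (rule mfd_chartI)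
  show "openin (En n) {x\<in>Rn n. x\<in>O'}" if "openin (En n) O'" for O'
  proof -
   have "{x\<in>Rn n. x\<in>O'} = O'" using openin_En_imp_subset[OF that] by blast
   then show ?thesis using that by simp
  qed
 qed auto
 have comp: "mfd_compatible n (Rn n, \<lambda>x. x) (Rn n, \<lambda>x. x)"
  using mfd_compatible_iff[OF ch ch] germ_coord[OF ch] by auto
 show "atlas_mfd (Rn_mfd n)" "(Rn n, \<lambda>x. x)\<in>mcharts (Rn_mfd n)"
  unfolding Rn_mfd_def using atlas_mfd_of_atlas[of "{(Rn n, \<lambda>x. x)}" "En n" n] ch comp by auto
qed

lemma smooth_at_Rn_mfd: "smooth_fun n O' f ==> x\<in>O' ==> smooth_at (Rn_mfd n) f x"
 using openin_En_imp_subset[OF smooth_fun_openin, of n O' f]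
 by (intro smooth_atI[OF atlas_Rn_mfd Rn_mfd_chart]) (auto intro!: germI[of n O' f])

lemma smooth_at_Rn_mfdE:
 assumes "smooth_at (Rn_mfd n) f x"
 obtains O' where "smooth_fun n O' f" "x\<in>O'"
proof -
 have "x\<in>Rn n" using assms by (simp add: smooth_at_def)
 from germE[OF smooth_at_germ[OF assms Rn_mfd_chart this]]
 obtain O' g where O': "smooth_fun n O' g" "x\<in>O'" "\<And>y. y\<in>Rn n ==> y\<in>O' ==> f y = g y" by auto
 have "smooth_fun n O' f" by (rule smooth_fun_cong[OF O'(1)]) (use O'(3) openin_En_imp_subset[OF smooth_fun_openin[OF O'(1)]] in auto)
 then show thesis using that O'(2) by blast
qed

lemma real_mfd_simps [simp]: "mtop real_mfd = euclideanreal" "mdim real_mfd = 1"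
 by (auto simp: real_mfd_def mfd_of_atlas_def)

lemma real_coord_Rn [simp]: "real_coord t\<in>Rn 1"
 by (simp add: real_coord_def Rn_iff)

lemma
 shows atlas_real_mfd: "atlas_mfd real_mfd"
  and real_mfd_chart: "(UNIV, real_coord)\<in>mcharts real_mfd"
proof -
 have img: "real_coord ` W = {z\<in>Rn 1. z 0\<in>W}" for W
  by (auto simp: real_coord_def Rn_iff image_iff fun_eq_iff)
 have ch: "mfd_chart euclideanreal 1 (UNIV, real_coord)"
 proof (rule mfd_chartI)
  show W: "openin (En 1) (real_coord ` W)" if "openin euclideanreal W" for W
  proof -
   have "open W" using that by simp
   from openin_En_preimage[OF openin_Rn continuous_on_coord this] show ?thesis unfolding img .
  qed
  show "openin (En 1) (real_coord ` UNIV)" by (rule W) simp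
  show "inj_on real_coord UNIV" by (rule injI) (metis real_coord_def)
  show "openin euclideanreal {x\<in>UNIV. real_coord x\<in>O'}" if O': "openin (En 1) O'" for O'
  proof -
   have "\<exists>e>0. ball t e\<subseteq>{x. real_coord x\<in>O'}" if t: "real_coord t\<in>O'" for t
   proof -
    obtain \<epsilon> where e: "\<epsilon> > 0" "cube 1 \<epsilon> (real_coord t)\<subseteq>O'" using cube_nbhd[OF O' t] by blast
    have "real_coord s\<in>cube 1 \<epsilon> (real_coord t)" if "s\<in>ball t \<epsilon>" for s
     using that by (auto simp: cube_def real_coord_def Rn_iff dist_real_def)
    then show ?thesis using e by blast
   qed
   then show ?thesis by (simp add: open_contains_ball)
  qed
 qed auto
 have comp: "mfd_compatible 1 (UNIV, real_coord) (UNIV, real_coord)"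
  using mfd_compatible_iff[OF ch ch] germ_coord[OF ch] by auto
 show "atlas_mfd real_mfd" "(UNIV, real_coord)\<in>mcharts real_mfd"
  unfolding real_mfd_def using atlas_mfd_of_atlas[of "{(UNIV, real_coord)}" euclideanreal 1] ch comp by auto
qed

lemma smooth_map_const:
 assumes M: "atlas_mfd M" and N: "atlas_mfd N" and c: "c\<in>mpoints N"
 shows "smooth_map M N (\<lambda>_. c)"
 unfolding smooth_map_iff[OF M N] using c by (auto intro: smooth_at_const[OF M])

section \<open>Regular actions on manifolds\<close>

lemma smooth_map_local:
 assumes M: "atlas_mfd M" and N: "atlas_mfd N"
  and loc: "\<And>x. x\<in>mpoints M ==> \<exists>W. openin (mtop M) W \<and> x\<in>W \<and> smooth_map (open_submfd M W) N F"
 shows "smooth_map M N F"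
proof (rule smooth_mapI[OF M N])
 fix x assume x: "x\<in>mpoints M"
 then obtain W where W: "openin (mtop M) W" "x\<in>W" "smooth_map (open_submfd M W) N F" using loc by blast
 have xW: "x\<in>mpoints (open_submfd M W)" using x W(2) by simp
 have C: "continuous_map (subtopology (mtop M) W) (mtop N) F" using smooth_map_cont[OF W(3)] by simp
 have "F x\<in>mpoints N" using C xW by (auto simp: continuous_map_def)
 then obtain V \<psi> where d: "(V, \<psi>)\<in>mcharts N" "F x\<in>V" using atlas_mfd_cover[OF N] by metis
 let ?W = "{y\<in>topspace (subtopology (mtop M) W). F y\<in>V}"
 have "openin (subtopology (mtop M) W) ?W"
  by (rule openin_continuous_map_preimage[OF C mfd_chartD(1)[OF atlas_mfd_chart[OF N d(1)]]])
 then have o: "openin (mtop M) ?W" using W(1) by (simp add: openin_open_subtopology)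
 have "smooth_at M (\<lambda>y. \<psi> (F y) i) x" for i
  using smooth_map_at[OF atlas_open_submfd[OF M W(1)] N W(3) xW smooth_at_coord[OF N d, of i]]
  by (simp add: smooth_at_open_submfd[OF M W(1,2)])
 then show "\<exists>W V \<psi>. openin (mtop M) W \<and> x\<in>W \<and> (V, \<psi>)\<in>mcharts N \<and> F ` W\<subseteq>V \<and> (\<forall>i<mdim N. smooth_at M (\<lambda>y. \<psi> (F y) i) x)"
  using o d x W(2) by (intro exI[of _ ?W] exI[of _ V] exI[of _ \<psi>]) auto
qed

text \<open>If k < l, the change of coordinates would map an open subset of R^l injectively and
  continuously into the proper subspace \<open>Rn k\<close> of R^l, whereas invariance of domain
  makes its image open.\<close>

lemma mfd_chart_dim_unique:
 assumes c: "mfd_chart T k (U, \<phi>)" and d: "mfd_chart T l (V, \<psi>)" and x: "x\<in>U" "x\<in>V"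
 shows "k = l"
proof -
 have False if kl: "k < l" and c: "mfd_chart T k (U, \<phi>)" and d: "mfd_chart T l (V, \<psi>)" and x: "x\<in>U" "x\<in>V" for k l U V \<phi> \<psi>
 proof -
  note D = mfd_chartD[OF c] and E = mfd_chartD[OF d]
  have o: "openin T (U\<inter>V)" using D(1) E(1) by blast
  have oV: "openin (En l) (\<psi> ` (U\<inter>V))" by (rule E(7)[OF o]) simp
  let ?f = "\<lambda>z. \<phi> (inv_into V \<psi> z)"
  have inj: "inj_on ?f (\<psi> ` (U\<inter>V))"
   by (rule inj_onI) (use D(4) E(6) in \<open>auto dest: inj_onD\<close>)
  have fR: "?f z\<in>Rn k" if "z\<in>\<psi> ` (U\<inter>V)" for z using that E(6) D(5) by auto
  have "continuous_map (subtopology (En l) (\<psi> ` (U\<inter>V))) (En l) ?f"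
  proof (rule continuous_map_En_into[OF openin_En_imp_subset[OF oV]])
   show "?f z\<in>Rn l" if "z\<in>\<psi> ` (U\<inter>V)" for z using Rn_mono[OF fR[OF that]] kl by simp
   show "continuous_on (\<psi> ` (U\<inter>V)) (\<lambda>z. ?f z i)" for i
   proof (rule continuous_on_En_openI[OF oV])
    fix S :: "real set" assume S: "open S"
    have "openin T {y\<in>U. \<phi> y\<in>{z\<in>Rn k. z i\<in>S}}"
     by (rule D(8)[OF openin_En_preimage[OF openin_Rn continuous_on_coord S]])
    then have "openin T ({y\<in>U. \<phi> y\<in>{z\<in>Rn k. z i\<in>S}}\<inter>V)" using E(1) by blast
    then have "openin (En l) (\<psi> ` ({y\<in>U. \<phi> y\<in>{z\<in>Rn k. z i\<in>S}}\<inter>V))" by (rule E(7)) simp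
    moreover have "\<psi> ` ({y\<in>U. \<phi> y\<in>{z\<in>Rn k. z i\<in>S}}\<inter>V) = {z\<in>\<psi> ` (U\<inter>V). ?f z i\<in>S}"
     using E(6) D(5) by auto
    ultimately show "openin (En l) {z\<in>\<psi> ` (U\<inter>V). ?f z i\<in>S}" by simp
   qed
  qed
  from invariance_of_domain_Euclidean_space[OF oV this inj] have o2: "openin (En l) (?f ` \<psi> ` (U\<inter>V))" .
  have xx: "?f (\<psi> x)\<in>?f ` \<psi> ` (U\<inter>V)" using x by blast
  obtain \<epsilon> where e: "\<epsilon> > 0" "cube l \<epsilon> (?f (\<psi> x))\<subseteq>?f ` \<psi> ` (U\<inter>V)" using cube_nbhd[OF o2 xx] by blast
  have R: "?f (\<psi> x)\<in>Rn k" using fR x by blast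
  \<comment> \<open>Index \<open>k\<close> is the first one that vanishes on \<open>Rn k\<close>; it
    is still below \<open>l\<close>, so it can be moved inside the cube.\<close>
  have "(?f (\<psi> x))(k := \<epsilon> / 2)\<in>cube l \<epsilon> (?f (\<psi> x))"
   using e(1) kl Rn_upd[OF Rn_mono[OF R], of l k] R by (auto simp: cube_def Rn_iff)
  then have "(?f (\<psi> x))(k := \<epsilon> / 2)\<in>?f ` \<psi> ` (U\<inter>V)" using e(2) by (rule subsetD[rotated])
  then obtain z where "z\<in>\<psi> ` (U\<inter>V)" "(?f (\<psi> x))(k := \<epsilon> / 2) = ?f z" by (rule imageE)
  then have "(?f (\<psi> x))(k := \<epsilon> / 2)\<in>Rn k" using fR by metis
  then have "((?f (\<psi> x))(k := \<epsilon> / 2)) k = 0" unfolding Rn_iff by blast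
  then show False using e(1) by simp
 qed
 from this[OF _ c d x] this[OF _ d c x(2,1)] show ?thesis by (metis linorder_neqE_nat)
qed

abbreviation jt :: "real \<Rightarrow> (nat \<Rightarrow> real) \<Rightarrow> nat \<Rightarrow> real" where
 "jt t w \<equiv> join_coords 1 (real_coord t) w"

lemma jt_upd: "(jt s w)(0 := t) = jt t w"
 by (auto simp: join_coords_def real_coord_def fun_eq_iff)

lemma jt_0 [simp]: "jt t w 0 = t"
 by (simp add: join_coords_def real_coord_def)

lemma smooth_jt: "smooth_coord_map n (Rn n) (1 + n) (jt t)"
proof (rule cmapI)
 show "jt t w\<in>Rn (1 + n)" if "w\<in>Rn n" for w using join_coords_simps(1)[OF real_coord_Rn that] .
 show "smooth_fun n (Rn n) (\<lambda>w. jt t w i)" for i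
  unfolding join_coords_def by (intro smooth_fun_if smooth_fun_coord smooth_fun_const openin_Rn)
qed simp

text \<open>The velocity of the orbit at time 0 is a tangent vector at h_0 e, so the chart
  \<open>\<phi>\<close> has to contain \<open>h (0, e)\<close>; the point \<open>e\<close> itself
  may be far away in the fibre.\<close>

definition vel :: "(real\<times>'a \<Rightarrow> 'a) \<Rightarrow> ('a \<Rightarrow> nat \<Rightarrow> real) \<Rightarrow> 'a \<Rightarrow> nat \<Rightarrow> real" where
 "vel h \<phi> e i = deriv (\<lambda>t. \<phi> (h (t, e)) i) 0"

text \<open>Connectedness is what later forces the fixed set to have a single dimension. It holds,
  like non-emptiness, for every stratum.\<close>

locale regular_mfd =
 fixes E :: "'a mfd" and h :: "real\<times>'a \<Rightarrow> 'a"
 assumes sm: "smooth_manifold E" and reg: "regular_action E h"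
  and conn: "connected_space (mtop E)" and nonempty: "mpoints E\<noteq>{}"
begin

abbreviation "n \<equiv> mdim E"

lemma atl: "atlas_mfd E" by (rule smooth_manifold_imp_atlas[OF sm])

lemma h_in: "e\<in>mpoints E ==> h (t, e)\<in>mpoints E"
 and h_1: "e\<in>mpoints E ==> h (1, e) = e"
 and h_h: "e\<in>mpoints E ==> h (t, h (s, e)) = h (t * s, e)"
 and h_smooth: "smooth_map (prod_mfd real_mfd E) E h"
 and h_zero: "e\<in>mpoints E ==> zero_velocity E (\<lambda>t. h (t, e)) \<longleftrightarrow> e = h (0, e)"
 using reg by (auto simp: regular_action_def monoid_action_def)

definition base :: "'a set" where "base = {e\<in>mpoints E. h (0, e) = e}"

lemma proj_base: "e\<in>mpoints E ==> h (0, e)\<in>base"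
 by (simp add: base_def h_in h_h)

lemma baseD: "x\<in>base ==> x\<in>mpoints E" "x\<in>base ==> h (t, x) = x"
proof -
 assume x: "x\<in>base"
 then show "x\<in>mpoints E" by (simp add: base_def)
 then have "h (t, h (0, x)) = h (0, x)" by (simp add: h_h)
 then show "h (t, x) = x" using x by (simp add: base_def)
qed

lemma proj_h: "e\<in>mpoints E ==> h (0, h (t, e)) = h (0, e)"
 by (simp add: h_h)

lemma h_inverse: "e\<in>mpoints E ==> s\<noteq>0 ==> h (inverse s, h (s, e)) = e"
 by (simp add: h_h h_1)

lemma smooth_h: "smooth_map E E (\<lambda>e. h (t, e))"
proof -
 have "smooth_map E (prod_mfd real_mfd E) (\<lambda>e. (t, e))"
  by (intro smooth_map_pair atl atlas_real_mfd smooth_map_const smooth_map_id) simp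
 from smooth_map_compose[OF atl atlas_prod_mfd[OF atlas_real_mfd atl] atl this h_smooth] show ?thesis by simp
qed

lemma continuous_h_time: "e\<in>mpoints E ==> continuous_map euclideanreal (mtop E) (\<lambda>t. h (t, e))"
proof -
 assume e: "e\<in>mpoints E"
 have "continuous_map euclideanreal (prod_topology euclideanreal (mtop E)) (\<lambda>t. (t, e))"
  using e by (simp add: continuous_map_pairwise o_def)
 then show ?thesis using continuous_map_compose[of _ _ "\<lambda>t. (t, e)" _ h] smooth_map_cont[OF h_smooth] by (simp add: o_def)
qed

lemma h_eventually:
 assumes e: "e\<in>mpoints E" and W: "openin (mtop E) W" "h (t0, e)\<in>W"
 shows "\<forall>\<^sub>F t in nhds t0. h (t, e)\<in>W"
proof -
 have "openin euclideanreal {t\<in>topspace euclideanreal. h (t, e)\<in>W}"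
  by (rule openin_continuous_map_preimage[OF continuous_h_time[OF e] W(1)])
 then have "open {t. h (t, e)\<in>W}" by simp
 from eventually_nhds_in_open[OF this, of t0] show ?thesis using W(2) by simp
qed

lemma chartD: "(U, \<phi>)\<in>mcharts E ==> mfd_chart (mtop E) n (U, \<phi>)"
 by (rule atlas_mfd_chart[OF atl])

text \<open>\<open>h\<close> is smooth in time and point together: near (0, e) a coordinate of
  \<open>h\<close> is a smooth function \<open>g\<close> of the pair, and the velocity is the
  partial derivative of \<open>g\<close> in the time direction, which has index 0.\<close>

lemma
 assumes c: "(U, \<phi>)\<in>mcharts E" and e: "e\<in>mpoints E" and x: "h (0, e)\<in>U"
 shows vel_deriv: "((\<lambda>t. \<phi> (h (t, e)) i) has_real_derivative vel h \<phi> e i) (at 0)"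
  and smooth_vel: "smooth_at E (\<lambda>e. vel h \<phi> e i) e"
proof -
 obtain V \<kappa> where d: "(V, \<kappa>)\<in>mcharts E" "e\<in>V" using atlas_mfd_cover[OF atl e] by metis
 note D = mfd_chartD[OF chartD[OF d(1)]]
 have P: "atlas_mfd (prod_mfd real_mfd E)" by (rule atlas_prod_mfd[OF atlas_real_mfd atl])
 have s: "smooth_at (prod_mfd real_mfd E) (\<lambda>p. \<phi> (h p) i) (0, e)"
  by (rule smooth_map_at[OF P atl h_smooth _ smooth_at_coord[OF atl c x]]) (use e in simp)
 have "germ (1 + n) (UNIV\<times>V, prod_chart 1 real_coord \<kappa>) (\<lambda>p. \<phi> (h p) i) (0, e)"
  using smooth_at_germ[OF s prod_mfd_chart[OF atlas_real_mfd atl real_mfd_chart d(1)]] d(2) by simp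
 then obtain O' g where O': "smooth_fun (1 + n) O' g" "jt 0 (\<kappa> e)\<in>O'"
  "\<And>t y. y\<in>V ==> jt t (\<kappa> y)\<in>O' ==> \<phi> (h (t, y)) i = g (jt t (\<kappa> y))"
  by (auto elim!: germE)
 have der: "((\<lambda>t. \<phi> (h (t, y)) i) has_real_derivative pd 0 g (jt 0 (\<kappa> y))) (at 0)" if y: "y\<in>V" "jt 0 (\<kappa> y)\<in>O'" for y
 proof -
  have "has_pd 0 g (pd 0 g (jt 0 (\<kappa> y))) (jt 0 (\<kappa> y))" by (rule smooth_fun_has_pd[OF O'(1) _ y(2)]) simp
  then have 1: "((\<lambda>t. g (jt t (\<kappa> y))) has_real_derivative pd 0 g (jt 0 (\<kappa> y))) (at 0)"
   unfolding has_pd_def jt_upd jt_0 .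
  have "\<forall>\<^sub>F t in nhds 0. (jt 0 (\<kappa> y))(0 := t)\<in>O'"
   using openin_En_upd_eventually[OF smooth_fun_openin[OF O'(1)] y(2), of 0] unfolding jt_0 by simp
  then have "\<forall>\<^sub>F t in nhds 0. \<phi> (h (t, y)) i = g (jt t (\<kappa> y))"
   unfolding jt_upd by (rule eventually_mono) (rule O'(3)[OF y(1)])
  from DERIV_cong_ev[OF refl this refl] 1 show ?thesis by blast
 qed
 then have v: "vel h \<phi> y i = pd 0 g (jt 0 (\<kappa> y))" if "y\<in>V" "jt 0 (\<kappa> y)\<in>O'" for y
  unfolding vel_def using that by (intro DERIV_imp_deriv)
 show "((\<lambda>t. \<phi> (h (t, e)) i) has_real_derivative vel h \<phi> e i) (at 0)"
  using der[OF d(2) O'(2)] v[OF d(2) O'(2)] by simp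
 let ?O = "{w\<in>Rn n. jt 0 w\<in>O'}"
 have o: "openin (En n) ?O"
  by (rule cmap_openin_preimage[OF smooth_jt smooth_fun_openin[OF O'(1)]])
 have "smooth_coord_map n ?O (1 + n) (jt 0)" by (rule cmap_subset[OF smooth_jt o]) auto
 moreover have "smooth_fun (1 + n) O' (pd 0 g)" by (rule smooth_fun_pd[OF O'(1)]) simp
 ultimately have "smooth_fun n ?O (\<lambda>w. pd 0 g (jt 0 w))"
  by (intro smooth_fun_compose[of "1 + n" O' "pd 0 g" n ?O "jt 0"]) auto
 then have "germ n (V, \<kappa>) (\<lambda>e. vel h \<phi> e i) e"
  by (rule germI) (use v O'(2) D(5) d(2) in auto)
 then show "smooth_at E (\<lambda>e. vel h \<phi> e i) e" by (rule smooth_atI[OF atl d])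
qed

text \<open>Since h_t h_s = h_(ts), this is the chain rule for the substitution of t s for t. The
  homogeneity obtained here makes scalar multiplication linear in the fibre coordinates.\<close>

lemma vel_h:
 assumes c: "(U, \<phi>)\<in>mcharts E" and e: "e\<in>mpoints E" and x: "h (0, e)\<in>U"
 shows "vel h \<phi> (h (s, e)) i = s * vel h \<phi> e i"
proof -
 have "((\<lambda>t. t * s) has_real_derivative s) (at 0)" by (auto intro!: derivative_eq_intros)
 moreover have "((\<lambda>t. \<phi> (h (t, e)) i) has_real_derivative vel h \<phi> e i) (at (0 * s))" using vel_deriv[OF c e x] by simp
 ultimately have "((\<lambda>t. \<phi> (h (t * s, e)) i) has_real_derivative vel h \<phi> e i * s) (at 0)"
  by (rule DERIV_chain2[rotated])
 then have "((\<lambda>t. \<phi> (h (t, h (s, e))) i) has_real_derivative vel h \<phi> e i * s) (at 0)" by (simp add: h_h[OF e])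
 then show ?thesis unfolding vel_def[of h \<phi> "h (s, e)"] by (simp add: DERIV_imp_deriv mult.commute)
qed

lemma vel_outside:
 assumes c: "(U, \<phi>)\<in>mcharts E" and e: "e\<in>mpoints E" and x: "h (0, e)\<in>U" and i: "i\<ge>n"
 shows "vel h \<phi> e i = 0"
proof -
 have "\<forall>\<^sub>F t in nhds 0. h (t, e)\<in>U" by (rule h_eventually[OF e mfd_chartD(1)[OF chartD[OF c]] x])
 then have "\<forall>\<^sub>F t in nhds 0. \<phi> (h (t, e)) i = 0"
  by eventually_elim (use mfd_chartD(5)[OF chartD[OF c]] i in \<open>auto simp: Rn_iff\<close>)
 from DERIV_cong_ev[OF refl this refl, of 0] have "((\<lambda>t. \<phi> (h (t, e)) i) has_real_derivative 0) (at 0)" by simp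
 then show ?thesis unfolding vel_def by (rule DERIV_imp_deriv)
qed

lemma vel_Rn:
 assumes "(U, \<phi>)\<in>mcharts E" "e\<in>mpoints E" "h (0, e)\<in>U" shows "vel h \<phi> e\<in>Rn n"
 using vel_outside[OF assms] by (simp add: Rn_iff)

lemma curve_coords:
 assumes c: "(U, \<phi>)\<in>mcharts E" and e: "e\<in>mpoints E" and x: "h (0, e)\<in>U"
 shows "\<forall>\<^sub>F t in nhds 0. \<phi> (h (t, e))\<in>Rn n"
proof -
 have "\<forall>\<^sub>F t in nhds 0. h (t, e)\<in>U" by (rule h_eventually[OF e mfd_chartD(1)[OF chartD[OF c]] x])
 then show ?thesis by eventually_elim (use mfd_chartD(5)[OF chartD[OF c]] in auto)
qed

text \<open>The coefficients form a row of the differential of the change of charts at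
  \<open>x\<close>. They depend on \<open>x\<close> only, so linear relations between velocities
  over the same base point do not depend on the chart.\<close>

lemma vel_change:
 assumes c: "(U, \<phi>)\<in>mcharts E" and d: "(V, \<psi>)\<in>mcharts E" and x: "x\<in>U" "x\<in>V"
 obtains a where "\<And>e. e\<in>mpoints E ==> h (0, e) = x ==> vel h \<psi> e i = (\<Sum>j<n. a j * vel h \<phi> e j)"
proof -
 obtain O' g where O': "smooth_fun n O' g" "\<phi> x\<in>O'" "\<And>y. y\<in>U ==> \<phi> y\<in>O' ==> \<psi> y i = g (\<phi> y)"
  using germE[OF smooth_at_germ[OF smooth_at_coord[OF atl d x(2), of i] c x(1)]] by metis
 show thesis
 proof (rule that[of "\<lambda>j. pd j g (\<phi> x)"])
  fix e assume e: "e\<in>mpoints E" "h (0, e) = x"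
  have xU: "h (0, e)\<in>U" using e x by simp
  have "((\<lambda>t. g (\<phi> (h (t, e)))) has_real_derivative (\<Sum>j<n. pd j g (\<phi> (h (0, e))) * vel h \<phi> e j)) (at 0)"
   by (rule cmap_chain_curve[OF O'(1) _ curve_coords[OF c e(1) xU] vel_deriv[OF c e(1) xU]])
    (use O'(2) e in simp)
  then have 1: "((\<lambda>t. g (\<phi> (h (t, e)))) has_real_derivative (\<Sum>j<n. pd j g (\<phi> x) * vel h \<phi> e j)) (at 0)" using e(2) by simp
  have "\<forall>\<^sub>F t in nhds 0. h (t, e)\<in>{y\<in>U. \<phi> y\<in>O'}"
   by (rule h_eventually[OF e(1) mfd_chartD(8)[OF chartD[OF c] smooth_fun_openin[OF O'(1)]]]) (use e x O'(2) in auto)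
  then have "\<forall>\<^sub>F t in nhds 0. \<psi> (h (t, e)) i = g (\<phi> (h (t, e)))"
   by eventually_elim (use O'(3) in auto)
  from DERIV_cong_ev[OF refl this refl]
   1 have "((\<lambda>t. \<psi> (h (t, e)) i) has_real_derivative (\<Sum>j<n. pd j g (\<phi> x) * vel h \<phi> e j)) (at 0)" by blast
  then show "vel h \<psi> e i = (\<Sum>j<n. pd j g (\<phi> x) * vel h \<phi> e j)" unfolding vel_def[of h \<psi>] by (rule DERIV_imp_deriv)
 qed
qed

text \<open>Regularity speaks of all charts at once; by \<open>vel_change\<close> one chart is
  enough.\<close>

lemma vel_eq_0_iff:
 assumes c: "(U, \<phi>)\<in>mcharts E" and e: "e\<in>mpoints E" and x: "h (0, e)\<in>U"
 shows "(\<forall>i<n. vel h \<phi> e i = 0) \<longleftrightarrow> h (0, e) = e"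
proof
 assume z: "\<forall>i<n. vel h \<phi> e i = 0"
 have "((\<lambda>t. \<psi> (h (t, e)) i) has_real_derivative 0) (at 0)" if d: "(V, \<psi>)\<in>mcharts E" "h (0, e)\<in>V" for V \<psi> i
 proof -
  obtain a where "\<And>e'. e'\<in>mpoints E ==> h (0, e') = h (0, e) ==> vel h \<psi> e' i = (\<Sum>j<n. a j * vel h \<phi> e' j)"
   using vel_change[OF c d(1) x d(2)] by metis
  from this[OF e refl] have "vel h \<psi> e i = 0" using z by simp
  then show ?thesis using vel_deriv[OF d(1) e d(2), of i] by simp
 qed
 then have "zero_velocity E (\<lambda>t. h (t, e))" by (auto simp: zero_velocity_def)
 then show "h (0, e) = e" using h_zero[OF e] by simp
next
 assume "h (0, e) = e"
 then have "e\<in>base" using e by (simp add: base_def)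
 then have "(\<lambda>t. \<phi> (h (t, e)) i) = (\<lambda>t. \<phi> e i)" for i by (simp add: baseD(2))
 then show "\<forall>i<n. vel h \<phi> e i = 0" by (simp add: vel_def)
qed

section \<open>Adapted charts and the manifold of fixed points\<close>

definition adapted :: "'a set \<Rightarrow> ('a \<Rightarrow> nat \<Rightarrow> real) \<Rightarrow> nat \<Rightarrow> real \<Rightarrow> bool" where
 "adapted U \<phi> k \<epsilon> \<longleftrightarrow> (U, \<phi>)\<in>mcharts E \<and> \<epsilon> > 0 \<and> k\<le>n \<and> \<phi> ` U = cube n \<epsilon> (\<lambda>_. 0) \<and>
  (\<forall>e\<in>U. h (0, e)\<in>U \<and> \<phi> (h (0, e)) = trunc k (\<phi> e))"

lemma adaptedD:
 assumes "adapted U \<phi> k \<epsilon>"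
 shows "(U, \<phi>)\<in>mcharts E" "\<epsilon> > 0" "k\<le>n" "\<phi> ` U = cube n \<epsilon> (\<lambda>_. 0)" "\<And>e. e\<in>U ==> h (0, e)\<in>U"
  "\<And>e. e\<in>U ==> \<phi> (h (0, e)) = trunc k (\<phi> e)" "\<And>e. e\<in>U ==> e\<in>mpoints E"
  "\<And>e. e\<in>U ==> e\<in>base \<longleftrightarrow> \<phi> e\<in>Rn k"
proof -
 show c: "(U, \<phi>)\<in>mcharts E" and "\<epsilon> > 0" "k\<le>n" "\<phi> ` U = cube n \<epsilon> (\<lambda>_. 0)" and u: "\<And>e. e\<in>U ==> h (0, e)\<in>U"
  and t: "\<And>e. e\<in>U ==> \<phi> (h (0, e)) = trunc k (\<phi> e)"
  using assms by (auto simp: adapted_def)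
 show E: "\<And>e. e\<in>U ==> e\<in>mpoints E" using mfd_chartD(2)[OF chartD[OF c]] by blast
 show "e\<in>base \<longleftrightarrow> \<phi> e\<in>Rn k" if "e\<in>U" for e
 proof -
  have "h (0, e) = e \<longleftrightarrow> \<phi> (h (0, e)) = \<phi> e" using mfd_chartD(4)[OF chartD[OF c]] that u[OF that] by (auto dest: inj_onD)
  then show ?thesis using E[OF that] t[OF that] trunc_eq_iff[of k "\<phi> e"] by (simp add: base_def)
 qed
qed

lemma adapted_exists:
 assumes x: "x\<in>base"
 obtains U \<phi> k \<epsilon> where "adapted U \<phi> k \<epsilon>" "x\<in>U" "\<phi> x = (\<lambda>_. 0)"
proof -
 obtain V \<psi> where d: "(V, \<psi>)\<in>mcharts E" "x\<in>V" using atlas_mfd_cover[OF atl baseD(1)[OF x]] by metis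
 note D = mfd_chartD[OF chartD[OF d(1)]]
 \<comment> \<open>The points of the chart whose projection stays in the chart; only there does h_0
   have a coordinate expression.\<close>
 let ?W = "V\<inter>{e\<in>mpoints E. h (0, e)\<in>V}"
 have W: "openin (mtop E) ?W"
  using openin_continuous_map_preimage[OF smooth_map_cont[OF smooth_h] D(1)] D(1) by blast
 define p where "p z = \<psi> (h (0, inv_into V \<psi> z))" for z
 have "germ n (V, \<psi>) (\<lambda>e. \<psi> (h (0, e)) i) y" if "y\<in>?W" for y i
  by (rule smooth_at_germ[OF smooth_map_at[OF atl atl smooth_h _ smooth_at_coord[OF atl d(1)]] d(1)]) (use that in auto)
 then have ps: "smooth_coord_map n (\<psi> ` ?W) n p"
  unfolding p_def using germ_iff_map[OF chartD[OF d(1)] W, of "\<lambda>e. \<psi> (h (0, e))" n] D(5) by auto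
 have pe: "p (\<psi> y) = \<psi> (h (0, y))" if "y\<in>V" for y using D(6)[OF that] by (simp add: p_def)
 have xW: "x\<in>?W" using d(2) x by (simp add: base_def)
 have px: "p (\<psi> x) = \<psi> x" using pe[OF d(2)] baseD(2)[OF x] by simp
 have idem: "p (p z) = p z" if z: "z\<in>\<psi> ` ?W" "p z\<in>\<psi> ` ?W" for z
 proof -
  obtain y where y: "y\<in>?W" "z = \<psi> y" using z by blast
  have yV: "y\<in>V" "h (0, y)\<in>V" "y\<in>mpoints E" using y by auto
  show ?thesis unfolding y(2) pe[OF yV(1)] pe[OF yV(2)] proj_h[OF yV(3)] ..
 qed
 have "\<exists>P H k \<epsilon>. \<psi> x\<in>P \<and> P\<subseteq>\<psi> ` ?W \<and> \<epsilon> > 0 \<and> k\<le>n \<and> coord_diffeo n P (cube n \<epsilon> (\<lambda>_. 0)) H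
  \<and> H (\<psi> x) = (\<lambda>_. 0) \<and> (\<forall>z\<in>P. p z\<in>P) \<and> (\<forall>z\<in>P. H (p z) = trunc k (H z))"
 proof (rule idempotent_straighten[OF ps imageI[OF xW] px idem], goal_cases)
  case (3 P H k \<epsilon>)
  then show ?case by (intro exI[of _ P] exI[of _ H] exI[of _ k] exI[of _ \<epsilon>]) simp
 qed auto
 then obtain P H k \<epsilon> where P: "\<psi> x\<in>P" "P\<subseteq>\<psi> ` ?W" "\<epsilon> > 0" "k\<le>n" "coord_diffeo n P (cube n \<epsilon> (\<lambda>_. 0)) H"
  "H (\<psi> x) = (\<lambda>_. 0)" "\<And>z. z\<in>P ==> p z\<in>P" "\<And>z. z\<in>P ==> H (p z) = trunc k (H z)"
  by (elim exE conjE) simp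
 let ?U = "{e\<in>V. \<psi> e\<in>P}" and ?\<phi> = "\<lambda>e. H (\<psi> e)"
 have UW: "?U\<subseteq>?W" using P(2) D(4) by (auto dest: inj_onD)
 have im: "?\<phi> ` ?U = cube n \<epsilon> (\<lambda>_. 0)"
 proof -
  have "\<psi> ` ?U = P" using P(2) by auto
  then have "?\<phi> ` ?U = H ` P" by (metis image_image)
  then show ?thesis using P(5) by (simp add: coord_diffeo_def bij_betw_def)
 qed
 have "adapted ?U ?\<phi> k \<epsilon>" unfolding adapted_def
 proof (intro conjI ballI mcharts_diffeo[OF atl d(1) P(5)] P(3,4) im)
  fix e assume e: "e\<in>?U"
  have eV: "e\<in>V" "h (0, e)\<in>V" using e UW by auto
  show "h (0, e)\<in>?U" using P(7)[of "\<psi> e"] e eV pe by auto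
  show "H (\<psi> (h (0, e))) = trunc k (H (\<psi> e))" using P(8)[of "\<psi> e"] e pe by auto
 qed
 then show thesis by (rule that) (use d P in auto)
qed

text \<open>The fixed points of a truncation are the points of \<open>Rn k\<close>, so an adapted
  chart restricts to a chart of the fixed set without any change of coordinates.\<close>

lemma slice_chart:
 assumes ad: "adapted U \<phi> k \<epsilon>"
 shows "mfd_chart (subtopology (mtop E) base) k (U\<inter>base, \<phi>)" "\<phi> ` (U\<inter>base) = cube k \<epsilon> (\<lambda>_. 0)"
proof -
 note A = adaptedD[OF ad]
 note D = mfd_chartD[OF chartD[OF A(1)]]
 have cube: "cube n \<epsilon> (\<lambda>_. 0)\<inter>Rn k = cube k \<epsilon> (\<lambda>_. 0)"
  using A(2,3) Rn_mono[of _ k n] by (auto simp: cube_def) (metis A(2) Rn_iff abs_zero not_less)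
 have "\<phi> ` (U\<inter>base) = \<phi> ` U\<inter>Rn k" using A(8) by auto
 then show im: "\<phi> ` (U\<inter>base) = cube k \<epsilon> (\<lambda>_. 0)" using cube A(4) by simp
 have topen: "openin (En k) (O'\<inter>Rn k)" if "openin (En n) O'" for O'
 proof -
  have "openin (En k) {z\<in>Rn k. z\<in>O'}"
   by (rule cmap_openin_preimage[OF smooth_coord_id[OF openin_Rn A(3)] that])
  moreover have "{z\<in>Rn k. z\<in>O'} = O'\<inter>Rn k" by auto
  ultimately show ?thesis by simp
 qed
 show "mfd_chart (subtopology (mtop E) base) k (U\<inter>base, \<phi>)"
 proof (rule mfd_chartI)
  show "openin (subtopology (mtop E) base) (U\<inter>base)" using D(1) by (auto simp: openin_subtopology)
  show "openin (En k) (\<phi> ` (U\<inter>base))" unfolding im by simp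
  show "inj_on \<phi> (U\<inter>base)" using D(4) by (rule inj_on_subset) simp
  show "openin (En k) (\<phi> ` W)" if W: "openin (subtopology (mtop E) base) W" "W\<subseteq>U\<inter>base" for W
  proof -
   obtain S where S: "openin (mtop E) S" "W = S\<inter>base" using W(1) by (auto simp: openin_subtopology)
   have "openin (mtop E) (S\<inter>U)" using S(1) D(1) by blast
   then have "openin (En n) (\<phi> ` (S\<inter>U))" by (rule D(7)) simp
   then have "openin (En k) (\<phi> ` (S\<inter>U)\<inter>Rn k)" by (rule topen)
   moreover have "\<phi> ` (S\<inter>U)\<inter>Rn k = \<phi> ` W" using A(8) S(2) W(2) by auto
   ultimately show ?thesis by simp
  qed
  show "openin (subtopology (mtop E) base) {x\<in>U\<inter>base. \<phi> x\<in>O'}" if O': "openin (En k) O'" for O'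
  proof -
   have "openin (En n) {z\<in>Rn n. trunc k z\<in>O'}"
    by (rule cmap_openin_preimage[OF smooth_trunc O']) simp
   then have "openin (mtop E) {x\<in>U. \<phi> x\<in>{z\<in>Rn n. trunc k z\<in>O'}}" by (rule D(8))
   moreover have "{x\<in>U\<inter>base. \<phi> x\<in>O'} = {x\<in>U. \<phi> x\<in>{z\<in>Rn n. trunc k z\<in>O'}}\<inter>base"
    using A(8) D(5) by (auto simp: trunc_id)
   ultimately show ?thesis by (auto simp: openin_subtopology)
  qed
 qed
qed

text \<open>The base is the image of a connected space under h_0.\<close>

lemma base_connected: "connectedin (mtop E) base" "base\<noteq>{}"
proof -
 have "base = (\<lambda>e. h (0, e)) ` mpoints E"
 proof (intro equalityI subsetI)
  fix x assume x: "x\<in>base"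
  show "x\<in>(\<lambda>e. h (0, e)) ` mpoints E" using baseD(2)[OF x, of 0] baseD(1)[OF x] by (metis image_eqI)
 qed (auto intro: proj_base)
 then show "connectedin (mtop E) base"
  using connectedin_continuous_map_image[OF smooth_map_cont[OF smooth_h[of 0]], of "mpoints E"] conn
  by (simp add: connectedin_topspace)
 show "base\<noteq>{}" using nonempty proj_base by blast
qed

text \<open>Any dimension occurring in an adapted chart around a base point may be picked, since
  \<open>adapted_dim\<close> shows that there is only one.\<close>

definition bdim :: nat where
 "bdim = (SOME k. \<exists>U \<phi> \<epsilon> x. adapted U \<phi> k \<epsilon> \<and> x\<in>U\<inter>base)"

text \<open>The points of the base with local dimension \<open>l\<close> form an open set
  \<open>W l\<close>. By invariance of domain these sets are pairwise disjoint, so each of them is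
  also closed, and the connected base is a single one of them.\<close>

lemma adapted_dim:
 assumes ad: "adapted U \<phi> k \<epsilon>" and x: "x\<in>U" "x\<in>base"
 shows "k = bdim"
proof -
 define W where "W l = \<Union> {U\<inter>base | U \<phi> \<epsilon>. adapted U \<phi> l \<epsilon>}" for l
 let ?T = "subtopology (mtop E) base"
 have Wo: "openin ?T (W l)" for l
  unfolding W_def using mfd_chartD(1)[OF slice_chart(1)] by (intro openin_Union) blast
 have pts: "topspace ?T = base" using baseD(1) by auto
 have WB: "W l\<subseteq>base" for l by (auto simp: W_def)
 have disj: "l = m" if yl: "y\<in>W l" and ym: "y\<in>W m" for l m y
 proof -
  obtain U1 \<phi>1 \<epsilon>1 where 1: "adapted U1 \<phi>1 l \<epsilon>1" "y\<in>U1\<inter>base" using yl unfolding W_def by blast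
  obtain U2 \<phi>2 \<epsilon>2 where 2: "adapted U2 \<phi>2 m \<epsilon>2" "y\<in>U2\<inter>base" using ym unfolding W_def by blast
  show ?thesis by (rule mfd_chart_dim_unique[OF slice_chart(1)[OF 1(1)] slice_chart(1)[OF 2(1)] 1(2) 2(2)])
 qed
 have cov: "\<exists>l. y\<in>W l" if y: "y\<in>base" for y
 proof -
  obtain U \<phi> l \<epsilon> where "adapted U \<phi> l \<epsilon>" "y\<in>U" using adapted_exists[OF y] by metis
  then show ?thesis using y unfolding W_def by blast
 qed
 have cn: "connected_space ?T" using base_connected(1) by (simp add: connectedin_def)
 have all: "W l = base" if "W l\<noteq>{}" for l
 proof -
  have "base - W l = \<Union> (W ` (- {l}))"
  proof (intro equalityI subsetI)
   fix y assume "y\<in>base - W l"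
   then show "y\<in>\<Union> (W ` (- {l}))" using cov[of y] by auto
  next
   fix y assume "y\<in>\<Union> (W ` (- {l}))"
   then obtain m where "m\<noteq>l" "y\<in>W m" by auto
   then show "y\<in>base - W l" using disj[of y m l] WB[of m] by auto
  qed
  moreover have "openin ?T (\<Union> (W ` (- {l})))" using Wo by (intro openin_Union) auto
  ultimately have "openin ?T (base - W l)" by simp
  then have "closedin ?T (W l)" using WB by (simp add: closedin_def pts del: topspace_subtopology)
  then show ?thesis using cn Wo[of l] that pts by (auto simp: connected_space_clopen_in)
 qed
 have "\<exists>U \<phi> \<epsilon> x. adapted U \<phi> k \<epsilon> \<and> x\<in>U\<inter>base" using ad x by blast
 then have "\<exists>U \<phi> \<epsilon> x. adapted U \<phi> bdim \<epsilon> \<and> x\<in>U\<inter>base" unfolding bdim_def by (rule someI)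
 then obtain y where "y\<in>W bdim" unfolding W_def by blast
 then have "W bdim = base" using all by blast
 then show ?thesis using disj[of x k bdim] ad x unfolding W_def by blast
qed

lemma adapted_exists_bdim:
 assumes x: "x\<in>base"
 obtains U \<phi> \<epsilon> where "adapted U \<phi> bdim \<epsilon>" "x\<in>U" "\<phi> x = (\<lambda>_. 0)"
proof -
 obtain U \<phi> k \<epsilon> where "adapted U \<phi> k \<epsilon>" "x\<in>U" "\<phi> x = (\<lambda>_. 0)" using adapted_exists[OF x] by metis
 with adapted_dim[OF this(1,2) x] that show thesis by blast
qed

definition base_mfd :: "'a mfd" where
 "base_mfd = mfd_of_atlas (subtopology (mtop E) base) bdim {(U\<inter>base, \<phi>) | U \<phi> \<epsilon>. adapted U \<phi> bdim \<epsilon>}"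

lemma base_mfd_simps [simp]: "mtop base_mfd = subtopology (mtop E) base" "mdim base_mfd = bdim" "mpoints base_mfd = base"
 using baseD(1) by (auto simp: base_mfd_def mfd_of_atlas_def)

lemma germ_slice:
 assumes ad: "adapted U \<phi> k \<epsilon>" and x: "x\<in>U" "x\<in>base" and f: "germ n (U, \<phi>) f x"
 shows "germ k (U\<inter>base, \<phi>) f x"
proof -
 note A = adaptedD[OF ad]
 obtain O' g where O': "smooth_fun n O' g" "\<phi> x\<in>O'" "\<And>y. y\<in>U ==> \<phi> y\<in>O' ==> f y = g (\<phi> y)"
  using germE[OF f] by metis
 let ?O = "{z\<in>Rn k. z\<in>O'}"
 have o: "openin (En k) ?O"
  by (rule cmap_openin_preimage[OF smooth_coord_id[OF openin_Rn A(3)] smooth_fun_openin[OF O'(1)]])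
 have "smooth_fun k ?O (\<lambda>z. g z)"
  by (rule smooth_fun_compose[OF O'(1) smooth_coord_id[OF o A(3)]]) auto
 then show ?thesis by (rule germI) (use O' A(8) x in auto)
qed

lemma
 shows atlas_base: "atlas_mfd base_mfd"
  and base_chart: "adapted U \<phi> bdim \<epsilon> ==> (U\<inter>base, \<phi>)\<in>mcharts base_mfd"
proof -
 let ?A = "{(U\<inter>base, \<phi>) | U \<phi> \<epsilon>. adapted U \<phi> bdim \<epsilon>}"
 have ch: "mfd_chart (subtopology (mtop E) base) bdim c" if "c\<in>?A" for c using that slice_chart(1) by blast
 have pts: "topspace (subtopology (mtop E) base) = base" using baseD(1) by auto
 have cov: "\<Union> (fst ` ?A) = topspace (subtopology (mtop E) base)"
 proof (intro equalityI subsetI)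
  fix x assume "x\<in>topspace (subtopology (mtop E) base)"
  then have x: "x\<in>base" by simp
  obtain U \<phi> \<epsilon> where "adapted U \<phi> bdim \<epsilon>" "x\<in>U" using adapted_exists_bdim[OF x] by metis
  then show "x\<in>\<Union> (fst ` ?A)" using x by (intro UN_I[of "(U\<inter>base, \<phi>)"]) auto
 qed (use pts in auto)
 have comp: "mfd_compatible bdim c d" if cd: "c\<in>?A" "d\<in>?A" for c d
 proof -
  obtain U \<phi> \<epsilon> where c: "c = (U\<inter>base, \<phi>)" "adapted U \<phi> bdim \<epsilon>" using cd(1) by blast
  obtain V \<psi> \<delta> where d: "d = (V\<inter>base, \<psi>)" "adapted V \<psi> bdim \<delta>" using cd(2) by blast
  show ?thesis unfolding c(1) d(1) mfd_compatible_iff[OF slice_chart(1)[OF c(2)] slice_chart(1)[OF d(2)]]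
  proof (intro conjI ballI allI impI)
   fix x i assume x: "x\<in>U\<inter>base\<inter>(V\<inter>base)"
   show "germ bdim (U\<inter>base, \<phi>) (\<lambda>y. \<psi> y i) x"
    by (rule germ_slice[OF c(2) _ _ smooth_at_germ[OF smooth_at_coord[OF atl adaptedD(1)[OF d(2)]] adaptedD(1)[OF c(2)]]]) (use x in auto)
   show "germ bdim (V\<inter>base, \<psi>) (\<lambda>y. \<phi> y i) x"
    by (rule germ_slice[OF d(2) _ _ smooth_at_germ[OF smooth_at_coord[OF atl adaptedD(1)[OF c(2)]] adaptedD(1)[OF d(2)]]]) (use x in auto)
  qed
 qed
 show "atlas_mfd base_mfd" unfolding base_mfd_def by (rule atlas_mfd_of_atlas(1)[OF ch cov comp])
 show "(U\<inter>base, \<phi>)\<in>mcharts base_mfd" if "adapted U \<phi> bdim \<epsilon>"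
  unfolding base_mfd_def using atlas_mfd_of_atlas(2)[OF ch cov comp] that by blast
qed

lemma smooth_base: "smooth_manifold base_mfd"
 unfolding smooth_manifold_iff topological_manifold_def
proof (intro conjI ballI atlas_base)
 have "Hausdorff_space (mtop E)" "second_countable (mtop E)"
  using sm by (auto simp: smooth_manifold_def topological_manifold_def)
 then show "Hausdorff_space (mtop base_mfd)" "second_countable (mtop base_mfd)"
  by (auto intro: Hausdorff_space_subtopology second_countable_subtopology)
 fix x assume "x\<in>mpoints base_mfd"
 then obtain U \<phi> where "(U, \<phi>)\<in>mcharts base_mfd" "x\<in>U" using atlas_mfd_cover[OF atlas_base] by metis
 then show "\<exists>c. mfd_chart (mtop base_mfd) (mdim base_mfd) c \<and> x\<in>fst c"
  using atlas_mfd_chart[OF atlas_base] by fastforce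
qed

lemma smooth_at_base:
 assumes f: "smooth_at E f x" and x: "x\<in>base" shows "smooth_at base_mfd f x"
proof -
 obtain U \<phi> \<epsilon> where a: "adapted U \<phi> bdim \<epsilon>" "x\<in>U" using adapted_exists_bdim[OF x] by metis
 show ?thesis
  by (rule smooth_atI[OF atlas_base base_chart[OF a(1)]])
   (use a x germ_slice[OF a x smooth_at_germ[OF f adaptedD(1)[OF a(1)] a(2)]] in auto)
qed

text \<open>At a point of the base this is composition with a truncation in an adapted chart. A
  point \<open>e\<close> outside all adapted charts is reached through h_0 = h_0 h_0: the statement
  at h_0 e is pulled back along the smooth map h_0.\<close>

lemma smooth_at_proj:
 assumes f: "smooth_at base_mfd f (h (0, e))" and e: "e\<in>mpoints E"
 shows "smooth_at E (\<lambda>e. f (h (0, e))) e"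
proof -
 let ?x = "h (0, e)"
 have x: "?x\<in>base" by (rule proj_base[OF e])
 obtain U \<phi> \<epsilon> where a: "adapted U \<phi> bdim \<epsilon>" "?x\<in>U" using adapted_exists_bdim[OF x] by metis
 note A = adaptedD[OF a(1)]
 obtain O' g where O': "smooth_fun bdim O' g" "\<phi> ?x\<in>O'" "\<And>y. y\<in>U\<inter>base ==> \<phi> y\<in>O' ==> f y = g (\<phi> y)"
 proof -
  have "germ bdim (U\<inter>base, \<phi>) f ?x" using smooth_at_germ[OF f base_chart[OF a(1)]] a(2) x by simp
  from germE[OF this] that show thesis by metis
 qed
 let ?O = "{z\<in>Rn n. trunc bdim z\<in>O'}"
 have o: "openin (En n) ?O"
  by (rule cmap_openin_preimage[OF smooth_trunc smooth_fun_openin[OF O'(1)]]) simp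
 have s: "smooth_fun n ?O (\<lambda>z. g (trunc bdim z))" by (rule smooth_fun_compose[OF O'(1) smooth_trunc[OF o]]) auto
 have "germ n (U, \<phi>) (\<lambda>y. f (h (0, y))) ?x"
 proof (rule germI[OF s])
  have "\<phi> ?x\<in>Rn bdim" using A(8)[OF a(2)] x by simp
  then show "\<phi> ?x\<in>?O" using O'(2) Rn_mono[OF _ A(3)] by (simp add: trunc_id)
  fix y assume y: "y\<in>U" "\<phi> y\<in>?O"
  then show "f (h (0, y)) = g (trunc bdim (\<phi> y))"
   using O'(3)[of "h (0, y)"] A(5,6)[OF y(1)] proj_base[OF A(7)[OF y(1)]] by simp
 qed
 then have "smooth_at E (\<lambda>y. f (h (0, y))) ?x" by (rule smooth_atI[OF atl A(1) a(2)])
 then have "smooth_at E (\<lambda>y. f (h (0, h (0, y)))) e" by (rule smooth_map_at[OF atl atl smooth_h e])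
 then show ?thesis by (rule smooth_at_cong[OF atl _ openin_topspace e]) (simp add: proj_h)
qed

lemma smooth_inclusion: "smooth_map base_mfd E (\<lambda>x. x)"
 unfolding smooth_map_iff[OF atlas_base atl]
 using smooth_at_base[OF smooth_at_coord[OF atl]] by (auto intro: continuous_map_into_fulltopology[of _ _ base])

lemma smooth_proj: "smooth_map E base_mfd (\<lambda>e. h (0, e))"
 unfolding smooth_map_iff[OF atl atlas_base]
 using smooth_at_proj[OF smooth_at_coord[OF atlas_base]] smooth_map_cont[OF smooth_h[of 0]] proj_base
 by (auto simp: continuous_map_in_subtopology)

text \<open>h_0 is a smooth retraction onto the base, so a map with values in the base equals its
  composite with h_0.\<close>

lemma smooth_map_into_base:
 assumes L: "atlas_mfd L" and F: "smooth_map L E F" and im: "\<And>x. x\<in>mpoints L ==> F x\<in>base"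
 shows "smooth_map L base_mfd F"
proof (rule smooth_map_cong[OF L atlas_base smooth_map_compose[OF L atl atlas_base F smooth_proj]])
 show "h (0, F x) = F x" if "x\<in>mpoints L" for x using baseD(2)[OF im[OF that]] .
qed

end

section \<open>Velocities near a fixed point and the local trivialisation\<close>

context regular_mfd
begin

text \<open>The first \<open>k\<close> coordinates of h_t e are those of h_0 h_t e = h_0 e, hence
  constant in t.\<close>

lemma adapted_vel_low:
 assumes ad: "adapted U \<phi> k \<epsilon>" and e: "e\<in>mpoints E" "h (0, e)\<in>U" and i: "i < k"
 shows "vel h \<phi> e i = 0"
proof -
 note A = adaptedD[OF ad]
 have "\<forall>\<^sub>F t in nhds 0. h (t, e)\<in>U" by (rule h_eventually[OF e(1) mfd_chartD(1)[OF chartD[OF A(1)]] e(2)])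
 then have "\<forall>\<^sub>F t in nhds 0. \<phi> (h (t, e)) i = \<phi> (h (0, e)) i"
 proof eventually_elim
  case (elim t)
  have "\<phi> (h (0, h (t, e))) i = \<phi> (h (t, e)) i" using A(6)[OF elim] i by (simp add: trunc_def)
  then show ?case by (simp add: proj_h[OF e(1)])
 qed
 from DERIV_cong_ev[OF refl this refl, of 0] have "((\<lambda>t. \<phi> (h (t, e)) i) has_real_derivative 0) (at 0)" by simp
 then show ?thesis unfolding vel_def by (rule DERIV_imp_deriv)
qed

text \<open>The rows of the derivative \<open>K\<close> below \<open>k\<close> vanish since the
  velocity is vertical, its columns below \<open>k\<close> since the velocity vanishes on the base,
  and homogeneity makes \<open>K\<close> idempotent. These facts still allow a rank smaller than n -
  k, and it is here that regularity enters.\<close>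

lemma vel_linearise:
 assumes ad: "adapted U \<phi> k \<epsilon>" and x0: "x0\<in>U" "\<phi> x0 = (\<lambda>_. 0)"
 defines "v \<equiv> \<lambda>z. vel h \<phi> (inv_into U \<phi> z)"
 shows "smooth_coord_map n (cube n \<epsilon> (\<lambda>_. 0)) n v"
  and "\<And>i j. i < n ==> j < n ==> pd j (\<lambda>z. v z i) (\<lambda>_. 0) = (if i = j \<and> k\<le>i then 1 else 0)"
proof -
 note A = adaptedD[OF ad]
 note D = mfd_chartD[OF chartD[OF A(1)]]
 define B where "B = cube n \<epsilon> (\<lambda>_. 0)"
 have BU: "\<phi> ` U = B" using A(4) by (simp add: B_def)
 have Bop: "openin (En n) B" by (simp add: B_def)
 have ve: "v (\<phi> e) = vel h \<phi> e" if "e\<in>U" for e using D(6)[OF that] by (simp add: v_def)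
 have "smooth_coord_map n (\<phi> ` U) n v" unfolding v_def
  using germ_iff_map[OF chartD[OF A(1)] D(1) order_refl, of "vel h \<phi>" n]
   vel_Rn[OF A(1) A(7) A(5)] smooth_at_germ[OF smooth_vel[OF A(1) A(7) A(5)] A(1)] by blast
 then show vs: "smooth_coord_map n (cube n \<epsilon> (\<lambda>_. 0)) n v" using BU by (simp add: B_def)
 then have vs: "smooth_coord_map n B n v" by (simp add: B_def)
 note V = cmapD[OF vs]
 have v_low: "v z i = 0" if "z\<in>B" "i < k" for z i
 proof -
  obtain e where e: "e\<in>U" "z = \<phi> e" using \<open>z\<in>B\<close> BU by blast
  show ?thesis unfolding e(2) ve[OF e(1)] by (rule adapted_vel_low[OF ad A(7)[OF e(1)] A(5)[OF e(1)] that(2)])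
 qed
 have v_base: "v z i = 0" if "z\<in>B" "z\<in>Rn k" for z i
 proof -
  obtain e where e: "e\<in>U" "z = \<phi> e" using \<open>z\<in>B\<close> BU by blast
  have "e\<in>base" using A(8)[OF e(1)] that e by simp
  then have "\<forall>i<n. vel h \<phi> e i = 0" using vel_eq_0_iff[OF A(1) A(7)[OF e(1)] A(5)[OF e(1)]] by (simp add: baseD)
  then have "vel h \<phi> e i = 0" using vel_outside[OF A(1) A(7)[OF e(1)] A(5)[OF e(1)], of i] by (meson not_less)
  then show ?thesis by (simp add: e(2) ve[OF e(1)])
 qed
 have zB: "(\<lambda>_. 0)\<in>B" using A(2) by (auto simp: B_def cube_def Rn_iff)
 have zRk: "(\<lambda>_. 0)\<in>Rn k" by (simp add: Rn_iff)
 have tB: "trunc k z\<in>B" if "z\<in>B" for z using that A(2,3) by (auto simp: B_def cube_def trunc_def Rn_iff)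
 define z0 :: "nat \<Rightarrow> real" where "z0 = (\<lambda>_. 0)"
 define K where "K = jac n v z0"
 have Kc: "K\<in>carrier_mat n n" by (simp add: K_def)
 have Kij: "K $$ (i, j) = pd j (\<lambda>z. v z i) z0" if "i < n" "j < n" for i j using that by (simp add: K_def jac_def)
 have z0B: "z0\<in>B" using zB by (simp add: z0_def)
 have Krow: "K $$ (i, j) = 0" if "i < n" "j < n" "i < k" for i j
 proof -
  have "pd j (\<lambda>z. v z i) z0 = pd j (\<lambda>z. 0) z0"
   by (rule pd_cong[OF Bop z0B that(2)]) (use v_low that in auto)
  also have "has_pd j (\<lambda>z. 0) 0 z0" by (simp add: has_pd_def)
  then have "pd j (\<lambda>z. 0) z0 = 0" by (rule pd_unique)
  finally show ?thesis using Kij that by simp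
 qed
 have Kcol: "K $$ (i, j) = 0" if "i < n" "j < n" "j < k" for i j
 proof -
  have "\<forall>\<^sub>F t in nhds (z0 j). z0(j := t)\<in>B" by (rule openin_En_upd_eventually[OF Bop z0B that(2)])
  then have "\<forall>\<^sub>F t in nhds (z0 j). v (z0(j := t)) i = 0"
   by eventually_elim (rule v_base, assumption, use that in \<open>auto simp: z0_def Rn_iff\<close>)
  from DERIV_cong_ev[OF refl this refl, of 0] have "has_pd j (\<lambda>z. v z i) 0 z0" unfolding has_pd_def by simp
  then show ?thesis using Kij that pd_unique by simp
 qed
 \<comment> \<open>Two computations of the derivative at s = 0 of the velocity along the orbit: the
   chain rule gives the left side, and homogeneity, by which the velocity at h_s e is s times that
   at e, gives the right side.\<close>
 have star: "(\<Sum>j<n. pd j (\<lambda>z. v z i) (trunc k z) * v z j) = v z i" if z: "z\<in>B" for z i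
 proof -
  obtain e where e: "e\<in>U" "z = \<phi> e" using z BU by blast
  note eE = A(7)[OF e(1)] and eU = A(5)[OF e(1)]
  have "((\<lambda>s. v (\<phi> (h (s, e))) i) has_real_derivative (\<Sum>j<n. pd j (\<lambda>z. v z i) (\<phi> (h (0, e))) * vel h \<phi> e j)) (at 0)"
   by (rule cmap_chain_curve[OF V(3) _ curve_coords[OF A(1) eE eU] vel_deriv[OF A(1) eE eU]])
    (use BU eU in blast)
  moreover have "\<forall>\<^sub>F s in nhds 0. h (s, e)\<in>U" by (rule h_eventually[OF eE D(1) eU])
  then have "\<forall>\<^sub>F s in nhds 0. v (\<phi> (h (s, e))) i = s * vel h \<phi> e i"
   by eventually_elim (simp add: ve vel_h[OF A(1) eE eU])
  from DERIV_cong_ev[OF refl this refl, of "vel h \<phi> e i"]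
  have "((\<lambda>s. v (\<phi> (h (s, e))) i) has_real_derivative vel h \<phi> e i) (at 0)"
   by (auto intro!: derivative_eq_intros)
  ultimately have "(\<Sum>j<n. pd j (\<lambda>z. v z i) (\<phi> (h (0, e))) * vel h \<phi> e j) = vel h \<phi> e i" by (rule DERIV_unique)
  then show ?thesis using A(6)[OF e(1)] by (simp add: e(2) ve[OF e(1)])
 qed
 \<comment> \<open>Differentiating \<open>star\<close> at the origin in direction \<open>l\<close>:
   as \<open>v\<close> vanishes there, the product rule leaves only the terms in which
   \<open>v\<close> is differentiated, and these form K K.\<close>
 have KK: "K * K = K"
 proof (rule eq_matI)
  fix i l assume "i < dim_row K" "l < dim_col K"
  then have il: "i < n" "l < n" using Kc by auto
  define a where "a j z = pd j (\<lambda>z. v z i) (trunc k z)" for j z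
  have as: "smooth_fun n B (a j)" if "j < n" for j unfolding a_def
   by (rule smooth_fun_compose[OF smooth_fun_pd[OF V(3) that] smooth_trunc_into[OF Bop A(3)] tB])
  have ap: "has_pd l (a j) (pd l (a j) z0) z0" if "j < n" for j by (rule smooth_fun_has_pd[OF as[OF that] il(2) z0B])
  have a0: "a j z0 = K $$ (i, j)" if "j < n" for j
   using Kij[OF il(1) that] by (simp add: a_def z0_def trunc_def)
  have vp: "has_pd l (\<lambda>z. v z j) (K $$ (j, l)) z0" if "j < n" for j
   using smooth_fun_has_pd[OF V(3) il(2) z0B, of j] Kij[OF that il(2)] by simp
  have v0: "v z0 j = 0" for j using v_base[OF zB zRk] by (simp add: z0_def)
  have "((\<lambda>t. a j (z0(l := t)) * v (z0(l := t)) j) has_real_derivative K $$ (i, j) * K $$ (j, l)) (at (z0 l))" if j: "j < n" for j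
  proof -
   have "((\<lambda>t. a j (z0(l := t)) * v (z0(l := t)) j) has_real_derivative
     pd l (a j) z0 * v (z0(l := z0 l)) j + K $$ (j, l) * a j (z0(l := z0 l))) (at (z0 l))"
    by (rule DERIV_mult) (use ap[OF j] vp[OF j] in \<open>auto simp: has_pd_def\<close>)
   then show ?thesis by (simp add: v0 a0[OF j] mult.commute)
  qed
  then have "has_pd l (\<lambda>z. \<Sum>j<n. a j z * v z j) (\<Sum>j<n. K $$ (i, j) * K $$ (j, l)) z0"
   unfolding has_pd_def by (intro DERIV_sum) auto
  then have "has_pd l (\<lambda>z. v z i) (\<Sum>j<n. K $$ (i, j) * K $$ (j, l)) z0"
   using has_pd_cong[OF Bop z0B il(2), of "\<lambda>z. \<Sum>j<n. a j z * v z j" "\<lambda>z. v z i"] star by (simp add: a_def)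
  then show "(K * K) $$ (i, l) = K $$ (i, l)"
   using pd_unique Kij[OF il] Kc il by (simp add: scalar_prod_def atLeast0LessThan)
 qed auto
 \<comment> \<open>The defect of \<open>K\<close> with respect to the expected projection; a
   non-zero entry is led to a contradiction.\<close>
 define R where "R i j = (if i = j \<and> k\<le>i then 1 else 0) - K $$ (i, j)" for i j
 have "R i0 j0 = 0" if ij: "i0 < n" "j0 < n" for i0 j0
 proof (rule ccontr)
  assume nz: "R i0 j0\<noteq>0"
  have I: "smooth_coord_map n B n (\<lambda>z. z)" by (rule smooth_coord_id[OF Bop order_refl])
  have lK: "smooth_coord_map n B n (\<lambda>z. lin n K z)" by (rule lin_smooth[OF Bop])
  \<comment> \<open>The map v + (1 - K) has Jacobian 1 at the origin, so its image contains a
    neighbourhood of the origin.\<close>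
  define F where "F z i = v z i + (z i - lin n K z i)" for z i
  have d: "smooth_coord_map n B n (\<lambda>z i. z i - lin n K z i)" by (rule cmap_diff[OF I lK])
  have Fs: "smooth_coord_map n B n F" unfolding F_def by (rule cmap_add[OF vs d])
  have "jac n F z0 = K + (1\<^sub>m n - K * 1\<^sub>m n)"
   using jac_add[OF vs d z0B] jac_diff[OF I lK z0B] jac_lin_compose[OF I z0B Kc] by (simp add: F_def[abs_def] K_def jac_id)
  also have "\<dots> = 1\<^sub>m n" using Kc by (auto intro!: eq_matI)
  finally have "inverse_mats n (jac n F z0) (1\<^sub>m n)" using inverse_mats_one by simp
  from inverse_function[OF Fs z0B this] obtain P where P: "z0\<in>P" "P\<subseteq>B" "coord_diffeo n P (F ` P) F" by blast
  have lin0: "lin n K z0 = z0" by (simp add: lin_def z0_def fun_eq_iff)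
  have v0: "v z0 j = 0" for j using v_base[OF zB zRk] by (simp add: z0_def)
  have F0: "F z0 = z0" using lin0 v0 by (simp add: F_def fun_eq_iff z0_def)
  have FP: "openin (En n) (F ` P)" using P(3) by (auto simp: coord_diffeo_def smooth_coord_map_def)
  have "z0\<in>F ` P" using P(1) F0 by (metis imageI)
  then obtain \<delta> where \<delta>: "\<delta> > 0" "cube n \<delta> z0\<subseteq>F ` P" using cube_nbhd[OF FP] by blast
  \<comment> \<open>Chosen so small that the multiple \<open>w\<close> of column \<open>j0\<close>
    of the defect lies in the cube contained in the image of \<open>F\<close>.\<close>
  define s where "s = \<delta> / (1 + (\<Sum>i<n. \<bar>R i j0\<bar>))"
  have den: "1 + (\<Sum>i<n. \<bar>R i j0\<bar>) > 0" by (simp add: add_pos_nonneg sum_nonneg)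
  have s: "s > 0" unfolding s_def using \<delta>(1) den by simp
  define w where "w i = (if i < n then s * R i j0 else 0)" for i
  have "\<bar>s * R i j0\<bar> < \<delta>" if "i < n" for i
  proof -
   have "\<bar>R i j0\<bar>\<le>(\<Sum>i<n. \<bar>R i j0\<bar>)" using that by (intro member_le_sum) auto
   then have "\<bar>R i j0\<bar> < 1 + (\<Sum>i<n. \<bar>R i j0\<bar>)" by simp
   then have "s * \<bar>R i j0\<bar> < s * (1 + (\<Sum>i<n. \<bar>R i j0\<bar>))" using s by simp
   also have "\<dots> = \<delta>" using den by (simp add: s_def)
   finally show ?thesis using s by (simp add: abs_mult)
  qed
  then have "w\<in>cube n \<delta> z0" by (simp add: cube_def w_def z0_def Rn_iff)
  then obtain z where z: "z\<in>P" "F z = w" using \<delta>(2) by blast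
  have zB: "z\<in>B" using z P by blast
  have zR: "z\<in>Rn n" using zB openin_En_imp_subset[OF Bop] by blast
  have "z i = 0" if i: "i < k" for i
  proof -
   have "i < n" using i A(3) by simp
   have "lin n K z i = 0" using \<open>i < n\<close> i by (simp add: lin_def Krow)
   moreover have "w i = 0" using \<open>i < n\<close> i ij by (simp add: w_def R_def Krow)
   ultimately show ?thesis using fun_cong[OF z(2), of i] v_low[OF zB i] by (simp add: F_def)
  qed
  then have tz: "trunc k z = z0" by (simp add: trunc_def z0_def fun_eq_iff)
  \<comment> \<open>\<open>z\<close> lies over the origin, so \<open>star\<close> reads K v = v at
    \<open>z\<close>.\<close>
  have Kv: "lin n K (v z) i = v z i" if "i < n" for i
   using star[OF zB, of i] that Kij[OF that] by (simp add: lin_def tz)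
  \<comment> \<open>K times the defect is K - K K = 0, because the first \<open>k\<close> columns of
    \<open>K\<close> vanish.\<close>
  have Kw: "lin n K w i = 0" if i: "i < n" for i
  proof -
   have "(\<Sum>j<n. K $$ (i, j) * w j) = s * (\<Sum>j<n. K $$ (i, j) * R j j0)"
    by (simp add: w_def sum_distrib_left mult.left_commute)
   also have "(\<Sum>j<n. K $$ (i, j) * R j j0) = (\<Sum>j<n. (if j = j0 then (if k\<le>j0 then K $$ (i, j0) else 0) else 0)) - (\<Sum>j<n. K $$ (i, j) * K $$ (j, j0))"
    by (subst sum_subtractf[symmetric], rule sum.cong) (auto simp: R_def algebra_simps)
   also have "(\<Sum>j<n. K $$ (i, j) * K $$ (j, j0)) = (K * K) $$ (i, j0)"
    using Kc i ij by (simp add: scalar_prod_def atLeast0LessThan)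
   also have "\<dots> = K $$ (i, j0)" by (simp add: KK)
   also have "(\<Sum>j<n. (if j = j0 then (if k\<le>j0 then K $$ (i, j0) else 0) else 0)) = K $$ (i, j0)"
    using ij i Kcol[of i j0] by auto
   finally show ?thesis using i by (simp add: lin_def)
  qed
  \<comment> \<open>Applying \<open>K\<close> to F z = w annihilates the right side and the term (1
    - K) z, and leaves v z. So \<open>z\<close> has zero velocity and by regularity is a fixed point
    over the origin, although w, and with it z, is not zero.\<close>
  have "v z i = 0" if i: "i < n" for i
  proof -
   have "lin n K (F z) i = lin n K (v z) i + (lin n K z i - lin n K (lin n K z) i)"
    unfolding F_def lin_add lin_diff ..
   also have "lin n K (lin n K z) i = lin n K z i" by (simp add: lin_mult[OF Kc Kc] KK)
   finally show ?thesis using Kw[OF i] Kv[OF i] z(2) by simp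
  qed
  moreover obtain e where e: "e\<in>U" "z = \<phi> e" using zB BU by blast
  ultimately have "\<forall>i<n. vel h \<phi> e i = 0" using ve[OF e(1)] by simp
  then have "h (0, e) = e" using vel_eq_0_iff[OF A(1) A(7)[OF e(1)] A(5)[OF e(1)]] by blast
  then have "z = z0" using A(6)[OF e(1)] e(2) tz by simp
  then have "w = z0" using z(2) F0 by simp
  from fun_cong[OF this, of i0] have "s * R i0 j0 = 0" using ij(1) unfolding w_def z0_def by simp
  then show False using nz s by simp
 qed
 then show "pd j (\<lambda>z. v z i) (\<lambda>_. 0) = (if i = j \<and> k\<le>i then 1 else 0)" if "i < n" "j < n" for i j
  using Kij[OF that] that by (simp add: R_def z0_def)
qed

text \<open>In an adapted chart the two summands occupy complementary coordinates: h_0 e the first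
  \<open>bdim\<close>, the velocity the others. The sum thus only records the pair as one point of
  R^n.\<close>

definition Phat :: "('a \<Rightarrow> nat \<Rightarrow> real) \<Rightarrow> 'a \<Rightarrow> nat \<Rightarrow> real" where
 "Phat \<phi> e i = \<phi> (h (0, e)) i + vel h \<phi> e i"

text \<open>\<open>Gi\<close> is the coordinate expression of the inverse of \<open>Phat\<close>,
  defined on a cube so that it can be combined with rescaling. The last clause puts the fixed points
  with coordinates in the cube into the domain \<open>P\<close>, so that the orbits in their fibres
  enter it as the parameter tends to 0.\<close>

definition trivialised :: "'a set \<Rightarrow> ('a \<Rightarrow> nat \<Rightarrow> real) \<Rightarrow> real \<Rightarrow> (nat \<Rightarrow> real) set \<Rightarrow> ((nat \<Rightarrow> real) \<Rightarrow> nat \<Rightarrow> real) \<Rightarrow> bool" where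
 "trivialised U \<phi> \<delta> P Gi \<longleftrightarrow> (\<exists>\<epsilon>. adapted U \<phi> bdim \<epsilon>) \<and> \<delta> > 0 \<and> openin (En n) P \<and> P\<subseteq>\<phi> ` U \<and>
  smooth_coord_map n (cube n \<delta> (\<lambda>_. 0)) n Gi \<and>
  (\<forall>y\<in>cube n \<delta> (\<lambda>_. 0). Gi y\<in>P \<and> Phat \<phi> (inv_into U \<phi> (Gi y)) = y) \<and>
  (\<forall>e\<in>U. \<phi> e\<in>P \<longrightarrow> Phat \<phi> e\<in>cube n \<delta> (\<lambda>_. 0) \<and> Gi (Phat \<phi> e) = \<phi> e) \<and>
  cube n \<delta> (\<lambda>_. 0)\<inter>Rn bdim\<subseteq>P"

lemma trivialised_exists:
 assumes x: "x\<in>base"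
 obtains U \<phi> \<delta> P Gi where "trivialised U \<phi> \<delta> P Gi" "x\<in>U" "\<phi> x = (\<lambda>_. 0)"
proof -
 obtain U \<phi> \<epsilon> where ad: "adapted U \<phi> bdim \<epsilon>" and xU: "x\<in>U" and x0: "\<phi> x = (\<lambda>_. 0)"
  using adapted_exists_bdim[OF x] by metis
 note A = adaptedD[OF ad]
 note D = mfd_chartD[OF chartD[OF A(1)]]
 let ?k = bdim and ?B = "cube n \<epsilon> (\<lambda>_. 0)"
 define v where "v z = vel h \<phi> (inv_into U \<phi> z)" for z
 note L = vel_linearise[OF ad xU x0, folded v_def]
 have B: "openin (En n) ?B" by simp
 have zB: "(\<lambda>_. 0)\<in>?B" using A(2) by (auto simp: cube_def Rn_iff)
 define G where "G z i = trunc ?k z i + v z i" for z i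
 have t: "smooth_coord_map n ?B n (trunc ?k)" by (rule smooth_trunc_into[OF B A(3)])
 have Gs: "smooth_coord_map n ?B n G" unfolding G_def by (rule cmap_add[OF t L(1)])
 have Ge: "G (\<phi> e) = Phat \<phi> e" if "e\<in>U" for e
  using A(6)[OF that] D(6)[OF that] by (simp add: G_def Phat_def v_def fun_eq_iff)
 have Gz: "G z = Phat \<phi> (inv_into U \<phi> z)" if "z\<in>\<phi> ` U" for z using Ge D(6) that by auto
 \<comment> \<open>Truncation contributes the unit entries below \<open>bdim\<close> and, by
   \<open>vel_linearise\<close>, the velocity those from \<open>bdim\<close> on.\<close>
 have jG: "pd j (\<lambda>z. G z i) (\<lambda>_. 0) = (if i = j then 1 else 0)" if ij: "i < n" "j < n" for i j
 proof (rule pd_unique)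
  have "has_pd j (\<lambda>z. trunc ?k z i) (if i = j \<and> i < ?k then 1 else 0) (\<lambda>_. 0)"
   by (cases "i < ?k"; cases "i = j") (simp_all add: has_pd_def trunc_def)
  moreover have "has_pd j (\<lambda>z. v z i) (if i = j \<and> ?k\<le>i then 1 else 0) (\<lambda>_. 0)"
   using smooth_fun_has_pd[OF cmapD(3)[OF L(1)] ij(2) zB, of i] L(2)[OF ij] by simp
  ultimately have "has_pd j (\<lambda>z. G z i) ((if i = j \<and> i < ?k then 1 else 0) + (if i = j \<and> ?k\<le>i then 1 else 0)) (\<lambda>_. 0)"
   unfolding has_pd_def G_def by (rule DERIV_add)
  also have "(if i = j \<and> i < ?k then 1 else 0) + (if i = j \<and> ?k\<le>i then 1 else 0) = (if i = j then 1 else (0::real))" by auto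
  finally show "has_pd j (\<lambda>z. G z i) (if i = j then 1 else 0) (\<lambda>_. 0)" .
 qed
 from inverse_function_id[OF Gs zB jG] obtain P0 where P0: "(\<lambda>_. 0)\<in>P0" "P0\<subseteq>?B" "coord_diffeo n P0 (G ` P0) G" by metis
 obtain Gi where Gi: "coord_diffeo n (G ` P0) P0 Gi" "\<And>z. z\<in>P0 ==> Gi (G z) = z" "\<And>y. y\<in>G ` P0 ==> G (Gi y) = y"
  using coord_diffeo_inverse[OF P0(3)] by metis
 have Gis: "smooth_coord_map n (G ` P0) n Gi" using Gi(1) by (simp add: coord_diffeo_def)
 have Gs0: "smooth_coord_map n P0 n G" using P0(3) by (simp add: coord_diffeo_def)
 have v0: "v (\<lambda>_. 0) = (\<lambda>_. 0)"
 proof -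
  have "inv_into U \<phi> (\<lambda>_. 0) = x" using D(6)[OF xU] x0 by simp
  then have "v (\<lambda>_. 0) = vel h \<phi> x" by (simp add: v_def)
  moreover have "(\<lambda>t. \<phi> (h (t, x)) i) = (\<lambda>t. \<phi> x i)" for i using baseD(2)[OF x] by simp
  ultimately show ?thesis by (simp add: vel_def[abs_def])
 qed
 have G0: "G (\<lambda>_. 0) = (\<lambda>_. 0)" using v0 by (simp add: G_def trunc_def fun_eq_iff)
 \<comment> \<open>The cube has to lie in the image, where \<open>Gi\<close> is defined, and also in
   \<open>P0\<close>, because \<open>G\<close> fixes the coordinates of base points and these must
   belong to \<open>P\<close>.\<close>
 have "openin (En n) (P0\<inter>G ` P0)" using cmapD(1)[OF Gs0] cmapD(1)[OF Gis] by blast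
 moreover have "(\<lambda>_. 0)\<in>P0\<inter>G ` P0" using P0(1) G0 by (metis IntI imageI)
 ultimately obtain \<delta> where \<delta>: "\<delta> > 0" "cube n \<delta> (\<lambda>_. 0)\<subseteq>P0\<inter>G ` P0" using cube_nbhd by metis
 define P where "P = {z\<in>P0. G z\<in>cube n \<delta> (\<lambda>_. 0)}"
 have "openin (En n) P" unfolding P_def by (rule cmap_openin_preimage[OF Gs0 openin_cube])
 moreover have PU: "P\<subseteq>\<phi> ` U" using P0(2) A(4) by (auto simp: P_def)
 moreover have "smooth_coord_map n (cube n \<delta> (\<lambda>_. 0)) n Gi"
  by (rule cmap_subset[OF Gis openin_cube]) (use \<delta>(2) in blast)
 moreover have "Gi y\<in>P \<and> Phat \<phi> (inv_into U \<phi> (Gi y)) = y" if y: "y\<in>cube n \<delta> (\<lambda>_. 0)" for y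
 proof -
  have yG: "y\<in>G ` P0" using y \<delta>(2) by blast
  have "Gi y\<in>P0" using Gi(1) yG by (auto simp: coord_diffeo_def bij_betw_def)
  then have "Gi y\<in>P" using Gi(3)[OF yG] y by (simp add: P_def)
  then show ?thesis using Gz[of "Gi y"] PU Gi(3)[OF yG] by auto
 qed
 moreover have "Phat \<phi> e\<in>cube n \<delta> (\<lambda>_. 0) \<and> Gi (Phat \<phi> e) = \<phi> e" if "e\<in>U" "\<phi> e\<in>P" for e
  using that Gi(2) unfolding Ge[OF that(1), symmetric] by (simp add: P_def)
 moreover have "cube n \<delta> (\<lambda>_. 0)\<inter>Rn ?k\<subseteq>P"
 proof
  fix z assume z: "z\<in>cube n \<delta> (\<lambda>_. 0)\<inter>Rn ?k"
  then have "z\<in>P0" using \<delta>(2) by blast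
  then have "z\<in>\<phi> ` U" using P0(2) A(4) by blast
  then obtain e where e: "e\<in>U" "z = \<phi> e" by blast
  have "e\<in>base" using A(8)[OF e(1)] z e(2) by simp
  then have "(\<lambda>t. \<phi> (h (t, e)) i) = (\<lambda>t. \<phi> e i)" for i by (simp add: baseD(2))
  then have "vel h \<phi> e i = 0" for i by (simp add: vel_def)
  then have "G z = z" unfolding e(2) Ge[OF e(1)] using baseD(2)[OF \<open>e\<in>base\<close>] by (simp add: Phat_def fun_eq_iff)
  then show "z\<in>P" using z \<open>z\<in>P0\<close> by (simp add: P_def)
 qed
 ultimately have "trivialised U \<phi> \<delta> P Gi" unfolding trivialised_def using ad \<delta>(1) by blast
 then show thesis using that xU x0 by blast
qed

end

text \<open>The action h_s as seen through \<open>Phat\<close>: base coordinates stay and fibre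
  coordinates are multiplied by \<open>s\<close>.\<close>

definition sc :: "nat \<Rightarrow> real \<Rightarrow> (nat \<Rightarrow> real) \<Rightarrow> nat \<Rightarrow> real" where
 "sc k s y = (\<lambda>i. if i < k then y i else s * y i)"

lemma sc_Rn: "y\<in>Rn n ==> sc k s y\<in>Rn n"
 by (auto simp: sc_def Rn_iff)

lemma sc_sc: "sc k s (sc k t y) = sc k (s * t) y"
 by (auto simp: sc_def fun_eq_iff)

lemma sc_1 [simp]: "sc k 1 y = y"
 by (auto simp: sc_def fun_eq_iff)

section \<open>Spreading the local trivialisation over whole fibres\<close>

locale trivialised_mfd = regular_mfd +
 fixes U :: "'a set" and \<phi> :: "'a \<Rightarrow> nat \<Rightarrow> real" and \<delta> :: real
  and P :: "(nat \<Rightarrow> real) set" and Gi :: "(nat \<Rightarrow> real) \<Rightarrow> nat \<Rightarrow> real"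
 assumes triv: "trivialised U \<phi> \<delta> P Gi"
begin

abbreviation "k \<equiv> bdim"
abbreviation "\<Delta> \<equiv> cube n \<delta> (\<lambda>_. 0)"

lemma trivD:
 "\<delta> > 0" "openin (En n) P" "P\<subseteq>\<phi> ` U" "smooth_coord_map n \<Delta> n Gi"
 "\<And>y. y\<in>\<Delta> ==> Gi y\<in>P" "\<And>y. y\<in>\<Delta> ==> Phat \<phi> (inv_into U \<phi> (Gi y)) = y"
 "\<And>e. e\<in>U ==> \<phi> e\<in>P ==> Phat \<phi> e\<in>\<Delta>" "\<And>e. e\<in>U ==> \<phi> e\<in>P ==> Gi (Phat \<phi> e) = \<phi> e"
 "\<And>y. y\<in>\<Delta> ==> y\<in>Rn k ==> y\<in>P"
 using triv by (auto simp: trivialised_def)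

lemma ad: obtains \<epsilon> where "adapted U \<phi> k \<epsilon>"
 using triv by (auto simp: trivialised_def)

lemma
 shows cU: "(U, \<phi>)\<in>mcharts E" and k_le: "k\<le>n" and pU: "\<And>e. e\<in>U ==> h (0, e)\<in>U"
  and pt: "\<And>e. e\<in>U ==> \<phi> (h (0, e)) = trunc k (\<phi> e)" and UE: "\<And>e. e\<in>U ==> e\<in>mpoints E"
  and baseU: "\<And>e. e\<in>U ==> e\<in>base \<longleftrightarrow> \<phi> e\<in>Rn k"
  and vel_low: "\<And>e i. e\<in>mpoints E ==> h (0, e)\<in>U ==> i < k ==> vel h \<phi> e i = 0"
  and slice: "(U\<inter>base, \<phi>)\<in>mcharts base_mfd"
proof -
 obtain \<epsilon> where a: "adapted U \<phi> k \<epsilon>" by (rule ad)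
 note A = adaptedD[OF a]
 show "(U, \<phi>)\<in>mcharts E" "k\<le>n" by (rule A)+
 show "h (0, e)\<in>U" "\<phi> (h (0, e)) = trunc k (\<phi> e)" "e\<in>mpoints E" "e\<in>base \<longleftrightarrow> \<phi> e\<in>Rn k" if "e\<in>U" for e
  using A(5-8) that by auto
 show "vel h \<phi> e i = 0" if "e\<in>mpoints E" "h (0, e)\<in>U" "i < k" for e i using adapted_vel_low[OF a that] .
 show "(U\<inter>base, \<phi>)\<in>mcharts base_mfd" by (rule base_chart[OF a])
qed

lemma chU: "mfd_chart (mtop E) n (U, \<phi>)" by (rule chartD[OF cU])

text \<open>\<open>U1\<close> is the part of the base over which the bundle gets trivialised and
  \<open>S\<close> its full preimage under h_0, whereas \<open>U'\<close> is only a neighbourhood of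
  \<open>U1\<close> on which \<open>Phat\<close> is already known to be invertible.\<close>

definition "U1 = {x\<in>U\<inter>base. \<phi> x\<in>\<Delta>}"
definition "S = {e\<in>mpoints E. h (0, e)\<in>U1}"
definition "U' = {e\<in>U. \<phi> e\<in>P}"

lemma U1D: "x\<in>U1 ==> x\<in>U" "x\<in>U1 ==> x\<in>base" "x\<in>U1 ==> \<phi> x\<in>\<Delta>" "x\<in>U1 ==> \<phi> x\<in>Rn k"
 using baseU by (auto simp: U1_def)

lemma SD: "e\<in>S ==> e\<in>mpoints E" "e\<in>S ==> h (0, e)\<in>U1" "e\<in>S ==> h (0, e)\<in>U"
 using U1D by (auto simp: S_def)

lemma S_h: "e\<in>S ==> h (s, e)\<in>S"
 by (simp add: S_def h_in proj_h)

lemma U1_U': "x\<in>U1 ==> x\<in>U'"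
 using U1D trivD(9) by (auto simp: U'_def)

lemma openU': "openin (mtop E) U'"
 unfolding U'_def by (rule mfd_chartD(8)[OF chU trivD(2)])

lemma Phat_low: "e\<in>S ==> i < k ==> Phat \<phi> e i = \<phi> (h (0, e)) i"
 by (simp add: Phat_def vel_low SD)

lemma Phat_high: "e\<in>S ==> i\<ge>k ==> Phat \<phi> e i = vel h \<phi> e i"
 using U1D(4)[OF SD(2), of e] by (simp add: Phat_def Rn_iff)

lemma Phat_h: "e\<in>S ==> Phat \<phi> (h (s, e)) = sc k s (Phat \<phi> e)"
proof
 fix i assume e: "e\<in>S"
 show "Phat \<phi> (h (s, e)) i = sc k s (Phat \<phi> e) i"
  using Phat_low[OF e] Phat_high[OF e] Phat_low[OF S_h[OF e]] Phat_high[OF S_h[OF e]]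
  by (cases "i < k") (simp_all add: sc_def proj_h SD(1)[OF e] vel_h[OF cU SD(1)[OF e] SD(3)[OF e]])
qed

lemma U'_S: "e\<in>U' ==> e\<in>S"
proof -
 assume "e\<in>U'"
 then have e: "e\<in>U" "\<phi> e\<in>P" by (auto simp: U'_def)
 have eE: "e\<in>mpoints E" by (rule UE[OF e(1)])
 have "\<bar>\<phi> (h (0, e)) i\<bar> < \<delta>" if i: "i < k" for i
 proof -
  have "\<bar>Phat \<phi> e i\<bar> < \<delta>" using trivD(7)[OF e] i k_le by (auto simp: cube_def)
  then show ?thesis using vel_low[OF eE pU[OF e(1)] i] by (simp add: Phat_def)
 qed
 moreover have "\<phi> (h (0, e)) i = 0" if "i\<ge>k" for i using pt[OF e(1)] that by (simp add: trunc_def)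
 ultimately have "\<bar>\<phi> (h (0, e)) i\<bar> < \<delta>" for i using trivD(1) by (cases "i < k") auto
 then have "\<phi> (h (0, e))\<in>\<Delta>" using mfd_chartD(5)[OF chU pU[OF e(1)]] by (simp add: cube_def)
 then show "e\<in>S" using pU[OF e(1)] proj_base[OF eE] eE by (simp add: S_def U1_def)
qed

text \<open>As s tends to 0, h_s e tends to h_0 e, a point of \<open>U1\<close> and so of the open
  set \<open>U'\<close>. Positive parameters are used because h_s has to be inverted
  afterwards.\<close>

lemma scale_into: "e\<in>S ==> \<forall>\<^sub>F s in at_right 0. h (s, e)\<in>U'"
proof -
 assume e: "e\<in>S"
 have "\<forall>\<^sub>F s in nhds 0. h (s, e)\<in>U'" by (rule h_eventually[OF SD(1)[OF e] openU']) (use U1_U' SD(2) e in auto)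
 then show ?thesis unfolding eventually_nhds_conv_at eventually_at_split by blast
qed

text \<open>Both points are moved into \<open>U'\<close> by h_s with a common small s > 0,
  identified there by the local inverse, and moved back by h_(1/s).\<close>

lemma Phat_inj: "inj_on (Phat \<phi>) S"
proof (rule inj_onI)
 fix e1 e2 assume e: "e1\<in>S" "e2\<in>S" "Phat \<phi> e1 = Phat \<phi> e2"
 have "\<forall>\<^sub>F s in at_right (0::real). h (s, e1)\<in>U' \<and> h (s, e2)\<in>U' \<and> s > 0"
  using scale_into[OF e(1)] scale_into[OF e(2)] eventually_at_right_less[of "0::real"] by eventually_elim auto
 from eventually_happens'[OF trivial_limit_at_right_real this]
 obtain s where s: "h (s, e1)\<in>U'" "h (s, e2)\<in>U'" "s > 0" by blast
 have eq: "Phat \<phi> (h (s, e1)) = Phat \<phi> (h (s, e2))" unfolding Phat_h[OF e(1)] Phat_h[OF e(2)] e(3) ..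
 have "Gi (Phat \<phi> (h (s, e1))) = \<phi> (h (s, e1))" by (rule trivD(8)) (use s in \<open>simp_all add: U'_def\<close>)
 moreover have "Gi (Phat \<phi> (h (s, e2))) = \<phi> (h (s, e2))" by (rule trivD(8)) (use s in \<open>simp_all add: U'_def\<close>)
 ultimately have "\<phi> (h (s, e1)) = \<phi> (h (s, e2))" using eq by simp
 then have "h (s, e1) = h (s, e2)"
  by (rule inj_onD[OF mfd_chartD(4)[OF chU]]) (use s in \<open>simp_all add: U'_def\<close>)
 then have "h (inverse s, h (s, e1)) = h (inverse s, h (s, e2))" by simp
 then show "e1 = e2" using s(3) by (simp only: h_inverse[OF SD(1)[OF e(1)]] h_inverse[OF SD(1)[OF e(2)]] less_imp_neq[symmetric] not_False_eq_True)
qed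

text \<open>The inverse of \<open>Phat\<close> on all of \<open>S\<close>: scale down into the cube,
  apply the local inverse, scale back. The value is the same for all s > 0 for which
  \<open>sc k s y\<close> lies in the cube.\<close>

definition "Psi s y = h (inverse s, inv_into U \<phi> (Gi (sc k s y)))"

lemma Psi_in:
 assumes s: "s > 0" and y: "sc k s y\<in>\<Delta>"
 shows "Psi s y\<in>S" "Phat \<phi> (Psi s y) = y"
proof -
 let ?e = "inv_into U \<phi> (Gi (sc k s y))"
 have "Gi (sc k s y)\<in>\<phi> ` U" using trivD(5)[OF y] trivD(3) by blast
 then have "?e\<in>U" "\<phi> ?e = Gi (sc k s y)" by (auto simp: inv_into_into f_inv_into_f)
 then have "?e\<in>U'" using trivD(5)[OF y] by (simp add: U'_def)
 then have eS: "?e\<in>S" by (rule U'_S)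
 then show "Psi s y\<in>S" unfolding Psi_def by (rule S_h)
 show "Phat \<phi> (Psi s y) = y" unfolding Psi_def Phat_h[OF eS] trivD(6)[OF y] sc_sc using s by simp
qed

lemma scale_exists:
 assumes y: "y\<in>Rn n" "\<And>i. i < k ==> \<bar>y i\<bar> < \<delta>"
 obtains s where "s > 0" "sc k s y\<in>\<Delta>"
proof -
 \<comment> \<open>Only the coordinates from \<open>k\<close> on are multiplied by \<open>s\<close>;
   the first \<open>k\<close> are covered by the assumption on \<open>y\<close>. Adding 1 to the sum
   avoids division by zero.\<close>
 define s where "s = \<delta> / (1 + (\<Sum>i<n. \<bar>y i\<bar>))"
 have den: "1 + (\<Sum>i<n. \<bar>y i\<bar>) > 0" by (simp add: add_pos_nonneg sum_nonneg)
 have s: "s > 0" unfolding s_def using trivD(1) den by simp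
 have "\<bar>s * y i\<bar> < \<delta>" if "i < n" for i
 proof -
  have "\<bar>y i\<bar>\<le>(\<Sum>i<n. \<bar>y i\<bar>)" using that by (intro member_le_sum) auto
  then have "\<bar>y i\<bar> < 1 + (\<Sum>i<n. \<bar>y i\<bar>)" by simp
  then have "s * \<bar>y i\<bar> < s * (1 + (\<Sum>i<n. \<bar>y i\<bar>))" using s by simp
  also have "\<dots> = \<delta>" using den by (simp add: s_def)
  finally show ?thesis using s by (simp add: abs_mult)
 qed
 then have "sc k s y\<in>\<Delta>" using y sc_Rn[OF y(1)] by (auto simp: cube_def sc_def)
 with s that show thesis by blast
qed

text \<open>\<open>shift k\<close> discards the velocity coordinates that vanish identically in an
  adapted chart.\<close>

definition "triv_map e = (h (0, e), shift k (vel h \<phi> e))"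

abbreviation "Emf \<equiv> open_submfd E S"
abbreviation "Bmf \<equiv> open_submfd base_mfd U1"
abbreviation "Pmf \<equiv> prod_mfd Bmf (Rn_mfd (n - k))"

lemma openU1: "openin (mtop base_mfd) U1"
proof -
 have "openin (mtop E) {x\<in>U. \<phi> x\<in>\<Delta>}" by (rule mfd_chartD(8)[OF chU openin_cube])
 moreover have "U1 = {x\<in>U. \<phi> x\<in>\<Delta>}\<inter>base" by (auto simp: U1_def)
 ultimately show ?thesis by (auto simp: openin_subtopology)
qed

lemma openS: "openin (mtop E) S"
 unfolding S_def by (rule openin_continuous_map_preimage[OF smooth_map_cont[OF smooth_proj] openU1])

lemma atlE: "atlas_mfd Emf" by (rule atlas_open_submfd[OF atl openS])
lemma atlB: "atlas_mfd Bmf" by (rule atlas_open_submfd[OF atlas_base openU1])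
lemma atlP: "atlas_mfd Pmf" by (rule atlas_prod_mfd[OF atlB atlas_Rn_mfd])

lemma ptsE: "mpoints Emf = S" using SD(1) by auto
lemma ptsB: "mpoints Bmf = U1" using U1D(2) baseD(1) by auto
lemma ptsP: "mpoints Pmf = U1\<times>Rn (n - k)" using ptsB by simp

lemma Phat_join:
 assumes "e\<in>S" shows "Phat \<phi> e = join_coords k (\<phi> (h (0, e))) (shift k (vel h \<phi> e))"
proof
 fix i show "Phat \<phi> e i = join_coords k (\<phi> (h (0, e))) (shift k (vel h \<phi> e)) i"
  using Phat_low[OF assms] Phat_high[OF assms] by (cases "i < k") (simp_all add: join_coords_def shift_def)
qed

lemma shift_vel: "e\<in>S ==> shift k (vel h \<phi> e)\<in>Rn (n - k)"
 using vel_Rn[OF cU SD(1) SD(3)] k_le shift_Rn[of _ k "n - k"] by simp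

text \<open>Surjectivity comes from \<open>Psi\<close>. The coordinate equation is kept because it
  identifies the inverse with \<open>Psi\<close> when its smoothness is shown.\<close>

lemma triv_map_inverse:
 assumes p: "p\<in>U1\<times>Rn (n - k)"
 obtains e where "e\<in>S" "triv_map e = p" "Phat \<phi> e = join_coords k (\<phi> (fst p)) (snd p)"
proof -
 obtain x w where xw: "p = (x, w)" "x\<in>U1" "w\<in>Rn (n - k)" using p by auto
 define y where "y = join_coords k (\<phi> x) w"
 note J = join_coords_simps[OF U1D(4)[OF xw(2)] xw(3)]
 have yR: "y\<in>Rn n" using J(1) k_le by (simp add: y_def)
 have "\<bar>y i\<bar> < \<delta>" if "i < k" for i using U1D(3)[OF xw(2)] that k_le by (auto simp: y_def join_coords_def cube_def)
 then obtain s where s: "s > 0" "sc k s y\<in>\<Delta>" using scale_exists[OF yR] by metis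
 note Q = Psi_in[OF s]
 have eq: "join_coords k (\<phi> (h (0, Psi s y))) (shift k (vel h \<phi> (Psi s y))) = join_coords k (\<phi> x) w"
  using Phat_join[OF Q(1)] Q(2) by (simp add: y_def)
 note J' = join_coords_simps[OF U1D(4)[OF SD(2)[OF Q(1)]] shift_vel[OF Q(1)]]
 have "\<phi> (h (0, Psi s y)) = \<phi> x" using J'(2) J(2) eq by simp
 then have "h (0, Psi s y) = x"
  by (rule inj_onD[OF mfd_chartD(4)[OF chU] _ SD(3)[OF Q(1)] U1D(1)[OF xw(2)]])
 moreover have "shift k (vel h \<phi> (Psi s y)) = w" using J'(3) J(3) eq by simp
 ultimately show thesis using that[OF Q(1)] Q(2) xw by (simp add: triv_map_def y_def)
qed

lemma triv_map_bij: "bij_betw triv_map S (U1\<times>Rn (n - k))"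
proof (rule bij_betwI')
 fix e1 e2 assume e: "e1\<in>S" "e2\<in>S"
 show "triv_map e1 = triv_map e2 \<longleftrightarrow> e1 = e2"
  using Phat_join[OF e(1)] Phat_join[OF e(2)] inj_onD[OF Phat_inj _ e] by (auto simp: triv_map_def)
next
 fix e assume "e\<in>S" then show "triv_map e\<in>U1\<times>Rn (n - k)" using SD(2) shift_vel by (simp add: triv_map_def)
next
 fix p assume "p\<in>U1\<times>Rn (n - k)"
 then show "\<exists>e\<in>S. p = triv_map e" using triv_map_inverse by metis
qed

lemma smooth_triv_map: "smooth_map Emf Pmf triv_map"
 unfolding triv_map_def
proof (rule smooth_map_pair[OF atlE atlB atlas_Rn_mfd])
 show "smooth_map Emf Bmf (\<lambda>e. h (0, e))"
  by (rule smooth_map_open_codomain[OF atlE atlas_base openU1 smooth_map_open_domain[OF atl atlas_base openS smooth_proj]])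
   (use ptsE SD(2) in auto)
 show "smooth_map Emf (Rn_mfd (n - k)) (\<lambda>e. shift k (vel h \<phi> e))"
 proof (rule smooth_mapI[OF atlE atlas_Rn_mfd])
  fix e assume "e\<in>mpoints Emf"
  then have e: "e\<in>S" by simp
  have "smooth_at Emf (\<lambda>e. shift k (vel h \<phi> e) i) e" for i
   using smooth_vel[OF cU SD(1)[OF e] SD(3)[OF e]] smooth_at_open_submfd[OF atl openS e] by (simp add: shift_def)
  then show "\<exists>W V \<psi>. openin (mtop Emf) W \<and> e\<in>W \<and> (V, \<psi>)\<in>mcharts (Rn_mfd (n - k)) \<and>
    (\<lambda>e. shift k (vel h \<phi> e)) ` W\<subseteq>V \<and> (\<forall>i<mdim (Rn_mfd (n - k)). smooth_at Emf (\<lambda>y. \<psi> (shift k (vel h \<phi> y)) i) e)"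
   using Rn_mfd_chart shift_vel e ptsE
   by (intro exI[of _ "mpoints Emf"] exI[of _ "Rn (n - k)"] exI[of _ "\<lambda>x. x"] conjI openin_topspace) auto
 qed
qed

lemma smooth_inv_coords: "smooth_map (open_submfd (Rn_mfd n) \<Delta>) E (\<lambda>y. inv_into U \<phi> (Gi y))"
proof (rule smooth_mapI[OF atlas_open_submfd[OF atlas_Rn_mfd] atl])
 show o: "openin (mtop (Rn_mfd n)) \<Delta>" by simp
 fix y assume "y\<in>mpoints (open_submfd (Rn_mfd n) \<Delta>)"
 then have y: "y\<in>\<Delta>" by simp
 have GU: "Gi z\<in>\<phi> ` U" if "z\<in>\<Delta>" for z using trivD(5)[OF that] trivD(3) by blast
 have "smooth_at (Rn_mfd n) (\<lambda>y. Gi y i) y" for i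
  by (rule smooth_at_Rn_mfd[OF cmapD(3)[OF trivD(4)] y])
 then have "smooth_at (Rn_mfd n) (\<lambda>y. \<phi> (inv_into U \<phi> (Gi y)) i) y" for i
  by (rule smooth_at_cong[OF atlas_Rn_mfd _ o y]) (simp add: f_inv_into_f[OF GU])
 then have "smooth_at (open_submfd (Rn_mfd n) \<Delta>) (\<lambda>y. \<phi> (inv_into U \<phi> (Gi y)) i) y" for i
  using smooth_at_open_submfd[OF atlas_Rn_mfd o y] by blast
 moreover have "(\<lambda>y. inv_into U \<phi> (Gi y)) ` \<Delta>\<subseteq>U" using GU by (auto simp: inv_into_into)
 moreover have "openin (mtop (open_submfd (Rn_mfd n) \<Delta>)) \<Delta>" by (simp add: openin_open_subtopology)
 ultimately show "\<exists>W V \<psi>. openin (mtop (open_submfd (Rn_mfd n) \<Delta>)) W \<and> y\<in>W \<and> (V, \<psi>)\<in>mcharts E \<and>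
   (\<lambda>y. inv_into U \<phi> (Gi y)) ` W\<subseteq>V \<and> (\<forall>i<mdim E. smooth_at (open_submfd (Rn_mfd n) \<Delta>) (\<lambda>y. \<psi> (inv_into U \<phi> (Gi y)) i) y)"
  using cU y by (intro exI[of _ \<Delta>] exI[of _ U] exI[of _ \<phi>] conjI allI impI)
qed

lemma smooth_sc_join:
 "smooth_map Pmf (Rn_mfd n) (\<lambda>p. sc k s (join_coords k (\<phi> (fst p)) (snd p)))"
proof (rule smooth_mapI[OF atlP atlas_Rn_mfd])
 fix p assume p: "p\<in>mpoints Pmf"
 have pp: "fst p\<in>U1" "snd p\<in>Rn (n - k)" using p[unfolded ptsP] by (simp_all only: mem_Times_iff)
 have 1: "smooth_at Pmf (\<lambda>p. \<phi> (fst p) i) p" for i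
 proof (rule smooth_at_fst[OF atlB atlas_Rn_mfd])
  have "smooth_at base_mfd (\<lambda>x. \<phi> x i) (fst p)" by (rule smooth_at_coord[OF atlas_base slice]) (use U1D pp in auto)
  then show "smooth_at Bmf (\<lambda>x. \<phi> x i) (fst p)" using smooth_at_open_submfd[OF atlas_base openU1 pp(1)] by blast
 qed (use pp in simp)
 have 2: "smooth_at Pmf (\<lambda>p. snd p i) p" for i
  by (rule smooth_at_snd[OF atlB atlas_Rn_mfd]) (use pp ptsB smooth_at_coord[OF atlas_Rn_mfd Rn_mfd_chart] in auto)
 have 3: "smooth_at Pmf (\<lambda>p. s * snd p i) p" for i
  by (rule smooth_at_mult[OF atlP smooth_at_const[OF atlP p] 2])
 have "smooth_at Pmf (\<lambda>p. sc k s (join_coords k (\<phi> (fst p)) (snd p)) i) p" for i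
  using 1 3 by (cases "i < k") (simp_all add: sc_def join_coords_def)
 moreover have "sc k s (join_coords k (\<phi> (fst q)) (snd q))\<in>Rn n" if "q\<in>mpoints Pmf" for q
 proof (rule sc_Rn)
  have q: "fst q\<in>U1" "snd q\<in>Rn (n - k)" using that[unfolded ptsP] by (simp_all only: mem_Times_iff)
  show "join_coords k (\<phi> (fst q)) (snd q)\<in>Rn n" using join_coords_simps(1)[OF U1D(4)[OF q(1)] q(2)] k_le by simp
 qed
 ultimately show "\<exists>W V \<psi>. openin (mtop Pmf) W \<and> p\<in>W \<and> (V, \<psi>)\<in>mcharts (Rn_mfd n) \<and>
   (\<lambda>p. sc k s (join_coords k (\<phi> (fst p)) (snd p))) ` W\<subseteq>V \<and>
   (\<forall>i<mdim (Rn_mfd n). smooth_at Pmf (\<lambda>y. \<psi> (sc k s (join_coords k (\<phi> (fst y)) (snd y))) i) p)"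
  using Rn_mfd_chart p by (intro exI[of _ "mpoints Pmf"] exI[of _ "Rn n"] exI[of _ "\<lambda>x. x"] conjI openin_topspace) auto
qed

text \<open>The scaling factor that works at \<open>p\<close> works on a neighbourhood
  \<open>W\<close> of it, and with \<open>s\<close> fixed \<open>Psi\<close> is a composite of
  smooth maps.\<close>

lemma smooth_triv_map_inv: "smooth_map Pmf Emf (inv_into S triv_map)"
proof (rule smooth_map_local[OF atlP atlE])
 fix p assume p: "p\<in>mpoints Pmf"
 then have pp: "p\<in>U1\<times>Rn (n - k)" unfolding ptsP .
 let ?J = "\<lambda>p. join_coords k (\<phi> (fst p)) (snd p)"
 have pp': "fst p\<in>U1" "snd p\<in>Rn (n - k)" using pp by (simp_all only: mem_Times_iff)
 have JR: "?J p\<in>Rn n" using join_coords_simps(1)[OF U1D(4)[OF pp'(1)] pp'(2)] k_le by simp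
 have "\<bar>?J p i\<bar> < \<delta>" if "i < k" for i using U1D(3)[OF pp'(1)] that k_le by (auto simp: join_coords_def cube_def)
 then obtain s where s: "s > 0" "sc k s (?J p)\<in>\<Delta>" using scale_exists[OF JR] by metis
 define W where "W = {q\<in>mpoints Pmf. sc k s (?J q)\<in>\<Delta>}"
 have W: "openin (mtop Pmf) W" unfolding W_def
  by (rule openin_continuous_map_preimage[OF smooth_map_cont[OF smooth_sc_join]]) simp
 have pW: "p\<in>W" using p s by (simp add: W_def)
 have atlW: "atlas_mfd (open_submfd Pmf W)" by (rule atlas_open_submfd[OF atlP W])
 have oD: "openin (mtop (Rn_mfd n)) \<Delta>" by simp
 have 1: "smooth_map (open_submfd Pmf W) (open_submfd (Rn_mfd n) \<Delta>) (\<lambda>p. sc k s (?J p))"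
  by (rule smooth_map_open_codomain[OF atlW atlas_Rn_mfd oD smooth_map_open_domain[OF atlP atlas_Rn_mfd W smooth_sc_join]])
   (auto simp: W_def)
 have 2: "smooth_map (open_submfd Pmf W) E (\<lambda>p. Psi s (?J p))" unfolding Psi_def
  by (rule smooth_map_compose[OF atlW atl atl smooth_map_compose[OF atlW atlas_open_submfd[OF atlas_Rn_mfd oD] atl 1 smooth_inv_coords] smooth_h])
 have PS: "Psi s (?J q)\<in>S" "Phat \<phi> (Psi s (?J q)) = ?J q" if "q\<in>W" for q using Psi_in[OF s(1), of "?J q"] that by (auto simp: W_def)
 have 3: "smooth_map (open_submfd Pmf W) Emf (\<lambda>p. Psi s (?J p))"
  by (rule smooth_map_open_codomain[OF atlW atl openS 2]) (use PS in auto)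
 have "Psi s (?J q) = inv_into S triv_map q" if q: "q\<in>W" for q
 proof -
  have "q\<in>U1\<times>Rn (n - k)" using q unfolding W_def ptsP by blast
  then obtain e where e: "e\<in>S" "triv_map e = q" "Phat \<phi> e = ?J q" by (rule triv_map_inverse)
  have "e = Psi s (?J q)" by (rule inj_onD[OF Phat_inj _ e(1) PS(1)[OF q]]) (simp add: e PS(2)[OF q])
  moreover have "inv_into S triv_map q = e"
   using e bij_betw_imp_inj_on[OF triv_map_bij] by (metis inv_into_f_f)
  ultimately show ?thesis by simp
 qed
 then have "smooth_map (open_submfd Pmf W) Emf (inv_into S triv_map)"
  by (intro smooth_map_cong[OF atlW atlE 3]) auto
 then show "\<exists>W. openin (mtop Pmf) W \<and> p\<in>W \<and> smooth_map (open_submfd Pmf W) Emf (inv_into S triv_map)"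
  using W pW by blast
qed

lemma triv_diffeo: "diffeomorphism Emf Pmf triv_map"
 using triv_map_bij smooth_triv_map smooth_triv_map_inv unfolding diffeomorphism_def ptsE ptsP by blast

end

text \<open>Defined through all charts around the base point at once, so that no choice of a
  trivialisation enters and the result can be compared with the addition of an arbitrary bundle.
  That one chart suffices to recognise the sum is shown in \<open>badd_eqI\<close>.\<close>

definition badd :: "'a mfd \<Rightarrow> (real\<times>'a \<Rightarrow> 'a) \<Rightarrow> 'a \<Rightarrow> 'a \<Rightarrow> 'a" where
 "badd E h u v = (THE e. e\<in>mpoints E \<and> h (0, e) = h (0, u) \<and>
   (\<forall>(V, \<psi>)\<in>mcharts E. h (0, u)\<in>V \<longrightarrow> (\<forall>i<mdim E. vel h \<psi> e i = vel h \<psi> u i + vel h \<psi> v i)))"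

section \<open>Fibre addition and the vector bundle over the fixed points\<close>

context regular_mfd
begin

text \<open>In a trivialising chart this is injectivity of \<open>Phat\<close>; the given chart is
  reached through \<open>vel_change\<close>.\<close>

lemma vel_inj:
 assumes e: "e\<in>mpoints E" "e'\<in>mpoints E" "h (0, e) = h (0, e')" and c: "(V, \<psi>)\<in>mcharts E" "h (0, e)\<in>V"
  and v: "\<And>i. i < n ==> vel h \<psi> e i = vel h \<psi> e' i"
 shows "e = e'"
proof -
 obtain U \<phi> \<delta> P Gi where t: "trivialised U \<phi> \<delta> P Gi" "h (0, e)\<in>U" "\<phi> (h (0, e)) = (\<lambda>_. 0)"
  using trivialised_exists[OF proj_base[OF e(1)]] by metis
 interpret trivialised_mfd E h U \<phi> \<delta> P Gi by unfold_locales (rule t)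
 have x: "h (0, e)\<in>U1" using t(2,3) proj_base[OF e(1)] trivD(1) by (auto simp: U1_def cube_def Rn_iff)
 have S: "e\<in>S" "e'\<in>S" using x e by (auto simp: S_def)
 have "vel h \<phi> e i = vel h \<phi> e' i" for i
 proof -
  obtain a where a: "\<And>e'. e'\<in>mpoints E ==> h (0, e') = h (0, e) ==> vel h \<phi> e' i = (\<Sum>j<n. a j * vel h \<psi> e' j)"
   using vel_change[OF c(1) cU c(2) t(2)] by metis
  show ?thesis using a[OF e(1) refl] a[OF e(2) e(3)[symmetric]] v by simp
 qed
 then have "Phat \<phi> e = Phat \<phi> e'" using e(3) by (simp add: Phat_def fun_eq_iff)
 then show ?thesis by (rule inj_onD[OF Phat_inj _ S])
qed

lemma vel_change_add:
 assumes c: "(U, \<phi>)\<in>mcharts E" and d: "(V, \<psi>)\<in>mcharts E"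
  and e: "e\<in>mpoints E" "u\<in>mpoints E" "v\<in>mpoints E" "h (0, e) = x" "h (0, u) = x" "h (0, v) = x" and x: "x\<in>U" "x\<in>V"
  and s: "\<And>i. i < n ==> vel h \<phi> e i = vel h \<phi> u i + vel h \<phi> v i"
 shows "vel h \<psi> e i = vel h \<psi> u i + vel h \<psi> v i"
proof -
 obtain a where a: "\<And>e'. e'\<in>mpoints E ==> h (0, e') = x ==> vel h \<psi> e' i = (\<Sum>j<n. a j * vel h \<phi> e' j)"
  using vel_change[OF c d x] by metis
 show ?thesis unfolding a[OF e(1,4)] a[OF e(2,5)] a[OF e(3,6)] sum.distrib[symmetric]
  by (rule sum.cong) (simp_all add: s distrib_left)
qed

lemma badd_eqI:
 assumes e: "e\<in>mpoints E" "h (0, e) = h (0, u)" "u\<in>mpoints E" "v\<in>mpoints E" "h (0, u) = h (0, v)"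
  and c: "(U, \<phi>)\<in>mcharts E" "h (0, u)\<in>U" and s: "\<And>i. i < n ==> vel h \<phi> e i = vel h \<phi> u i + vel h \<phi> v i"
 shows "badd E h u v = e"
 unfolding badd_def
proof (rule the_equality)
 show "e\<in>mpoints E \<and> h (0, e) = h (0, u) \<and>
   (\<forall>(V, \<psi>)\<in>mcharts E. h (0, u)\<in>V \<longrightarrow> (\<forall>i<n. vel h \<psi> e i = vel h \<psi> u i + vel h \<psi> v i))"
 proof (intro conjI e(1,2), clarify)
  fix V \<psi> i assume d: "(V, \<psi>)\<in>mcharts E" "h (0, u)\<in>V"
  show "vel h \<psi> e i = vel h \<psi> u i + vel h \<psi> v i"
   by (rule vel_change_add[OF c(1) d(1) e(1,3,4,2) refl e(5)[symmetric] c(2) d(2) s])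
 qed
 fix e' assume e': "e'\<in>mpoints E \<and> h (0, e') = h (0, u) \<and>
   (\<forall>(V, \<psi>)\<in>mcharts E. h (0, u)\<in>V \<longrightarrow> (\<forall>i<n. vel h \<psi> e' i = vel h \<psi> u i + vel h \<psi> v i))"
 then have 1: "e'\<in>mpoints E" "h (0, e') = h (0, u)" and 2: "\<And>i. i < n ==> vel h \<phi> e' i = vel h \<phi> u i + vel h \<phi> v i"
  using c by auto
 show "e' = e" by (rule vel_inj[OF 1(1) e(1) _ c(1)]) (use 1 2 e c s in auto)
qed

text \<open>Existence of the sum: surjectivity of the trivialisation provides a point over the same
  base point whose velocity is the required one.\<close>

lemma badd:
 assumes u: "u\<in>mpoints E" "v\<in>mpoints E" "h (0, u) = h (0, v)"
 shows "badd E h u v\<in>mpoints E" "h (0, badd E h u v) = h (0, u)"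
  and "\<And>V \<psi> i. (V, \<psi>)\<in>mcharts E ==> h (0, u)\<in>V ==> vel h \<psi> (badd E h u v) i = vel h \<psi> u i + vel h \<psi> v i"
proof -
 let ?x = "h (0, u)"
 obtain U \<phi> \<delta> P Gi where t: "trivialised U \<phi> \<delta> P Gi" "?x\<in>U" "\<phi> ?x = (\<lambda>_. 0)"
  using trivialised_exists[OF proj_base[OF u(1)]] by metis
 interpret trivialised_mfd E h U \<phi> \<delta> P Gi by unfold_locales (rule t)
 have x: "?x\<in>U1" using t(2,3) proj_base[OF u(1)] trivD(1) by (auto simp: U1_def cube_def Rn_iff)
 have vx: "h (0, v)\<in>U" using u(3) t(2) by simp
 \<comment> \<open>Only the coordinates from \<open>k\<close> on have to be prescribed; those below
   vanish for all points of the fibre.\<close>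
 define w where "w i = vel h \<phi> u (i + k) + vel h \<phi> v (i + k)" for i
 have "w\<in>Rn (n - k)"
  using vel_outside[OF cU u(1) t(2)] vel_outside[OF cU u(2) vx] by (auto simp: w_def Rn_iff)
 then have "(?x, w)\<in>U1\<times>Rn (n - k)" using x by simp
 then obtain e where e: "e\<in>S" "triv_map e = (?x, w)" by (rule triv_map_inverse)
 have eE: "e\<in>mpoints E" "h (0, e) = ?x" using SD(1)[OF e(1)] e(2) by (auto simp: triv_map_def)
 have s: "vel h \<phi> e i = vel h \<phi> u i + vel h \<phi> v i" for i
 proof (cases "i < k")
  case True
  then show ?thesis using vel_low[OF u(1) t(2)] vel_low[OF u(2) vx] vel_low[OF eE(1)] eE(2) t(2) by simp
 next
  case False
  have "shift k (vel h \<phi> e) (i - k) = w (i - k)" using e(2) by (simp add: triv_map_def)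
  then show ?thesis using False by (simp add: shift_def w_def)
 qed
 have b: "badd E h u v = e" by (rule badd_eqI[OF eE u cU t(2) s])
 show "badd E h u v\<in>mpoints E" "h (0, badd E h u v) = ?x" using eE b by auto
 show "vel h \<psi> (badd E h u v) i = vel h \<psi> u i + vel h \<psi> v i" if d: "(V, \<psi>)\<in>mcharts E" "?x\<in>V" for V \<psi> i
  unfolding b by (rule vel_change_add[OF cU d(1) eE(1) u(1,2) eE(2) refl u(3)[symmetric] t(2) d(2) s])
qed

lemma fibre_iff: "e\<in>fibre (mpoints E) (\<lambda>e. h (0, e)) x \<longleftrightarrow> e\<in>mpoints E \<and> h (0, e) = x"
 by (simp add: fibre_def)

text \<open>Velocity is injective on the fibre and turns \<open>add\<close> and \<open>scl\<close>
  into addition and scaling of coordinates, so each axiom is inherited from R^n. \<open>add\<close>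
  and \<open>scl\<close> are arbitrary functions with the right values on the fibres, because a
  stratified bundle has one addition for all strata.\<close>

lemma fibre_vector_space:
 fixes add :: "'a \<Rightarrow> 'a \<Rightarrow> 'a"
 assumes x: "x\<in>base"
  and add: "\<And>u v. u\<in>mpoints E ==> v\<in>mpoints E ==> h (0, u) = h (0, v) ==> add u v = badd E h u v"
  and scl: "\<And>r u. u\<in>mpoints E ==> scl r u = h (r, u)"
 shows "real_vector_space_on (fibre (mpoints E) (\<lambda>e. h (0, e)) x) add x scl"
proof -
 obtain V \<psi> where c: "(V, \<psi>)\<in>mcharts E" "x\<in>V" using atlas_mfd_cover[OF atl baseD(1)[OF x]] by metis
 let ?F = "fibre (mpoints E) (\<lambda>e. h (0, e)) x"
 have FD: "e\<in>mpoints E" "h (0, e) = x" "h (0, e)\<in>V" if "e\<in>?F" for e using that c by (auto simp: fibre_iff)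
 have FI: "e\<in>?F" if "e\<in>mpoints E" "h (0, e) = x" for e using that by (auto simp: fibre_iff)
 have a: "add u v\<in>?F" "vel h \<psi> (add u v) i = vel h \<psi> u i + vel h \<psi> v i" if "u\<in>?F" "v\<in>?F" for u v i
 proof -
  have uv: "u\<in>mpoints E" "v\<in>mpoints E" "h (0, u) = h (0, v)" using FD that by auto
  show "add u v\<in>?F" "vel h \<psi> (add u v) i = vel h \<psi> u i + vel h \<psi> v i"
   unfolding add[OF uv]
   using badd(3)[OF uv c(1) FD(3)[OF that(1)]] FI[OF badd(1,2)[OF uv, unfolded FD(2)[OF that(1)]]] by blast+
 qed
 have s: "scl r u\<in>?F" "vel h \<psi> (scl r u) i = r * vel h \<psi> u i" if "u\<in>?F" for r u i
 proof -
  note u = FD[OF that]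
  show "scl r u\<in>?F" unfolding scl[OF u(1)] by (rule FI[OF h_in[OF u(1)]]) (simp add: proj_h[OF u(1)] u(2))
  show "vel h \<psi> (scl r u) i = r * vel h \<psi> u i" unfolding scl[OF u(1)] by (rule vel_h[OF c(1) u(1,3)])
 qed
 have eqI: "e = e'" if "e\<in>?F" "e'\<in>?F" "\<And>i. vel h \<psi> e i = vel h \<psi> e' i" for e e'
  by (rule vel_inj[OF FD(1)[OF that(1)] FD(1)[OF that(2)] _ c(1) FD(3)[OF that(1)] that(3)])
   (simp add: FD(2)[OF that(1)] FD(2)[OF that(2)])
 have z: "x\<in>?F" using x by (intro FI) (auto simp: baseD)
 have vz: "vel h \<psi> x i = 0" for i using baseD(2)[OF x] by (simp add: vel_def)
 have inv: "\<exists>v\<in>?F. add u v = x" if u: "u\<in>?F" for u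
 proof (rule bexI[of _ "scl (-1) u"])
  show "add u (scl (-1) u) = x" by (rule eqI) (use a[OF u s(1)[OF u]] s[OF u] z vz in auto)
 qed (rule s[OF u])
 show ?thesis unfolding real_vector_space_on_def
 proof (intro conjI ballI allI)
  fix u v w assume uvw: "u\<in>?F" "v\<in>?F" "w\<in>?F"
  show "add (add u v) w = add u (add v w)" by (rule eqI) (simp_all add: a uvw)
 next
  fix u v r assume uv: "u\<in>?F" "v\<in>?F"
  show "add u v = add v u" by (rule eqI) (simp_all add: a uv)
  show "scl r (add u v) = add (scl r u) (scl r v)" by (rule eqI) (simp_all add: a s uv distrib_left)
 next
  fix u r s' assume u: "u\<in>?F"
  show "add x u = u" by (rule eqI) (simp_all add: a u z vz)
  show "scl (r + s') u = add (scl r u) (scl s' u)" by (rule eqI) (simp_all add: a s u distrib_right)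
  show "scl (r * s') u = scl r (scl s' u)" by (rule eqI) (simp_all add: s u)
  show "scl 1 u = u" by (rule eqI) (simp_all add: s u)
 qed (use a s z inv in auto)
qed

lemma action_smooth_vector_bundle:
 fixes add :: "'a \<Rightarrow> 'a \<Rightarrow> 'a" and zero :: "'a \<Rightarrow> 'a"
 assumes add: "\<And>u v. u\<in>mpoints E ==> v\<in>mpoints E ==> h (0, u) = h (0, v) ==> add u v = badd E h u v"
  and scl: "\<And>r u. u\<in>mpoints E ==> scl r u = h (r, u)" and zero: "\<And>x. x\<in>base ==> zero x = x"
 shows "smooth_vector_bundle E base_mfd (\<lambda>e. h (0, e)) add zero scl"
 unfolding smooth_vector_bundle_def
proof (intro conjI ballI sm smooth_base smooth_proj)
 fix x assume "x\<in>mpoints base_mfd"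
 then have x: "x\<in>base" by simp
 show "real_vector_space_on (fibre (mpoints E) (\<lambda>e. h (0, e)) x) add (zero x) scl"
  unfolding zero[OF x] by (rule fibre_vector_space[OF x add scl])
 obtain U \<phi> \<delta> P Gi where t: "trivialised U \<phi> \<delta> P Gi" "x\<in>U" "\<phi> x = (\<lambda>_. 0)"
  using trivialised_exists[OF x] by metis
 interpret trivialised_mfd E h U \<phi> \<delta> P Gi by unfold_locales (rule t)
 have xU: "x\<in>U1" using t(2,3) x trivD(1) by (auto simp: U1_def cube_def Rn_iff)
 show "\<exists>U k \<Phi>. openin (mtop base_mfd) U \<and> x\<in>U \<and>
    diffeomorphism (open_submfd E {e\<in>mpoints E. h (0, e)\<in>U}) (prod_mfd (open_submfd base_mfd U) (Rn_mfd k)) \<Phi> \<and>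
    (\<forall>e\<in>mpoints E. h (0, e)\<in>U \<longrightarrow> fst (\<Phi> e) = h (0, e)) \<and>
    (\<forall>y\<in>U. \<forall>u\<in>fibre (mpoints E) (\<lambda>e. h (0, e)) y. \<forall>v\<in>fibre (mpoints E) (\<lambda>e. h (0, e)) y. \<forall>i.
      snd (\<Phi> (add u v)) i = snd (\<Phi> u) i + snd (\<Phi> v) i) \<and>
    (\<forall>y\<in>U. \<forall>u\<in>fibre (mpoints E) (\<lambda>e. h (0, e)) y. \<forall>r i. snd (\<Phi> (scl r u)) i = r * snd (\<Phi> u) i)"
 proof (intro exI[of _ U1] exI[of _ "n - k"] exI[of _ triv_map] conjI openU1 xU triv_diffeo[unfolded S_def] ballI allI impI)
  show "fst (triv_map e) = h (0, e)" for e by (simp add: triv_map_def)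
  fix y u i assume y: "y\<in>U1" and u: "u\<in>fibre (mpoints E) (\<lambda>e. h (0, e)) y"
  have uE: "u\<in>mpoints E" "h (0, u) = y" "h (0, u)\<in>U" using u y U1D(1) by (auto simp: fibre_iff)
  show "snd (triv_map (scl r u)) i = r * snd (triv_map u) i" for r
   by (simp add: triv_map_def scl[OF uE(1)] shift_def vel_h[OF cU uE(1,3)])
  fix v assume v: "v\<in>fibre (mpoints E) (\<lambda>e. h (0, e)) y"
  have uv: "v\<in>mpoints E" "h (0, u) = h (0, v)" using u v by (auto simp: fibre_iff)
  show "snd (triv_map (add u v)) i = snd (triv_map u) i + snd (triv_map v) i"
   unfolding add[OF uE(1) uv] by (simp add: triv_map_def shift_def badd(3)[OF uE(1) uv cU uE(3)])
 qed
qed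

end

section \<open>Stratified regular actions\<close>

text \<open>The zero vector is thereby determined by scalar multiplication alone, which is why the
  action determines the zero section of a bundle.\<close>

lemma vector_space_scale_0:
 assumes "real_vector_space_on V plus0 z scl" "u\<in>V"
 shows "scl 0 u = z"
proof -
 have V: "z\<in>V" "\<And>u v. u\<in>V ==> v\<in>V ==> plus0 u v = plus0 v u" "\<And>u. u\<in>V ==> plus0 z u = u"
  "\<And>u. u\<in>V ==> \<exists>v\<in>V. plus0 u v = z" "\<And>r u. u\<in>V ==> scl r u\<in>V"
  "\<And>u v w. u\<in>V ==> v\<in>V ==> w\<in>V ==> plus0 (plus0 u v) w = plus0 u (plus0 v w)"
  "\<And>r s u. u\<in>V ==> scl (r + s) u = plus0 (scl r u) (scl s u)"
  using assms(1)[unfolded real_vector_space_on_def] by (meson | blast)+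
 define w where "w = scl 0 u"
 have w: "w\<in>V" unfolding w_def by (rule V(5)[OF assms(2)])
 have "scl (0 + 0) u = plus0 (scl 0 u) (scl 0 u)" by (rule V(7)[OF assms(2)])
 then have ww: "plus0 w w = w" by (simp add: w_def)
 obtain v where v: "v\<in>V" "plus0 w v = z" using V(4)[OF w] by (elim bexE)
 have "plus0 (plus0 w w) v = plus0 w (plus0 w v)" by (rule V(6)[OF w w v(1)])
 then have "z = plus0 w z" using ww v(2) by simp
 also have "\<dots> = plus0 z w" by (rule V(2)[OF w V(1)])
 also have "\<dots> = w" by (rule V(3)[OF w])
 finally show ?thesis by (simp add: w_def)
qed

section \<open>Smooth vector bundles and their zero sections\<close>

lemma smooth_map_open_inclusion:
 "atlas_mfd M ==> openin (mtop M) S ==> smooth_map (open_submfd M S) M (\<lambda>x. x)"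
 by (intro smooth_map_open_domain smooth_map_id)

locale smooth_bundle =
 fixes E :: "'a mfd" and M :: "'b mfd" and p plus0 zer scl
 assumes vb: "smooth_vector_bundle E M p plus0 zer scl"
begin

lemma atlE: "atlas_mfd E" and atlM: "atlas_mfd M" and smooth_p: "smooth_map E M p"
 and vs: "x\<in>mpoints M ==> real_vector_space_on (fibre (mpoints E) p x) plus0 (zer x) scl"
 using vb by (auto simp: smooth_vector_bundle_def smooth_manifold_imp_atlas)

lemma zerD: "x\<in>mpoints M ==> zer x\<in>mpoints E" "x\<in>mpoints M ==> p (zer x) = x"
 using vs[of x] by (auto simp: real_vector_space_on_def fibre_def)

lemma p_in: "e\<in>mpoints E ==> p e\<in>mpoints M"
 using smooth_map_cont[OF smooth_p] by (auto simp: continuous_map_def)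

lemma scl_0: "e\<in>mpoints E ==> scl 0 e = zer (p e)"
 by (rule vector_space_scale_0[OF vs[OF p_in]]) (auto simp: fibre_def)

text \<open>The data of a local trivialisation in the form in which they are used: in place of the
  diffeomorphism, the bijection together with the smoothness of its inverse as a map into the whole
  total space.\<close>

definition local_triv :: "'b set \<Rightarrow> nat \<Rightarrow> ('a \<Rightarrow> 'b\<times>(nat \<Rightarrow> real)) \<Rightarrow> bool" where
 "local_triv U k \<Phi> \<longleftrightarrow> openin (mtop M) U \<and> openin (mtop E) {e\<in>mpoints E. p e\<in>U} \<and>
  bij_betw \<Phi> {e\<in>mpoints E. p e\<in>U} (U\<times>Rn k) \<and>
  smooth_map (prod_mfd (open_submfd M U) (Rn_mfd k)) E (inv_into {e\<in>mpoints E. p e\<in>U} \<Phi>) \<and>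
  (\<forall>e\<in>mpoints E. p e\<in>U \<longrightarrow> fst (\<Phi> e) = p e) \<and>
  (\<forall>y\<in>U. \<forall>u\<in>fibre (mpoints E) p y. \<forall>v\<in>fibre (mpoints E) p y. \<forall>i. snd (\<Phi> (plus0 u v)) i = snd (\<Phi> u) i + snd (\<Phi> v) i) \<and>
  (\<forall>y\<in>U. \<forall>u\<in>fibre (mpoints E) p y. \<forall>r i. snd (\<Phi> (scl r u)) i = r * snd (\<Phi> u) i)"

lemma local_trivD:
 assumes "local_triv U k \<Phi>"
 shows "openin (mtop M) U" "openin (mtop E) {e\<in>mpoints E. p e\<in>U}" "bij_betw \<Phi> {e\<in>mpoints E. p e\<in>U} (U\<times>Rn k)"
  "smooth_map (prod_mfd (open_submfd M U) (Rn_mfd k)) E (inv_into {e\<in>mpoints E. p e\<in>U} \<Phi>)"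
  "\<And>e. e\<in>mpoints E ==> p e\<in>U ==> fst (\<Phi> e) = p e"
  "\<And>y u v i. y\<in>U ==> u\<in>fibre (mpoints E) p y ==> v\<in>fibre (mpoints E) p y ==>
    snd (\<Phi> (plus0 u v)) i = snd (\<Phi> u) i + snd (\<Phi> v) i"
  "\<And>y u r i. y\<in>U ==> u\<in>fibre (mpoints E) p y ==> snd (\<Phi> (scl r u)) i = r * snd (\<Phi> u) i"
 using assms unfolding local_triv_def by blast+

lemma trivialisation:
 assumes x: "x\<in>mpoints M"
 obtains U k \<Phi> where "x\<in>U" "local_triv U k \<Phi>"
proof -
 obtain U k \<Phi> where U: "openin (mtop M) U" "x\<in>U"
  and diff: "diffeomorphism (open_submfd E {e\<in>mpoints E. p e\<in>U}) (prod_mfd (open_submfd M U) (Rn_mfd k)) \<Phi>"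
  and F: "\<forall>e\<in>mpoints E. p e\<in>U \<longrightarrow> fst (\<Phi> e) = p e"
  and A: "\<forall>y\<in>U. \<forall>u\<in>fibre (mpoints E) p y. \<forall>v\<in>fibre (mpoints E) p y. \<forall>i. snd (\<Phi> (plus0 u v)) i = snd (\<Phi> u) i + snd (\<Phi> v) i"
  and S: "\<forall>y\<in>U. \<forall>u\<in>fibre (mpoints E) p y. \<forall>r i. snd (\<Phi> (scl r u)) i = r * snd (\<Phi> u) i"
  using vb x unfolding smooth_vector_bundle_def by blast
 let ?S = "{e\<in>mpoints E. p e\<in>U}"
 have oS: "openin (mtop E) ?S" by (rule openin_continuous_map_preimage[OF smooth_map_cont[OF smooth_p] U(1)])
 have pE: "mpoints (open_submfd E ?S) = ?S" by auto
 have pP: "mpoints (prod_mfd (open_submfd M U) (Rn_mfd k)) = U\<times>Rn k" using openin_subset[OF U(1)] by auto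
 have P: "atlas_mfd (prod_mfd (open_submfd M U) (Rn_mfd k))"
  by (rule atlas_prod_mfd[OF atlas_open_submfd[OF atlM U(1)] atlas_Rn_mfd])
 have "smooth_map (prod_mfd (open_submfd M U) (Rn_mfd k)) (open_submfd E ?S) (inv_into ?S \<Phi>)"
  using diff unfolding diffeomorphism_def pE by blast
 from smooth_map_compose[OF P atlas_open_submfd[OF atlE oS] atlE this smooth_map_open_inclusion[OF atlE oS]]
 have s: "smooth_map (prod_mfd (open_submfd M U) (Rn_mfd k)) E (inv_into ?S \<Phi>)" .
 have b: "bij_betw \<Phi> ?S (U\<times>Rn k)" using diff unfolding diffeomorphism_def pE pP by blast
 have "local_triv U k \<Phi>" unfolding local_triv_def using U(1) oS b s F A S by blast
 then show thesis by (rule that[OF U(2)])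
qed

text \<open>A trivialisation turns \<open>scl 0\<close> into multiplication by 0, and
  \<open>scl 0\<close> fixes zero vectors; so locally the zero section is the inverse trivialisation
  applied to (y, 0).\<close>

lemma smooth_zer: "smooth_map M E zer"
proof (rule smooth_map_local[OF atlM atlE])
 fix x assume x: "x\<in>mpoints M"
 obtain U k \<Phi> where xU: "x\<in>U" and t: "local_triv U k \<Phi>" by (rule trivialisation[OF x])
 note U = local_trivD[OF t]
 let ?S = "{e\<in>mpoints E. p e\<in>U}"
 let ?N = "open_submfd M U"
 have N: "atlas_mfd ?N" by (rule atlas_open_submfd[OF atlM U(1)])
 have P: "atlas_mfd (prod_mfd ?N (Rn_mfd k))" by (rule atlas_prod_mfd[OF N atlas_Rn_mfd])
 have "smooth_map ?N (prod_mfd ?N (Rn_mfd k)) (\<lambda>x. (x, \<lambda>_. 0))"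
  by (intro smooth_map_pair N atlas_Rn_mfd smooth_map_id smooth_map_const) (simp add: Rn_iff)
 from smooth_map_compose[OF N P atlE this U(4)]
 have 1: "smooth_map ?N E (\<lambda>x. inv_into ?S \<Phi> (x, \<lambda>_. 0))" .
 have "smooth_map ?N E zer"
 proof (rule smooth_map_cong[OF N atlE 1])
  fix y assume "y\<in>mpoints ?N"
  then have y: "y\<in>mpoints M" "y\<in>U" by auto
  have zf: "zer y\<in>fibre (mpoints E) p y" using zerD[OF y(1)] by (simp add: fibre_def)
  have "scl 0 (zer y) = zer y" using scl_0[OF zerD(1)[OF y(1)]] zerD(2)[OF y(1)] by simp
  then have "snd (\<Phi> (zer y)) i = 0" for i using U(7)[OF y(2) zf, of 0 i] by simp
  then have "\<Phi> (zer y) = (y, \<lambda>_. 0)" using U(5)[of "zer y"] zerD[OF y(1)] y(2) by (simp add: prod_eq_iff fun_eq_iff)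
  moreover have "zer y\<in>?S" using zerD[OF y(1)] y(2) by simp
  ultimately show "inv_into ?S \<Phi> (y, \<lambda>_. 0) = zer y"
   by (intro inv_into_f_eq[OF bij_betw_imp_inj_on[OF U(3)]])
 qed
 then show "\<exists>W. openin (mtop M) W \<and> x\<in>W \<and> smooth_map (open_submfd M W) E zer" using U(1) xU by blast
qed

end

text \<open>A vector bundle structure with scalar multiplication \<open>h\<close> has fibre addition \<open>badd\<close>: in a trivialisation
 the curve \<open>h (t, e)\<close> is \<open>t\<close> times a vector, so \<open>vel\<close> is linear on the fibres.\<close>

lemma (in regular_mfd) bundle_addition:
 assumes vb: "smooth_vector_bundle E M p plus0 zer scl" and scl: "\<And>r e. e\<in>mpoints E ==> scl r e = h (r, e)"
  and uv: "u\<in>mpoints E" "v\<in>mpoints E" "p u = p v"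
 shows "plus0 u v = badd E h u v"
proof -
 interpret B: smooth_bundle E M p plus0 zer scl by unfold_locales (rule vb)
 let ?x = "p u"
 have x: "?x\<in>mpoints M" by (rule B.p_in[OF uv(1)])
 obtain U k \<Phi> where xU: "?x\<in>U" and t: "B.local_triv U k \<Phi>" by (rule B.trivialisation[OF x])
 note L = B.local_trivD[OF t]
 note U = L(1) xU and bij = L(3) and sm\<Phi> = L(4) and F = L(5) and A = L(6) and S = L(7)
 let ?S = "{e\<in>mpoints E. p e\<in>U}" and ?F = "fibre (mpoints E) p ?x"
 have fF: "u\<in>?F" "v\<in>?F" using uv by (auto simp: fibre_def)
 have vsx: "real_vector_space_on ?F plus0 (zer ?x) scl" by (rule B.vs[OF x])
 have h0: "h (0, e) = zer ?x" if "e\<in>?F" for e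
  using B.scl_0[of e] scl[of e 0] that by (auto simp: fibre_def)
 have hF: "h (t, e)\<in>?F" if "e\<in>?F" for t e
 proof -
  have "scl t e\<in>?F" using vsx that by (auto simp: real_vector_space_on_def)
  then show ?thesis using scl[of e t] that by (simp add: fibre_def)
 qed
 have \<Phi>inv: "inv_into ?S \<Phi> (?x, snd (\<Phi> e)) = e" if e: "e\<in>?F" for e
 proof -
  have eS: "e\<in>?S" using e U(2) by (auto simp: fibre_def)
  have "(?x, snd (\<Phi> e)) = \<Phi> e" using F[of e] eS e by (simp add: prod_eq_iff fibre_def)
  then show ?thesis using bij_betw_imp_inj_on[OF bij] eS by (simp add: inv_into_f_f)
 qed
 have \<Phi>R: "snd (\<Phi> e)\<in>Rn k" if "e\<in>?F" for e
 proof -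
  have "e\<in>?S" using that U(2) by (simp add: fibre_def)
  from bij_betwE[OF bij, rule_format, OF this] have "\<Phi> e\<in>U\<times>Rn k" .
  then show ?thesis by auto
 qed
 have zM: "zer ?x\<in>mpoints E" by (rule B.zerD[OF x])
 obtain V \<psi> where c: "(V, \<psi>)\<in>mcharts E" "zer ?x\<in>V" using atlas_mfd_cover[OF atl zM] by metis
 let ?f = "\<lambda>w. inv_into ?S \<Phi> (?x, w)"
 have PN: "atlas_mfd (prod_mfd (open_submfd M U) (Rn_mfd k))"
  by (rule atlas_prod_mfd[OF atlas_open_submfd[OF B.atlM U(1)] atlas_Rn_mfd])
 have "smooth_map (Rn_mfd k) (prod_mfd (open_submfd M U) (Rn_mfd k)) (\<lambda>w. (?x, w))"
  by (intro smooth_map_pair atlas_Rn_mfd smooth_map_id smooth_map_const atlas_open_submfd[OF B.atlM U(1)]) (use x U in simp)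
 from smooth_map_compose[OF atlas_Rn_mfd PN atl this sm\<Phi>] have fs: "smooth_map (Rn_mfd k) E ?f" .
 have z: "zer ?x\<in>?F" using B.zerD[OF x] by (simp add: fibre_def)
 have "h (0, zer ?x) = zer ?x" by (rule h0[OF z])
 then have sz: "snd (\<Phi> (zer ?x)) = (\<lambda>_. 0)" using S[OF U(2) z, of 0] scl[OF zM, of 0] by (simp add: fun_eq_iff)
 have f0: "?f (\<lambda>_. 0) = zer ?x" using \<Phi>inv[OF z] by (simp add: sz)
 have lin: "\<exists>a. \<forall>e\<in>?F. vel h \<psi> e i = (\<Sum>j<k. snd (\<Phi> e) j * a j)" for i
 proof -
  have "smooth_at (Rn_mfd k) (\<lambda>w. \<psi> (?f w) i) (\<lambda>_. 0)"
   by (rule smooth_map_at[OF atlas_Rn_mfd atl fs _ smooth_at_coord[OF atl c(1)]]) (use f0 c(2) in \<open>auto simp: Rn_iff\<close>)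
  then obtain O' where O': "smooth_fun k O' (\<lambda>w. \<psi> (?f w) i)" "(\<lambda>_. 0)\<in>O'" by (rule smooth_at_Rn_mfdE)
  define a where "a j = pd j (\<lambda>w. \<psi> (?f w) i) (\<lambda>_. 0)" for j
  have "vel h \<psi> e i = (\<Sum>j<k. snd (\<Phi> e) j * a j)" if e: "e\<in>?F" for e
  proof -
   let ?w = "snd (\<Phi> e)"
   have eE: "e\<in>mpoints E" using e by (simp add: fibre_def)
   have "((\<lambda>t. \<psi> (?f (\<lambda>j. t * ?w j)) i) has_real_derivative
    (\<Sum>j<k. pd j (\<lambda>w. \<psi> (?f w) i) (\<lambda>j. 0 * ?w j) * ?w j)) (at 0)"
   proof (rule cmap_chain_curve[OF O'(1), where c="\<lambda>t j. t * ?w j"])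
    show "\<forall>\<^sub>F t in nhds 0. (\<lambda>j. t * ?w j)\<in>Rn k" using \<Phi>R[OF e] by (auto simp: Rn_iff)
    show "((\<lambda>t. t * ?w j) has_real_derivative ?w j) (at 0)" for j by (auto intro!: derivative_eq_intros)
   qed (use O'(2) in simp)
   moreover have "?f (\<lambda>j. t * ?w j) = h (t, e)" for t
   proof -
    have "snd (\<Phi> (h (t, e))) = (\<lambda>j. t * ?w j)" using S[OF U(2) e, of t] scl[OF eE, of t] by (simp add: fun_eq_iff)
    then show ?thesis using \<Phi>inv[OF hF[OF e], of t] by simp
   qed
   ultimately have "((\<lambda>t. \<psi> (h (t, e)) i) has_real_derivative (\<Sum>j<k. ?w j * a j)) (at 0)"
    by (simp add: a_def mult.commute)
   then show ?thesis unfolding vel_def by (rule DERIV_imp_deriv)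
  qed
  then show ?thesis by blast
 qed
 have addF: "plus0 u v\<in>?F" using vsx fF by (auto simp: real_vector_space_on_def)
 have "vel h \<psi> (plus0 u v) i = vel h \<psi> u i + vel h \<psi> v i" for i
 proof -
  obtain a where a: "\<forall>e\<in>?F. vel h \<psi> e i = (\<Sum>j<k. snd (\<Phi> e) j * a j)" using lin[of i] by blast
  show ?thesis unfolding a[rule_format, OF addF] a[rule_format, OF fF(1)] a[rule_format, OF fF(2)] sum.distrib[symmetric]
   by (rule sum.cong) (simp_all add: A[OF U(2) fF] distrib_right)
 qed
 moreover have "plus0 u v\<in>mpoints E" using addF by (simp add: fibre_def)
 ultimately show ?thesis
  by (intro badd_eqI[symmetric, OF _ _ uv(1,2) _ c(1)]) (use h0 addF fF c(2) in auto)
qed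

text \<open>A cover of \<open>C\<close> is extended to a cover of the whole space by means of the
  complement of \<open>C\<close>; a refinement of that is then intersected with
  \<open>C\<close>.\<close>

lemma paracompact_space_closed:
 assumes X: "paracompact_space X" and C: "closedin X C" shows "paracompact_space (subtopology X C)"
 unfolding paracompact_space_def
proof (intro allI impI)
 fix \<U> assume U: "(\<forall>U\<in>\<U>. openin (subtopology X C) U) \<and> \<Union>\<U> = topspace (subtopology X C)"
 have CX: "C\<subseteq>topspace X" using C closedin_subset by blast
 have UC: "\<Union>\<U> = C" using U CX by auto
 have "\<forall>U\<in>\<U>. \<exists>T. openin X T \<and> U = T\<inter>C" using U by (auto simp: openin_subtopology)
 then obtain T where T: "\<And>U. U\<in>\<U> ==> openin X (T U)" "\<And>U. U\<in>\<U> ==> U = T U\<inter>C" by metis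
 let ?W = "insert (topspace X - C) (T ` \<U>)"
 have W1: "\<forall>U\<in>?W. openin X U" using T(1) C by auto
 have W2: "\<Union>?W = topspace X"
 proof (intro equalityI subsetI)
  fix x assume "x\<in>topspace X"
  moreover have "x\<in>\<Union> (T ` \<U>)" if "x\<in>C"
  proof -
   obtain U where u: "U\<in>\<U>" "x\<in>U" using \<open>x\<in>C\<close> UC by blast
   then have "x\<in>T U" using T(2)[OF u(1)] by blast
   then show ?thesis using u by blast
  qed
  ultimately show "x\<in>\<Union>?W" by blast
 next
  fix x assume "x\<in>\<Union>?W"
  then show "x\<in>topspace X" using T(1) openin_subset by blast
 qed
 from X[unfolded paracompact_space_def, rule_format, OF conjI, OF W1 W2]
 obtain \<V> where V: "\<forall>V\<in>\<V>. openin X V" "\<Union>\<V> = topspace X" "\<forall>V\<in>\<V>. \<exists>U\<in>?W. V\<subseteq>U" "locally_finite_in X \<V>"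
  by (elim exE conjE)
 \<comment> \<open>Members that miss \<open>C\<close> are dropped: they may refine only the
   complement of \<open>C\<close> and need not lie in any member of the original cover.\<close>
 let ?V = "(\<lambda>V. V\<inter>C) ` {V\<in>\<V>. V\<inter>C\<noteq>{}}"
 show "\<exists>\<V>. (\<forall>V\<in>\<V>. openin (subtopology X C) V) \<and> \<Union>\<V> = topspace (subtopology X C) \<and>
      (\<forall>V\<in>\<V>. \<exists>U\<in>\<U>. V\<subseteq>U) \<and> locally_finite_in (subtopology X C) \<V>"
 proof (intro exI[of _ ?V] conjI)
  show "\<forall>V\<in>?V. openin (subtopology X C) V" using V(1) by (auto simp: openin_subtopology)
  show un: "\<Union>?V = topspace (subtopology X C)" using V(2) by auto
  show "\<forall>V\<in>?V. \<exists>U\<in>\<U>. V\<subseteq>U"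
  proof
   fix W assume "W\<in>?V"
   then obtain V0 where V0: "V0\<in>\<V>" "V0\<inter>C\<noteq>{}" "W = V0\<inter>C" by blast
   obtain U0 where U0: "U0\<in>?W" "V0\<subseteq>U0" using bspec[OF V(3) V0(1)] by (elim bexE)
   have "U0\<noteq>topspace X - C" using U0(2) V0(2) by blast
   then have "U0\<in>T ` \<U>" using U0(1) by simp
   then obtain U where U: "U\<in>\<U>" "U0 = T U" by (elim imageE)
   have "W\<subseteq>U" using T(2)[OF U(1)] U(2) U0(2) V0(3) by simp blast
   then show "\<exists>U\<in>\<U>. W\<subseteq>U" using U(1) by (rule bexI)
  qed
  show "locally_finite_in (subtopology X C) ?V" unfolding locally_finite_in_def
  proof (intro conjI ballI)
   show "\<Union>?V\<subseteq>topspace (subtopology X C)" using un by simp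
   fix x assume "x\<in>topspace (subtopology X C)"
   then have "x\<in>topspace X" "x\<in>C" by auto
   then obtain W where W: "openin X W" "x\<in>W" "finite {U\<in>\<V>. U\<inter>W\<noteq>{}}"
    using V(4) unfolding locally_finite_in_def by metis
   have "{U\<in>?V. U\<inter>(W\<inter>C)\<noteq>{}}\<subseteq>(\<lambda>V. V\<inter>C) ` {U\<in>\<V>. U\<inter>W\<noteq>{}}" by blast
   then have "finite {U\<in>?V. U\<inter>(W\<inter>C)\<noteq>{}}" using W(3) by (rule finite_subset[OF _ finite_imageI])
   moreover have "openin (subtopology X C) (W\<inter>C)" using W(1) by (auto simp: openin_subtopology)
   ultimately show "\<exists>V. openin (subtopology X C) V \<and> x\<in>V \<and> finite {U\<in>?V. U\<inter>V\<noteq>{}}"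
    using W(2) \<open>x\<in>C\<close> by blast
  qed
 qed
qed

section \<open>The stratified base of an action\<close>

lemma strata_partition:
 assumes "stratified_space X"
 shows "\<Union> (strata X) = spoints X" "B\<in>strata X ==> B\<noteq>{}" "B\<in>strata X ==> B\<subseteq>spoints X"
  and "B\<in>strata X ==> C\<in>strata X ==> a\<in>B ==> a\<in>C ==> B = C"
  and "B\<in>strata X ==> mpoints (smfd X B) = B" "B\<in>strata X ==> mtop (smfd X B) = subtopology (stop X) B"
  and "B\<in>strata X ==> smooth_manifold (smfd X B)"
proof -
 have p: "\<Union> (strata X) = spoints X" "disjoint (strata X)" "{}\<notin>strata X"
  using assms by (auto simp: stratified_space_def partition_on_def)
 show "\<Union> (strata X) = spoints X" "B\<in>strata X ==> B\<noteq>{}" and sub: "B\<in>strata X ==> B\<subseteq>spoints X" using p by auto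
 show "B\<in>strata X ==> C\<in>strata X ==> a\<in>B ==> a\<in>C ==> B = C" using p(2) by (auto simp: disjoint_def)
 show m: "B\<in>strata X ==> mtop (smfd X B) = subtopology (stop X) B" and "B\<in>strata X ==> smooth_manifold (smfd X B)"
  using assms by (auto simp: stratified_space_def)
 show "B\<in>strata X ==> mpoints (smfd X B) = B" using m sub by (simp add: Int_absorb1)
qed

locale strat_action =
 fixes A :: "'a strat_space" and \<mu> :: "real\<times>'a \<Rightarrow> 'a"
 assumes ss: "stratified_space A" and act: "stratified_regular_action A \<mu>"
begin

lemmas part = strata_partition[OF ss]

lemma rm: assumes B: "B\<in>strata A" shows "regular_mfd (smfd A B) \<mu>"
proof
 show "smooth_manifold (smfd A B)" by (rule part(7)[OF B])
 show "regular_action (smfd A B) \<mu>" using act B by (simp add: stratified_regular_action_def)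
 have "connectedin (stop A) B" using ss B by (simp add: stratified_space_def)
 then show "connected_space (mtop (smfd A B))" by (simp add: part(6)[OF B] connectedin_def)
 show "mpoints (smfd A B)\<noteq>{}" using part(2,5)[OF B] by simp
qed

definition "M = {a\<in>spoints A. \<mu> (0, a) = a}"

lemma stratum_of: "a\<in>spoints A ==> \<exists>B\<in>strata A. a\<in>B"
 using part(1) by blast

lemma mu_B: assumes "B\<in>strata A" "a\<in>B" shows "\<mu> (t, a)\<in>B"
 using regular_mfd.h_in[OF rm[OF assms(1)], of a t] assms part(5) by simp

lemma mu_in: "a\<in>spoints A ==> \<mu> (t, a)\<in>spoints A"
 using act by (auto simp: stratified_regular_action_def monoid_action_def)

lemma mu_mu: "a\<in>spoints A ==> \<mu> (t, \<mu> (s, a)) = \<mu> (t * s, a)" and mu_1: "a\<in>spoints A ==> \<mu> (1, a) = a"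
 using act by (auto simp: stratified_regular_action_def monoid_action_def)

text \<open>The stratum containing \<open>a\<close> is invariant, and strata are disjoint.\<close>

lemma mu_B_iff: assumes "B\<in>strata A" "a\<in>spoints A" shows "\<mu> (t, a)\<in>B \<longleftrightarrow> a\<in>B"
proof -
 obtain C where C: "C\<in>strata A" "a\<in>C" using stratum_of[OF assms(2)] by blast
 have "\<mu> (t, a)\<in>C" by (rule mu_B[OF C])
 then show ?thesis using part(4)[OF assms(1) C(1)] C(2) mu_B[OF assms(1)] by blast
qed

lemma proj_M: "a\<in>spoints A ==> \<mu> (0, a)\<in>M"
 by (simp add: M_def mu_in mu_mu)

lemma MD: "x\<in>M ==> x\<in>spoints A" "x\<in>M ==> \<mu> (0, x) = x"
 by (auto simp: M_def)

lemma base_eq: assumes B: "B\<in>strata A" shows "regular_mfd.base (smfd A B) \<mu> = B\<inter>M"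
 using part(3)[OF B] by (auto simp: regular_mfd.base_def[OF rm[OF B]] part(5)[OF B] M_def)

lemma continuous_mu: "continuous_map (prod_topology euclideanreal (stop A)) (stop A) \<mu>"
 using act by (simp add: stratified_regular_action_def stratified_morphism_def real_times_def)

lemma continuous_mu_t: "continuous_map (stop A) (stop A) (\<lambda>a. \<mu> (t, a))"
proof -
 have "continuous_map (stop A) (prod_topology euclideanreal (stop A)) (\<lambda>a. (t, a))"
  by (simp add: continuous_map_pairwise o_def)
 from continuous_map_compose[OF this continuous_mu] show ?thesis by (simp add: o_def)
qed

text \<open>The set where two continuous maps into a Hausdorff space agree.\<close>

lemma closed_M: "closedin (stop A) M"
proof -
 have "Hausdorff_space (stop A)" using ss by (simp add: stratified_space_def)
 from closedin_continuous_maps_eq[OF this continuous_mu_t[of 0] continuous_map_id]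
 show ?thesis by (simp add: M_def)
qed

text \<open>The field \<open>smfd\<close> receives only the set B \<inter> M. As this set is
  non-empty and strata are disjoint, it determines the stratum \<open>B\<close>, whose manifold of
  fixed points is meant.\<close>

definition "strat_base = \<lparr>stop = subtopology (stop A) M, strata = (\<lambda>B. B\<inter>M) ` strata A,
 smfd = (\<lambda>S. regular_mfd.base_mfd (smfd A (THE B. B\<in>strata A \<and> B\<inter>M = S)) \<mu>)\<rparr>"

text \<open>There is one addition for the whole space; the stratum in which to add is read off from
  the first summand.\<close>

definition "bundle = \<lparr>sv_total = A, sv_base = strat_base, sv_proj = (\<lambda>a. \<mu> (0, a)),
 sv_add = (\<lambda>u v. badd (smfd A (THE B. B\<in>strata A \<and> u\<in>B)) \<mu> u v), sv_zero = (\<lambda>x. x), sv_scale = (\<lambda>t a. \<mu> (t, a))\<rparr>"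

lemma BM_nonempty: "B\<in>strata A ==> B\<inter>M\<noteq>{}"
 using part(2) mu_B proj_M part(3) by blast

lemma smfd_base: assumes B: "B\<in>strata A" shows "smfd strat_base (B\<inter>M) = regular_mfd.base_mfd (smfd A B) \<mu>"
proof -
 have "(THE C. C\<in>strata A \<and> C\<inter>M = B\<inter>M) = B"
 proof (rule the_equality)
  fix C assume C: "C\<in>strata A \<and> C\<inter>M = B\<inter>M"
  obtain a where "a\<in>B\<inter>M" using BM_nonempty[OF B] by blast
  then have "a\<in>C" "a\<in>B" using C by auto
  then show "C = B" using part(4) C B by blast
 qed (use B in auto)
 then show ?thesis by (simp add: strat_base_def)
qed

lemma strat_base_simps: "stop strat_base = subtopology (stop A) M" "strata strat_base = (\<lambda>B. B\<inter>M) ` strata A"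
 "spoints strat_base = M"
 using MD(1) by (auto simp: strat_base_def)

lemma stratified_base: "stratified_space strat_base"
 unfolding stratified_space_def
proof (intro conjI ballI impI)
 show "Hausdorff_space (stop strat_base)" "second_countable (stop strat_base)" "paracompact_space (stop strat_base)"
  using ss closed_M by (auto simp: strat_base_simps stratified_space_def
   intro: Hausdorff_space_subtopology second_countable_subtopology paracompact_space_closed)
 show "partition_on (spoints strat_base) (strata strat_base)" unfolding strat_base_simps(2,3)
 proof (rule partition_onI)
  show "\<Union> ((\<lambda>B. B\<inter>M) ` strata A) = M" using part(1) MD(1) by blast
  show "{}\<notin>(\<lambda>B. B\<inter>M) ` strata A" using BM_nonempty by blast
  show "disjnt S R" if SR: "S\<in>(\<lambda>B. B\<inter>M) ` strata A" "R\<in>(\<lambda>B. B\<inter>M) ` strata A" "S\<noteq>R" for S R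
  proof -
   obtain B C where "B\<in>strata A" "S = B\<inter>M" "C\<in>strata A" "R = C\<inter>M" using SR by blast
   then show ?thesis using part(4)[of B C] SR(3) by (auto simp: disjnt_def)
  qed
 qed
 show "locally_finite_in (stop strat_base) (strata strat_base)" unfolding strat_base_simps locally_finite_in_def
 proof (intro conjI ballI)
  show "\<Union> ((\<lambda>B. B\<inter>M) ` strata A)\<subseteq>topspace (subtopology (stop A) M)" using MD(1) by auto
  fix x assume "x\<in>topspace (subtopology (stop A) M)"
  then have x: "x\<in>spoints A" "x\<in>M" by auto
  have "locally_finite_in (stop A) (strata A)" using ss by (simp add: stratified_space_def)
  then obtain W where W: "openin (stop A) W" "x\<in>W" "finite {U\<in>strata A. U\<inter>W\<noteq>{}}"
   using x(1) unfolding locally_finite_in_def by blast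
  have "{U\<in>(\<lambda>B. B\<inter>M) ` strata A. U\<inter>(W\<inter>M)\<noteq>{}}\<subseteq>(\<lambda>V. V\<inter>M) ` {U\<in>strata A. U\<inter>W\<noteq>{}}" by blast
  then have "finite {U\<in>(\<lambda>B. B\<inter>M) ` strata A. U\<inter>(W\<inter>M)\<noteq>{}}" using W(3) by (rule finite_subset[OF _ finite_imageI])
  moreover have "openin (subtopology (stop A) M) (W\<inter>M)" using W(1) by (auto simp: openin_subtopology)
  ultimately show "\<exists>V. openin (subtopology (stop A) M) V \<and> x\<in>V \<and> finite {U\<in>(\<lambda>B. B\<inter>M) ` strata A. U\<inter>V\<noteq>{}}"
   using W(2) x(2) by blast
 qed
 fix S assume "S\<in>strata strat_base"
 then obtain B where B: "B\<in>strata A" "S = B\<inter>M" by (auto simp: strat_base_simps)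
 interpret regular_mfd "smfd A B" \<mu> by (rule rm[OF B(1)])
 have "connectedin (stop A) (B\<inter>M)"
  using base_connected(1) unfolding base_eq[OF B(1)] part(6)[OF B(1)] connectedin_subtopology by blast
 then show "connectedin (stop strat_base) S" unfolding B(2) strat_base_simps connectedin_subtopology by blast
 have "locally_closed_in (stop A) B" using ss B(1) by (simp add: stratified_space_def)
 then obtain U C where UC: "openin (stop A) U" "closedin (stop A) C" "B = U\<inter>C"
  unfolding locally_closed_in_def by (elim exE conjE)
 have "B\<inter>M = (U\<inter>M)\<inter>(C\<inter>M)" using UC(3) by blast
 moreover have "openin (subtopology (stop A) M) (U\<inter>M)" "closedin (subtopology (stop A) M) (C\<inter>M)"
  using UC by (auto simp: openin_subtopology closedin_subtopology)
 ultimately show "locally_closed_in (stop strat_base) S" unfolding B(2) strat_base_simps locally_closed_in_def by blast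
 have "subtopology (subtopology (stop A) B) (B\<inter>M) = subtopology (subtopology (stop A) M) (B\<inter>M)"
  unfolding subtopology_subtopology by (rule arg_cong[of _ _ "subtopology (stop A)"]) blast
 then show "mtop (smfd strat_base S) = subtopology (stop strat_base) S"
  unfolding B(2) smfd_base[OF B(1)] strat_base_simps base_mfd_simps base_eq[OF B(1)] part(6)[OF B(1)] .
 show "smooth_manifold (smfd strat_base S)" unfolding B(2) smfd_base[OF B(1)] by (rule smooth_base)
 fix R assume "R\<in>strata strat_base" and ne: "S\<inter>(stop strat_base closure_of R)\<noteq>{}"
 then obtain D where D: "D\<in>strata A" "R = D\<inter>M" by (auto simp: strat_base_simps)
 have cl: "stop strat_base closure_of R = M\<inter>stop A closure_of (D\<inter>M)"
  unfolding strat_base_simps(1) closure_of_subtopology D(2) by (simp add: inf_absorb2)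
 have "stop A closure_of (D\<inter>M)\<subseteq>stop A closure_of D" by (rule closure_of_mono) blast
 then have "B\<inter>stop A closure_of D\<noteq>{}" using ne unfolding cl B(2) by blast
 moreover have "\<forall>S\<in>strata A. \<forall>R\<in>strata A. S\<inter>(stop A closure_of R)\<noteq>{} \<longrightarrow> S\<subseteq>stop A closure_of R"
  using ss by (simp add: stratified_space_def)
 ultimately have BD: "B\<subseteq>stop A closure_of D" using B(1) D(1) by simp
 show "S\<subseteq>stop strat_base closure_of R"
 proof
  fix x assume x: "x\<in>S"
  \<comment> \<open>The frontier condition of \<open>A\<close> only makes \<open>x\<close> a limit
    of points of \<open>D\<close>. The continuous map \<mu>_0 fixes \<open>x\<close> and sends
    \<open>D\<close> into D \<inter> M, and so makes it a limit of points of D \<inter> M.\<close>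
  have "(\<lambda>a. \<mu> (0, a)) ` D\<subseteq>D\<inter>M" using mu_B[OF D(1)] proj_M part(3)[OF D(1)] by blast
  then have "stop A closure_of (\<lambda>a. \<mu> (0, a)) ` D\<subseteq>stop A closure_of (D\<inter>M)" by (rule closure_of_mono)
  moreover have "\<mu> (0, x)\<in>stop A closure_of (\<lambda>a. \<mu> (0, a)) ` D"
   using continuous_map_image_closure_subset[OF continuous_mu_t[of 0], of D] BD x B(2) by blast
  ultimately show "x\<in>stop strat_base closure_of R" unfolding cl using x MD(2) B(2) by auto
 qed
qed

lemma bundle_simps: "sv_total bundle = A" "sv_base bundle = strat_base" "sv_proj bundle = (\<lambda>a. \<mu> (0, a))"
 "sv_zero bundle = (\<lambda>x. x)" "sv_scale bundle = (\<lambda>t a. \<mu> (t, a))"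
 by (auto simp: bundle_def)

lemma bundle_add: assumes "B\<in>strata A" "u\<in>B" shows "sv_add bundle u v = badd (smfd A B) \<mu> u v"
proof -
 have "(THE B. B\<in>strata A \<and> u\<in>B) = B" by (rule the_equality) (use assms part(4) in blast)+
 then show ?thesis by (simp add: bundle_def)
qed

lemma bundle_preimage: "B\<in>strata A ==> {a\<in>spoints A. \<mu> (0, a)\<in>B\<inter>M} = B"
 using mu_B_iff proj_M part(3) by blast

lemma stratified_bundle: "stratified_vector_bundle bundle"
 unfolding stratified_vector_bundle_def bundle_simps
proof (intro conjI ballI ss stratified_base)
 show "stratified_morphism A strat_base (\<lambda>a. \<mu> (0, a))" unfolding stratified_morphism_def
 proof (intro conjI ballI)
  show "continuous_map (stop A) (stop strat_base) (\<lambda>a. \<mu> (0, a))"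
   using continuous_mu_t proj_M by (auto simp: strat_base_simps continuous_map_in_subtopology)
  fix B assume B: "B\<in>strata A"
  have "(\<lambda>a. \<mu> (0, a)) ` B\<subseteq>B\<inter>M" using mu_B[OF B] proj_M part(3)[OF B] by blast
  moreover have "smooth_map (smfd A B) (smfd strat_base (B\<inter>M)) (\<lambda>a. \<mu> (0, a))"
   unfolding smfd_base[OF B] by (rule regular_mfd.smooth_proj[OF rm[OF B]])
  moreover have "B\<inter>M\<in>strata strat_base" using B by (simp add: strat_base_simps)
  ultimately show "\<exists>R\<in>strata strat_base. (\<lambda>a. \<mu> (0, a)) ` B\<subseteq>R \<and> smooth_map (smfd A B) (smfd strat_base R) (\<lambda>a. \<mu> (0, a))" by blast
 qed
 have "(\<lambda>(t, a). \<mu> (t, a)) = \<mu>" by auto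
 then show "stratified_morphism (real_times A) A (\<lambda>(t, a). \<mu> (t, a))" using act by (simp add: stratified_regular_action_def)
 fix S assume "S\<in>strata strat_base"
 then obtain B where B: "B\<in>strata A" "S = B\<inter>M" by (auto simp: strat_base_simps)
 show "{a\<in>spoints A. \<mu> (0, a)\<in>S}\<in>strata A" using bundle_preimage[OF B(1)] B by simp
 have "smooth_vector_bundle (smfd A B) (regular_mfd.base_mfd (smfd A B) \<mu>) (\<lambda>a. \<mu> (0, a)) (sv_add bundle) (\<lambda>x. x) (\<lambda>t a. \<mu> (t, a))"
  by (rule regular_mfd.action_smooth_vector_bundle[OF rm[OF B(1)]]) (use bundle_add[OF B(1)] part(5)[OF B(1)] in auto)
 then show "smooth_vector_bundle (smfd A {a\<in>spoints A. \<mu> (0, a)\<in>S}) (smfd strat_base S) (\<lambda>a. \<mu> (0, a)) (sv_add bundle) (\<lambda>x. x) (\<lambda>t a. \<mu> (t, a))"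
  unfolding B(2) bundle_preimage[OF B(1)] smfd_base[OF B(1)] .
qed

lemma svb_bundle: "svb_of_action A \<mu> bundle" "continuous_zero_section bundle"
 using stratified_bundle
 by (auto simp: svb_of_action_def bundle_simps continuous_zero_section_def strat_base_simps)

end

section \<open>Comparison with an arbitrary bundle\<close>

locale strat_action_bundle = strat_action A \<mu> for A :: "'a strat_space" and \<mu> +
 fixes V' :: "('a, 'b) svb"
 assumes svb: "svb_of_action A \<mu> V'"
begin

abbreviation "X' \<equiv> sv_base V'"
abbreviation "p' \<equiv> sv_proj V'"
abbreviation "z' \<equiv> sv_zero V'"

lemma tot: "sv_total V' = A" and scl: "a\<in>spoints A ==> sv_scale V' t a = \<mu> (t, a)"
 and ssX: "stratified_space X'" and p'_cont: "continuous_map (stop A) (stop X') p'"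
 and fib_strat: "S\<in>strata X' ==> {a\<in>spoints A. p' a\<in>S}\<in>strata A"
 and fib_vb: "S\<in>strata X' ==> smooth_vector_bundle (smfd A {a\<in>spoints A. p' a\<in>S}) (smfd X' S) p' (sv_add V') z' (sv_scale V')"
 using svb by (auto simp: svb_of_action_def stratified_vector_bundle_def stratified_morphism_def)

lemmas partX = strata_partition[OF ssX]

lemma p'_in: "a\<in>spoints A ==> p' a\<in>spoints X'"
 using p'_cont by (auto simp: continuous_map_def)

lemma z'D: assumes "x\<in>spoints X'" shows "z' x\<in>spoints A" "p' (z' x) = x"
proof -
 obtain S where S: "S\<in>strata X'" "x\<in>S" using partX(1) assms by blast
 interpret smooth_bundle "smfd A {a\<in>spoints A. p' a\<in>S}" "smfd X' S" p' "sv_add V'" z' "sv_scale V'"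
  by unfold_locales (rule fib_vb[OF S(1)])
 show "z' x\<in>spoints A" "p' (z' x) = x" using zerD[of x] S partX(5)[OF S(1)] part(5)[OF fib_strat[OF S(1)]] by auto
qed

lemma z'_p': assumes a: "a\<in>spoints A" shows "z' (p' a) = \<mu> (0, a)"
proof -
 obtain S where S: "S\<in>strata X'" "p' a\<in>S" using partX(1) p'_in[OF a] by blast
 interpret smooth_bundle "smfd A {a\<in>spoints A. p' a\<in>S}" "smfd X' S" p' "sv_add V'" z' "sv_scale V'"
  by unfold_locales (rule fib_vb[OF S(1)])
 have "a\<in>mpoints (smfd A {a\<in>spoints A. p' a\<in>S})" using part(5)[OF fib_strat[OF S(1)]] a S(2) by simp
 from scl_0[OF this] show ?thesis using scl[OF a] by simp
qed

lemma p'_mu: "a\<in>spoints A ==> p' (\<mu> (0, a)) = p' a"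
 using z'_p'[of a] z'D(2)[OF p'_in] by metis

lemma z'_M: "x\<in>spoints X' ==> z' x\<in>M"
 using z'_p'[OF z'D(1)] z'D by (simp add: M_def)

text \<open>\<open>restrict\<close> fixes the value outside \<open>M\<close>, so that uniqueness can
  be stated for functions in \<open>extensional M\<close>.\<close>

definition "g = restrict p' M"

lemma g_eq: "x\<in>M ==> g x = p' x" by (simp add: g_def)

lemma z'_g: "x\<in>M ==> z' (g x) = x"
 using z'_p'[OF MD(1)] MD(2) by (simp add: g_eq)

lemma g_z': "x\<in>spoints X' ==> g (z' x) = x"
 using z'_M z'D(2) by (simp add: g_eq)

lemma g_bij: "bij_betw g M (spoints X')"
 by (rule bij_betw_byWitness[where f'=z']) (use z'_g g_z' z'_M p'_in MD(1) g_eq in auto)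

lemma inv_g: "y\<in>spoints X' ==> inv_into M g y = z' y"
 by (rule inv_into_f_eq[OF bij_betw_imp_inj_on[OF g_bij] z'_M g_z'])

text \<open>For \<open>a\<close> in \<open>B\<close>, the preimage under \<open>p'\<close> of the
  stratum through p' a is a stratum of \<open>A\<close> meeting \<open>B\<close>, hence equal to
  \<open>B\<close>.\<close>

lemma stratum_image: assumes B: "B\<in>strata A"
 obtains S where "S\<in>strata X'" "{a\<in>spoints A. p' a\<in>S} = B" "g ` (B\<inter>M) = S"
proof -
 obtain a where a: "a\<in>B" using part(2)[OF B] by blast
 have aA: "a\<in>spoints A" using a part(3)[OF B] by blast
 obtain S where S: "S\<in>strata X'" "p' a\<in>S" using partX(1) p'_in[OF aA] by blast
 have e: "{a\<in>spoints A. p' a\<in>S} = B" by (rule part(4)[OF fib_strat[OF S(1)] B, of a]) (use a aA S in auto)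
 have "g ` (B\<inter>M) = S"
 proof (intro equalityI subsetI)
  fix y assume "y\<in>g ` (B\<inter>M)" then show "y\<in>S" using e g_eq by auto
 next
  fix y assume y: "y\<in>S"
  then have yX: "y\<in>spoints X'" using partX(3)[OF S(1)] by blast
  have "z' y\<in>B" using z'D[OF yX] y e by auto
  then show "y\<in>g ` (B\<inter>M)" using z'_M[OF yX] g_z'[OF yX] by (metis IntI imageI)
 qed
 then show thesis using that S(1) e by blast
qed

lemma p'_eq_iff: assumes "a\<in>spoints A" "b\<in>spoints A" shows "p' a = p' b \<longleftrightarrow> \<mu> (0, a) = \<mu> (0, b)"
 using z'_p'[OF assms(1)] z'_p'[OF assms(2)] p'_mu[OF assms(1)] p'_mu[OF assms(2)] by metis

lemma comparison: "svb_comparison bundle V' g"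
 unfolding svb_comparison_def bundle_simps strat_base_simps(2,3)
proof (intro conjI ballI impI)
 show "bij_betw g M (spoints X')" by (rule g_bij)
 show "p' a = g (\<mu> (0, a))" if "a\<in>spoints A" for a using that p'_mu proj_M by (simp add: g_eq)
 have strat: "\<exists>S. S\<in>strata X' \<and> g ` (B\<inter>M) = S \<and> diffeomorphism (smfd strat_base (B\<inter>M)) (smfd X' S) g" if B: "B\<in>strata A" for B
 proof -
  obtain S where S: "S\<in>strata X'" "{a\<in>spoints A. p' a\<in>S} = B" "g ` (B\<inter>M) = S" using stratum_image[OF B] by metis
  interpret B: smooth_bundle "smfd A B" "smfd X' S" p' "sv_add V'" z' "sv_scale V'"
   by unfold_locales (use fib_vb[OF S(1)] S(2) in simp)
  interpret R: regular_mfd "smfd A B" \<mu> by (rule rm[OF B])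
  have bp: "mpoints R.base_mfd = B\<inter>M" using R.base_mfd_simps(3) base_eq[OF B] by simp
  have "smooth_map R.base_mfd (smfd X' S) p'"
   by (rule smooth_map_compose[OF R.atlas_base R.atl B.atlM R.smooth_inclusion B.smooth_p])
  then have 1: "smooth_map R.base_mfd (smfd X' S) g"
   by (rule smooth_map_cong[OF R.atlas_base B.atlM]) (simp only: bp g_eq Int_iff)
  have SX: "y\<in>spoints X'" if "y\<in>S" for y using that partX(3)[OF S(1)] by blast
  have bij: "bij_betw g (B\<inter>M) S" unfolding S(3)[symmetric]
   using inj_on_subset[OF bij_betw_imp_inj_on[OF g_bij]] by (simp add: inj_on_imp_bij_betw)
  \<comment> \<open>On a single stratum the zero section is smooth, although nothing is known about
    its continuity across strata.\<close>
  have "smooth_map (smfd X' S) R.base_mfd z'"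
  proof (rule R.smooth_map_into_base[OF B.atlM B.smooth_zer])
   fix y assume "y\<in>mpoints (smfd X' S)"
   then have y: "y\<in>S" using partX(5)[OF S(1)] by simp
   have "z' y\<in>B" using z'D[OF SX[OF y]] y S(2) by auto
   then show "z' y\<in>R.base" using z'_M[OF SX[OF y]] base_eq[OF B] by simp
  qed
  then have 2: "smooth_map (smfd X' S) R.base_mfd (inv_into (B\<inter>M) g)"
  proof (rule smooth_map_cong[OF B.atlM R.atlas_base])
   fix y assume "y\<in>mpoints (smfd X' S)"
   then have y: "y\<in>S" using partX(5)[OF S(1)] by simp
   have "z' y\<in>B\<inter>M" using z'D[OF SX[OF y]] y S(2) z'_M[OF SX[OF y]] by auto
   then show "z' y = inv_into (B\<inter>M) g y"
    using inv_into_f_eq[OF bij_betw_imp_inj_on[OF bij] _ g_z'[OF SX[OF y]]] by simp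
  qed
  have "diffeomorphism (smfd strat_base (B\<inter>M)) (smfd X' S) g"
   unfolding diffeomorphism_def smfd_base[OF B] bp partX(5)[OF S(1)] using bij 1 2 by blast
  then show ?thesis using S by blast
 qed
 show "stratified_morphism strat_base X' g" unfolding stratified_morphism_def
 proof (intro conjI ballI)
  show "continuous_map (stop strat_base) (stop X') g" unfolding strat_base_simps
   by (rule continuous_map_eq[OF continuous_map_from_subtopology[OF p'_cont]]) (simp add: g_eq)
  fix S assume "S\<in>strata strat_base"
  then obtain B where B: "B\<in>strata A" "S = B\<inter>M" by (auto simp: strat_base_simps)
  from strat[OF B(1)] show "\<exists>R\<in>strata X'. g ` S\<subseteq>R \<and> smooth_map (smfd strat_base S) (smfd X' R) g"
   unfolding B(2) diffeomorphism_def by blast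
 qed
 show "g ` S\<in>strata X'" "diffeomorphism (smfd strat_base S) (smfd X' (g ` S)) g" if "S\<in>(\<lambda>B. B\<inter>M) ` strata A" for S
  using strat that by blast+
 fix a b assume ab: "a\<in>spoints A" "b\<in>spoints A" "\<mu> (0, a) = \<mu> (0, b)"
 obtain B where B: "B\<in>strata A" "a\<in>B" using stratum_of[OF ab(1)] by blast
 have bB: "b\<in>B" using mu_B_iff[OF B(1) ab(1), of 0] mu_B_iff[OF B(1) ab(2), of 0] ab(3) B(2) by simp
 obtain S where S: "S\<in>strata X'" "{a\<in>spoints A. p' a\<in>S} = B" using stratum_image[OF B(1)] by metis
 have vb: "smooth_vector_bundle (smfd A B) (smfd X' S) p' (sv_add V') z' (sv_scale V')" using fib_vb[OF S(1)] S(2) by simp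
 have "p' a = p' b" using p'_eq_iff[OF ab(1,2)] ab(3) by simp
 then have "sv_add V' a b = badd (smfd A B) \<mu> a b"
  by (intro regular_mfd.bundle_addition[OF rm[OF B(1)] vb]) (use part(3,5)[OF B(1)] B(2) bB in \<open>auto intro!: scl\<close>)
 then show "sv_add V' a b = sv_add bundle a b" using bundle_add[OF B] by simp
qed

text \<open>Compatibility with the projections, evaluated at a fixed point \<open>x\<close>, already
  gives f x = p' x.\<close>

lemma comparison_unique:
 assumes "f\<in>extensional M" "svb_comparison bundle V' f" shows "f = g"
proof (rule extensionalityI[OF assms(1), of g])
 show "g\<in>extensional M" by (simp add: g_def)
 show "f x = g x" if x: "x\<in>M" for x
  using assms(2) MD[OF x] x by (simp add: svb_comparison_def bundle_simps g_eq)
qed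

lemma isomorphism:
 assumes "continuous_map (stop X') (stop A) z'" shows "svb_isomorphism bundle V' g"
proof -
 have "homeomorphic_maps (stop strat_base) (stop X') g z'" unfolding homeomorphic_maps_def
 proof (intro conjI ballI)
  show "continuous_map (stop strat_base) (stop X') g"
   using comparison by (simp add: svb_comparison_def stratified_morphism_def bundle_simps)
  show "continuous_map (stop X') (stop strat_base) z'"
   using assms z'_M by (auto simp: strat_base_simps continuous_map_in_subtopology)
 qed (use z'_g g_z' strat_base_simps in auto)
 then have "homeomorphic_map (stop strat_base) (stop X') g" by (simp add: homeomorphic_maps_map)
 then show ?thesis using comparison by (simp add: svb_isomorphism_def bundle_simps)
qed

lemma g_extensional: "g\<in>extensional M" by (simp add: g_def)

end

section \<open>Charts of stratified spaces\<close>

lemma embeddingI: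
 assumes U: "openin T U" and R: "\<And>w. w\<in>U ==> \<phi> w\<in>Rn n" and inj: "inj_on \<phi> U"
  and c: "\<And>O'. openin (En n) O' ==> openin T {w\<in>U. \<phi> w\<in>O'}"
  and o: "\<And>W w. openin T W ==> w\<in>U ==> w\<in>W ==>
   \<exists>V. openin (En n) V \<and> \<phi> w\<in>V \<and> (\<forall>u\<in>U. \<phi> u\<in>V \<longrightarrow> u\<in>W)"
 shows "embedding_map (subtopology T U) (En n) \<phi>"
proof -
 have UT: "topspace (subtopology T U) = U" using openin_subset[OF U] by auto
 have "continuous_map (subtopology T U) (En n) \<phi>" unfolding continuous_map_def UT
 proof (intro conjI allI impI)
  show "\<phi>\<in>U \<rightarrow> Rn n" using R by simp
  fix O' assume "openin (En n) O'"
  then show "openin (subtopology T U) {w\<in>U. \<phi> w\<in>O'}" unfolding openin_open_subtopology[OF U] using c by simp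
 qed
 then have cm: "continuous_map (subtopology T U) (subtopology (En n) (\<phi> ` U)) \<phi>"
  by (simp add: continuous_map_in_subtopology UT)
 show ?thesis unfolding embedding_map_def UT
 proof (rule bijective_open_imp_homeomorphic_map[OF cm])
  show "open_map (subtopology T U) (subtopology (En n) (\<phi> ` U)) \<phi>" unfolding open_map_def
  proof (intro allI impI)
   fix W assume "openin (subtopology T U) W"
   then have W: "openin T W" "W\<subseteq>U" unfolding openin_open_subtopology[OF U] by simp_all
   \<comment> \<open>The union of all suitable open sets, which avoids choosing one for each point
     of \<open>W\<close>.\<close>
   define V where "V = \<Union>{V. openin (En n) V \<and> (\<forall>u\<in>U. \<phi> u\<in>V \<longrightarrow> u\<in>W)}"
   have "openin (En n) V" unfolding V_def by (rule openin_Union) blast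
   moreover have "\<phi> ` W = V\<inter>\<phi> ` U"
   proof (intro equalityI subsetI)
    fix y assume "y\<in>\<phi> ` W"
    then obtain w where w: "w\<in>W" "y = \<phi> w" by (elim imageE)
    have wU: "w\<in>U" using w(1) W(2) by (rule subsetD[rotated])
    from o[OF W(1) wU w(1)] have "y\<in>V" unfolding V_def w(2) by blast
    then show "y\<in>V\<inter>\<phi> ` U" using wU w(2) by simp
   next
    fix y assume "y\<in>V\<inter>\<phi> ` U"
    then show "y\<in>\<phi> ` W" unfolding V_def by blast
   qed
   ultimately show "openin (subtopology (En n) (\<phi> ` U)) (\<phi> ` W)" unfolding openin_subtopology by (intro exI conjI)
  qed
  show "\<phi> ` topspace (subtopology T U) = topspace (subtopology (En n) (\<phi> ` U))" using R UT by auto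
  show "inj_on \<phi> (topspace (subtopology T U))" using inj UT by simp
 qed
qed

text \<open>The topological part of \<open>strat_chart\<close>, separated from the strata because
  the comparison of two charts uses nothing else.\<close>

definition emb :: "'a topology \<Rightarrow> nat \<Rightarrow> 'a set \<Rightarrow> ('a \<Rightarrow> nat \<Rightarrow> real) \<Rightarrow> bool" where
 "emb T n U \<phi> \<longleftrightarrow> openin T U \<and> embedding_map (subtopology T U) (En n) \<phi>"

lemma embD:
 assumes e: "emb T n U \<phi>"
 shows "openin T U" "U\<subseteq>topspace T" "w\<in>U ==> \<phi> w\<in>Rn n" "inj_on \<phi> U"
  "openin (En n) O' ==> openin T {w\<in>U. \<phi> w\<in>O'}"
  "openin T W ==> \<exists>V. openin (En n) V \<and> (\<forall>u\<in>U. \<phi> u\<in>V \<longleftrightarrow> u\<in>W)"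
proof -
 show U: "openin T U" using e by (simp add: emb_def)
 then show "U\<subseteq>topspace T" by (rule openin_subset)
 then have UT: "topspace (subtopology T U) = U" by auto
 have h: "homeomorphic_map (subtopology T U) (subtopology (En n) (\<phi> ` U)) \<phi>"
  using e unfolding emb_def embedding_map_def UT by simp
 have c: "continuous_map (subtopology T U) (En n) \<phi>"
  using homeomorphic_imp_continuous_map[OF h] by (simp add: continuous_map_in_subtopology)
 have "\<phi>\<in>U \<rightarrow> Rn n" using c unfolding continuous_map_def UT by simp
 then show "w\<in>U ==> \<phi> w\<in>Rn n" by (rule funcset_mem)
 show inj: "inj_on \<phi> U" using homeomorphic_imp_injective_map[OF h] UT by simp
 show "openin T {w\<in>U. \<phi> w\<in>O'}" if "openin (En n) O'"
  using openin_continuous_map_preimage[OF c that] unfolding UT openin_open_subtopology[OF U] by simp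
 show "\<exists>V. openin (En n) V \<and> (\<forall>u\<in>U. \<phi> u\<in>V \<longleftrightarrow> u\<in>W)" if W: "openin T W"
 proof -
  have "openin (subtopology T U) (U\<inter>W)" using openin_Int[OF U W] by (simp add: openin_open_subtopology[OF U])
  then have "openin (subtopology (En n) (\<phi> ` U)) (\<phi> ` (U\<inter>W))"
   using homeomorphic_imp_open_map[OF h] unfolding open_map_def by simp
  then obtain V where V: "openin (En n) V" "\<phi> ` (U\<inter>W) = V\<inter>\<phi> ` U" unfolding openin_subtopology by (elim exE conjE)
  have "\<phi> u\<in>V \<longleftrightarrow> u\<in>W" if u: "u\<in>U" for u
  proof
   assume "\<phi> u\<in>V"
   then have "\<phi> u\<in>\<phi> ` (U\<inter>W)" using V(2) u by simp
   then obtain w where w: "w\<in>U" "w\<in>W" "\<phi> u = \<phi> w" by blast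
   have "u = w" by (rule inj_onD[OF inj w(3) u w(1)])
   then show "u\<in>W" using w by simp
  next
   assume "u\<in>W"
   then have "\<phi> u\<in>\<phi> ` (U\<inter>W)" using u by blast
   then show "\<phi> u\<in>V" using V(2) by simp
  qed
  then show ?thesis using V(1) by (intro exI[of _ V] conjI ballI)
 qed
qed

text \<open>\<open>\<tau>\<close> is defined on the whole of \<open>Rn n\<close>, so such relations
  compose without shrinking domains in coordinates; by \<open>cmap_extend\<close> this is no loss,
  since the equation is local anyway.\<close>

definition factors :: "'a topology \<Rightarrow> nat \<Rightarrow> ('a \<Rightarrow> nat \<Rightarrow> real) \<Rightarrow> nat \<Rightarrow> ('a \<Rightarrow> nat \<Rightarrow> real) \<Rightarrow> 'a \<Rightarrow> bool" where
 "factors T n \<phi> m \<psi> x \<longleftrightarrow> (\<exists>W \<tau>. openin T W \<and> x\<in>W \<and> smooth_coord_map n (Rn n) m \<tau> \<and> (\<forall>w\<in>W. \<psi> w = \<tau> (\<phi> w)))"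

lemma factorsI: "openin T W ==> x\<in>W ==> smooth_coord_map n (Rn n) m \<tau> ==> (\<And>w. w\<in>W ==> \<psi> w = \<tau> (\<phi> w)) ==> factors T n \<phi> m \<psi> x"
 unfolding factors_def by (intro exI[of _ W] exI[of _ \<tau>] conjI ballI)

lemma factorsE:
 assumes "factors T n \<phi> m \<psi> x"
 obtains W \<tau> where "openin T W" "x\<in>W" "smooth_coord_map n (Rn n) m \<tau>" "\<forall>w\<in>W. \<psi> w = \<tau> (\<phi> w)"
 using assms unfolding factors_def by (elim exE conjE) (rule that, assumption+)

definition sfun_at :: "'a topology \<Rightarrow> nat \<Rightarrow> ('a \<Rightarrow> nat \<Rightarrow> real) \<Rightarrow> ('a \<Rightarrow> real) \<Rightarrow> 'a \<Rightarrow> bool" where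
 "sfun_at T n \<phi> f x \<longleftrightarrow> (\<exists>W g. openin T W \<and> x\<in>W \<and> smooth_fun n (Rn n) g \<and> (\<forall>w\<in>W. f w = g (\<phi> w)))"

lemma sfun_atI: "openin T W ==> x\<in>W ==> smooth_fun n (Rn n) g ==> (\<And>w. w\<in>W ==> f w = g (\<phi> w)) ==> sfun_at T n \<phi> f x"
 unfolding sfun_at_def by (intro exI[of _ W] exI[of _ g] conjI ballI)

lemma sfun_atE:
 assumes "sfun_at T n \<phi> f x"
 obtains W g where "openin T W" "x\<in>W" "smooth_fun n (Rn n) g" "\<forall>w\<in>W. f w = g (\<phi> w)"
 using assms unfolding sfun_at_def by (elim exE conjE) (rule that, assumption+)

lemma factors_trans:
 assumes "factors T n \<phi> m \<psi> x" "factors T m \<psi> l \<theta> x" shows "factors T n \<phi> l \<theta> x"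
proof -
 obtain W \<tau> where 1: "openin T W" "x\<in>W" "smooth_coord_map n (Rn n) m \<tau>" "\<forall>w\<in>W. \<psi> w = \<tau> (\<phi> w)"
  by (rule factorsE[OF assms(1)])
 obtain V \<sigma> where 2: "openin T V" "x\<in>V" "smooth_coord_map m (Rn m) l \<sigma>" "\<forall>w\<in>V. \<theta> w = \<sigma> (\<psi> w)"
  by (rule factorsE[OF assms(2)])
 show ?thesis
 proof (rule factorsI)
  show "openin T (W\<inter>V)" using 1(1) 2(1) by (rule openin_Int)
  show "smooth_coord_map n (Rn n) l (\<lambda>z. \<sigma> (\<tau> z))" by (rule cmap_compose[OF 2(3) 1(3)]) (rule cmapD(2)[OF 1(3)])
 qed (use 1 2 in simp_all)
qed

lemma sfun_at_factors:
 assumes "factors T n \<phi> m \<psi> x" "sfun_at T m \<psi> f x" shows "sfun_at T n \<phi> f x"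
proof -
 obtain W \<tau> where 1: "openin T W" "x\<in>W" "smooth_coord_map n (Rn n) m \<tau>" "\<forall>w\<in>W. \<psi> w = \<tau> (\<phi> w)"
  by (rule factorsE[OF assms(1)])
 obtain V g where 2: "openin T V" "x\<in>V" "smooth_fun m (Rn m) g" "\<forall>w\<in>V. f w = g (\<psi> w)"
  by (rule sfun_atE[OF assms(2)])
 show ?thesis
 proof (rule sfun_atI)
  show "openin T (W\<inter>V)" using 1(1) 2(1) by (rule openin_Int)
  show "smooth_fun n (Rn n) (\<lambda>z. g (\<tau> z))" by (rule smooth_fun_compose[OF 2(3) 1(3)]) (rule cmapD(2)[OF 1(3)])
 qed (use 1 2 in simp_all)
qed

lemma sfun_at_cong:
 assumes "sfun_at T n \<phi> f x" "openin T V" "x\<in>V" "\<And>w. w\<in>V ==> f w = f' w" shows "sfun_at T n \<phi> f' x"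
proof -
 obtain W g where W: "openin T W" "x\<in>W" "smooth_fun n (Rn n) g" "\<forall>w\<in>W. f w = g (\<phi> w)"
  by (rule sfun_atE[OF assms(1)])
 show ?thesis
 proof (rule sfun_atI[OF openin_Int[OF W(1) assms(2)] _ W(3)])
  show "f' w = g (\<phi> w)" if "w\<in>W\<inter>V" for w using bspec[OF W(4), of w] assms(4)[of w] that by simp
 qed (use W(2) assms(3) in simp)
qed

lemma sfun_at_subtopology:
 assumes "sfun_at T n \<phi> f x" "x\<in>S" shows "sfun_at (subtopology T S) n \<phi> f x"
proof -
 obtain W g where W: "openin T W" "x\<in>W" "smooth_fun n (Rn n) g" "\<forall>w\<in>W. f w = g (\<phi> w)"
  by (rule sfun_atE[OF assms(1)])
 show ?thesis by (rule sfun_atI[of _ "W\<inter>S", OF _ _ W(3)]) (use W assms in \<open>auto simp: openin_subtopology\<close>)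
qed

lemma factors_subtopology:
 assumes "factors T n \<phi> m \<psi> x" "x\<in>S" shows "factors (subtopology T S) n \<phi> m \<psi> x"
proof -
 obtain W \<tau> where 1: "openin T W" "x\<in>W" "smooth_coord_map n (Rn n) m \<tau>" "\<forall>w\<in>W. \<psi> w = \<tau> (\<phi> w)"
  by (rule factorsE[OF assms(1)])
 show ?thesis by (rule factorsI[of _ "W\<inter>S", OF _ _ 1(3)]) (use 1 assms in \<open>auto simp: openin_subtopology\<close>)
qed

lemma factors_coords:
 assumes s: "\<And>i. i < m ==> sfun_at T n \<phi> (\<lambda>w. \<psi> w i) x"
  and W: "openin T W" "x\<in>W" "\<And>w. w\<in>W ==> \<psi> w\<in>Rn m"
 shows "factors T n \<phi> m \<psi> x"
proof -
 have "\<exists>p. openin T (fst p) \<and> x\<in>fst p \<and> smooth_fun n (Rn n) (snd p) \<and> (\<forall>w\<in>fst p. \<psi> w i = snd p (\<phi> w))" if "i < m" for i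
  using s[OF that] unfolding sfun_at_def by (elim exE) (rule exI[of _ "(_, _)"], simp)
 then obtain p where p: "\<And>i. i < m ==> openin T (fst (p i)) \<and> x\<in>fst (p i) \<and> smooth_fun n (Rn n) (snd (p i)) \<and>
   (\<forall>w\<in>fst (p i). \<psi> w i = snd (p i) (\<phi> w))" by metis
 let ?\<tau> = "\<lambda>z j. if j < m then snd (p j) z else 0"
 let ?W = "W\<inter>\<Inter>((\<lambda>i. fst (p i)) ` {..<m})"
 show ?thesis
 proof (rule factorsI)
  show "openin T ?W" by (rule openin_Int_Inter[OF _ W(1)]) (use p in auto)
  show "smooth_coord_map n (Rn n) m ?\<tau>"
  proof (rule cmapI)
   show "smooth_fun n (Rn n) (\<lambda>z. ?\<tau> z i)" if "i < m" for i using p[OF that] that by simp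
  qed (simp_all add: Rn_iff)
  show "\<psi> w = ?\<tau> (\<phi> w)" if w: "w\<in>?W" for w
  proof (rule Rn_eqI)
   show "\<psi> w\<in>Rn m" using W(3) w by simp
   show "?\<tau> (\<phi> w)\<in>Rn m" by (simp add: Rn_iff)
   show "\<psi> w i = ?\<tau> (\<phi> w) i" if "i < m" for i using p[OF that] w that by auto
  qed
 qed (use W(2) p in auto)
qed

text \<open>A smooth map on an open subset of R^k is restricted to the subspace \<open>Rn n\<close>,
  truncated to \<open>m\<close> coordinates, and then continued from a neighbourhood to all of
  \<open>Rn n\<close>.\<close>

lemma factors_via_diffeo:
 assumes \<phi>: "\<And>O'. openin (En n) O' ==> openin T {w\<in>U. \<phi> w\<in>O'}" "\<And>w. w\<in>U ==> \<phi> w\<in>Rn n"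
  and \<psi>: "\<And>w. w\<in>W ==> \<psi> w\<in>Rn m"
  and H: "smooth_coord_map k P k H" "n\<le>k"
  and W: "openin T W" "x\<in>W" "W\<subseteq>U" "\<phi> ` W\<subseteq>P" "\<And>w. w\<in>W ==> H (\<phi> w) = \<psi> w"
 shows "factors T n \<phi> m \<psi> x"
proof -
 have i: "smooth_coord_map n (Rn n) k (\<lambda>z. z)" by (rule smooth_coord_id[OF _ H(2)]) simp
 let ?P = "{z\<in>Rn n. z\<in>P}"
 have oP: "openin (En n) ?P" by (rule cmap_openin_preimage[OF i cmapD(1)[OF H(1)]])
 have "smooth_coord_map n ?P k (\<lambda>z. H z)" by (rule cmap_compose[OF H(1) cmap_subset[OF i oP]]) auto
 from cmap_compose[OF smooth_trunc[of k "Rn k" m] this]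
 have s: "smooth_coord_map n ?P m (\<lambda>z. trunc m (H z))" using cmapD(2)[OF H(1)] by simp
 have xP: "\<phi> x\<in>?P" using W \<phi>(2) by blast
 obtain g V where g: "smooth_coord_map n (Rn n) m g" "openin (En n) V" "\<phi> x\<in>V" "V\<subseteq>?P"
  "\<And>y. y\<in>V ==> g y = trunc m (H y)" by (rule cmap_extend[OF s xP]) blast
 show ?thesis
 proof (rule factorsI[of _ "{w\<in>U. \<phi> w\<in>V}\<inter>W"])
  show "openin T ({w\<in>U. \<phi> w\<in>V}\<inter>W)" by (rule openin_Int[OF \<phi>(1)[OF g(2)] W(1)])
  show "x\<in>{w\<in>U. \<phi> w\<in>V}\<inter>W" using W(2,3) g(3) by blast
  show "\<psi> w = g (\<phi> w)" if "w\<in>{w\<in>U. \<phi> w\<in>V}\<inter>W" for w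
   using that g(5)[of "\<phi> w"] W(5)[of w] trunc_id[OF \<psi>, of w] by simp
 qed (rule g(1))
qed

text \<open>Two charts are compatible iff each is, locally, a smooth function of the other one: two such functions,
 composed with truncations, have mutually inverse differentials along the image of the tangent space,
 and \<open>local_diffeo_of_mutual\<close> corrects them to a diffeomorphism.\<close>

lemma strat_compatible_iff:
 assumes c: "emb (stop X) n U \<phi>" and d: "emb (stop X) m V \<psi>"
 shows "strat_compatible X (n, U, \<phi>) (m, V, \<psi>) \<longleftrightarrow>
  (\<forall>x\<in>U\<inter>V. factors (stop X) n \<phi> m \<psi> x \<and> factors (stop X) m \<psi> n \<phi> x)" (is "?L \<longleftrightarrow> ?R")
proof
 assume L: ?L
 show ?R
 proof
  fix x assume x: "x\<in>U\<inter>V"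
  have "\<exists>W P Q H. openin (stop X) W \<and> x\<in>W \<and> W\<subseteq>U\<inter>V \<and> \<phi> ` W\<subseteq>P \<and> \<psi> ` W\<subseteq>Q \<and>
   coord_diffeo (max n m) P Q H \<and> (\<forall>w\<in>W. H (\<phi> w) = \<psi> w)"
   using L x unfolding strat_compatible_def by simp
  then obtain W P Q H where W: "openin (stop X) W" "x\<in>W" "W\<subseteq>U\<inter>V" "\<phi> ` W\<subseteq>P" "\<psi> ` W\<subseteq>Q"
   and cd: "coord_diffeo (max n m) P Q H" and HW: "\<forall>w\<in>W. H (\<phi> w) = \<psi> w" by (elim exE conjE)
  obtain G where H: "smooth_coord_map (max n m) P (max n m) H" and G: "smooth_coord_map (max n m) Q (max n m) G"
   and GH: "\<And>x. x\<in>P ==> G (H x) = x" by (rule coord_diffeoE[OF cd]) blast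
  have WU: "W\<subseteq>U" and WV: "W\<subseteq>V" using W(3) by auto
  have GW: "G (\<psi> w) = \<phi> w" if w: "w\<in>W" for w using GH[of "\<phi> w"] HW w W(4) by auto
  have "factors (stop X) n \<phi> m \<psi> x"
   by (rule factors_via_diffeo[OF embD(5)[OF c] embD(3)[OF c] _ H _ W(1,2) WU W(4)]) (use embD(3)[OF d] WV HW in auto)
  moreover have "factors (stop X) m \<psi> n \<phi> x"
   by (rule factors_via_diffeo[OF embD(5)[OF d] embD(3)[OF d] _ G _ W(1,2) WV W(5) GW]) (use embD(3)[OF c] WU in auto)
  ultimately show "factors (stop X) n \<phi> m \<psi> x \<and> factors (stop X) m \<psi> n \<phi> x" ..
 qed
next
 assume R: ?R
 let ?k = "max n m"
 have "\<exists>W P Q H. openin (stop X) W \<and> x\<in>W \<and> W\<subseteq>U\<inter>V \<and> \<phi> ` W\<subseteq>P \<and> \<psi> ` W\<subseteq>Q \<and>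
   coord_diffeo ?k P Q H \<and> (\<forall>w\<in>W. H (\<phi> w) = \<psi> w)" if x: "x\<in>U\<inter>V" for x
 proof -
  obtain W1 \<sigma> where 1: "openin (stop X) W1" "x\<in>W1" "smooth_coord_map n (Rn n) m \<sigma>" "\<forall>w\<in>W1. \<psi> w = \<sigma> (\<phi> w)"
   by (rule factorsE[OF conjunct1[OF bspec[OF R x]]])
  obtain W2 \<tau> where 2: "openin (stop X) W2" "x\<in>W2" "smooth_coord_map m (Rn m) n \<tau>" "\<forall>w\<in>W2. \<phi> w = \<tau> (\<psi> w)"
   by (rule factorsE[OF conjunct2[OF bspec[OF R x]]])
  have F: "smooth_coord_map ?k (Rn ?k) ?k (\<lambda>z. \<sigma> (trunc n z))"
   by (rule cmap_into[of _ _ m, OF cmap_compose[OF 1(3) smooth_trunc]]) auto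
  have G: "smooth_coord_map ?k (Rn ?k) ?k (\<lambda>z. \<tau> (trunc m z))"
   by (rule cmap_into[of _ _ n, OF cmap_compose[OF 2(3) smooth_trunc]]) auto
  have tn: "trunc n (\<phi> w) = \<phi> w" "\<phi> w\<in>Rn ?k" if "w\<in>U" for w
   using embD(3)[OF c that] Rn_mono[of "\<phi> w" n ?k] by (simp_all add: trunc_id)
  have tm: "trunc m (\<psi> w) = \<psi> w" "\<psi> w\<in>Rn ?k" if "w\<in>V" for w
   using embD(3)[OF d that] Rn_mono[of "\<psi> w" m ?k] by (simp_all add: trunc_id)
  have FW: "\<sigma> (trunc n (\<phi> w)) = \<psi> w" if "w\<in>W1" "w\<in>U" for w using bspec[OF 1(4) that(1)] tn(1)[OF that(2)] by simp
  have GW: "\<tau> (trunc m (\<psi> w)) = \<phi> w" if "w\<in>W2" "w\<in>V" for w using bspec[OF 2(4) that(1)] tm(1)[OF that(2)] by simp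
  have xU: "x\<in>U" "x\<in>V" using x by auto
  obtain P H where P: "\<phi> x\<in>P" "coord_diffeo ?k P (H ` P) H"
   "\<And>z. z\<in>P ==> \<tau> (trunc m (\<sigma> (trunc n z))) = z ==> H z = \<sigma> (trunc n z)"
   by (rule local_diffeo_of_mutual[OF F G, of "\<phi> x"])
    (simp_all only: FW[OF 1(2) xU(1)] GW[OF 2(2) xU(2)] tn(2)[OF xU(1)] tm(2)[OF xU(2)])
  have "openin (En ?k) P" using P(2) cmapD(1) unfolding coord_diffeo_def by blast
  then have oP: "openin (En n) {z\<in>Rn n. z\<in>P}"
   by (intro cmap_openin_preimage[OF smooth_coord_id, of n "Rn n" ?k]) simp_all
  define W where "W = W1\<inter>W2\<inter>{w\<in>U. \<phi> w\<in>{z\<in>Rn n. z\<in>P}}\<inter>V"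
  have oW: "openin (stop X) W" unfolding W_def by (intro openin_Int 1(1) 2(1) embD(5)[OF c oP] embD(1)[OF d])
  have WD: "w\<in>W1" "w\<in>W2" "w\<in>U" "w\<in>V" "\<phi> w\<in>P" if "w\<in>W" for w using that by (auto simp: W_def)
  have HW: "H (\<phi> w) = \<psi> w" if w: "w\<in>W" for w
   using P(3)[OF WD(5)[OF w]] FW[OF WD(1,3)[OF w]] GW[OF WD(2,4)[OF w]] by simp
  show ?thesis
  proof (rule exI[of _ W], rule exI[of _ P], rule exI[of _ "H ` P"], rule exI[of _ H], intro conjI ballI)
   show "x\<in>W" using 1(2) 2(2) xU P(1) embD(3)[OF c xU(1)] by (simp add: W_def)
   show "\<psi> ` W\<subseteq>H ` P"
   proof
    fix y assume "y\<in>\<psi> ` W"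
    then obtain w where "w\<in>W" "y = \<psi> w" by (elim imageE)
    then show "y\<in>H ` P" using HW[of w] WD(5)[of w] by (simp add: image_eqI[of _ H "\<phi> w"])
   qed
  qed (use oW P(2) HW WD in auto)
 qed
 then show ?L unfolding strat_compatible_def by simp
qed

lemma strat_chart_emb: "strat_chart X (n, U, \<phi>) ==> emb (stop X) n U \<phi>"
 by (simp add: strat_chart_def emb_def)

text \<open>As for manifolds, transitivity is obtained by factoring through a generating chart
  around the point; the composites are formed with \<open>factors_trans\<close>, where no
  diffeomorphism has to be exhibited.\<close>

lemma smooth_structure_generated:
 assumes R: "\<And>c. c\<in>\<R> ==> strat_chart X c"
  and cov: "\<And>x. x\<in>spoints X ==> \<exists>n U \<phi>. (n, U, \<phi>)\<in>\<R> \<and> x\<in>U"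
  and comp: "\<And>c d. c\<in>\<R> ==> d\<in>\<R> ==> strat_compatible X c d"
 defines "\<E> \<equiv> {c. strat_chart X c \<and> (\<forall>d\<in>\<R>. strat_compatible X c d)}"
 shows "smooth_structure X \<E>" "\<R>\<subseteq>\<E>"
proof -
 show RE: "\<R>\<subseteq>\<E>" using R comp by (auto simp: \<E>_def)
 show "smooth_structure X \<E>" unfolding smooth_structure_def
 proof (intro conjI ballI allI impI)
  show "strat_chart X c" if "c\<in>\<E>" for c using that by (simp add: \<E>_def)
  show "\<Union> {U. \<exists>n \<phi>. (n, U, \<phi>)\<in>\<E>} = spoints X"
  proof (intro equalityI subsetI)
   fix x assume "x\<in>\<Union> {U. \<exists>n \<phi>. (n, U, \<phi>)\<in>\<E>}"
   then obtain n U \<phi> where "(n, U, \<phi>)\<in>\<E>" "x\<in>U" by blast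
   then show "x\<in>spoints X" using embD(2)[OF strat_chart_emb, of X n U \<phi>] by (auto simp: \<E>_def)
  next
   fix x assume "x\<in>spoints X"
   then obtain n U \<phi> where "(n, U, \<phi>)\<in>\<R>" "x\<in>U" using cov by blast
   then show "x\<in>\<Union> {U. \<exists>n \<phi>. (n, U, \<phi>)\<in>\<E>}" using RE by blast
  qed
  show "strat_compatible X c d" if cd: "c\<in>\<E>" "d\<in>\<E>" for c d
  proof -
   obtain n U \<phi> m V \<psi> where e: "c = (n, U, \<phi>)" "d = (m, V, \<psi>)" using prod_cases3 by metis
   have ce: "emb (stop X) n U \<phi>" "emb (stop X) m V \<psi>" using cd e by (auto simp: \<E>_def strat_chart_emb)
   show ?thesis unfolding e strat_compatible_iff[OF ce]
   proof
    fix x assume x: "x\<in>U\<inter>V"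
    then have "x\<in>spoints X" using embD(2)[OF ce(1)] by blast
    then obtain l O' \<theta> where r: "(l, O', \<theta>)\<in>\<R>" "x\<in>O'" using cov by metis
    have re: "emb (stop X) l O' \<theta>" using R[OF r(1)] by (rule strat_chart_emb)
    have "strat_compatible X (n, U, \<phi>) (l, O', \<theta>)" "strat_compatible X (m, V, \<psi>) (l, O', \<theta>)" using cd r(1) by (auto simp: \<E>_def e)
    then have "factors (stop X) n \<phi> l \<theta> x" "factors (stop X) l \<theta> n \<phi> x" "factors (stop X) m \<psi> l \<theta> x" "factors (stop X) l \<theta> m \<psi> x"
     unfolding strat_compatible_iff[OF ce(1) re] strat_compatible_iff[OF ce(2) re] using x r(2) by simp_all
    note f = this
    show "factors (stop X) n \<phi> m \<psi> x \<and> factors (stop X) m \<psi> n \<phi> x"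
     using factors_trans[OF f(1,4)] factors_trans[OF f(3,2)] ..
   qed
  qed
  show "c\<in>\<E>" if "strat_chart X c \<and> (\<forall>d\<in>\<E>. strat_compatible X c d)" for c using that RE by (auto simp: \<E>_def)
 qed
qed

text \<open>A product of compact sets, with the single point 0 in every coordinate from
  \<open>n\<close> on.\<close>

lemma compactin_closed_box: "compactin (En n) {y\<in>Rn n. \<forall>i<n. \<bar>y i - x i\<bar>\<le>r}"
proof -
 let ?S = "\<lambda>i. if i < n then {x i - r..x i + r} else {0::real}"
 have e: "{y\<in>Rn n. \<forall>i<n. \<bar>y i - x i\<bar>\<le>r} = PiE UNIV ?S"
  by (auto simp: Rn_iff PiE_iff abs_diff_le_iff split: if_splits) (metis not_le, force+)?
 have "compactin (powertop_real UNIV) (PiE UNIV ?S)" unfolding compactin_PiE by simp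
 moreover have "PiE UNIV ?S\<subseteq>{x. \<forall>i\<ge>n. x i = 0}" unfolding e[symmetric] by (auto simp: Rn_iff)
 ultimately show ?thesis unfolding e by (simp only: Euclidean_space_def compactin_subtopology)
qed

section \<open>Smooth functions on differentiable stratified spaces\<close>

locale smooth_strat =
 fixes X :: "'a strat_space" and \<D>
 assumes str: "smooth_structure X \<D>"
begin

lemma chart: "(n, U, \<phi>)\<in>\<D> ==> strat_chart X (n, U, \<phi>)"
 using str unfolding smooth_structure_def by blast

lemmas chart_emb = strat_chart_emb[OF chart]

lemma cover: "x\<in>spoints X ==> \<exists>n U \<phi>. (n, U, \<phi>)\<in>\<D> \<and> x\<in>U"
 using str unfolding smooth_structure_def by blast

lemma change: assumes "(n, U, \<phi>)\<in>\<D>" "(m, V, \<psi>)\<in>\<D>" "x\<in>U" "x\<in>V" shows "factors (stop X) n \<phi> m \<psi> x"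
proof -
 have "\<forall>c\<in>\<D>. \<forall>d\<in>\<D>. strat_compatible X c d" using str unfolding smooth_structure_def by (elim conjE)
 from bspec[OF bspec[OF this assms(1)] assms(2)] have "strat_compatible X (n, U, \<phi>) (m, V, \<psi>)" .
 then show ?thesis unfolding strat_compatible_iff[OF chart_emb[OF assms(1)] chart_emb[OF assms(2)]] using assms(3,4) by simp
qed

lemma smoothD: assumes f: "smooth_strat_fun X \<D> f" and c: "(n, U, \<phi>)\<in>\<D>" "x\<in>U" shows "sfun_at (stop X) n \<phi> f x"
proof -
 have "\<exists>W g. openin (stop X) W \<and> x\<in>W \<and> W\<subseteq>U \<and> smooth_fun n (Rn n) g \<and> (\<forall>w\<in>W. f w = g (\<phi> w))"
  using bspec[OF conjunct2[OF f[unfolded smooth_strat_fun_def]] c(1)] c(2) by simp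
 then show ?thesis unfolding sfun_at_def by (elim exE conjE) (intro exI conjI)
qed

text \<open>One chart around each point is enough, because the coordinates of one chart are locally
  smooth functions of those of another.\<close>

lemma smoothI:
 assumes loc: "\<And>x. x\<in>spoints X ==> \<exists>n U \<phi>. (n, U, \<phi>)\<in>\<D> \<and> x\<in>U \<and> sfun_at (stop X) n \<phi> f x"
 shows "smooth_strat_fun X \<D> f"
 unfolding smooth_strat_fun_def
proof (intro conjI)
 show "continuous_map (stop X) euclideanreal f" unfolding continuous_map_def
 proof (intro conjI allI impI)
  fix S :: "real set" assume "openin euclideanreal S"
  then have S: "open S" by (rule open_openin[THEN iffD2])
  show "openin (stop X) {x\<in>spoints X. f x\<in>S}"
  proof (subst openin_subopen, intro ballI)
   fix x assume "x\<in>{x\<in>spoints X. f x\<in>S}"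
   then have x: "x\<in>spoints X" "f x\<in>S" by simp_all
   obtain n U \<phi> where c: "(n, U, \<phi>)\<in>\<D>" "x\<in>U" "sfun_at (stop X) n \<phi> f x" using loc[OF x(1)] by (elim exE conjE)
   obtain W g where W: "openin (stop X) W" "x\<in>W" "smooth_fun n (Rn n) g" "\<forall>w\<in>W. f w = g (\<phi> w)"
    by (rule sfun_atE[OF c(3)])
   have "openin (En n) {z\<in>Rn n. g z\<in>S}" by (rule openin_En_preimage[OF openin_Rn smooth_fun_continuous[OF W(3)] S])
   from openin_Int[OF W(1) embD(5)[OF chart_emb[OF c(1)] this]]
   have "openin (stop X) (W\<inter>{w\<in>U. \<phi> w\<in>{z\<in>Rn n. g z\<in>S}})" .
   moreover have "x\<in>W\<inter>{w\<in>U. \<phi> w\<in>{z\<in>Rn n. g z\<in>S}}" using W(2,4) c(2) x(2) embD(3)[OF chart_emb[OF c(1)] c(2)] by simp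
   moreover have "W\<inter>{w\<in>U. \<phi> w\<in>{z\<in>Rn n. g z\<in>S}}\<subseteq>{x\<in>spoints X. f x\<in>S}"
    using W(4) embD(2)[OF chart_emb[OF c(1)]] by auto
   ultimately show "\<exists>T. openin (stop X) T \<and> x\<in>T \<and> T\<subseteq>{x\<in>spoints X. f x\<in>S}" by (intro exI conjI)
  qed
 qed simp
 have "\<exists>W g. openin (stop X) W \<and> x\<in>W \<and> W\<subseteq>U \<and> smooth_fun n (Rn n) g \<and> (\<forall>w\<in>W. f w = g (\<phi> w))"
  if c: "(n, U, \<phi>)\<in>\<D>" "x\<in>U" for n U \<phi> x
 proof -
  have "x\<in>spoints X" using c embD(2)[OF chart_emb[OF c(1)]] by blast
  then obtain m V \<psi> where d: "(m, V, \<psi>)\<in>\<D>" "x\<in>V" "sfun_at (stop X) m \<psi> f x" using loc by metis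
  obtain W g where W: "openin (stop X) W" "x\<in>W" "smooth_fun n (Rn n) g" "\<forall>w\<in>W. f w = g (\<phi> w)"
   by (rule sfun_atE[OF sfun_at_factors[OF change[OF c(1) d(1) c(2) d(2)] d(3)]])
  show ?thesis by (rule exI[of _ "W\<inter>U"], rule exI[of _ g]) (use W c(2) openin_Int[OF W(1) embD(1)[OF chart_emb[OF c(1)]]] in simp)
 qed
 then show "\<forall>(n, U, \<phi>)\<in>\<D>. \<forall>x\<in>U. \<exists>W g. openin (stop X) W \<and> x\<in>W \<and> W\<subseteq>U \<and> smooth_fun n (Rn n) g \<and> (\<forall>w\<in>W. f w = g (\<phi> w))"
  by (intro ballI case_prodI2) (simp only: prod.case)?
qed

lemma smooth_cong:
 assumes f: "smooth_strat_fun X \<D> f" and e: "\<And>x. x\<in>spoints X ==> f x = f' x" shows "smooth_strat_fun X \<D> f'"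
proof (rule smoothI)
 fix x assume x: "x\<in>spoints X"
 obtain n U \<phi> where c: "(n, U, \<phi>)\<in>\<D>" "x\<in>U" using cover[OF x] by metis
 have "sfun_at (stop X) n \<phi> f' x" by (rule sfun_at_cong[OF smoothD[OF f c] openin_topspace x e])
 then show "\<exists>n U \<phi>. (n, U, \<phi>)\<in>\<D> \<and> x\<in>U \<and> sfun_at (stop X) n \<phi> f' x" using c by (intro exI conjI)
qed

text \<open>Smooth maps are tested by functions on the whole space, so a coordinate expression has
  to be cut off and continued by zero. The support must lie in a subset of the chart that is closed
  in \<open>X\<close>: the set \<open>K\<close> is compact, because the chart has a locally closed
  image, and \<open>X\<close> is Hausdorff. The germ at \<open>x\<close> is kept, and the support
  can be forced into any neighbourhood \<open>N\<close>.\<close>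

lemma smooth_extension:
 assumes haus: "Hausdorff_space (stop X)" and c: "(n, U, \<phi>)\<in>\<D>" "x\<in>U" and g: "smooth_fun n (Rn n) g"
  and N: "openin (stop X) N" "x\<in>N"
 obtains F W where "smooth_strat_fun X \<D> F" "openin (stop X) W" "x\<in>W" "\<And>w. w\<in>W ==> w\<in>U \<and> F w = g (\<phi> w)"
  "\<And>y. F y\<noteq>0 ==> y\<in>N"
proof -
 note e = chart_emb[OF c(1)]
 obtain V where V: "openin (En n) V" "\<forall>u\<in>U. \<phi> u\<in>V \<longleftrightarrow> u\<in>N" using embD(6)[OF e N(1)] by (elim exE conjE)
 have "locally_closed_in (En n) (\<phi> ` U)" using chart[OF c(1)] by (simp add: strat_chart_def)
 then obtain L C where L: "openin (En n) L" "closedin (En n) C" "\<phi> ` U = L\<inter>C"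
  unfolding locally_closed_in_def by (elim exE conjE)
 have "\<phi> x\<in>V\<inter>L" using V(2) N(2) c(2) L(3) by blast
 then obtain \<delta> where \<delta>: "\<delta> > 0" "cube n \<delta> (\<phi> x)\<subseteq>V\<inter>L" by (rule cube_nbhd[OF openin_Int[OF V(1) L(1)]])
 define \<epsilon> where "\<epsilon> = \<delta> / 2"
 have \<epsilon>: "\<epsilon> > 0" "3/2 * \<epsilon> < \<delta>" using \<delta>(1) by (simp_all add: \<epsilon>_def)
 obtain \<rho> where \<rho>: "smooth_fun n (Rn n) \<rho>" "\<And>y. y\<in>cube n \<epsilon> (\<phi> x) ==> \<rho> y = 1"
  "\<And>y i. i < n ==> \<bar>y i - \<phi> x i\<bar>\<ge>3/2 * \<epsilon> ==> \<rho> y = 0" by (rule smooth_cutoff[OF \<epsilon>(1), of n "\<phi> x"]) blast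
 \<comment> \<open>The closed box is compact and lies inside \<open>L\<close>, where the image of
   the chart is cut out by the closed set \<open>C\<close>; so its intersection with
   \<open>C\<close> is a compact part of the image.\<close>
 let ?D = "{y\<in>Rn n. \<forall>i<n. \<bar>y i - \<phi> x i\<bar>\<le>3/2 * \<epsilon>}\<inter>C"
 have DV: "?D\<subseteq>V\<inter>L\<inter>C"
 proof
  fix y assume "y\<in>?D"
  then have "y\<in>cube n \<delta> (\<phi> x)" "y\<in>C" using \<epsilon>(2) by (auto simp: cube_def intro: le_less_trans)
  then show "y\<in>V\<inter>L\<inter>C" using \<delta>(2) by blast
 qed
 have UT: "topspace (subtopology (stop X) U) = U" using embD(2)[OF e] by auto
 have h: "homeomorphic_map (subtopology (stop X) U) (subtopology (En n) (\<phi> ` U)) \<phi>"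
  using e unfolding emb_def embedding_map_def UT by simp
 then obtain \<psi> where "homeomorphic_maps (subtopology (stop X) U) (subtopology (En n) (\<phi> ` U)) \<phi> \<psi>"
  unfolding homeomorphic_map_maps by (elim exE)
 then have \<psi>: "continuous_map (subtopology (En n) (\<phi> ` U)) (subtopology (stop X) U) \<psi>" "\<And>u. u\<in>U ==> \<psi> (\<phi> u) = u"
  unfolding homeomorphic_maps_def UT by simp_all
 define K where "K = \<psi> ` ?D"
 have "compactin (subtopology (En n) (\<phi> ` U)) ?D"
  unfolding compactin_subtopology using compact_Int_closedin[OF compactin_closed_box L(2)] DV L(3) by blast
 from image_compactin[OF this \<psi>(1)] have "compactin (stop X) K" unfolding K_def compactin_subtopology by simp
 then have Kc: "closedin (stop X) K" by (rule compactin_imp_closedin[OF haus])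
 have KUN: "K\<subseteq>U\<inter>N"
 proof
  fix u assume "u\<in>K"
  then obtain y where y: "y\<in>?D" "u = \<psi> y" unfolding K_def by (elim imageE)
  then have "y\<in>\<phi> ` U" "y\<in>V" using DV L(3) by auto
  then obtain v where v: "v\<in>U" "y = \<phi> v" by (elim imageE)
  then show "u\<in>U\<inter>N" using \<psi>(2) y(2) V(2) \<open>y\<in>V\<close> by simp
 qed
 define F where "F y = (if y\<in>U then \<rho> (\<phi> y) * g (\<phi> y) else 0)" for y
 have FK: "y\<in>K" if "F y\<noteq>0" for y
 proof -
  have y: "y\<in>U" "\<rho> (\<phi> y)\<noteq>0" using that by (auto simp: F_def split: if_splits)
  have "\<bar>\<phi> y i - \<phi> x i\<bar>\<le>3/2 * \<epsilon>" if "i < n" for i using \<rho>(3)[OF that, of "\<phi> y"] y(2) by argo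
  moreover have "\<phi> y\<in>C" using L(3) y(1) by blast
  ultimately have "\<phi> y\<in>?D" using embD(3)[OF e y(1)] by simp
  then show ?thesis unfolding K_def by (rule image_eqI[where f=\<psi>, OF \<psi>(2)[OF y(1), symmetric]])
 qed
 show thesis
 proof (rule that)
  show "smooth_strat_fun X \<D> F"
  proof (rule smoothI)
   fix y assume y: "y\<in>spoints X"
   show "\<exists>n U \<phi>. (n, U, \<phi>)\<in>\<D> \<and> y\<in>U \<and> sfun_at (stop X) n \<phi> F y"
   proof (cases "y\<in>U")
    case True
    have "sfun_at (stop X) n \<phi> F y"
     by (rule sfun_atI[OF embD(1)[OF e] True smooth_fun_mult[OF \<rho>(1) g]]) (simp add: F_def)
    then show ?thesis using c True by (intro exI conjI)
   next
    case False
    obtain m V' \<psi>' where d: "(m, V', \<psi>')\<in>\<D>" "y\<in>V'" using cover[OF y] by metis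
    have "openin (stop X) (spoints X - K)" using Kc by (rule openin_diff[OF openin_topspace])
    then have "sfun_at (stop X) m \<psi>' F y"
    proof (rule sfun_atI)
     show "y\<in>spoints X - K" using y False KUN by blast
     show "smooth_fun m (Rn m) (\<lambda>_. 0)" by simp
     show "F w = 0" if "w\<in>spoints X - K" for w using that FK[of w] by blast
    qed
    then show ?thesis using d by (intro exI conjI)
   qed
  qed
  show "openin (stop X) {w\<in>U. \<phi> w\<in>cube n \<epsilon> (\<phi> x)}" by (rule embD(5)[OF e openin_cube])
  show "x\<in>{w\<in>U. \<phi> w\<in>cube n \<epsilon> (\<phi> x)}" using c(2) cube_centre[OF embD(3)[OF e c(2)] \<epsilon>(1)] by simp
  show "w\<in>U \<and> F w = g (\<phi> w)" if "w\<in>{w\<in>U. \<phi> w\<in>cube n \<epsilon> (\<phi> x)}" for w using that \<rho>(2) by (simp add: F_def)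
  show "y\<in>N" if "F y\<noteq>0" for y using FK[OF that] KUN by blast
 qed
qed

end

text \<open>The definition of \<open>smooth_strat_map\<close> does not mention continuity. It
  follows from the existence of smooth functions that are 1 at f x and vanish off \<open>N\<close>:
  the points where the pullback is non-zero form an open neighbourhood mapped into
  \<open>N\<close>.\<close>

lemma smooth_strat_map_continuous:
 assumes Y: "smooth_structure Y \<E>" and H: "Hausdorff_space (stop Y)" and f: "smooth_strat_map X \<D> Y \<E> f"
 shows "continuous_map (stop X) (stop Y) f"
 unfolding continuous_map_def
proof (intro conjI allI impI)
 interpret Y: smooth_strat Y \<E> by unfold_locales (rule Y)
 show fX: "f\<in>spoints X \<rightarrow> spoints Y" using f by (auto simp: smooth_strat_map_def)
 fix N assume N: "openin (stop Y) N"
 show "openin (stop X) {x\<in>spoints X. f x\<in>N}"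
 proof (subst openin_subopen, intro ballI)
  fix x assume "x\<in>{x\<in>spoints X. f x\<in>N}"
  then have x: "x\<in>spoints X" "f x\<in>N" by simp_all
  obtain n U \<phi> where c: "(n, U, \<phi>)\<in>\<E>" "f x\<in>U" using Y.cover[OF funcset_mem[OF fX x(1)]] by metis
  obtain F W where F: "smooth_strat_fun Y \<E> F" "f x\<in>W" "\<And>w. w\<in>W ==> w\<in>U \<and> F w = 1" "\<And>y. F y\<noteq>0 ==> y\<in>N"
   by (rule Y.smooth_extension[OF H c smooth_fun_const[OF openin_Rn, of n 1] N x(2)]) blast
  have "smooth_strat_fun X \<D> (F \<circ> f)" using f F(1) by (simp add: smooth_strat_map_def)
  then have "continuous_map (stop X) euclideanreal (F \<circ> f)" by (simp add: smooth_strat_fun_def)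
  from openin_continuous_map_preimage[OF this, of "- {0}"]
  have "openin (stop X) {x\<in>spoints X. F (f x)\<noteq>0}" by (simp add: open_Compl)
  moreover have "F (f x)\<noteq>0" using F(2,3) by simp
  ultimately show "\<exists>T. openin (stop X) T \<and> x\<in>T \<and> T\<subseteq>{x\<in>spoints X. f x\<in>N}"
   using x(1) F(4) by (intro exI[of _ "{x\<in>spoints X. F (f x)\<noteq>0}"]) auto
 qed
qed

section \<open>Charts of the product with the real line\<close>

lemma jt_shift: "shift 1 (jt t w) = w" "jt (z 0) (shift 1 z) = z" "jt t w 0 = t"
 by (auto simp: fun_eq_iff shift_def join_coords_def real_coord_def)

lemma jt_Rn: "w\<in>Rn n ==> jt t w\<in>Rn (1 + n)"
 by (rule join_coords_simps(1)[OF real_coord_Rn])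

lemma smooth_jt_prod:
 assumes F: "smooth_coord_map n U m F"
 shows "smooth_coord_map (1 + n) {z\<in>Rn (1 + n). shift 1 z\<in>U} (1 + m) (\<lambda>z. jt (z 0) (F (shift 1 z)))" (is "smooth_coord_map _ ?S _ _")
proof (rule cmapI)
 show o: "openin (En (1 + n)) ?S"
  by (rule cmap_openin_preimage[OF smooth_shift cmapD(1)[OF F]])
 have sh: "smooth_coord_map (1 + n) ?S n (shift 1)" by (rule cmap_subset[OF smooth_shift o]) blast
 have sF: "smooth_coord_map (1 + n) ?S m (\<lambda>z. F (shift 1 z))" by (rule cmap_compose[OF F sh]) blast
 show "jt (z 0) (F (shift 1 z))\<in>Rn (1 + m)" if "z\<in>?S" for z
  by (rule jt_Rn[OF cmapD(2)[OF F]]) (use that in blast)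
 show "smooth_fun (1 + n) ?S (\<lambda>z. jt (z 0) (F (shift 1 z)) i)" for i
 proof (cases "i = 0")
  case True
  show ?thesis unfolding True jt_shift(3) by (rule smooth_fun_coord[OF o])
 next
  case False
  then have "(\<lambda>z. jt (z 0) (F (shift 1 z)) i) = (\<lambda>z. F (shift 1 z) (i - 1))" by (simp add: join_coords_def)
  then show ?thesis using cmapD(3)[OF sF] by simp
 qed
qed

lemma coord_diffeo_prod:
 assumes "coord_diffeo n P Q H"
 shows "coord_diffeo (1 + n) {z\<in>Rn (1 + n). shift 1 z\<in>P} {z\<in>Rn (1 + n). shift 1 z\<in>Q} (\<lambda>z. jt (z 0) (H (shift 1 z)))"
proof -
 obtain G where H: "smooth_coord_map n P n H" and G: "smooth_coord_map n Q n G"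
  and HQ: "\<And>x. x\<in>P ==> H x\<in>Q" and GP: "\<And>y. y\<in>Q ==> G y\<in>P"
  and GH: "\<And>x. x\<in>P ==> G (H x) = x" and HG: "\<And>y. y\<in>Q ==> H (G y) = y"
  by (rule coord_diffeoE[OF assms]) blast
 show ?thesis
 proof (rule coord_diffeoI[OF smooth_jt_prod[OF H] smooth_jt_prod[OF G]])
  fix z assume "z\<in>{z\<in>Rn (1 + n). shift 1 z\<in>P}"
  then have z: "shift 1 z\<in>P" by blast
  show "jt (z 0) (H (shift 1 z))\<in>{z\<in>Rn (1 + n). shift 1 z\<in>Q}"
   unfolding mem_Collect_eq jt_shift(1) using HQ[OF z] jt_Rn[OF cmapD(2)[OF H z]] by blast
  show "jt (jt (z 0) (H (shift 1 z)) 0) (G (shift 1 (jt (z 0) (H (shift 1 z))))) = z"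
   unfolding jt_shift(1,3) GH[OF z] by (rule jt_shift(2))
 next
  fix z assume "z\<in>{z\<in>Rn (1 + n). shift 1 z\<in>Q}"
  then have z: "shift 1 z\<in>Q" by blast
  show "jt (z 0) (G (shift 1 z))\<in>{z\<in>Rn (1 + n). shift 1 z\<in>P}"
   unfolding mem_Collect_eq jt_shift(1) using GP[OF z] jt_Rn[OF cmapD(2)[OF G z]] by blast
  show "jt (jt (z 0) (G (shift 1 z)) 0) (H (shift 1 (jt (z 0) (G (shift 1 z))))) = z"
   unfolding jt_shift(1,3) HG[OF z] by (rule jt_shift(2))
 qed
qed

text \<open>The real coordinate comes first, so that the product of the line with
  \<open>Rn k\<close> is \<open>Rn (1 + k)\<close>, and the product of the identity with a
  flattening map is again a flattening map.\<close>

lemma embedded_submanifold_prod: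
 assumes "embedded_submanifold n N" shows "embedded_submanifold (1 + n) {z\<in>Rn (1 + n). shift 1 z\<in>N}" (is "embedded_submanifold _ ?N")
proof -
 obtain k where N: "N\<subseteq>Rn n" and k: "k\<le>n"
  and loc: "\<forall>x\<in>N. \<exists>P Q H. x\<in>P \<and> coord_diffeo n P Q H \<and> H ` (N\<inter>P) = Q\<inter>Rn k"
  using assms unfolding embedded_submanifold_def by (elim exE conjE)
 have "\<exists>P Q H. x\<in>P \<and> coord_diffeo (1 + n) P Q H \<and> H ` (?N\<inter>P) = Q\<inter>Rn (1 + k)" if x: "x\<in>?N" for x
 proof -
  have xN: "shift 1 x\<in>N" using x by blast
  obtain P Q H where P: "shift 1 x\<in>P" "coord_diffeo n P Q H" and im: "H ` (N\<inter>P) = Q\<inter>Rn k"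
   using bspec[OF loc xN] by (elim exE conjE)
  let ?P = "{z\<in>Rn (1 + n). shift 1 z\<in>P}" and ?Q = "{z\<in>Rn (1 + n). shift 1 z\<in>Q}"
  let ?H = "\<lambda>z. jt (z 0) (H (shift 1 z))"
  have "?H ` (?N\<inter>?P) = ?Q\<inter>Rn (1 + k)"
  proof (intro equalityI subsetI)
   fix y assume "y\<in>?H ` (?N\<inter>?P)"
   then obtain z where z: "z\<in>?N\<inter>?P" "y = ?H z" by (elim imageE)
   then have "H (shift 1 z)\<in>H ` (N\<inter>P)" by blast
   then have w: "H (shift 1 z)\<in>Q" "H (shift 1 z)\<in>Rn k" using im by auto
   show "y\<in>?Q\<inter>Rn (1 + k)" unfolding z(2) Int_iff mem_Collect_eq jt_shift(1)
    using w jt_Rn[OF w(2)] jt_Rn[OF Rn_mono[OF w(2) k]] by blast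
  next
   fix y assume y: "y\<in>?Q\<inter>Rn (1 + k)"
   then have "shift 1 y\<in>Q\<inter>Rn k" using shift_Rn[of y 1 k] by blast
   then obtain w where w: "w\<in>N" "w\<in>P" "shift 1 y = H w" unfolding im[symmetric] by blast
   have "jt (y 0) w\<in>?N\<inter>?P" unfolding Int_iff mem_Collect_eq jt_shift(1) using w jt_Rn[of w n] N by blast
   moreover have "?H (jt (y 0) w) = y" unfolding jt_shift(1,3) w(3)[symmetric] by (rule jt_shift(2))
   ultimately show "y\<in>?H ` (?N\<inter>?P)" by (intro image_eqI[where f="?H" and x="jt (y 0) w", OF sym])
  qed
  note im' = this
  have "x\<in>?P" using P(1) x by blast
  then show ?thesis using coord_diffeo_prod[OF P(2)] im' by (intro exI conjI)
 qed
 then show ?thesis unfolding embedded_submanifold_def using k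
  by (intro conjI exI[of _ "1 + k"] ballI) (blast, linarith)
qed

abbreviation "jmap \<phi> \<equiv> \<lambda>(t, x). join_coords 1 (real_coord t) (\<phi> x)"

lemma jmap_image:
 assumes "\<And>x. x\<in>N ==> \<phi> x\<in>Rn n"
 shows "jmap \<phi> ` (UNIV\<times>N) = {z\<in>Rn (1 + n). shift 1 z\<in>\<phi> ` N}"
proof (intro equalityI subsetI)
 fix z assume "z\<in>jmap \<phi> ` (UNIV\<times>N)"
 then obtain w where w: "w\<in>UNIV\<times>N" "z = jmap \<phi> w" by (elim imageE)
 obtain t x where tx: "w = (t, x)" by (cases w)
 have x: "x\<in>N" "z = jt t (\<phi> x)" using w unfolding tx by simp_all
 show "z\<in>{z\<in>Rn (1 + n). shift 1 z\<in>\<phi> ` N}" unfolding x(2) mem_Collect_eq jt_shift(1) using jt_Rn[OF assms[OF x(1)]] x(1) by blast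
next
 fix z assume "z\<in>{z\<in>Rn (1 + n). shift 1 z\<in>\<phi> ` N}"
 then have "shift 1 z\<in>\<phi> ` N" by blast
 then obtain x where x: "shift 1 z = \<phi> x" "x\<in>N" by (elim imageE)
 have "z = jmap \<phi> (z 0, x)" unfolding prod.case x(1)[symmetric] jt_shift(2) ..
 then show "z\<in>jmap \<phi> ` (UNIV\<times>N)" by (rule image_eqI) (simp add: x(2))
qed

lemma prod_emb:
 assumes e: "emb T n U \<phi>" shows "emb (prod_topology euclideanreal T) (1 + n) (UNIV\<times>U) (jmap \<phi>)"
 unfolding emb_def
proof (intro conjI)
 show oU: "openin (prod_topology euclideanreal T) (UNIV\<times>U)" using embD(1)[OF e] by (simp add: openin_prod_Times_iff)
 show "embedding_map (subtopology (prod_topology euclideanreal T) (UNIV\<times>U)) (En (1 + n)) (jmap \<phi>)"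
 proof (rule embeddingI[OF oU])
  fix w assume w: "w\<in>(UNIV :: real set)\<times>U"
  obtain t x where tx: "w = (t, x)" by (cases w)
  then have "x\<in>U" using w by simp
  then show "jmap \<phi> w\<in>Rn (1 + n)" unfolding tx prod.case by (intro jt_Rn embD(3)[OF e])
 next
  show "inj_on (jmap \<phi>) (UNIV\<times>U)"
  proof (rule inj_onI)
   fix v w assume v: "v\<in>(UNIV :: real set)\<times>U" and w: "w\<in>(UNIV :: real set)\<times>U" and eq: "jmap \<phi> v = jmap \<phi> w"
   obtain t x where v': "v = (t, x)" by (cases v)
   obtain s y where w': "w = (s, y)" by (cases w)
   have j: "jt t (\<phi> x) = jt s (\<phi> y)" using eq unfolding v' w' prod.case .
   have "t = s" using arg_cong[OF j, of "\<lambda>f. f 0"] unfolding jt_shift(3) .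
   moreover have "\<phi> x = \<phi> y" using arg_cong[OF j, of "shift 1"] unfolding jt_shift(1) .
   then have "x = y" using inj_onD[OF embD(4)[OF e]] v w v' w' by simp
   ultimately show "v = w" using v' w' by simp
  qed
 next
  fix O' assume O': "openin (En (1 + n)) O'"
  show "openin (prod_topology euclideanreal T) {w\<in>UNIV\<times>U. jmap \<phi> w\<in>O'}" unfolding openin_prod_topology_alt
  proof (intro allI impI)
   fix t x assume "(t, x)\<in>{w\<in>UNIV\<times>U. jmap \<phi> w\<in>O'}"
   then have x: "x\<in>U" "jt t (\<phi> x)\<in>O'" by simp_all
   obtain \<epsilon> where \<epsilon>: "\<epsilon> > 0" "cube (1 + n) \<epsilon> (jt t (\<phi> x))\<subseteq>O'" by (rule cube_nbhd[OF O' x(2)])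
   let ?W = "{u\<in>U. \<phi> u\<in>cube n \<epsilon> (\<phi> x)}"
   have "jt s (\<phi> u)\<in>cube (1 + n) \<epsilon> (jt t (\<phi> x))" if s: "s\<in>{t - \<epsilon><..<t + \<epsilon>}" and u: "u\<in>?W" for s u
   proof -
    have uU: "u\<in>U" and b: "\<forall>i<n. \<bar>\<phi> u i - \<phi> x i\<bar> < \<epsilon>" using u by (auto simp: cube_def)
    have "\<bar>jt s (\<phi> u) i - jt t (\<phi> x) i\<bar> < \<epsilon>" if "i < 1 + n" for i
     using that b s by (cases i) (auto simp: join_coords_def real_coord_def)
    then show ?thesis unfolding cube_def using jt_Rn[OF embD(3)[OF e uU]] by blast
   qed
   then have "{t - \<epsilon><..<t + \<epsilon>}\<times>?W\<subseteq>{w\<in>UNIV\<times>U. jmap \<phi> w\<in>O'}" using \<epsilon>(2) by auto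
   moreover have "x\<in>?W" using x(1) cube_centre[OF embD(3)[OF e x(1)] \<epsilon>(1)] by simp
   moreover have "openin T ?W" by (rule embD(5)[OF e openin_cube])
   ultimately show "\<exists>W W'. openin euclideanreal W \<and> openin T W' \<and> t\<in>W \<and> x\<in>W' \<and> W\<times>W'\<subseteq>{w\<in>UNIV\<times>U. jmap \<phi> w\<in>O'}"
    using \<epsilon>(1) by (intro exI[of _ "{t - \<epsilon><..<t + \<epsilon>}"] exI[of _ ?W] conjI) auto
  qed
 next
  fix W w assume W: "openin (prod_topology euclideanreal T) W" "w\<in>(UNIV :: real set)\<times>U" "w\<in>W"
  obtain t x where tx: "w = (t, x)" by (cases w)
  have xU: "x\<in>U" using W(2) tx by simp
  have "\<exists>W1 W2. openin euclideanreal W1 \<and> openin T W2 \<and> t\<in>W1 \<and> x\<in>W2 \<and> W1\<times>W2\<subseteq>W"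
   using W(1)[unfolded openin_prod_topology_alt, rule_format] W(3) tx by simp
  then obtain W1 W2 where w: "openin euclideanreal W1" "openin T W2" "t\<in>W1" "x\<in>W2" "W1\<times>W2\<subseteq>W" by (elim exE conjE)
  obtain V where V: "openin (En n) V" "\<forall>u\<in>U. \<phi> u\<in>V \<longleftrightarrow> u\<in>W2" using embD(6)[OF e w(2)] by (elim exE conjE)
  let ?V = "{z\<in>Rn (1 + n). z 0\<in>W1}\<inter>{z\<in>Rn (1 + n). shift 1 z\<in>V}"
  show "\<exists>V. openin (En (1 + n)) V \<and> jmap \<phi> w\<in>V \<and> (\<forall>u\<in>UNIV\<times>U. jmap \<phi> u\<in>V \<longrightarrow> u\<in>W)"
  proof (intro exI[of _ ?V] conjI ballI impI)
   show "openin (En (1 + n)) ?V"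
    by (intro openin_Int openin_En_preimage cmap_openin_preimage[OF smooth_shift V(1)] continuous_on_coord openin_Rn)
     (use w(1) open_openin in blast)
   show "jmap \<phi> w\<in>?V" unfolding tx prod.case Int_iff mem_Collect_eq jt_shift(1,3)
    using jt_Rn[OF embD(3)[OF e xU]] w(3,4) V(2) xU by blast
   fix u assume u: "u\<in>(UNIV :: real set)\<times>U" "jmap \<phi> u\<in>?V"
   obtain s y where sy: "u = (s, y)" by (cases u)
   have "s\<in>W1" "\<phi> y\<in>V" using u(2) unfolding sy prod.case Int_iff mem_Collect_eq jt_shift(1,3) by blast+
   moreover have "y\<in>U" using u(1) sy by simp
   ultimately have "(s, y)\<in>W1\<times>W2" using V(2) by simp
   then show "u\<in>W" using w(5) sy by blast
  qed
 qed
qed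

lemma prod_strat_chart:
 assumes c: "strat_chart A (n, U, \<phi>)" shows "strat_chart (real_times A) (1 + n, UNIV\<times>U, jmap \<phi>)"
proof -
 note e = strat_chart_emb[OF c]
 have st: "stop (real_times A) = prod_topology euclideanreal (stop A)" "strata (real_times A) = (\<lambda>S. UNIV\<times>S) ` strata A"
  by (simp_all add: real_times_def)
 have "locally_closed_in (En n) (\<phi> ` U)" using c by (simp add: strat_chart_def)
 then obtain L C where L: "openin (En n) L" "closedin (En n) C" "\<phi> ` U = L\<inter>C"
  unfolding locally_closed_in_def by (elim exE conjE)
 have sc: "continuous_map (En (1 + n)) (En n) (shift 1)"
  using cmap_continuous_map[OF smooth_shift[of 1 n]] unfolding subtopology_topspace .
 have "jmap \<phi> ` (UNIV\<times>U) = {z\<in>Rn (1 + n). shift 1 z\<in>\<phi> ` U}" by (rule jmap_image[OF embD(3)[OF e]])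
 then have im: "jmap \<phi> ` (UNIV\<times>U) = {z\<in>Rn (1 + n). shift 1 z\<in>L}\<inter>{z\<in>Rn (1 + n). shift 1 z\<in>C}"
  unfolding L(3) by blast
 have 1: "locally_closed_in (En (1 + n)) (jmap \<phi> ` (UNIV\<times>U))" unfolding locally_closed_in_def
  using openin_continuous_map_preimage[OF sc L(1)] closedin_continuous_map_preimage[OF sc L(2)] im by (intro exI conjI)
 have 2: "embedded_submanifold (1 + n) (jmap \<phi> ` (S\<inter>(UNIV\<times>U)))" if S: "S\<in>strata (real_times A)" for S
 proof -
  obtain S0 where S0: "S0\<in>strata A" "S = UNIV\<times>S0" using S st(2) by auto
  have 1: "embedded_submanifold n (\<phi> ` (S0\<inter>U))" using c S0(1) by (simp add: strat_chart_def)
  have 2: "S\<inter>(UNIV\<times>U) = UNIV\<times>(S0\<inter>U)" using S0(2) by blast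
  have 3: "jmap \<phi> ` (UNIV\<times>(S0\<inter>U)) = {z\<in>Rn (1 + n). shift 1 z\<in>\<phi> ` (S0\<inter>U)}"
   by (rule jmap_image) (use embD(3)[OF e] in blast)
  show ?thesis unfolding 2 3 by (rule embedded_submanifold_prod[OF 1])
 qed
 show ?thesis unfolding strat_chart_def prod.case
  by (intro conjI ballI) (rule conjunct1[OF prod_emb[OF e, unfolded emb_def, folded st(1)]]
   conjunct2[OF prod_emb[OF e, unfolded emb_def, folded st(1)]] 1 | erule 2)+
qed

lemma prod_factors:
 assumes "factors T n \<phi> m \<psi> x"
 shows "factors (prod_topology euclideanreal T) (1 + n) (jmap \<phi>) (1 + m) (jmap \<psi>) (t, x)"
proof -
 obtain W \<tau> where W: "openin T W" "x\<in>W" "smooth_coord_map n (Rn n) m \<tau>" "\<forall>w\<in>W. \<psi> w = \<tau> (\<phi> w)"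
  by (rule factorsE[OF assms])
 have "{z\<in>Rn (1 + n). shift 1 z\<in>Rn n} = Rn (1 + n)" using shift_Rn[of _ 1 n] by blast
 then have s: "smooth_coord_map (1 + n) (Rn (1 + n)) (1 + m) (\<lambda>z. jt (z 0) (\<tau> (shift 1 z)))" using smooth_jt_prod[OF W(3)] by metis
 show ?thesis
 proof (rule factorsI[of _ "UNIV\<times>W", OF _ _ s])
  show "openin (prod_topology euclideanreal T) (UNIV\<times>W)" using W(1) by (simp add: openin_prod_Times_iff)
  show "jmap \<psi> w = jt (jmap \<phi> w 0) (\<tau> (shift 1 (jmap \<phi> w)))" if "w\<in>UNIV\<times>W" for w
  proof -
   obtain s y where w: "w = (s, y)" by (cases w)
   then have "\<psi> y = \<tau> (\<phi> y)" using that W(4) by simp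
   then show ?thesis unfolding w prod.case jt_shift(1,3) by simp
  qed
 qed (use W(2) in simp)
qed

context smooth_strat
begin

lemma prod_chart_in:
 assumes c: "(n, U, \<phi>)\<in>\<D>" shows "(1 + n, UNIV\<times>U, jmap \<phi>)\<in>real_times_structure X \<D>"
proof -
 have st: "stop (real_times X) = prod_topology euclideanreal (stop X)" by (simp add: real_times_def)
 have "strat_compatible (real_times X) (1 + n, UNIV\<times>U, jmap \<phi>) (1 + m, UNIV\<times>V, jmap \<psi>)" if d: "(m, V, \<psi>)\<in>\<D>" for m V \<psi>
 proof (subst strat_compatible_iff)
  show "emb (stop (real_times X)) (1 + n) (UNIV\<times>U) (jmap \<phi>)" unfolding st by (rule prod_emb[OF chart_emb[OF c]])
  show "emb (stop (real_times X)) (1 + m) (UNIV\<times>V) (jmap \<psi>)" unfolding st by (rule prod_emb[OF chart_emb[OF d]])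
  show "\<forall>x\<in>UNIV\<times>U\<inter>UNIV\<times>V. factors (stop (real_times X)) (1 + n) (jmap \<phi>) (1 + m) (jmap \<psi>) x \<and>
    factors (stop (real_times X)) (1 + m) (jmap \<psi>) (1 + n) (jmap \<phi>) x"
  proof
   fix w assume w: "w\<in>(UNIV :: real set)\<times>U\<inter>UNIV\<times>V"
   obtain t x where tx: "w = (t, x)" by (cases w)
   have x: "x\<in>U" "x\<in>V" using w tx by auto
   show "factors (stop (real_times X)) (1 + n) (jmap \<phi>) (1 + m) (jmap \<psi>) w \<and>
    factors (stop (real_times X)) (1 + m) (jmap \<psi>) (1 + n) (jmap \<phi>) w"
    unfolding st tx using prod_factors[OF change[OF c d x]] prod_factors[OF change[OF d c x(2,1)]] ..
  qed
 qed
 then have "\<forall>(m, V, \<psi>)\<in>\<D>. strat_compatible (real_times X) (1 + n, UNIV\<times>U, jmap \<phi>) (1 + m, UNIV\<times>V, jmap \<psi>)"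
  by (intro ballI case_prodI2) simp
 then show ?thesis unfolding real_times_structure_def using prod_strat_chart[OF chart[OF c]] by (intro CollectI conjI)
qed

text \<open>In product charts the constant \<open>t\<close> is substituted for the first coordinate.
  For t = 0 this extracts from the smoothness of the action that of its projection.\<close>

lemma smooth_slice:
 assumes f: "smooth_strat_fun (real_times X) (real_times_structure X \<D>) f"
 shows "smooth_strat_fun X \<D> (\<lambda>x. f (t, x))"
proof (rule smoothI)
 fix x assume x: "x\<in>spoints X"
 have st: "stop (real_times X) = prod_topology euclideanreal (stop X)" by (simp add: real_times_def)
 obtain n U \<phi> where c: "(n, U, \<phi>)\<in>\<D>" "x\<in>U" using cover[OF x] by metis
 have "\<exists>W g. openin (stop (real_times X)) W \<and> (t, x)\<in>W \<and> W\<subseteq>UNIV\<times>U \<and> smooth_fun (1 + n) (Rn (1 + n)) g \<and> (\<forall>w\<in>W. f w = g (jmap \<phi> w))"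
  using bspec[OF conjunct2[OF f[unfolded smooth_strat_fun_def]] prod_chart_in[OF c(1)], unfolded prod.case[of _ "1 + n" "(UNIV\<times>U, jmap \<phi>)"]
   prod.case[of _ "UNIV\<times>U" "jmap \<phi>"], THEN bspec, of "(t, x)"] c(2) by blast
 then obtain W g where W: "openin (prod_topology euclideanreal (stop X)) W" "(t, x)\<in>W" "smooth_fun (1 + n) (Rn (1 + n)) g"
  "\<forall>w\<in>W. f w = g (jmap \<phi> w)" unfolding st by (elim exE conjE)
 have "\<exists>W1 W2. openin euclideanreal W1 \<and> openin (stop X) W2 \<and> t\<in>W1 \<and> x\<in>W2 \<and> W1\<times>W2\<subseteq>W"
  using W(1)[unfolded openin_prod_topology_alt, rule_format] W(2) by simp
 then obtain W1 W2 where w: "openin (stop X) W2" "t\<in>W1" "x\<in>W2" "W1\<times>W2\<subseteq>W" by (elim exE conjE)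
 have "sfun_at (stop X) n \<phi> (\<lambda>x. f (t, x)) x"
 proof (rule sfun_atI[OF w(1,3)])
  show "smooth_fun n (Rn n) (\<lambda>z. g (jt t z))" by (rule smooth_fun_compose[OF W(3) smooth_jt]) (rule jt_Rn)
  fix y assume "y\<in>W2"
  then have "(t, y)\<in>W" using w(2,4) by blast
  from bspec[OF W(4) this] show "f (t, y) = g (jt t (\<phi> y))" unfolding prod.case .
 qed
 then show "\<exists>n U \<phi>. (n, U, \<phi>)\<in>\<D> \<and> x\<in>U \<and> sfun_at (stop X) n \<phi> (\<lambda>x. f (t, x)) x" using c by (intro exI conjI)
qed

end

section \<open>Fixed sets of retractions as embedded submanifolds\<close>

lemma coord_diffeo_extend:
 assumes "coord_diffeo k P Q H" "k\<le>n"
 shows "coord_diffeo n {z\<in>Rn n. trunc k z\<in>P} {z\<in>Rn n. trunc k z\<in>Q} (\<lambda>z i. if i < k then H (trunc k z) i else z i)"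
proof -
 obtain G where H: "smooth_coord_map k P k H" and G: "smooth_coord_map k Q k G"
  and HQ: "\<And>x. x\<in>P ==> H x\<in>Q" and GP: "\<And>y. y\<in>Q ==> G y\<in>P"
  and GH: "\<And>x. x\<in>P ==> G (H x) = x" and HG: "\<And>y. y\<in>Q ==> H (G y) = y"
  by (rule coord_diffeoE[OF assms(1)]) blast
 have s: "smooth_coord_map n {z\<in>Rn n. trunc k z\<in>P} n (\<lambda>z i. if i < k then H (trunc k z) i else z i)"
  if H: "smooth_coord_map k P k H" for H P
 proof (rule cmapI)
  show o: "openin (En n) {z\<in>Rn n. trunc k z\<in>P}"
   by (rule cmap_openin_preimage[OF smooth_trunc[OF openin_Rn] cmapD(1)[OF H]])
  show "(\<lambda>i. if i < k then H (trunc k z) i else z i)\<in>Rn n" if "z\<in>{z\<in>Rn n. trunc k z\<in>P}" for z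
   using that assms(2) by (simp add: Rn_iff)
  show "smooth_fun n {z\<in>Rn n. trunc k z\<in>P} (\<lambda>z. if i < k then H (trunc k z) i else z i)" for i
   by (intro smooth_fun_if smooth_fun_coord[OF o] cmapD(3)[OF cmap_compose[OF H smooth_trunc[OF o]]]) simp
 qed
 have tr: "trunc k (\<lambda>i. if i < k then w i else z i) = w" if "w\<in>Rn k" for w z :: "nat \<Rightarrow> real"
  using that by (auto simp: trunc_def Rn_iff fun_eq_iff)
 have a: "(\<lambda>i. if i < k then w i else z i)\<in>Rn n" if "z\<in>Rn n" for w z :: "nat \<Rightarrow> real" using that assms(2) by (simp add: Rn_iff)
 have b: "(\<lambda>i. if i < k then trunc k z i else if i < k then w i else z i) = z" for w z :: "nat \<Rightarrow> real" by (auto simp: trunc_def)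
 show ?thesis
 proof (rule coord_diffeoI[OF s[OF H] s[OF G]])
  fix z assume "z\<in>{z\<in>Rn n. trunc k z\<in>P}"
  then have z: "z\<in>Rn n" "trunc k z\<in>P" by auto
  show "(\<lambda>i. if i < k then H (trunc k z) i else z i)\<in>{z\<in>Rn n. trunc k z\<in>Q}"
   unfolding mem_Collect_eq tr[OF cmapD(2)[OF H z(2)]] using a[OF z(1)] HQ[OF z(2)] by blast
  show "(\<lambda>i. if i < k then G (trunc k (\<lambda>i. if i < k then H (trunc k z) i else z i)) i else if i < k then H (trunc k z) i else z i) = z"
   unfolding tr[OF cmapD(2)[OF H z(2)]] GH[OF z(2)] b ..
 next
  fix z assume "z\<in>{z\<in>Rn n. trunc k z\<in>Q}"
  then have z: "z\<in>Rn n" "trunc k z\<in>Q" by auto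
  show "(\<lambda>i. if i < k then G (trunc k z) i else z i)\<in>{z\<in>Rn n. trunc k z\<in>P}"
   unfolding mem_Collect_eq tr[OF cmapD(2)[OF G z(2)]] using a[OF z(1)] GP[OF z(2)] by blast
  show "(\<lambda>i. if i < k then H (trunc k (\<lambda>i. if i < k then G (trunc k z) i else z i)) i else if i < k then G (trunc k z) i else z i) = z"
   unfolding tr[OF cmapD(2)[OF G z(2)]] HG[OF z(2)] b ..
 qed
qed

text \<open>Turns a flattening map of the ambient space into a chart of the subspace in the sense of
  manifolds, so that its dimension can be compared by \<open>mfd_chart_dim_unique\<close>.\<close>

lemma submanifold_chart:
 assumes e: "emb T n U \<phi>" and cd: "coord_diffeo n P Q H" and j: "j\<le>n"
  and im: "H ` (\<phi> ` (S\<inter>U)\<inter>P) = Q\<inter>Rn j"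
 shows "mfd_chart (subtopology T S) j ({w\<in>S\<inter>U. \<phi> w\<in>P}, \<lambda>w. H (\<phi> w))"
proof -
 let ?W = "{w\<in>S\<inter>U. \<phi> w\<in>P}" and ?Q = "{z\<in>Rn j. z\<in>Q}"
 obtain G where H: "smooth_coord_map n P n H" and G: "smooth_coord_map n Q n G"
  and GH: "\<And>x. x\<in>P ==> G (H x) = x" by (rule coord_diffeoE[OF cd]) blast
 have oP: "openin (En n) P" and oQ: "openin (En n) Q" using cmapD(1)[OF H] cmapD(1)[OF G] .
 have i: "smooth_coord_map j (Rn j) n (\<lambda>z. z)" by (rule smooth_coord_id[OF openin_Rn j])
 have oQj: "openin (En j) ?Q" by (rule cmap_openin_preimage[OF i oQ])
 have Gj: "smooth_coord_map j ?Q n (\<lambda>z. G z)" by (rule cmap_compose[OF G cmap_subset[OF i oQj]]) auto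
 have HW: "H (\<phi> w)\<in>Q\<inter>Rn j" if "w\<in>?W" for w
 proof -
  have "H (\<phi> w)\<in>H ` (\<phi> ` (S\<inter>U)\<inter>P)" using that by blast
  then show ?thesis unfolding im .
 qed
 have WH: "\<exists>w\<in>?W. z = H (\<phi> w)" if "z\<in>Q\<inter>Rn j" for z
 proof -
  have "z\<in>H ` (\<phi> ` (S\<inter>U)\<inter>P)" using that unfolding im .
  then obtain y where y: "y\<in>\<phi> ` (S\<inter>U)\<inter>P" "z = H y" by (elim imageE)
  then obtain w where "w\<in>S\<inter>U" "y = \<phi> w" by blast
  then show ?thesis using y by blast
 qed
 show ?thesis
 proof (rule mfd_chartI)
  have "?W = {w\<in>U. \<phi> w\<in>P}\<inter>S" by blast
  then show "openin (subtopology T S) ?W" unfolding openin_subtopology using embD(5)[OF e oP] by (intro exI conjI)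
  have "(\<lambda>w. H (\<phi> w)) ` ?W = ?Q"
  proof (intro equalityI subsetI)
   fix z assume "z\<in>(\<lambda>w. H (\<phi> w)) ` ?W"
   then obtain w where "w\<in>?W" "z = H (\<phi> w)" by (elim imageE)
   then show "z\<in>?Q" using HW[of w] by simp
  next
   fix z assume "z\<in>?Q"
   then have "\<exists>w\<in>?W. z = H (\<phi> w)" by (intro WH) simp
   then show "z\<in>(\<lambda>w. H (\<phi> w)) ` ?W" by (elim bexE) (rule image_eqI)
  qed
  then show "openin (En j) ((\<lambda>w. H (\<phi> w)) ` ?W)" using oQj by simp
  show "inj_on (\<lambda>w. H (\<phi> w)) ?W"
  proof (rule inj_onI)
   fix u v assume u: "u\<in>?W" and v: "v\<in>?W" and eq: "H (\<phi> u) = H (\<phi> v)"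
   have P: "\<phi> u\<in>P" "\<phi> v\<in>P" using u v by simp_all
   have "\<phi> u = \<phi> v" using arg_cong[OF eq, of G] unfolding GH[OF P(1)] GH[OF P(2)] .
   then show "u = v" by (rule inj_onD[OF embD(4)[OF e]]) (use u v in simp_all)
  qed
 next
  fix W assume W: "openin (subtopology T S) W" "W\<subseteq>?W"
  then obtain W0 where W0: "openin T W0" "W = W0\<inter>S" unfolding openin_subtopology by (elim exE conjE)
  obtain V where V: "openin (En n) V" "\<forall>u\<in>U. \<phi> u\<in>V \<longleftrightarrow> u\<in>W0" using embD(6)[OF e W0(1)] by (elim exE conjE)
  have "(\<lambda>w. H (\<phi> w)) ` W = {z\<in>?Q. G z\<in>V}"
  proof (intro equalityI subsetI)
   fix z assume "z\<in>(\<lambda>w. H (\<phi> w)) ` W"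
   then obtain w where w: "w\<in>W" "z = H (\<phi> w)" by (elim imageE)
   then have w': "w\<in>?W" "w\<in>W0" using W(2) W0(2) by auto
   have "G z\<in>V" using GH[of "\<phi> w"] V(2) w' w(2) by simp
   then show "z\<in>{z\<in>?Q. G z\<in>V}" using HW[OF w'(1)] w(2) by simp
  next
   fix z assume z: "z\<in>{z\<in>?Q. G z\<in>V}"
   then have "\<exists>w\<in>?W. z = H (\<phi> w)" by (intro WH) simp
   then obtain w where w: "w\<in>?W" "z = H (\<phi> w)" by (elim bexE)
   have "\<phi> w\<in>V" using z GH[of "\<phi> w"] w by simp
   then have "w\<in>W" using V(2) w(1) W0(2) by simp
   then show "z\<in>(\<lambda>w. H (\<phi> w)) ` W" using w(2) by (rule image_eqI[rotated])
  qed
  then show "openin (En j) ((\<lambda>w. H (\<phi> w)) ` W)" using cmap_openin_preimage[OF Gj V(1)] by simp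
 next
  fix O' assume O': "openin (En j) O'"
  have "openin (En n) {z\<in>P. trunc j (H z)\<in>O'}"
   by (rule cmap_openin_preimage[OF cmap_compose[OF smooth_trunc[OF openin_Rn] H] O']) (rule cmapD(2)[OF H])
  from embD(5)[OF e this] have "openin T {w\<in>U. \<phi> w\<in>{z\<in>P. trunc j (H z)\<in>O'}}" .
  moreover have "{x\<in>?W. H (\<phi> x)\<in>O'} = {w\<in>U. \<phi> w\<in>{z\<in>P. trunc j (H z)\<in>O'}}\<inter>S"
  proof (intro equalityI subsetI)
   fix w assume w: "w\<in>{x\<in>?W. H (\<phi> x)\<in>O'}"
   then have "trunc j (H (\<phi> w)) = H (\<phi> w)" using HW[of w] by (simp add: trunc_id)
   then show "w\<in>{w\<in>U. \<phi> w\<in>{z\<in>P. trunc j (H z)\<in>O'}}\<inter>S" using w by simp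
  next
   fix w assume w: "w\<in>{w\<in>U. \<phi> w\<in>{z\<in>P. trunc j (H z)\<in>O'}}\<inter>S"
   then have "trunc j (H (\<phi> w)) = H (\<phi> w)" using HW[of w] by (simp add: trunc_id)
   then show "w\<in>{x\<in>?W. H (\<phi> x)\<in>O'}" using w by simp
  qed
  ultimately show "openin (subtopology T S) {x\<in>?W. H (\<phi> x)\<in>O'}" unfolding openin_subtopology by (intro exI conjI)
 qed
qed

text \<open>\<open>g\<close> describes \<open>r\<close> in coordinates but need not be idempotent
  away from the image of \<open>B\<close>, so it cannot be straightened in R^n. Flattening
  \<open>B\<close> first makes \<open>r\<close> an idempotent map on an open subset of R^k, which
  can be straightened; the result is continued to R^n by the identity in the other
  coordinates.\<close>

lemma retract_submanifold:
 assumes e: "emb T n U \<phi>" and sub: "embedded_submanifold n (\<phi> ` (B\<inter>U))"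
  and rB: "\<And>b. b\<in>B ==> r b\<in>B" "\<And>b. b\<in>B ==> r (r b) = r b"
  and x: "x\<in>B" "x\<in>U" "r x = x"
  and W: "openin T W" "x\<in>W" "W\<subseteq>U" and g: "smooth_coord_map n (Rn n) n g" "\<And>w. w\<in>W ==> r w\<in>U \<and> \<phi> (r w) = g (\<phi> w)"
 obtains j P Q H where "j\<le>n" "\<phi> x\<in>P" "coord_diffeo n P Q H" "H ` (\<phi> ` ({b\<in>B. r b = b}\<inter>U)\<inter>P) = Q\<inter>Rn j"
proof -
 obtain k where k: "k\<le>n"
  and loc: "\<forall>x\<in>\<phi> ` (B\<inter>U). \<exists>P Q H. x\<in>P \<and> coord_diffeo n P Q H \<and> H ` (\<phi> ` (B\<inter>U)\<inter>P) = Q\<inter>Rn k"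
  using sub unfolding embedded_submanifold_def by (elim exE conjE)
 have "\<phi> x\<in>\<phi> ` (B\<inter>U)" using x by simp
 from bspec[OF loc this] obtain P Q H where P: "\<phi> x\<in>P" "coord_diffeo n P Q H" and im: "H ` (\<phi> ` (B\<inter>U)\<inter>P) = Q\<inter>Rn k"
  by (elim exE conjE)
 obtain G where H: "smooth_coord_map n P n H" and G: "smooth_coord_map n Q n G" and GH: "\<And>x. x\<in>P ==> G (H x) = x"
  by (rule coord_diffeoE[OF P(2)]) blast
 obtain V where V: "openin (En n) V" "\<forall>u\<in>U. \<phi> u\<in>V \<longleftrightarrow> u\<in>W" using embD(6)[OF e W(1)] by (elim exE conjE)
 have i: "smooth_coord_map k (Rn k) n (\<lambda>z. z)" by (rule smooth_coord_id[OF openin_Rn k])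
 let ?S = "{z\<in>Rn k. z\<in>Q}"
 have oS: "openin (En k) ?S" by (rule cmap_openin_preimage[OF i cmapD(1)[OF G]])
 have Gk: "smooth_coord_map k ?S n (\<lambda>z. G z)" by (rule cmap_compose[OF G cmap_subset[OF i oS]]) auto
 have gG: "smooth_coord_map k ?S n (\<lambda>z. g (G z))" by (rule cmap_compose[OF g(1) Gk]) (rule cmapD(2)[OF Gk])
 \<comment> \<open>The points of the flattened stratum where \<open>g\<close> represents
   \<open>r\<close> and its value stays in the domain of \<open>H\<close>.\<close>
 define O' where "O' = {z\<in>?S. G z\<in>V}\<inter>{z\<in>?S. g (G z)\<in>P}"
 have oO: "openin (En k) O'" unfolding O'_def
  by (intro openin_Int cmap_openin_preimage[OF Gk V(1)] cmap_openin_preimage[OF gG cmapD(1)[OF H]])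
 define p where "p z = H (g (G z))" for z
 have Hk: "H (\<phi> b)\<in>Q\<inter>Rn k" if "b\<in>B" "b\<in>U" "\<phi> b\<in>P" for b
 proof -
  have "H (\<phi> b)\<in>H ` (\<phi> ` (B\<inter>U)\<inter>P)" using that by blast
  then show ?thesis unfolding im .
 qed
 have kH: "\<exists>b. b\<in>B \<and> b\<in>U \<and> \<phi> b\<in>P \<and> z = H (\<phi> b)" if "z\<in>Q\<inter>Rn k" for z
 proof -
  have "z\<in>H ` (\<phi> ` (B\<inter>U)\<inter>P)" using that unfolding im .
  then obtain y where y: "y\<in>\<phi> ` (B\<inter>U)\<inter>P" "z = H y" by (elim imageE)
  then obtain b where "b\<in>B\<inter>U" "y = \<phi> b" by blast
  then show ?thesis using y by blast
 qed
 have pt: "r b\<in>B \<and> r b\<in>U \<and> \<phi> (r b)\<in>P \<and> p (H (\<phi> b)) = H (\<phi> (r b)) \<and> g (\<phi> b) = \<phi> (r b)"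
  if b: "b\<in>B" "b\<in>U" "\<phi> b\<in>P" and z: "H (\<phi> b)\<in>O'" for b
 proof -
  have Gb: "G (H (\<phi> b)) = \<phi> b" by (rule GH[OF b(3)])
  have "\<phi> b\<in>V" "g (\<phi> b)\<in>P" using z unfolding O'_def Int_iff mem_Collect_eq Gb by blast+
  then have "b\<in>W" using V(2) b(2) by simp
  then have "r b\<in>U" "\<phi> (r b) = g (\<phi> b)" using g(2) by simp_all
  then show ?thesis using rB(1)[OF b(1)] \<open>g (\<phi> b)\<in>P\<close> by (simp add: p_def Gb)
 qed
 have Ok: "\<exists>b. b\<in>B \<and> b\<in>U \<and> \<phi> b\<in>P \<and> z = H (\<phi> b)" if "z\<in>O'" for z
  by (rule kH) (use that in \<open>auto simp: O'_def\<close>)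
 have pk: "p z\<in>Rn k" if z: "z\<in>O'" for z
 proof -
  obtain b where b: "b\<in>B" "b\<in>U" "\<phi> b\<in>P" "z = H (\<phi> b)" using Ok[OF z] by (elim exE conjE)
  show ?thesis using pt[OF b(1-3)] Hk[of "r b"] z b(4) by simp
 qed
 have OS: "O'\<subseteq>?S" by (auto simp: O'_def)
 have pn: "smooth_coord_map k O' n p" unfolding p_def
  by (rule cmap_compose[OF H cmap_subset[OF gG oO OS]]) (simp add: O'_def)
 have ps: "smooth_coord_map k O' k p" by (rule cmapI[OF oO]) (erule pk, rule cmapD(3)[OF pn])
 have xV: "\<phi> x\<in>V" "g (\<phi> x) = \<phi> x" using V(2) W(2) x g(2)[OF W(2)] by simp_all
 have x0: "H (\<phi> x)\<in>O'" using Hk[OF x(1,2) P(1)] xV P(1) by (simp add: O'_def GH[OF P(1)])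
 have px: "p (H (\<phi> x)) = H (\<phi> x)" by (simp add: p_def GH[OF P(1)] xV)
 have idem: "p (p z) = p z" if z: "z\<in>O'" "p z\<in>O'" for z
 proof -
  obtain b where b: "b\<in>B" "b\<in>U" "\<phi> b\<in>P" "z = H (\<phi> b)" using Ok[OF z(1)] by (elim exE conjE)
  have 1: "r b\<in>B" "r b\<in>U" "\<phi> (r b)\<in>P" "p z = H (\<phi> (r b))" using pt[OF b(1-3)] z(1) b(4) by simp_all
  have "p (H (\<phi> (r b))) = H (\<phi> (r (r b)))" using pt[OF 1(1-3)] z(2) 1(4) by simp
  then show ?thesis using rB(2)[OF b(1)] 1(4) by simp
 qed
 have "\<exists>P2 H2 j \<epsilon>. H (\<phi> x)\<in>P2 \<and> P2\<subseteq>O' \<and> j\<le>k \<and> coord_diffeo k P2 (cube k \<epsilon> (\<lambda>_. 0)) H2 \<and>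
  (\<forall>z\<in>P2. p z\<in>P2) \<and> (\<forall>z\<in>P2. H2 (p z) = trunc j (H2 z))"
 proof (rule idempotent_straighten[OF ps x0 px idem])
  fix P2 H2 j and \<epsilon> :: real
  assume "H (\<phi> x)\<in>P2" "P2\<subseteq>O'" "j\<le>k" "coord_diffeo k P2 (cube k \<epsilon> (\<lambda>_. 0)) H2"
   "\<And>z. z\<in>P2 ==> p z\<in>P2" "\<And>z. z\<in>P2 ==> H2 (p z) = trunc j (H2 z)"
  note P2 = this
  show "\<exists>P2 H2 j \<epsilon>. H (\<phi> x)\<in>P2 \<and> P2\<subseteq>O' \<and> j\<le>k \<and> coord_diffeo k P2 (cube k \<epsilon> (\<lambda>_. 0)) H2 \<and>
   (\<forall>z\<in>P2. p z\<in>P2) \<and> (\<forall>z\<in>P2. H2 (p z) = trunc j (H2 z))" by (rule exI[of _ P2], rule exI[of _ H2], rule exI[of _ j], rule exI[of _ \<epsilon>], intro conjI ballI)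
   (rule P2(1-4) | erule P2(5) | erule P2(6))+
 qed
 then obtain P2 H2 j \<epsilon> where P2: "H (\<phi> x)\<in>P2" "P2\<subseteq>O'" "j\<le>k" "coord_diffeo k P2 (cube k \<epsilon> (\<lambda>_. 0)) H2"
  and pH: "\<forall>z\<in>P2. p z\<in>P2" "\<forall>z\<in>P2. H2 (p z) = trunc j (H2 z)" by (elim exE conjE)
 note pP2 = bspec[OF pH(1)] and H2p = bspec[OF pH(2)]
 obtain G2 where H2: "smooth_coord_map k P2 k H2" and GH2: "\<And>z. z\<in>P2 ==> G2 (H2 z) = z"
  by (rule coord_diffeoE[OF P2(4)]) blast
 \<comment> \<open>In the straightened coordinates \<open>r\<close> is truncation to
   \<open>j\<close> coordinates, so the fixed points are those with coordinates in
   \<open>Rn j\<close>; injectivity of each coordinate map transports the equation r b = b.\<close>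
 have fix_iff: "r b = b \<longleftrightarrow> H2 (H (\<phi> b))\<in>Rn j" if b: "b\<in>B" "b\<in>U" "\<phi> b\<in>P" and z: "H (\<phi> b)\<in>P2" for b
 proof -
  have 1: "r b\<in>U" "\<phi> (r b)\<in>P" "p (H (\<phi> b)) = H (\<phi> (r b))" using pt[OF b] z P2(2) by auto
  have "r b = b \<longleftrightarrow> \<phi> (r b) = \<phi> b" using inj_onD[OF embD(4)[OF e] _ 1(1) b(2)] by metis
  also have "\<dots> \<longleftrightarrow> p (H (\<phi> b)) = H (\<phi> b)" using GH[OF 1(2)] GH[OF b(3)] 1(3) by metis
  also have "\<dots> \<longleftrightarrow> H2 (p (H (\<phi> b))) = H2 (H (\<phi> b))" using GH2[OF pP2[OF z]] GH2[OF z] by metis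
  also have "\<dots> \<longleftrightarrow> H2 (H (\<phi> b))\<in>Rn j" unfolding H2p[OF z] by (rule trunc_eq_iff)
  finally show ?thesis .
 qed
 define E where "E z = (\<lambda>i. if i < k then H2 (trunc k z) i else z i)" for z
 let ?PE = "{z\<in>Rn n. trunc k z\<in>P2}" and ?QE = "{z\<in>Rn n. trunc k z\<in>cube k \<epsilon> (\<lambda>_. 0)}"
 have E: "coord_diffeo n ?PE ?QE E" unfolding E_def by (rule coord_diffeo_extend[OF P2(4) k])
 have oPE: "openin (En n) ?PE"
  by (rule cmap_openin_preimage[OF smooth_trunc[OF openin_Rn] cmapD(1)[OF H2]])
 have Ek: "E z = H2 z" if "z\<in>Rn k" "z\<in>P2" for z
 proof
  show "E z i = H2 z i" for i using that cmapD(2)[OF H2 that(2)] by (auto simp: E_def trunc_id Rn_iff)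
 qed
 define P3 where "P3 = {y\<in>P. H y\<in>?PE}"
 have oP3: "openin (En n) P3" unfolding P3_def by (rule cmap_openin_preimage[OF H oPE])
 have P3P: "P3\<subseteq>P" by (auto simp: P3_def)
 have D: "coord_diffeo n P3 (E ` (H ` P3)) (\<lambda>y. E (H y))"
  by (rule coord_diffeo_compose[OF coord_diffeo_restrict(1)[OF P(2) oP3 P3P] E]) (auto simp: P3_def)
 have "(\<lambda>y. E (H y)) ` (\<phi> ` ({b\<in>B. r b = b}\<inter>U)\<inter>P3) = E ` (H ` P3)\<inter>Rn j"
 proof (intro equalityI subsetI)
  fix v assume "v\<in>(\<lambda>y. E (H y)) ` (\<phi> ` ({b\<in>B. r b = b}\<inter>U)\<inter>P3)"
  then obtain y where y: "y\<in>\<phi> ` ({b\<in>B. r b = b}\<inter>U)" "y\<in>P3" "v = E (H y)" by blast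
  then obtain b where b: "b\<in>B" "b\<in>U" "r b = b" "y = \<phi> b" by blast
  have bP: "\<phi> b\<in>P" using y(2) b(4) P3P by blast
  have hk: "H (\<phi> b)\<in>Rn k" using Hk[OF b(1,2) bP] by simp
  then have hP: "H (\<phi> b)\<in>P2" using y(2) b(4) by (simp add: P3_def trunc_id)
  have "v\<in>Rn j" using fix_iff[OF b(1,2) bP hP] b(3,4) y(3) Ek[OF hk hP] by simp
  then show "v\<in>E ` (H ` P3)\<inter>Rn j" using y by blast
 next
  fix v assume "v\<in>E ` (H ` P3)\<inter>Rn j"
  then obtain y where y: "y\<in>P3" "v = E (H y)" "v\<in>Rn j" by blast
  have yP: "y\<in>P" using y(1) P3P by blast
  \<comment> \<open>\<open>E\<close> leaves the coordinates from \<open>k\<close> on unchanged and j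
    \<le> k, so a point that \<open>E\<close> sends into \<open>Rn j\<close> has no non-zero
    coordinate from \<open>k\<close> on.\<close>
  have hk: "H y\<in>Rn k" unfolding Rn_iff
  proof (intro allI impI)
   fix i assume i: "i\<ge>k"
   then have "E (H y) i = 0" using y(2,3) P2(3) by (simp add: Rn_iff)
   then show "H y i = 0" using i by (simp add: E_def)
  qed
  have "bij_betw H P Q" using P(2) by (simp add: coord_diffeo_def)
  then have "H y\<in>Q" using yP by (rule bij_betwE[THEN bspec])
  then have "H y\<in>Q\<inter>Rn k" using hk by (rule IntI)
  from kH[OF this] obtain b where b: "b\<in>B" "b\<in>U" "\<phi> b\<in>P" "H y = H (\<phi> b)" by (elim exE conjE)
  have yb: "y = \<phi> b" using arg_cong[OF b(4), of G] unfolding GH[OF yP] GH[OF b(3)] .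
  have hP: "H (\<phi> b)\<in>P2" using y(1) hk b(4) by (simp add: P3_def trunc_id)
  have "r b = b" using fix_iff[OF b(1-3) hP] y(2,3) Ek[OF hk] hP unfolding b(4) by simp
  then have "b\<in>{b\<in>B. r b = b}\<inter>U" using b(1,2) by simp
  then have "y\<in>\<phi> ` ({b\<in>B. r b = b}\<inter>U)\<inter>P3" using yb y(1) by blast
  then show "v\<in>(\<lambda>y. E (H y)) ` (\<phi> ` ({b\<in>B. r b = b}\<inter>U)\<inter>P3)" unfolding y(2) by (rule imageI)
 qed
 moreover have "\<phi> x\<in>P3" using P(1) P2(1) x0 OS cmapD(2)[OF H P(1)] by (auto simp: P3_def trunc_id)
 moreover have "j\<le>n" using P2(3) k by simp
 moreover note D
 ultimately show thesis by (intro that)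
qed

section \<open>Smooth stratified regular actions\<close>

lemma emb_subtopology:
 assumes e: "emb T n U \<phi>" shows "emb (subtopology T S) n (U\<inter>S) \<phi>"
 unfolding emb_def
proof (intro conjI)
 show o: "openin (subtopology T S) (U\<inter>S)" unfolding openin_subtopology using embD(1)[OF e] by (intro exI[of _ U] conjI refl)
 show "embedding_map (subtopology (subtopology T S) (U\<inter>S)) (En n) \<phi>"
 proof (rule embeddingI[OF o])
  show "\<phi> w\<in>Rn n" if "w\<in>U\<inter>S" for w using embD(3)[OF e] that by simp
  show "inj_on \<phi> (U\<inter>S)" by (rule inj_on_subset[OF embD(4)[OF e]]) simp
  fix O' assume "openin (En n) O'"
  from embD(5)[OF e this] have "openin T {w\<in>U. \<phi> w\<in>O'}" .
  moreover have "{w\<in>U\<inter>S. \<phi> w\<in>O'} = {w\<in>U. \<phi> w\<in>O'}\<inter>S" by blast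
  ultimately show "openin (subtopology T S) {w\<in>U\<inter>S. \<phi> w\<in>O'}" unfolding openin_subtopology by (intro exI conjI)
 next
  fix W w assume W: "openin (subtopology T S) W" "w\<in>U\<inter>S" "w\<in>W"
  obtain W0 where W0: "openin T W0" "W = W0\<inter>S" using W(1) unfolding openin_subtopology by (elim exE conjE)
  obtain V where V: "openin (En n) V" "\<forall>u\<in>U. \<phi> u\<in>V \<longleftrightarrow> u\<in>W0" using embD(6)[OF e W0(1)] by (elim exE conjE)
  show "\<exists>V. openin (En n) V \<and> \<phi> w\<in>V \<and> (\<forall>u\<in>U\<inter>S. \<phi> u\<in>V \<longrightarrow> u\<in>W)"
   by (rule exI[of _ V]) (use V W W0(2) in simp)
 qed
qed

locale smooth_strat_action = strat_action A \<mu> + smooth_strat A \<D> for A :: "'a strat_space" and \<mu> and \<D> +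
 assumes smu: "smooth_strat_map (real_times A) (real_times_structure A \<D>) A \<D> \<mu>"
begin

lemma haus: "Hausdorff_space (stop A)" using ss by (simp add: stratified_space_def)

lemma smooth_pullback:
 assumes "smooth_strat_fun A \<D> F" shows "smooth_strat_fun A \<D> (\<lambda>a. F (\<mu> (0, a)))"
proof -
 have "smooth_strat_fun (real_times A) (real_times_structure A \<D>) (F \<circ> \<mu>)" using smu assms by (simp add: smooth_strat_map_def)
 from smooth_slice[OF this, of 0] show ?thesis by (simp only: o_def)
qed

lemma open_mu0: "openin (stop A) W ==> openin (stop A) {a\<in>spoints A. \<mu> (0, a)\<in>W}"
 by (rule openin_continuous_map_preimage[OF continuous_mu_t])

text \<open>Each coordinate of \<open>\<phi>\<close> is continued to a smooth function on
  \<open>A\<close>, pulled back along \<mu>_0 and expressed in the chart again; agreement near the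
  fixed point \<open>x\<close> suffices.\<close>

lemma local_retract:
 assumes c: "(n, U, \<phi>)\<in>\<D>" and x: "x\<in>U" "\<mu> (0, x) = x"
 shows "\<exists>W g. openin (stop A) W \<and> x\<in>W \<and> W\<subseteq>U \<and> smooth_coord_map n (Rn n) n g \<and> (\<forall>w\<in>W. \<mu> (0, w)\<in>U \<and> \<phi> (\<mu> (0, w)) = g (\<phi> w))"
proof -
 note e = chart_emb[OF c]
 let ?W = "{a\<in>spoints A. \<mu> (0, a)\<in>U}"
 have oW: "openin (stop A) ?W" by (rule open_mu0[OF embD(1)[OF e]])
 have xA: "x\<in>spoints A" using x embD(2)[OF e] by blast
 have xW: "x\<in>?W" using x xA by simp
 have s: "sfun_at (stop A) n \<phi> (\<lambda>a. \<phi> (\<mu> (0, a)) i) x" if "i < n" for i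
 proof -
  obtain F W where F: "smooth_strat_fun A \<D> F" "openin (stop A) W" "x\<in>W" "\<forall>w\<in>W. w\<in>U \<and> F w = \<phi> w i"
   by (rule smooth_extension[OF haus c x(1) smooth_fun_coord[OF openin_Rn, of n i] openin_topspace xA]) blast
  show ?thesis
  proof (rule sfun_at_cong[OF smoothD[OF smooth_pullback[OF F(1)] c x(1)] open_mu0[OF F(2)]])
   show "x\<in>{a\<in>spoints A. \<mu> (0, a)\<in>W}" using xA x(2) F(3) by simp
   show "F (\<mu> (0, w)) = \<phi> (\<mu> (0, w)) i" if "w\<in>{a\<in>spoints A. \<mu> (0, a)\<in>W}" for w using that F(4) by simp
  qed
 qed
 have "factors (stop A) n \<phi> n (\<lambda>a. \<phi> (\<mu> (0, a))) x"
  by (rule factors_coords[OF s oW xW]) (use embD(3)[OF e] in simp_all)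
 then obtain W \<tau> where W: "openin (stop A) W" "x\<in>W" "smooth_coord_map n (Rn n) n \<tau>" "\<forall>w\<in>W. \<phi> (\<mu> (0, w)) = \<tau> (\<phi> w)"
  by (rule factorsE)
 show ?thesis
  by (rule exI[of _ "W\<inter>?W\<inter>U"], rule exI[of _ \<tau>])
   (use W oW xW x(1) openin_Int[OF openin_Int[OF W(1) oW] embD(1)[OF e]] in simp)
qed

text \<open>An embedded submanifold has one dimension in the whole chart, while
  \<open>retract_submanifold\<close> yields a dimension depending on the point. It is identified
  with the dimension of the manifold of fixed points of the stratum, which is constant by
  connectedness.\<close>

lemma embedded_base:
 assumes B: "B\<in>strata A" and c: "(n, U, \<phi>)\<in>\<D>" shows "embedded_submanifold n (\<phi> ` ((B\<inter>M)\<inter>U))"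
proof (cases "(B\<inter>M)\<inter>U = {}")
 \<comment> \<open>The empty set is treated apart: the bound \<open>R.bdim \<le> n\<close> is
   obtained only from a point in the chart.\<close>
 case True
 then show ?thesis by (auto simp: embedded_submanifold_def)
next
 case False
 note e = chart_emb[OF c]
 interpret R: regular_mfd "smfd A B" \<mu> by (rule rm[OF B])
 have BM: "{b\<in>B. \<mu> (0, b) = b} = B\<inter>M" using part(3)[OF B] by (auto simp: M_def)
 have sub: "embedded_submanifold n (\<phi> ` (B\<inter>U))" using chart[OF c] B by (simp add: strat_chart_def)
 have top: "mtop R.base_mfd = subtopology (stop A) (B\<inter>M)"
  unfolding R.base_mfd_simps base_eq[OF B] part(6)[OF B] subtopology_subtopology by (simp add: inf_absorb2)
 have loc: "R.bdim\<le>n \<and> (\<exists>P Q H. \<phi> x\<in>P \<and> coord_diffeo n P Q H \<and> H ` (\<phi> ` ((B\<inter>M)\<inter>U)\<inter>P) = Q\<inter>Rn R.bdim)"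
  if x: "x\<in>(B\<inter>M)\<inter>U" for x
 proof -
  have x': "x\<in>B" "x\<in>U" "x\<in>M" "\<mu> (0, x) = x" using x MD(2) by auto
  obtain W g where W: "openin (stop A) W" "x\<in>W" "W\<subseteq>U" and g: "smooth_coord_map n (Rn n) n g"
   "\<forall>w\<in>W. \<mu> (0, w)\<in>U \<and> \<phi> (\<mu> (0, w)) = g (\<phi> w)" using local_retract[OF c x'(2,4)] by (elim exE conjE)
  have r: "\<mu> (0, b)\<in>B" "\<mu> (0, \<mu> (0, b)) = \<mu> (0, b)" if "b\<in>B" for b
   using mu_B[OF B that] mu_mu[of b 0 0] part(3)[OF B] that by auto
  obtain j P Q H where P: "j\<le>n" "\<phi> x\<in>P" "coord_diffeo n P Q H"
    "H ` (\<phi> ` ({b\<in>B. \<mu> (0, b) = b}\<inter>U)\<inter>P) = Q\<inter>Rn j"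
   by (rule retract_submanifold[OF e sub r x'(1,2,4) W g(1) bspec[OF g(2)]])
  note im = P(4)[unfolded BM]
  have "mfd_chart (mtop R.base_mfd) j ({w\<in>(B\<inter>M)\<inter>U. \<phi> w\<in>P}, \<lambda>w. H (\<phi> w))"
   unfolding top by (rule submanifold_chart[OF e P(3,1) im])
  moreover have "x\<in>mpoints R.base_mfd" using R.base_mfd_simps(3) base_eq[OF B] x by simp
  then obtain V \<psi> where V: "(V, \<psi>)\<in>mcharts R.base_mfd" "x\<in>V" by (rule atlas_mfd_cover[OF R.atlas_base])
  have "mfd_chart (mtop R.base_mfd) R.bdim (V, \<psi>)" using atlas_mfd_chart[OF R.atlas_base V(1)] by simp
  ultimately have "j = R.bdim" by (rule mfd_chart_dim_unique[OF _ _ _ V(2)]) (use x P(2) in simp)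
  then have "R.bdim\<le>n" "H ` (\<phi> ` ((B\<inter>M)\<inter>U)\<inter>P) = Q\<inter>Rn R.bdim" using P(1) im by simp_all
  with P(2,3) show ?thesis by (intro conjI exI)
 qed
 have "\<phi> ` ((B\<inter>M)\<inter>U)\<subseteq>Rn n" using embD(3)[OF e] by auto
 moreover have "R.bdim\<le>n" using loc False by blast
 moreover have "\<forall>y\<in>\<phi> ` ((B\<inter>M)\<inter>U). \<exists>P Q H. y\<in>P \<and> coord_diffeo n P Q H \<and> H ` (\<phi> ` ((B\<inter>M)\<inter>U)\<inter>P) = Q\<inter>Rn R.bdim"
 proof
  fix y assume "y\<in>\<phi> ` ((B\<inter>M)\<inter>U)"
  then obtain x where "y = \<phi> x" "x\<in>(B\<inter>M)\<inter>U" by (elim imageE)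
  then show "\<exists>P Q H. y\<in>P \<and> coord_diffeo n P Q H \<and> H ` (\<phi> ` ((B\<inter>M)\<inter>U)\<inter>P) = Q\<inter>Rn R.bdim"
   using conjunct2[OF loc] by simp
 qed
 ultimately show ?thesis unfolding embedded_submanifold_def by (intro conjI exI)
qed

lemma base_chart:
 assumes c: "(n, U, \<phi>)\<in>\<D>" shows "strat_chart strat_base (n, U\<inter>M, \<phi>)"
proof -
 note e = chart_emb[OF c]
 have "openin (stop A) (spoints A - M)" by (rule openin_diff[OF openin_topspace closed_M])
 \<comment> \<open>\<open>V\<close> cuts out the complement of the closed set \<open>M\<close> in
   coordinates; removing it from \<open>C\<close> shows that the smaller image is again locally
   closed.\<close>
 then obtain V where V: "openin (En n) V" "\<forall>u\<in>U. \<phi> u\<in>V \<longleftrightarrow> u\<in>spoints A - M" using embD(6)[OF e] by metis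
 have "locally_closed_in (En n) (\<phi> ` U)" using chart[OF c] by (simp add: strat_chart_def)
 then obtain L C where L: "openin (En n) L" "closedin (En n) C" "\<phi> ` U = L\<inter>C"
  unfolding locally_closed_in_def by (elim exE conjE)
 have "\<phi> ` (U\<inter>M) = L\<inter>(C - V)"
 proof (intro equalityI subsetI)
  fix y assume "y\<in>\<phi> ` (U\<inter>M)"
  then obtain u where u: "y = \<phi> u" "u\<in>U\<inter>M" by (elim imageE)
  then have "y\<in>\<phi> ` U" "y\<notin>V" using V(2) by auto
  then show "y\<in>L\<inter>(C - V)" unfolding L(3) by blast
 next
  fix y assume y: "y\<in>L\<inter>(C - V)"
  then have "y\<in>\<phi> ` U" unfolding L(3) by blast
  then obtain u where u: "y = \<phi> u" "u\<in>U" by (elim imageE)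
  then have "u\<in>M" using V(2) y embD(2)[OF e] by auto
  then show "y\<in>\<phi> ` (U\<inter>M)" using u by simp
 qed
 then have 1: "locally_closed_in (En n) (\<phi> ` (U\<inter>M))"
  unfolding locally_closed_in_def using L(1) closedin_diff[OF L(2) V(1)] by (intro exI conjI)
 have 2: "embedded_submanifold n (\<phi> ` (S\<inter>(U\<inter>M)))" if "S\<in>strata strat_base" for S
 proof -
  obtain B where B: "B\<in>strata A" "S = B\<inter>M" using \<open>S\<in>strata strat_base\<close> unfolding strat_base_simps(2) by (elim imageE)
  have "S\<inter>(U\<inter>M) = (B\<inter>M)\<inter>U" using B(2) by blast
  then show ?thesis using embedded_base[OF B(1) c] by simp
 qed
 note es = emb_subtopology[OF e, of M, folded strat_base_simps(1), unfolded emb_def]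
 show ?thesis unfolding strat_chart_def prod.case
  by (intro conjI ballI) (rule conjunct1[OF es] conjunct2[OF es] 1 | erule 2)+
qed

definition "base_charts = {(n, U\<inter>M, \<phi>) | n U \<phi>. (n, U, \<phi>)\<in>\<D>}"

definition "base_structure = {c. strat_chart strat_base c \<and> (\<forall>d\<in>base_charts. strat_compatible strat_base c d)}"

lemma base_structure: "smooth_structure strat_base base_structure" "base_charts\<subseteq>base_structure"
proof -
 have 1: "strat_chart strat_base c" if c: "c\<in>base_charts" for c
 proof -
  obtain n U \<phi> where "(n, U, \<phi>)\<in>\<D>" "c = (n, U\<inter>M, \<phi>)" using c by (auto simp: base_charts_def)
  then show ?thesis using base_chart by simp
 qed
 have 2: "\<exists>n U \<phi>. (n, U, \<phi>)\<in>base_charts \<and> x\<in>U" if "x\<in>spoints strat_base" for x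
 proof -
  have x: "x\<in>M" using that unfolding strat_base_simps(3) .
  obtain n U \<phi> where c: "(n, U, \<phi>)\<in>\<D>" "x\<in>U" using cover[OF MD(1)[OF x]] by metis
  then have "(n, U\<inter>M, \<phi>)\<in>base_charts" unfolding base_charts_def by blast
  then show ?thesis using c(2) x by (intro exI conjI) (assumption, simp)
 qed
 have 3: "strat_compatible strat_base c d" if cd: "c\<in>base_charts" "d\<in>base_charts" for c d
 proof -
  obtain n U \<phi> where c: "(n, U, \<phi>)\<in>\<D>" "c = (n, U\<inter>M, \<phi>)" using cd by (auto simp: base_charts_def)
  obtain m V \<psi> where d: "(m, V, \<psi>)\<in>\<D>" "d = (m, V\<inter>M, \<psi>)" using cd by (auto simp: base_charts_def)
  show ?thesis unfolding c(2) d(2) strat_compatible_iff[OF strat_chart_emb[OF base_chart[OF c(1)]] strat_chart_emb[OF base_chart[OF d(1)]]]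
  proof
   fix x assume "x\<in>U\<inter>M\<inter>(V\<inter>M)"
   then have x: "x\<in>U" "x\<in>V" "x\<in>M" by auto
   show "factors (stop strat_base) n \<phi> m \<psi> x \<and> factors (stop strat_base) m \<psi> n \<phi> x" unfolding strat_base_simps(1)
    using factors_subtopology[OF change[OF c(1) d(1) x(1,2)] x(3)] factors_subtopology[OF change[OF d(1) c(1) x(2,1)] x(3)] ..
  qed
 qed
 show "smooth_structure strat_base base_structure" "base_charts\<subseteq>base_structure"
  using smooth_structure_generated[of base_charts strat_base, OF 1 2 3, folded base_structure_def] by blast+
qed

lemma base_smooth_strat: "smooth_strat strat_base base_structure"
 by unfold_locales (rule base_structure(1))

lemma smooth_restrict:
 assumes F: "smooth_strat_fun A \<D> F" shows "smooth_strat_fun strat_base base_structure F"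
proof (rule smooth_strat.smoothI[OF base_smooth_strat])
 fix x assume "x\<in>spoints strat_base"
 then have x: "x\<in>M" unfolding strat_base_simps(3) .
 obtain n U \<phi> where c: "(n, U, \<phi>)\<in>\<D>" "x\<in>U" using cover[OF MD(1)[OF x]] by metis
 then have b: "(n, U\<inter>M, \<phi>)\<in>base_structure" using base_structure(2) unfolding base_charts_def by blast
 have s: "sfun_at (stop strat_base) n \<phi> F x" unfolding strat_base_simps(1) by (rule sfun_at_subtopology[OF smoothD[OF F c] x])
 show "\<exists>n U \<phi>. (n, U, \<phi>)\<in>base_structure \<and> x\<in>U \<and> sfun_at (stop strat_base) n \<phi> F x"
  by (rule exI[of _ n], rule exI[of _ "U\<inter>M"], rule exI[of _ \<phi>]) (use b s c(2) x in simp)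
qed

text \<open>Near \<mu>_0 a the function \<open>f\<close> is given on \<open>M\<close> by a
  coordinate expression, which is continued to a smooth function \<open>F\<close> on all of
  \<open>A\<close>. Near \<open>a\<close> the composites of \<open>f\<close> and \<open>F\<close>
  with \<mu>_0 agree, since \<mu>_0 takes its values in \<open>M\<close>.\<close>

lemma smooth_lift:
 assumes f: "smooth_strat_fun strat_base base_structure f" shows "smooth_strat_fun A \<D> (\<lambda>a. f (\<mu> (0, a)))"
proof (rule smoothI)
 fix a assume a: "a\<in>spoints A"
 let ?x = "\<mu> (0, a)"
 have x: "?x\<in>M" by (rule proj_M[OF a])
 obtain n U \<phi> where c: "(n, U, \<phi>)\<in>\<D>" "?x\<in>U" using cover[OF MD(1)[OF x]] by metis
 then have b: "(n, U\<inter>M, \<phi>)\<in>base_structure" using base_structure(2) unfolding base_charts_def by blast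
 have "sfun_at (stop strat_base) n \<phi> f ?x"
  by (rule smooth_strat.smoothD[OF base_smooth_strat f b]) (use c(2) x in simp)
 then obtain W g where W: "openin (subtopology (stop A) M) W" "?x\<in>W" "smooth_fun n (Rn n) g" "\<forall>w\<in>W. f w = g (\<phi> w)"
  unfolding strat_base_simps(1) by (rule sfun_atE)
 obtain W0 where W0: "openin (stop A) W0" "W = W0\<inter>M" using W(1) unfolding openin_subtopology by (elim exE conjE)
 obtain F V where F: "smooth_strat_fun A \<D> F" "openin (stop A) V" "?x\<in>V" "\<forall>w\<in>V. w\<in>U \<and> F w = g (\<phi> w)"
  by (rule smooth_extension[OF haus c W(3) openin_topspace MD(1)[OF x]]) blast
 obtain m U' \<psi> where d: "(m, U', \<psi>)\<in>\<D>" "a\<in>U'" using cover[OF a] by metis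
 have "sfun_at (stop A) m \<psi> (\<lambda>a. f (\<mu> (0, a))) a"
 proof (rule sfun_at_cong[OF smoothD[OF smooth_pullback[OF F(1)] d] open_mu0[OF openin_Int[OF W0(1) F(2)]]])
  show "a\<in>{a\<in>spoints A. \<mu> (0, a)\<in>W0\<inter>V}" using a W(2) W0(2) F(3) by simp
  show "F (\<mu> (0, w)) = f (\<mu> (0, w))" if w: "w\<in>{a\<in>spoints A. \<mu> (0, a)\<in>W0\<inter>V}" for w
  proof -
   have "\<mu> (0, w)\<in>W" using w W0(2) proj_M by simp
   then show ?thesis using w F(4) bspec[OF W(4), of "\<mu> (0, w)"] by simp
  qed
 qed
 then show "\<exists>n U \<phi>. (n, U, \<phi>)\<in>\<D> \<and> a\<in>U \<and> sfun_at (stop A) n \<phi> (\<lambda>a. f (\<mu> (0, a))) a" using d by (intro exI conjI)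
qed

lemma differentiable_bundle: "differentiable_svb bundle \<D> base_structure" "smooth_zero_section bundle \<D> base_structure"
proof -
 have m: "(\<lambda>(t, a). \<mu> (t, a)) = \<mu>" by auto
 have p: "smooth_strat_map A \<D> strat_base base_structure (\<lambda>a. \<mu> (0, a))"
  unfolding smooth_strat_map_def strat_base_simps(3) using proj_M smooth_lift by (auto simp: o_def)
 show "differentiable_svb bundle \<D> base_structure"
  unfolding differentiable_svb_def bundle_simps m by (intro conjI stratified_bundle str base_structure(1) p smu)
 show "smooth_zero_section bundle \<D> base_structure"
  unfolding smooth_zero_section_def smooth_strat_map_def bundle_simps strat_base_simps(3) using MD(1) smooth_restrict by (auto simp: o_def)
qed

end

section \<open>Comparison of smooth structures on the base\<close>

locale smooth_strat_action_bundle = smooth_strat_action A \<mu> \<D> + strat_action_bundle A \<mu> V'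
 for A :: "'a strat_space" and \<mu> and \<D> and V' :: "('a, 'b) svb" +
 fixes \<E>'
 assumes diff: "differentiable_svb V' \<D> \<E>'"
begin

text \<open>On \<open>M\<close> a test function composed with \<open>g\<close> is the restriction of
  its composite with \<open>p'\<close>, which is smooth on \<open>A\<close>.\<close>

lemma smooth_g: "smooth_strat_map strat_base base_structure X' \<E>' g"
 unfolding smooth_strat_map_def strat_base_simps(3)
proof (intro conjI allI impI)
 show "g ` M\<subseteq>spoints X'" using g_bij by (simp add: bij_betw_def)
 fix f assume f: "smooth_strat_fun X' \<E>' f"
 have "smooth_strat_fun A \<D> (f \<circ> p')" using diff f by (simp add: differentiable_svb_def tot smooth_strat_map_def)
 from smooth_strat.smooth_cong[OF base_smooth_strat smooth_restrict[OF this], of "f \<circ> g"]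
 show "smooth_strat_fun strat_base base_structure (f \<circ> g)" unfolding strat_base_simps(3) by (simp add: g_eq)
qed

lemma smooth_isomorphism:
 assumes "smooth_zero_section V' \<D> \<E>'" shows "differentiable_svb_isomorphism bundle base_structure V' \<E>' g"
proof -
 have z: "smooth_strat_map X' \<E>' A \<D> z'" using assms by (simp add: smooth_zero_section_def tot)
 \<comment> \<open>Smoothness of the zero section implies its continuity, as \<open>A\<close> is
   Hausdorff.\<close>
 have iso: "svb_isomorphism bundle V' g" by (rule isomorphism[OF smooth_strat_map_continuous[OF str haus z]])
 have X: "smooth_strat X' \<E>'" by unfold_locales (use diff in \<open>simp add: differentiable_svb_def\<close>)
 have "smooth_strat_map X' \<E>' strat_base base_structure (inv_into M g)"
  unfolding smooth_strat_map_def strat_base_simps(3)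
 proof (intro conjI allI impI)
  show "inv_into M g ` spoints X'\<subseteq>M" using inv_g z'_M by auto
  fix f assume "smooth_strat_fun strat_base base_structure f"
  \<comment> \<open>A test function on the base is made into one on \<open>A\<close> by composition
    with \<mu>_0, which is the identity on the values of \<open>z'\<close>.\<close>
  then have "smooth_strat_fun X' \<E>' ((\<lambda>a. f (\<mu> (0, a))) \<circ> z')" using z smooth_lift unfolding smooth_strat_map_def by blast
  then show "smooth_strat_fun X' \<E>' (f \<circ> inv_into M g)"
  proof (rule smooth_strat.smooth_cong[OF X])
   fix y assume y: "y\<in>spoints X'"
   show "((\<lambda>a. f (\<mu> (0, a))) \<circ> z') y = (f \<circ> inv_into M g) y" by (simp add: inv_g[OF y] MD(2)[OF z'_M[OF y]])
  qed
 qed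
 then show ?thesis unfolding differentiable_svb_isomorphism_def bundle_simps strat_base_simps(3) using iso smooth_g by (intro conjI)
qed

end

theorem theorem2p5:
 fixes A :: "'a strat_space" and \<mu> :: "real \<times> 'a \<Rightarrow> 'a"
 assumes "stratified_space A"
 shows
  "(stratified_regular_action A \<mu> \<longrightarrow>
    (\<exists>V :: ('a, 'a) svb. svb_of_action A \<mu> V \<and> continuous_zero_section V \<and>
      (\<forall>V' :: ('a, 'b) svb. svb_of_action A \<mu> V' \<longrightarrow>
       (\<exists>!g. g \<in> extensional (spoints (sv_base V)) \<and> svb_comparison V V' g) \<and>
       (continuous_zero_section V' \<longrightarrow>
         (\<exists>!g. g \<in> extensional (spoints (sv_base V)) \<and> svb_isomorphism V V' g)))))
   \<and> (\<forall>\<D>. smooth_stratified_regular_action A \<D> \<mu> \<longrightarrow>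
    (\<exists>(V :: ('a, 'a) svb) \<E>. svb_of_action A \<mu> V \<and> differentiable_svb V \<D> \<E> \<and>
      smooth_zero_section V \<D> \<E> \<and>
      (\<forall>(V' :: ('a, 'b) svb) \<E>'. svb_of_action A \<mu> V' \<and> differentiable_svb V' \<D> \<E>' \<longrightarrow>
       (\<exists>!g. g \<in> extensional (spoints (sv_base V)) \<and> svb_comparison V V' g \<and>
         smooth_strat_map (sv_base V) \<E> (sv_base V') \<E>' g) \<and>
       (smooth_zero_section V' \<D> \<E>' \<longrightarrow>
         (\<exists>!g. g \<in> extensional (spoints (sv_base V)) \<and>
          differentiable_svb_isomorphism V \<E> V' \<E>' g)))))"
proof (intro conjI impI allI)
 assume act: "stratified_regular_action A \<mu>"
 interpret strat_action A \<mu> by unfold_locales (fact assms, fact act)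
 show "\<exists>V :: ('a, 'a) svb. svb_of_action A \<mu> V \<and> continuous_zero_section V \<and>
   (\<forall>V' :: ('a, 'b) svb. svb_of_action A \<mu> V' \<longrightarrow>
    (\<exists>!g. g \<in> extensional (spoints (sv_base V)) \<and> svb_comparison V V' g) \<and>
    (continuous_zero_section V' \<longrightarrow> (\<exists>!g. g \<in> extensional (spoints (sv_base V)) \<and> svb_isomorphism V V' g)))"
 \<comment> \<open>The base is realised inside \<open>A\<close> as the set of fixed points, so the
   witness lives over the type of \<open>A\<close> itself, while the bundles compared with it may
   have a base of another type.\<close>
 proof (intro exI[of _ "bundle"] conjI allI impI svb_bundle)
  fix V' :: "('a, 'b) svb" assume V': "svb_of_action A \<mu> V'"
  interpret strat_action_bundle A \<mu> V' by unfold_locales (rule V')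
  show "\<exists>!g. g \<in> extensional (spoints (sv_base bundle)) \<and> svb_comparison bundle V' g"
   unfolding bundle_simps strat_base_simps(3)
  proof (rule ex1I[of _ g])
   show "g \<in> extensional M \<and> svb_comparison bundle V' g" using g_extensional comparison ..
   show "f = g" if "f \<in> extensional M \<and> svb_comparison bundle V' f" for f using that by (intro comparison_unique) simp_all
  qed
  assume "continuous_zero_section V'"
  then have "continuous_map (stop X') (stop A) z'" by (simp add: continuous_zero_section_def tot)
  then have iso: "svb_isomorphism bundle V' g" by (rule isomorphism)
  show "\<exists>!g. g \<in> extensional (spoints (sv_base bundle)) \<and> svb_isomorphism bundle V' g"
   unfolding bundle_simps strat_base_simps(3)
  proof (rule ex1I[of _ g])
   show "g \<in> extensional M \<and> svb_isomorphism bundle V' g" using g_extensional iso ..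
   \<comment> \<open>An isomorphism is in particular a comparison, so its uniqueness is
     inherited.\<close>
   show "f = g" if "f \<in> extensional M \<and> svb_isomorphism bundle V' f" for f
    using that by (intro comparison_unique) (simp_all add: svb_isomorphism_def)
  qed
 qed
next
 fix \<D> assume act: "smooth_stratified_regular_action A \<D> \<mu>"
 interpret smooth_strat_action A \<mu> \<D>
  by unfold_locales (use assms act in \<open>simp_all add: smooth_stratified_regular_action_def\<close>)
 show "\<exists>(V :: ('a, 'a) svb) \<E>. svb_of_action A \<mu> V \<and> differentiable_svb V \<D> \<E> \<and> smooth_zero_section V \<D> \<E> \<and>
   (\<forall>(V' :: ('a, 'b) svb) \<E>'. svb_of_action A \<mu> V' \<and> differentiable_svb V' \<D> \<E>' \<longrightarrow>
    (\<exists>!g. g \<in> extensional (spoints (sv_base V)) \<and> svb_comparison V V' g \<and> smooth_strat_map (sv_base V) \<E> (sv_base V') \<E>' g) \<and>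
    (smooth_zero_section V' \<D> \<E>' \<longrightarrow>
      (\<exists>!g. g \<in> extensional (spoints (sv_base V)) \<and> differentiable_svb_isomorphism V \<E> V' \<E>' g)))"
 proof (intro exI[of _ "bundle"] exI[of _ base_structure] conjI allI impI svb_bundle(1) differentiable_bundle)
  fix V' :: "('a, 'b) svb" and \<E>' assume V': "svb_of_action A \<mu> V' \<and> differentiable_svb V' \<D> \<E>'"
  interpret smooth_strat_action_bundle A \<mu> \<D> V' \<E>' by unfold_locales (use V' in simp_all)
  show "\<exists>!g. g \<in> extensional (spoints (sv_base bundle)) \<and> svb_comparison bundle V' g \<and>
    smooth_strat_map (sv_base bundle) base_structure X' \<E>' g"
   unfolding bundle_simps strat_base_simps(3)
  proof (rule ex1I[of _ g])
   show "g \<in> extensional M \<and> svb_comparison bundle V' g \<and> smooth_strat_map strat_base base_structure X' \<E>' g"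
    using g_extensional comparison smooth_g by (intro conjI)
   show "f = g" if "f \<in> extensional M \<and> svb_comparison bundle V' f \<and> smooth_strat_map strat_base base_structure X' \<E>' f" for f
    using that by (intro comparison_unique) simp_all
  qed
  assume "smooth_zero_section V' \<D> \<E>'"
  then have iso: "differentiable_svb_isomorphism bundle base_structure V' \<E>' g" by (rule smooth_isomorphism)
  show "\<exists>!g. g \<in> extensional (spoints (sv_base bundle)) \<and> differentiable_svb_isomorphism bundle base_structure V' \<E>' g"
   unfolding bundle_simps strat_base_simps(3)
  proof (rule ex1I[of _ g])
   show "g \<in> extensional M \<and> differentiable_svb_isomorphism bundle base_structure V' \<E>' g" using g_extensional iso ..
   show "f = g" if "f \<in> extensional M \<and> differentiable_svb_isomorphism bundle base_structure V' \<E>' f" for f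
    using that by (intro comparison_unique) (simp_all add: differentiable_svb_isomorphism_def svb_isomorphism_def)
  qed
 qed
qed

end
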